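(* Let $c\in(0,\infty)$, $a,b>-1/2$ and $\sigma^2>0$. For each $N$, let $0\le\lambda_1(t)\le\cdots\le\lambda_N(t)\le1$ be the beta Jacobi process with parameters $a,b$ and $\beta=2c/N$ and given deterministic initial condition. Let $$x_i(t)=\gamma_N\left(\lambda_i\left(\tfrac{t}{\tau_N}\right)-E_N\right),\quad i=1,\dots,N,$$ where $\gamma_N,\tau_N,E_N>0$ are non-random. Let $\mu_t^{(N)}=\frac1N\sum_{i=1}^N\delta_{x_i(t)}$ and $S_n^{(N)}(t)=\frac1N\sum_{i=1}^Nx_i(t)^n$. Assume that as $N\to\infty$ $$\tau_N\to\infty,\quad\frac{\gamma_N}{\tau_N}\to0,\quad\frac{2\gamma_N^2}{\tau_N}E_N(1-E_N)\to\sigma^2.$$ (1) Assume that for each $n$, $S_n^{(N)}(0)\to a_n$ as $N\to\infty$ for some real $a_n$. Then for every $n$ and every $T>0$, $S_n^{(N)}(t)\to m_n(t)$ as $N\to\infty$ in probability as random elements in $C([0,T])$, where $m_0(t)=1$, $m_1(t)=a_1$ and, for $n\ge2$, $$m_n(t)=a_n+\sigma^2\frac{cn}{2}\sum_{j=0}^{n-2}\int_0^tm_j(u)m_{n-2-j}(u)\,du+\sigma^2\frac12n(n-1)\int_0^tm_{n-2}(u)\,du.$$ (2) Assume further that there is a constant $\Lambda>0$ with $|a_n|\le(\Lambda n)^n$ for all $n\ge1$. Then for any $t\ge0$ there is a unique probability measure $\mu_t$ on $\mathbb R$ having moments $\{m_n(t)\}_{n\ge0}$. Moreover, the probability measure-valued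 process $\mu_t$ is continuous and, for every $T>0$, the empirical measure process $(\mu_t^{(N)})_{0\le t\le T}$ converges to $(\mu_t)_{0\le t\le T}$ in probability under the topology of uniform convergence.
   Context: Beta Jacobi process with parameters $a,b>-1/2$, $\beta>0$: the continuous ordered process $0\le\lambda_1(t)\le\cdots\le\lambda_N(t)\le1$ solving (strong solution, integral form) $$d\lambda_i=\sqrt{2\lambda_i(1-\lambda_i)}\,db_i+\left(a+1-(a+b+2)\lambda_i+\frac\beta2\sum_{j\ne i}\frac{2\lambda_i(1-\lambda_i)}{\lambda_i-\lambda_j}\right)dt,\quad i=1,\dots,N,$$ with $b_1,\dots,b_N$ independent standard Brownian motions. $C([0,T])$ carries the supremum norm; random elements $X^{(N)}$ of $C([0,T])$ converge in probability to a non-random $x$ if $\mathbb P(\|X^{(N)}-x\|_\infty\ge\varepsilon)\to0$ for all $\varepsilon>0$. The space of probability measures carries the weak topology (metrized by some metric $d$); continuity of $\mu_t$ is with respect to it, and convergence in probability under the topology of uniform convergence means $\sup_{0\le t\le T}d(\mu_t^{(N)},\mu_t)\to0$ in probability. The numbers $a_n$ are unrelated to the parameter $a$. *)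

theory Defs
  imports "HOL-Probability.Probability"
begin

definition standard_BM :: "'w measure \<Rightarrow> (real \<Rightarrow> 'w \<Rightarrow> real) \<Rightarrow> bool" where
  "standard_BM M B \<longleftrightarrow>
     (\<forall>t\<ge>0. B t \<in> borel_measurable M) \<and>
     (AE \<omega> in M. B 0 \<omega> = 0 \<and> continuous_on {0..} (\<lambda>t. B t \<omega>)) \<and>
     (\<forall>s t. 0 \<le> s \<and> s < t \<longrightarrow>
        distributed M lborel (\<lambda>\<omega>. B t \<omega> - B s \<omega>) (normal_density 0 (sqrt (t - s)))) \<and>
     (\<forall>(k::nat) (u::nat \<Rightarrow> real). 0 \<le> u 0 \<and> (\<forall>j<k. u j < u (Suc j)) \<longrightarrow>
        prob_space.indep_vars M (\<lambda>_. borel) (\<lambda>j \<omega>. B (u (Suc j)) \<omega> - B (u j) \<omega>) {..<k})"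

definition independent_BMs :: "'w measure \<Rightarrow> nat \<Rightarrow> (nat \<Rightarrow> real \<Rightarrow> 'w \<Rightarrow> real) \<Rightarrow> bool" where
  "independent_BMs M N B \<longleftrightarrow>
     (\<forall>i\<in>{1..N}. standard_BM M (B i)) \<and>
     prob_space.indep_vars M (\<lambda>_. PiM {0..} (\<lambda>_::real. borel))
       (\<lambda>i \<omega>. \<lambda>t\<in>{0..}. B i t \<omega>) {1..N}"

text \<open>The filtration generated by the Brownian motions, augmented by the null sets.
  Adaptedness to it is what makes a solution of an SDE a strong solution.\<close>

definition BM_filtration ::
    "'w measure \<Rightarrow> nat \<Rightarrow> (nat \<Rightarrow> real \<Rightarrow> 'w \<Rightarrow> real) \<Rightarrow> real \<Rightarrow> 'w measure" where
  "BM_filtration M N B t = sigma (space M)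
     ({B i s -` A \<inter> space M | i s A. i \<in> {1..N} \<and> 0 \<le> s \<and> s \<le> t \<and> A \<in> sets borel} \<union> null_sets M)"

datatype 'w simple_process =
  Simple (steps: nat) (time: "nat \<Rightarrow> real") (coef: "nat \<Rightarrow> 'w \<Rightarrow> real")

definition simple_predictable ::
    "'w measure \<Rightarrow> (real \<Rightarrow> 'w measure) \<Rightarrow> 'w simple_process \<Rightarrow> bool" where
  "simple_predictable M F X \<longleftrightarrow>
     0 \<le> time X 0 \<and> (\<forall>j<steps X. time X j < time X (Suc j)) \<and>
     (\<forall>j<steps X. coef X j \<in> borel_measurable (F (time X j)) \<and>
        (\<exists>C. \<forall>\<omega>\<in>space M. \<bar>coef X j \<omega>\<bar> \<le> C))"

definition simple_value :: "'w simple_process \<Rightarrow> real \<Rightarrow> 'w \<Rightarrow> real" where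
  "simple_value X s \<omega> =
     (\<Sum>j<steps X. coef X j \<omega> * indicator {time X j<..time X (Suc j)} s)"

definition simple_integral_BM ::
    "(real \<Rightarrow> 'w \<Rightarrow> real) \<Rightarrow> 'w simple_process \<Rightarrow> real \<Rightarrow> 'w \<Rightarrow> real" where
  "simple_integral_BM B X t \<omega> =
     (\<Sum>j<steps X. coef X j \<omega> * (B (min t (time X (Suc j))) \<omega> - B (min t (time X j)) \<omega>))"

text \<open>\<open>ito_integral M F B H I\<close>: the process \<open>I\<close> is a continuous version of the Ito integral of
  \<open>H\<close> against \<open>B\<close>, in the usual construction as the \<open>L\<^sup>2\<close> limit of the integrals of
  simple predictable processes that approximate \<open>H\<close> in \<open>L\<^sup>2\<close> of the product of the
  probability measure and Lebesgue measure on \<open>[0,t]\<close>. By the Ito isometry \<open>I\<close> is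
  then unique up to null sets. This \<open>L\<^sup>2\<close> theory is enough below, where \<open>H\<close> is bounded.\<close>

definition ito_integral ::
    "'w measure \<Rightarrow> (real \<Rightarrow> 'w measure) \<Rightarrow> (real \<Rightarrow> 'w \<Rightarrow> real) \<Rightarrow>
     (real \<Rightarrow> 'w \<Rightarrow> real) \<Rightarrow> (real \<Rightarrow> 'w \<Rightarrow> real) \<Rightarrow> bool" where
  "ito_integral M F B H I \<longleftrightarrow>
     (\<forall>t\<ge>0. I t \<in> borel_measurable (F t)) \<and>
     (AE \<omega> in M. continuous_on {0..} (\<lambda>t. I t \<omega>)) \<and>
     (\<forall>t\<ge>0. \<exists>X. (\<forall>m::nat. simple_predictable M F (X m)) \<and>
        (\<lambda>m. \<integral>\<^sup>+\<omega>. (\<integral>\<^sup>+s\<in>{0..t}. ennreal ((simple_value (X m) s \<omega> - H s \<omega>)\<^sup>2) \<partial>lborel) \<partial>M)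
          \<longlonglongrightarrow> 0 \<and>
        (\<lambda>m. \<integral>\<^sup>+\<omega>. ennreal ((simple_integral_BM B (X m) t \<omega> - I t \<omega>)\<^sup>2) \<partial>M) \<longlonglongrightarrow> 0)"

definition jacobi_drift ::
    "nat \<Rightarrow> real \<Rightarrow> real \<Rightarrow> real \<Rightarrow> (nat \<Rightarrow> real) \<Rightarrow> nat \<Rightarrow> real" where
  "jacobi_drift N a b \<beta> l i =
     a + 1 - (a + b + 2) * l i
     + \<beta> / 2 * (\<Sum>j\<in>{1..N} - {i}. 2 * l i * (1 - l i) / (l i - l j))"

text \<open>The drift is undefined at collision times, so that the equation in integral form
  only makes sense if these times form a Lebesgue null set. Since division by zero is total
  here, this requirement has to be spelled out.\<close>

definition beta_jacobi_process ::
    "'w measure \<Rightarrow> nat \<Rightarrow> real \<Rightarrow> real \<Rightarrow> real \<Rightarrow> (nat \<Rightarrow> real \<Rightarrow> 'w \<Rightarrow> real) \<Rightarrow>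
     (nat \<Rightarrow> real) \<Rightarrow> (nat \<Rightarrow> real \<Rightarrow> 'w \<Rightarrow> real) \<Rightarrow> bool" where
  "beta_jacobi_process M N a b \<beta> B l0 l \<longleftrightarrow>
     prob_space M \<and> independent_BMs M N B \<and>
     (\<forall>i\<in>{1..N}. \<forall>\<omega>\<in>space M. continuous_on {0..} (\<lambda>t. l i t \<omega>)) \<and>
     (\<forall>i\<in>{1..N}. \<forall>t\<ge>0. \<forall>\<omega>\<in>space M. 0 \<le> l i t \<omega> \<and> l i t \<omega> \<le> 1) \<and>
     (\<forall>i\<in>{1..N}. \<forall>j\<in>{1..N}. i \<le> j \<longrightarrow> (\<forall>t\<ge>0. \<forall>\<omega>\<in>space M. l i t \<omega> \<le> l j t \<omega>)) \<and>
     (\<forall>i\<in>{1..N}. \<forall>t\<ge>0. l i t \<in> borel_measurable (BM_filtration M N B t)) \<and>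
     (\<forall>i\<in>{1..N}. \<forall>\<omega>\<in>space M. l i 0 \<omega> = l0 i) \<and>
     (\<forall>i\<in>{1..N}. \<forall>j\<in>{1..N}. i \<noteq> j \<longrightarrow>
        (AE \<omega> in M. AE s in lborel. 0 \<le> s \<longrightarrow> l i s \<omega> \<noteq> l j s \<omega>)) \<and>
     (\<forall>i\<in>{1..N}. \<exists>I.
        ito_integral M (BM_filtration M N B) (B i)
          (\<lambda>s \<omega>. sqrt (2 * l i s \<omega> * (1 - l i s \<omega>))) I \<and>
        (AE \<omega> in M. \<forall>t\<ge>0.
           set_integrable lborel {0..t} (\<lambda>s. jacobi_drift N a b \<beta> (\<lambda>j. l j s \<omega>) i) \<and>
           l i t \<omega> = l0 i + I t \<omega>
             + (LINT s:{0..t}|lborel. jacobi_drift N a b \<beta> (\<lambda>j. l j s \<omega>) i)))"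

definition power_mean :: "nat \<Rightarrow> (nat \<Rightarrow> real) \<Rightarrow> nat \<Rightarrow> real" where
  "power_mean N x n = 1 / real N * (\<Sum>i=1..N. x i ^ n)"

definition empirical_measure :: "nat \<Rightarrow> (nat \<Rightarrow> real) \<Rightarrow> real measure" where
  "empirical_measure N x = distr (uniform_count_measure {1..N}) borel x"

lemma measure_empirical_measure:
  assumes "1 \<le> N" "A \<in> sets borel"
  shows "measure (empirical_measure N x) A = 1 / real N * (\<Sum>i=1..N. measure (return borel (x i)) A)"
proof -
  have "measure (empirical_measure N x) A
      = measure (uniform_count_measure {1..N}) (x -` A \<inter> {1..N})"
    using assms unfolding empirical_measure_def
    by (subst measure_distr) (auto simp: space_uniform_count_measure measurable_def sets_uniform_count_measure)
  also have "\<dots> = real (card (x -` A \<inter> {1..N})) / real N"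
    by (subst measure_uniform_count_measure) auto
  also have "real (card (x -` A \<inter> {1..N})) = (\<Sum>i=1..N. indicator A (x i))"
  proof -
    have "(\<Sum>i=1..N. indicator A (x i)) = (\<Sum>i\<in>{1..N}. indicator (x -` A) i :: real)"
      by (simp add: indicator_def)
    also have "\<dots> = real (card ({1..N} \<inter> x -` A))"
      by (simp add: indicator_def sum.If_cases vimage_def)
    finally show ?thesis by (simp add: Int_commute)
  qed
  also have "\<dots> = (\<Sum>i=1..N. measure (return borel (x i)) A)"
    using assms by (intro sum.cong) (auto simp: measure_return)
  finally show ?thesis by simp
qed

text \<open>Convergence to zero in probability of nonnegative random variables that live on possibly
  different probability spaces. Measurability is included because \<open>measure\<close> returns zero
  on a set that is not measurable.\<close>

definition to_zero_in_prob :: "(nat \<Rightarrow> 'w measure) \<Rightarrow> (nat \<Rightarrow> 'w \<Rightarrow> real) \<Rightarrow> bool" where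
  "to_zero_in_prob M Y \<longleftrightarrow>
     (\<forall>N\<ge>1. Y N \<in> borel_measurable (M N)) \<and>
     (\<forall>\<epsilon>>0. (\<lambda>N. measure (M N) {\<omega> \<in> space (M N). \<epsilon> \<le> Y N \<omega>}) \<longlonglongrightarrow> 0)"

definition tendsto_in_prob_C ::
    "(nat \<Rightarrow> 'w measure) \<Rightarrow> real \<Rightarrow> (nat \<Rightarrow> real \<Rightarrow> 'w \<Rightarrow> real) \<Rightarrow> (real \<Rightarrow> real) \<Rightarrow> bool" where
  "tendsto_in_prob_C M T X x \<longleftrightarrow>
     (\<forall>N\<ge>1. \<forall>\<omega>\<in>space (M N). continuous_on {0..T} (\<lambda>t. X N t \<omega>)) \<and>
     continuous_on {0..T} x \<and>
     to_zero_in_prob M (\<lambda>N \<omega>. SUP t\<in>{0..T}. \<bar>X N t \<omega> - x t\<bar>)"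

definition weak_topology :: "real measure topology" where
  "weak_topology = topology_generated_by
     {{\<mu>. real_distribution \<mu> \<and> (\<integral>x. f x \<partial>\<mu>) \<in> U} | (f :: real \<Rightarrow> real) U.
        continuous_on UNIV f \<and> bounded (range f) \<and> open (U :: real set)}"

definition metrizes_weak_topology :: "(real measure \<Rightarrow> real measure \<Rightarrow> real) \<Rightarrow> bool" where
  "metrizes_weak_topology d \<longleftrightarrow>
     Metric_space {\<mu>. real_distribution \<mu>} d \<and>
     Metric_space.mtopology {\<mu>. real_distribution \<mu>} d = weak_topology"

text \<open>The statement ranges over all metrics for the weak topology. Such metrics exist:\<close>

lemma weak_conv_m_if_rat_steps:
  assumes "\<And>n. real_distribution (Ms n)" "real_distribution M"
    and conv: "\<And>p q::rat. p < q \<Longrightarrow> (\<lambda>n. integral\<^sup>L (Ms n) (cts_step (of_rat p) (of_rat q))) \<longlonglongrightarrow>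
      integral\<^sup>L M (cts_step (of_rat p) (of_rat q))"
  shows "weak_conv_m Ms M"
  unfolding weak_conv_m_def weak_conv_def
proof (intro allI impI)
  interpret M: real_distribution M by fact
  interpret Ms: real_distribution "Ms n" for n by fact
  fix x assume "isCont (cdf M) x"
  show "(\<lambda>n. cdf (Ms n) x) \<longlonglongrightarrow> cdf M x"
  proof (rule LIMSEQ_I)
    fix e :: real assume "0 < e"
    then obtain d where d: "d > 0" "\<And>y. \<bar>y - x\<bar> < d \<Longrightarrow> \<bar>cdf M y - cdf M x\<bar> < e"
      using \<open>isCont (cdf M) x\<close> unfolding continuous_at_eps_delta dist_real_def by blast
    obtain p1 where p1: "x - d < of_rat p1" "of_rat p1 < x" using of_rat_dense[of "x - d" x] d by auto
    obtain p2 where p2: "of_rat p1 < (of_rat p2::real)" "of_rat p2 < x" using of_rat_dense[OF p1(2)] by auto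
    obtain q1 where q1: "x < of_rat q1" "of_rat q1 < x + d" using of_rat_dense[of x "x + d"] d by auto
    obtain q2 where q2: "of_rat q1 < (of_rat q2::real)" "of_rat q2 < x + d" using of_rat_dense[OF q1(2)] by auto
    let ?P = "cts_step (of_rat p1) (of_rat p2)" and ?Q = "cts_step (of_rat q1) (of_rat q2)"
    have "\<bar>cdf M (of_rat p1) - cdf M x\<bar> < e" "\<bar>cdf M (of_rat q2) - cdf M x\<bar> < e"
      using d(2) p1 p2 q1 q2 by (auto simp: abs_if)
    moreover have "cdf M (of_rat p1) \<le> integral\<^sup>L M ?P" "integral\<^sup>L M ?Q \<le> cdf M (of_rat q2)"
      using M.cdf_cts_step p2 q2 by auto
    ultimately have lim: "cdf M x - e < integral\<^sup>L M ?P" "integral\<^sup>L M ?Q < cdf M x + e" by linarith+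
    have "p1 < p2" "q1 < q2" using p2 q2 by (auto simp: of_rat_less)
    then have "eventually (\<lambda>n. cdf M x - e < integral\<^sup>L (Ms n) ?P \<and> integral\<^sup>L (Ms n) ?Q < cdf M x + e) sequentially"
      using order_tendstoD(1)[OF conv lim(1)] order_tendstoD(2)[OF conv lim(2)] by (auto elim: eventually_elim2)
    then have "eventually (\<lambda>n. norm (cdf (Ms n) x - cdf M x) < e) sequentially"
    proof (rule eventually_mono)
      fix n assume A: "cdf M x - e < integral\<^sup>L (Ms n) ?P \<and> integral\<^sup>L (Ms n) ?Q < cdf M x + e"
      have "integral\<^sup>L (Ms n) ?P \<le> cdf (Ms n) (of_rat p2)" "cdf (Ms n) (of_rat q1) \<le> integral\<^sup>L (Ms n) ?Q"
        using Ms.cdf_cts_step p2 q2 by auto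
      moreover have "cdf (Ms n) (of_rat p2) \<le> cdf (Ms n) x" "cdf (Ms n) x \<le> cdf (Ms n) (of_rat q1)"
        using p2 q1 by (auto intro: Ms.cdf_nondecreasing)
      ultimately show "norm (cdf (Ms n) x - cdf M x) < e" using A by (auto simp: abs_if)
    qed
    then show "\<exists>no. \<forall>n\<ge>no. norm (cdf (Ms n) x - cdf M x) < e" by (simp add: eventually_sequentially)
  qed
qed

lemma topspace_weak_topology: "topspace weak_topology = {\<mu>. real_distribution \<mu>}"
proof -
  have "{\<mu>. real_distribution \<mu>} = {\<mu>. real_distribution \<mu> \<and> (\<integral>x. (\<lambda>_. 0::real) x \<partial>\<mu>) \<in> UNIV}" by simp
  then have "{\<mu>. real_distribution \<mu>} \<in> {{\<mu>. real_distribution \<mu> \<and> (\<integral>x. f x \<partial>\<mu>) \<in> U} | (f :: real \<Rightarrow> real) U.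
        continuous_on UNIV f \<and> bounded (range f) \<and> open (U :: real set)}"
    by (intro CollectI exI[of _ "\<lambda>_. 0::real"] exI[of _ "UNIV :: real set"]) auto
  then show ?thesis unfolding weak_topology_def topology_generated_by_topspace by auto
qed

lemma ex_metrizes_weak_topology: "\<exists>d. metrizes_weak_topology d"
proof -
  define P where "P = {\<mu> :: real measure. real_distribution \<mu>}"
  define g :: "nat \<Rightarrow> real \<Rightarrow> real" where
    "g k = (case from_nat k of (p::rat, q::rat) \<Rightarrow> if p < q then cts_step (of_rat p) (of_rat q) else (\<lambda>_. 0))" for k
  define I where "I k \<mu> = integral\<^sup>L \<mu> (g k)" for k and \<mu> :: "real measure"
  define d where "d \<mu> \<nu> = (if \<mu> \<in> P \<and> \<nu> \<in> P then (\<Sum>k. (1/2)^k * \<bar>I k \<mu> - I k \<nu>\<bar>) else 0)" for \<mu> \<nu>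
  have g01: "0 \<le> g k x" "g k x \<le> 1" for k x
    by (auto simp: g_def cts_step_def split: prod.split)
  have gcont: "continuous_on UNIV (g k)" for k
    by (auto simp: g_def split: prod.split intro!: uniformly_continuous_imp_continuous cts_step_uniformly_continuous simp: of_rat_less)
  have gint: "integrable \<mu> (g k)" if "\<mu> \<in> P" for \<mu> k
  proof -
    interpret real_distribution \<mu> using that by (simp add: P_def)
    show ?thesis using g01 borel_measurable_continuous_onI[OF gcont[of k]]
      by (intro integrable_const_bound[of _ 1]) auto
  qed
  have I01: "0 \<le> I k \<mu>" "I k \<mu> \<le> 1" if "\<mu> \<in> P" for \<mu> k
  proof -
    interpret real_distribution \<mu> using that by (simp add: P_def)
    show "0 \<le> I k \<mu>" unfolding I_def by (intro integral_nonneg_AE) (simp add: g01)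
    have "I k \<mu> \<le> (\<integral>x. 1 \<partial>\<mu>)" unfolding I_def
      by (intro integral_mono gint that) (auto simp: g01)
    then show "I k \<mu> \<le> 1" using prob_space by simp
  qed
  have diff1: "\<bar>I k \<mu> - I k \<nu>\<bar> \<le> 1" if "\<mu> \<in> P" "\<nu> \<in> P" for \<mu> \<nu> k
    using I01[OF that(1), of k] I01[OF that(2), of k] by (auto simp: abs_if)
  have sm: "summable (\<lambda>k. (1/2)^k * \<bar>I k \<mu> - I k \<nu>\<bar>)" if "\<mu> \<in> P" "\<nu> \<in> P" for \<mu> \<nu>
    by (rule summable_comparison_test'[of "\<lambda>k. (1/2::real)^k" 0])
      (use diff1[OF that] in \<open>auto simp: abs_mult\<close>)
  have dterm: "(1/2)^k * \<bar>I k \<mu> - I k \<nu>\<bar> \<le> d \<mu> \<nu>" if "\<mu> \<in> P" "\<nu> \<in> P" for \<mu> \<nu> k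
    unfolding d_def using sum_le_suminf[OF sm[OF that], of "{k}"] that by simp
  have wc: "weak_conv_m Ms \<mu>" if Ms: "\<And>n. Ms n \<in> P" and mu: "\<mu> \<in> P" and lim: "(\<lambda>n. d \<mu> (Ms n)) \<longlonglongrightarrow> 0" for Ms \<mu>
  proof (rule weak_conv_m_if_rat_steps)
    fix p q :: rat assume "p < q"
    define k where "k = to_nat (p, q)"
    have gk: "g k = cts_step (of_rat p) (of_rat q)" using \<open>p < q\<close> by (simp add: g_def k_def)
    have "(\<lambda>n. I k (Ms n) - I k \<mu>) \<longlonglongrightarrow> 0"
    proof (rule Lim_null_comparison)
      have "\<bar>I k (Ms n) - I k \<mu>\<bar> \<le> 2^k * d \<mu> (Ms n)" for n
        using dterm[OF mu Ms, of k n] by (simp add: field_simps abs_minus_commute)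
      then show "\<forall>\<^sub>F n in sequentially. norm (I k (Ms n) - I k \<mu>) \<le> 2^k * d \<mu> (Ms n)" by simp
      show "(\<lambda>n. 2^k * d \<mu> (Ms n)) \<longlonglongrightarrow> 0" using tendsto_mult_right_zero[OF lim] by simp
    qed
    then show "(\<lambda>n. integral\<^sup>L (Ms n) (cts_step (of_rat p) (of_rat q))) \<longlonglongrightarrow> integral\<^sup>L \<mu> (cts_step (of_rat p) (of_rat q))"
      unfolding LIM_zero_iff I_def gk .
  qed (use Ms mu in \<open>auto simp: P_def\<close>)
  have conv_d: "(\<lambda>n. integral\<^sup>L (Ms n) f) \<longlonglongrightarrow> integral\<^sup>L \<mu> f"
    if "\<And>n. Ms n \<in> P" "\<mu> \<in> P" "(\<lambda>n. d \<mu> (Ms n)) \<longlonglongrightarrow> 0"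
      and f: "continuous_on UNIV f" "bounded (range f)" for Ms \<mu> and f :: "real \<Rightarrow> real"
  proof -
    obtain C where C: "\<And>x. norm (f x) \<le> C" using f(2) by (auto simp: bounded_iff)
    show ?thesis
      by (rule weak_conv_imp_integral_bdd_continuous_conv[where B = C])
        (use that wc[of Ms \<mu>] C in \<open>auto simp: P_def continuous_on_eq_continuous_at\<close>)
  qed
  interpret ms: Metric_space P d
  proof
    fix \<mu> \<nu>
    show "0 \<le> d \<mu> \<nu>" unfolding d_def by (auto intro!: suminf_nonneg sm)
    show "d \<mu> \<nu> = d \<nu> \<mu>" unfolding d_def by (auto simp: abs_minus_commute)
  next
    fix \<mu> \<nu> assume P: "\<mu> \<in> P" "\<nu> \<in> P"
    show "d \<mu> \<nu> = 0 \<longleftrightarrow> \<mu> = \<nu>"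
    proof
      assume "d \<mu> \<nu> = 0"
      then have "weak_conv_m (\<lambda>_. \<nu>) \<mu>" by (intro wc P) simp
      then have "(\<lambda>_::nat. char \<nu> t) \<longlonglongrightarrow> char \<mu> t" for t
        using P by (intro levy_continuity1) (auto simp: P_def)
      then have "char \<nu> = char \<mu>" by (auto simp: LIMSEQ_const_iff)
      then show "\<mu> = \<nu>" using P Levy_uniqueness by (auto simp: P_def)
    qed (simp add: d_def)
  next
    fix \<mu> \<nu> \<rho> assume P: "\<mu> \<in> P" "\<nu> \<in> P" "\<rho> \<in> P"
    have "(\<Sum>k. (1/2)^k * \<bar>I k \<mu> - I k \<rho>\<bar>) \<le>
      (\<Sum>k. (1/2)^k * \<bar>I k \<mu> - I k \<nu>\<bar> + (1/2)^k * \<bar>I k \<nu> - I k \<rho>\<bar>)"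
    proof (intro suminf_le sm P summable_add)
      fix k
      have "\<bar>I k \<mu> - I k \<rho>\<bar> \<le> \<bar>I k \<mu> - I k \<nu>\<bar> + \<bar>I k \<nu> - I k \<rho>\<bar>" by simp
      then have "(1/2)^k * \<bar>I k \<mu> - I k \<rho>\<bar> \<le> (1/2)^k * (\<bar>I k \<mu> - I k \<nu>\<bar> + \<bar>I k \<nu> - I k \<rho>\<bar>)"
        by (intro mult_left_mono) auto
      then show "(1/2)^k * \<bar>I k \<mu> - I k \<rho>\<bar> \<le> (1/2)^k * \<bar>I k \<mu> - I k \<nu>\<bar> + (1/2)^k * \<bar>I k \<nu> - I k \<rho>\<bar>"
        by (simp only: distrib_left)
    qed
    then show "d \<mu> \<rho> \<le> d \<mu> \<nu> + d \<nu> \<rho>"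
      using P by (simp add: d_def suminf_add sm)
  qed
  have "openin ms.mtopology U" if "openin weak_topology U" for U
  proof -
    have "generate_topology_on {{\<mu>. real_distribution \<mu> \<and> (\<integral>x. f x \<partial>\<mu>) \<in> U} | (f :: real \<Rightarrow> real) U.
        continuous_on UNIV f \<and> bounded (range f) \<and> open (U :: real set)} U"
      using that unfolding weak_topology_def by (simp add: openin_topology_generated_by_iff)
    then show ?thesis
    proof induction
      case (Basis s)
      then obtain f :: "real \<Rightarrow> real" and V where s: "s = {\<mu>. real_distribution \<mu> \<and> (\<integral>x. f x \<partial>\<mu>) \<in> V}"
        and f: "continuous_on UNIV f" "bounded (range f)" and V: "open V" by blast
      show ?case unfolding ms.openin_mtopology
      proof (intro conjI allI impI)
        show "s \<subseteq> P" by (auto simp: s P_def)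
        fix \<mu> assume mu: "\<mu> \<in> s"
        then have muP: "\<mu> \<in> P" by (auto simp: s P_def)
        show "\<exists>r>0. ms.mball \<mu> r \<subseteq> s"
        proof (rule ccontr)
          assume neg: "\<not> (\<exists>r>0. ms.mball \<mu> r \<subseteq> s)"
          have "\<exists>\<nu>. \<nu> \<in> P \<and> d \<mu> \<nu> < 1 / real (Suc n) \<and> \<nu> \<notin> s" for n
          proof -
            have "\<not> ms.mball \<mu> (1 / real (Suc n)) \<subseteq> s" using neg by auto
            then show ?thesis by auto
          qed
          then obtain Ms where Ms: "\<And>n. Ms n \<in> P" "\<And>n. d \<mu> (Ms n) < 1 / real (Suc n)" "\<And>n. Ms n \<notin> s"
            by metis
          have "(\<lambda>n. d \<mu> (Ms n)) \<longlonglongrightarrow> 0"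
          proof (rule Lim_null_comparison)
            show "\<forall>\<^sub>F n in sequentially. norm (d \<mu> (Ms n)) \<le> inverse (real (Suc n))"
              using Ms(2) by (auto simp: inverse_eq_divide intro!: always_eventually less_imp_le)
          qed (rule LIMSEQ_inverse_real_of_nat)
          from conv_d[OF Ms(1) muP this f] have "(\<lambda>n. integral\<^sup>L (Ms n) f) \<longlonglongrightarrow> integral\<^sup>L \<mu> f" .
          moreover have "integral\<^sup>L \<mu> f \<in> V" using mu by (simp add: s)
          ultimately have "eventually (\<lambda>n. integral\<^sup>L (Ms n) f \<in> V) sequentially"
            using V by (auto dest: topological_tendstoD)
          then obtain n where "integral\<^sup>L (Ms n) f \<in> V" by (auto dest: eventually_happens)
          then have "Ms n \<in> s" using Ms(1)[of n] by (simp add: s P_def)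
          then show False using Ms(3) by simp
        qed
      qed
    qed auto
  qed
  moreover have "openin weak_topology U" if U: "openin ms.mtopology U" for U
  proof (subst openin_subopen, intro ballI)
    fix \<mu> assume mu: "\<mu> \<in> U"
    obtain r where r: "r > 0" "ms.mball \<mu> r \<subseteq> U" and UP: "U \<subseteq> P"
      using U mu unfolding ms.openin_mtopology by blast
    have muP: "\<mu> \<in> P" using mu UP by auto
    have "eventually (\<lambda>n. (1/2::real)^n < r / 4) sequentially"
      using r by (intro order_tendstoD(2)[OF LIMSEQ_power_zero]) auto
    then obtain K where K: "(1/2::real)^K < r / 4" by (auto dest: eventually_happens)
    define V where "V k = {\<nu>. real_distribution \<nu> \<and> (\<integral>x. g k x \<partial>\<nu>) \<in> ball (I k \<mu>) (r/4)}" for k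
    define W where "W = (\<Inter>k\<in>{..K}. V k)"
    have "openin weak_topology (V k)" for k
    proof -
      have "bounded (range (g k))" using g01 by (intro boundedI[of _ 1]) auto
      then show ?thesis unfolding weak_topology_def V_def
        by (intro topology_generated_by_Basis CollectI exI[of _ "g k"] exI[of _ "ball (I k \<mu>) (r/4)"]) (auto simp: gcont)
    qed
    then have "openin weak_topology W" unfolding W_def by (intro openin_INT2) auto
    moreover have "\<mu> \<in> W" using muP r by (auto simp: W_def V_def P_def I_def)
    moreover have "W \<subseteq> U"
    proof
      fix \<nu> assume nu: "\<nu> \<in> W"
      then have nuP: "\<nu> \<in> P" by (auto simp: W_def V_def P_def)
      have small: "\<bar>I k \<mu> - I k \<nu>\<bar> < r/4" if "k \<le> K" for k
        using nu that by (auto simp: W_def V_def I_def dist_real_def)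
      let ?h = "\<lambda>k. (1/2)^k * \<bar>I k \<mu> - I k \<nu>\<bar>"
      have "d \<mu> \<nu> = (\<Sum>k. ?h (k + K)) + (\<Sum>k<K. ?h k)"
        using muP nuP suminf_split_initial_segment[OF sm[OF muP nuP], of K] by (simp add: d_def)
      also have "(\<Sum>k. ?h (k + K)) \<le> (\<Sum>k. (1/2)^K * (1/2::real)^k)"
      proof (rule suminf_le)
        show "?h (k + K) \<le> (1/2)^K * (1/2)^k" for k
          using mult_left_mono[OF diff1[OF muP nuP, of "k + K"], of "(1/2)^(k+K)"] by (simp add: power_add mult.commute)
        show "summable (\<lambda>k. ?h (k + K))" using sm[OF muP nuP] by (rule summable_ignore_initial_segment)
      qed (auto intro!: summable_mult)
      also have "\<dots> = (1/2)^K * 2" by (subst suminf_mult) (auto simp: suminf_geometric)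
      also have "(\<Sum>k<K. ?h k) \<le> (\<Sum>k<K. (1/2)^k * (r/4))"
        by (intro sum_mono mult_left_mono less_imp_le small) auto
      also have "\<dots> = (\<Sum>k<K. (1/2::real)^k) * (r/4)" by (simp add: sum_distrib_right)
      also have "(\<Sum>k<K. (1/2::real)^k) \<le> 2"
        using sum_le_suminf[of "\<lambda>k. (1/2::real)^k" "{..<K}"] by (simp add: suminf_geometric)
      finally have "d \<mu> \<nu> \<le> (1/2)^K * 2 + 2 * (r/4)" using r by (simp add: mult_right_mono)
      then have "d \<mu> \<nu> < r" using K by simp
      then show "\<nu> \<in> U" using r muP nuP by auto
    qed
    ultimately show "\<exists>T. openin weak_topology T \<and> \<mu> \<in> T \<and> T \<subseteq> U" by blast
  qed
  ultimately have "ms.mtopology = weak_topology" by (auto simp: topology_eq)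
  then show ?thesis unfolding metrizes_weak_topology_def using ms.Metric_space_axioms
    unfolding P_def by blast
qed

definition has_moments :: "real measure \<Rightarrow> (nat \<Rightarrow> real) \<Rightarrow> bool" where
  "has_moments \<mu> m \<longleftrightarrow> real_distribution \<mu> \<and>
     (\<forall>n. integrable \<mu> (\<lambda>x. x ^ n) \<and> (\<integral>x. x ^ n \<partial>\<mu>) = m n)"

text \<open>The parameter \<open>v\<close> is \<open>\<sigma>\<^sup>2\<close>.\<close>

function limit_moment :: "real \<Rightarrow> real \<Rightarrow> (nat \<Rightarrow> real) \<Rightarrow> nat \<Rightarrow> real \<Rightarrow> real" where
  "limit_moment c v \<alpha> n t =
     (if n = 0 then 1 else if n = 1 then \<alpha> 1 else
        \<alpha> n
        + v * (c * real n / 2) * (\<Sum>j=0..n-2. integral {0..t}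
            (\<lambda>u. limit_moment c v \<alpha> j u * limit_moment c v \<alpha> (n - 2 - j) u))
        + v * (1 / 2) * real n * (real n - 1) * integral {0..t} (\<lambda>u. limit_moment c v \<alpha> (n - 2) u))"
  by pat_completeness auto
termination
  by (relation "Wellfounded.measure (\<lambda>(c, v, \<alpha>, n, t). n)") auto

declare limit_moment.simps [simp del]

end

theory Submission
 imports Defs
begin

text \<open>By Ito's formula the power mean \<open>S\<^sub>n\<close> of the rescaled particles is a drift plus a martingale. The singular
 interaction in the drift symmetrizes to a polynomial in the power means of order at most \<open>n\<close>; under the scaling this
 polynomial converges to the one in the recursion for \<open>m\<^sub>n\<close>, and the variance of the martingale is of order \<open>1/N\<close>. An even
 power mean dominates all power means of lower order, so Gronwall's inequality bounds its expectation, and Kolmogorov's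
 maximal inequality makes the errors uniform in time. Induction on \<open>n\<close> then gives (1). Ito's formula is only needed in
 the form that the compensated power sums are orthogonal to bounded functions of the past, which follows from Taylor expansions
 along uniform grids. The drift of a single particle is square integrable since the total repulsion exerted on
 the topmost particles has a sign.

 In (2), the growth condition propagates to \<open>\<bar>m\<^sub>n(t)\<bar> <= C^n n!\<close>, uniformly for bounded \<open>t\<close>. Characteristic functions then show
 that these moments determine the measure, tightness shows that convergence of the moments implies weak convergence,
 and compactness of \<open>[0,T]\<close> makes this uniform in \<open>t\<close>.\<close>

section \<open>Square integrable functions and Brownian increments\<close>

text \<open>Nothing is bounded uniformly in \<open>N\<close>: the particles fill an interval of
  length \<open>\<gamma> N\<close>, which tends to infinity, and the drift of one particle is
  singular at collisions. Bounds that grow with \<open>N\<close> therefore serve only to make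
  expectations exist and grid errors vanish for fixed \<open>N\<close>; whatever reaches the limit
  is expressed through even power means. Time stays unscaled as long as \<open>N\<close> is fixed.
  Rates and times enter through their products, so \<open>\<tau> N\<close> cancels once the horizon
  \<open>T / \<tau> N\<close> is inserted. The stochastic integral is given at each single time as
  an \<open>L2\<close> limit, with approximations that change with the time. Only the first two
  moments of its increments against bounded functions of the past are extracted, and all later
  arguments refer to these. The measures \<open>\<mu> t\<close> do not come from a solvability
  criterion for the moment problem: they are weak limits of empirical measures at single outcomes,
  chosen such that the first \<open>k\<close> moments are already close.\<close>

lemma abs_mult_le_sum_squares: "\<bar>x * y\<bar> <= x^2 + (y::real)^2"
proof -
 have "2 * (\<bar>x\<bar> * \<bar>y\<bar>) <= x^2 + y^2" using sum_squares_bound[of "\<bar>x\<bar>" "\<bar>y\<bar>"] by (simp add: mult.assoc)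
 moreover have "0 <= \<bar>x\<bar> * \<bar>y\<bar>" by simp
 ultimately show ?thesis unfolding abs_mult by linarith
qed

lemma sum_power2_le: "(x + y)^2 <= 2 * x^2 + 2 * (y::real)^2"
 using sum_squares_bound[of x y] by (simp add: power2_sum)

lemma integrable_mult_of_squares:
 fixes f g :: "'a => real"
 assumes [measurable]: "f \<in> borel_measurable M" "g \<in> borel_measurable M"
  and "integrable M (%x. (f x)^2)" "integrable M (%x. (g x)^2)"
 shows "integrable M (%x. f x * g x)"
proof (rule Bochner_Integration.integrable_bound)
 show "integrable M (%x. (f x)^2 + (g x)^2)" using assms by simp
 show "AE x in M. norm (f x * g x) <= norm ((f x)^2 + (g x)^2)"
  by (intro AE_I2) (simp add: abs_mult_le_sum_squares)
qed measurable

lemma integrable_square_add: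
 fixes f g :: "'a => real"
 assumes "f \<in> borel_measurable M" "g \<in> borel_measurable M"
  and "integrable M (%x. (f x)^2)" "integrable M (%x. (g x)^2)"
 shows "integrable M (%x. (f x + g x)^2)"
 using integrable_mult_of_squares[OF assms] assms(3,4) by (simp add: power2_sum mult.assoc)

lemma integrable_square_diff:
 fixes f g :: "'a => real"
 assumes "f \<in> borel_measurable M" "g \<in> borel_measurable M"
  and "integrable M (%x. (f x)^2)" "integrable M (%x. (g x)^2)"
 shows "integrable M (%x. (f x - g x)^2)"
 using integrable_mult_of_squares[OF assms] assms(3,4) by (simp add: power2_diff mult.assoc)

lemma Cauchy_Schwarz_integral:
 fixes f g :: "'a => real"
 assumes [measurable]: "f \<in> borel_measurable M" "g \<in> borel_measurable M"
  and sq: "integrable M (%x. (f x)^2)" "integrable M (%x. (g x)^2)"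
 shows "\<bar>\<integral>x. f x * g x \<partial>M\<bar> <= sqrt (\<integral>x. (f x)^2 \<partial>M) * sqrt (\<integral>x. (g x)^2 \<partial>M)"
proof -
 define a b c where "a = (\<integral>x. (f x)^2 \<partial>M)" and "b = (\<integral>x. (g x)^2 \<partial>M)" and "c = (\<integral>x. f x * g x \<partial>M)"
 have int: "integrable M (%x. f x * g x)" by (rule integrable_mult_of_squares[OF assms(1,2) sq])
 have quad: "0 <= a - 2 * y * c + y^2 * b" for y
 proof -
  have "0 <= (\<integral>x. (f x - y * g x)^2 \<partial>M)" by simp
  also have "(%x. (f x - y * g x)^2) = (%x. (f x)^2 - 2 * y * (f x * g x) + y^2 * (g x)^2)"
   by (auto simp: power2_eq_square algebra_simps)
  also have "(\<integral>x. (f x)^2 - 2 * y * (f x * g x) + y^2 * (g x)^2 \<partial>M) = a - 2 * y * c + y^2 * b"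
   using int sq by (simp add: a_def b_def c_def)
  finally show ?thesis .
 qed
 have a0: "0 <= a" and b0: "0 <= b" by (simp_all add: a_def b_def)
 have "c^2 <= a * b"
 proof (cases "b = 0")
  case True
  \<comment> \<open>For \<open>b = 0\<close> the quadratic is affine in \<open>y\<close>; the value
    \<open>(a + 1) / (2 * c)\<close> would make it equal to -1.\<close>
  have "c = 0"
  proof (rule ccontr)
   assume "c \<noteq> 0"
   then show False using quad[of "(a + 1) / (2 * c)"] True by (simp add: field_simps)
  qed
  then show ?thesis using True by simp
 next
  case False
  \<comment> \<open>\<open>c / b\<close> is the minimizer of the quadratic.\<close>
  then show ?thesis using quad[of "c / b"] b0 by (simp add: field_simps power2_eq_square)
 qed
 then have "sqrt (c^2) <= sqrt (a * b)" by (rule real_sqrt_le_mono)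
 then show ?thesis by (simp add: real_sqrt_mult a_def b_def c_def)
qed

text \<open>Serves to carry the polarized isometry from elementary integrands to their
  \<open>L2\<close> limits. Expanding around the limits leaves three products, each with at least
  one factor that is small in \<open>L2\<close>.\<close>

lemma L2_mult_tendsto:
 fixes f g :: "'a => real"
 assumes [measurable]: "\<And>m. fm m \<in> borel_measurable M" "\<And>m. gm m \<in> borel_measurable M"
   "f \<in> borel_measurable M" "g \<in> borel_measurable M"
  and sq: "\<And>m::nat. integrable M (%x. (fm m x)^2)" "\<And>m. integrable M (%x. (gm m x)^2)"
   "integrable M (%x. (f x)^2)" "integrable M (%x. (g x)^2)"
  and lim: "(%m. \<integral>x. (fm m x - f x)^2 \<partial>M) \<longlonglongrightarrow> 0" "(%m. \<integral>x. (gm m x - g x)^2 \<partial>M) \<longlonglongrightarrow> 0"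
 shows "(%m. \<integral>x. fm m x * gm m x \<partial>M) \<longlonglongrightarrow> (\<integral>x. f x * g x \<partial>M)"
proof -
 define A where "A m = (\<integral>x. (fm m x - f x)^2 \<partial>M)" for m
 define B where "B m = (\<integral>x. (gm m x - g x)^2 \<partial>M)" for m
 have sqd: "integrable M (%x. (fm m x - f x)^2)" "integrable M (%x. (gm m x - g x)^2)" for m
  by (intro integrable_square_diff sq; measurable)+
 have bound: "\<bar>(\<integral>x. fm m x * gm m x \<partial>M) - (\<integral>x. f x * g x \<partial>M)\<bar>
  <= sqrt (A m) * sqrt (B m) + sqrt (A m) * sqrt (\<integral>x. (g x)^2 \<partial>M) + sqrt (\<integral>x. (f x)^2 \<partial>M) * sqrt (B m)" for m
 proof -
  have i: "integrable M (%x. (fm m x - f x) * (gm m x - g x))" "integrable M (%x. (fm m x - f x) * g x)"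
   "integrable M (%x. f x * (gm m x - g x))" "integrable M (%x. fm m x * gm m x)" "integrable M (%x. f x * g x)"
   by (intro integrable_mult_of_squares sq sqd; measurable)+
  have "(\<integral>x. fm m x * gm m x \<partial>M) - (\<integral>x. f x * g x \<partial>M) = (\<integral>x. fm m x * gm m x - f x * g x \<partial>M)"
   using i by simp
  also have "(%x. fm m x * gm m x - f x * g x) = (%x. (fm m x - f x) * (gm m x - g x) + (fm m x - f x) * g x + f x * (gm m x - g x))"
   by (auto simp: algebra_simps)
  also have "(\<integral>x. (fm m x - f x) * (gm m x - g x) + (fm m x - f x) * g x + f x * (gm m x - g x) \<partial>M)
   = (\<integral>x. (fm m x - f x) * (gm m x - g x) \<partial>M) + (\<integral>x. (fm m x - f x) * g x \<partial>M) + (\<integral>x. f x * (gm m x - g x) \<partial>M)"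
   using i by simp
  finally have eq: "(\<integral>x. fm m x * gm m x \<partial>M) - (\<integral>x. f x * g x \<partial>M) =
   (\<integral>x. (fm m x - f x) * (gm m x - g x) \<partial>M) + (\<integral>x. (fm m x - f x) * g x \<partial>M) + (\<integral>x. f x * (gm m x - g x) \<partial>M)" .
  have "\<bar>\<integral>x. (fm m x - f x) * (gm m x - g x) \<partial>M\<bar> <= sqrt (A m) * sqrt (B m)"
   unfolding A_def B_def by (rule Cauchy_Schwarz_integral[OF _ _ sqd]) measurable
  moreover have "\<bar>\<integral>x. (fm m x - f x) * g x \<partial>M\<bar> <= sqrt (A m) * sqrt (\<integral>x. (g x)^2 \<partial>M)"
   unfolding A_def by (rule Cauchy_Schwarz_integral[OF _ _ sqd(1) sq(4)]) measurable
  moreover have "\<bar>\<integral>x. f x * (gm m x - g x) \<partial>M\<bar> <= sqrt (\<integral>x. (f x)^2 \<partial>M) * sqrt (B m)"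
   unfolding B_def by (rule Cauchy_Schwarz_integral[OF _ _ sq(3) sqd(2)]) measurable
  ultimately show ?thesis unfolding eq by linarith
 qed
 have "(%m. sqrt (A m) * sqrt (B m) + sqrt (A m) * sqrt (\<integral>x. (g x)^2 \<partial>M) + sqrt (\<integral>x. (f x)^2 \<partial>M) * sqrt (B m))
  \<longlonglongrightarrow> sqrt 0 * sqrt 0 + sqrt 0 * sqrt (\<integral>x. (g x)^2 \<partial>M) + sqrt (\<integral>x. (f x)^2 \<partial>M) * sqrt 0"
  unfolding A_def B_def by (intro tendsto_intros lim)
 then have "(%m. sqrt (A m) * sqrt (B m) + sqrt (A m) * sqrt (\<integral>x. (g x)^2 \<partial>M) + sqrt (\<integral>x. (f x)^2 \<partial>M) * sqrt (B m)) \<longlonglongrightarrow> 0"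
  by simp
 then have "(%m. (\<integral>x. fm m x * gm m x \<partial>M) - (\<integral>x. f x * g x \<partial>M)) \<longlonglongrightarrow> 0"
  by (rule Lim_null_comparison[rotated]) (use bound in simp)
 then show ?thesis by (rule LIM_zero_cancel)
qed

text \<open>The definition of \<open>ito_integral\<close> measures distances by nonnegative
  integrals and says nothing about integrability of the limit. One index at finite distance already
  makes the limit square integrable, and then both kinds of integral agree.\<close>

lemma L2_limit_of_nn_integral:
 fixes f :: "'a => real"
 assumes [measurable]: "\<And>m. fm m \<in> borel_measurable M" "f \<in> borel_measurable M"
  and sq: "\<And>m::nat. integrable M (%x. (fm m x)^2)"
  and lim: "(%m. \<integral>\<^sup>+x. ennreal ((fm m x - f x)^2) \<partial>M) \<longlonglongrightarrow> 0"
 shows "integrable M (%x. (f x)^2)" and "(%m. \<integral>x. (fm m x - f x)^2 \<partial>M) \<longlonglongrightarrow> 0"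
proof -
 obtain k where "(\<integral>\<^sup>+x. ennreal ((fm k x - f x)^2) \<partial>M) < 1"
  using order_tendstoD(2)[OF lim, of 1] by (auto dest: eventually_happens)
 then have k: "integrable M (%x. (fm k x - f x)^2)"
  by (intro integrableI_nonneg) (auto simp: less_top[symmetric] top_unique)
 have "integrable M (%x. (fm k x - (fm k x - f x))^2)"
  by (rule integrable_square_diff[OF _ _ sq k]) measurable
 then show f: "integrable M (%x. (f x)^2)" by (simp add: algebra_simps)
 have "ennreal (\<integral>x. (fm m x - f x)^2 \<partial>M) = (\<integral>\<^sup>+x. ennreal ((fm m x - f x)^2) \<partial>M)" for m
  by (rule nn_integral_eq_integral[symmetric]) (auto intro!: integrable_square_diff sq f)
 then have "(%m. ennreal (\<integral>x. (fm m x - f x)^2 \<partial>M)) \<longlonglongrightarrow> ennreal 0" using lim by simp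
 then show "(%m. \<integral>x. (fm m x - f x)^2 \<partial>M) \<longlonglongrightarrow> 0"
  by (subst (asm) tendsto_ennreal_iff) auto
qed

text \<open>A Dynkin system argument: the sets over which \<open>Y\<close> integrates to zero are
  closed under complements, because the total integral vanishes, and under countable disjoint
  unions. Hence a generator stable under intersections decides.\<close>

lemma integral_indicator_zero_sigma_sets:
 fixes Y :: "'a => real"
 assumes G: "Int_stable G" "G \<subseteq> sets M" and Y: "integrable M Y" "(\<integral>x. Y x \<partial>M) = 0"
  and zero: "\<And>A. A \<in> G ==> (\<integral>x\<in>A. Y x \<partial>M) = 0" and A: "A \<in> sigma_sets (space M) G"
 shows "(\<integral>x\<in>A. Y x \<partial>M) = 0"
proof -
 have GP: "G \<subseteq> Pow (space M)" using G(2) sets.sets_into_space by blast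
 have Yset: "set_integrable M A Y" if "A \<in> sets M" for A
  using integrable_mult_indicator[OF that Y(1)] by (simp add: set_integrable_def)
 have meas: "A \<in> sets M" if "A \<in> sigma_sets (space M) G" for A
  using that G(2) sets.sigma_sets_subset by blast
 show ?thesis
  using G(1) GP A
 proof (induction rule: sigma_sets_induct_disjoint)
  case (basic A) then show ?case by (rule zero)
 next
  case empty then show ?case by (simp add: set_lebesgue_integral_def)
 next
  case (compl A)
  have [measurable]: "A \<in> sets M" using compl(1) by (rule meas)
  have "(\<integral>x\<in>space M. Y x \<partial>M) = (\<integral>x\<in>A \<union> (space M - A). Y x \<partial>M)"
   using sets.sets_into_space[of A M] by (simp add: Un_absorb1 Un_absorb2)
  also have "\<dots> = (\<integral>x\<in>A. Y x \<partial>M) + (\<integral>x\<in>space M - A. Y x \<partial>M)"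
   by (rule set_integral_Un) (auto intro!: Yset)
  finally show ?case using compl(2) Y by (simp add: set_integral_space)
 next
  case (union A)
  have "(\<integral>x\<in>(\<Union>i. A i). Y x \<partial>M) = (\<Sum>i. (\<integral>x\<in>A i. Y x \<partial>M))"
   using union(1,2) by (intro lebesgue_integral_countable_add)
    (auto simp: disjoint_family_on_def intro!: Yset meas sets.countable_UN)
  then show ?case using union(3) by simp
 qed
qed

text \<open>The hypothesis on sets says that the conditional expectation of \<open>Y\<close>
  vanishes, so a measurable factor can be pulled out. Asking only for integrability of the product
  admits unbounded \<open>Z\<close> such as Brownian increments.\<close>

lemma (in prob_space) integral_mult_subalgebra_zero:
 fixes Y Z :: "'a => real"
 assumes F: "subalgebra M F" and Y: "integrable M Y"
  and zero: "\<And>A. A \<in> sets F ==> (\<integral>x\<in>A. Y x \<partial>M) = 0"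
  and Z: "Z \<in> borel_measurable F" and ZY: "integrable M (%x. Z x * Y x)"
 shows "(\<integral>x. Z x * Y x \<partial>M) = 0"
proof -
 have "finite_measure_subalgebra M F"
  by (intro finite_measure_subalgebra.intro finite_measure_axioms finite_measure_subalgebra_axioms.intro F)
 then interpret sub: sigma_finite_subalgebra M F
  by (rule finite_measure_subalgebra_is_sigma_finite)
 have ae: "AE x in M. real_cond_exp M F Y x = 0"
 proof (rule sub.real_cond_exp_charact[OF _ Y])
  show "(\<integral>x\<in>A. Y x \<partial>M) = (\<integral>x\<in>A. 0 \<partial>M)" if "A \<in> sets F" for A
   unfolding zero[OF that] by (simp add: set_lebesgue_integral_def)
 qed simp_all
 have "(\<integral>x. Z x * Y x \<partial>M) = (\<integral>x. Z x * real_cond_exp M F Y x \<partial>M)"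
  by (rule sub.real_cond_exp_intg(2)[OF ZY Z, symmetric]) (rule borel_measurable_integrable[OF Y])
 also have "\<dots> = (\<integral>x. 0 \<partial>M)"
 proof (rule integral_cong_AE)
  show "(%x. Z x * real_cond_exp M F Y x) \<in> borel_measurable M"
   by (rule borel_measurable_integrable[OF sub.real_cond_exp_intg(1)[OF ZY Z borel_measurable_integrable[OF Y]]])
  show "AE x in M. Z x * real_cond_exp M F Y x = 0" using ae by eventually_elim simp
 qed simp
 finally show ?thesis by simp
qed

section \<open>Brownian increments and their independence of the past\<close>

context prob_space
begin

lemma standard_BM_increment:
 assumes B: "standard_BM M B" and st: "0 <= s" "s <= t"
 shows "integrable M (%h. (B t h - B s h)^2)" "integrable M (%h. B t h - B s h)"
  "expectation (%h. B t h - B s h) = 0" "expectation (%h. (B t h - B s h)^2) = t - s"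
proof -
 have m: "B t \<in> borel_measurable M" "B s \<in> borel_measurable M" using B st by (auto simp: standard_BM_def)
 note [measurable] = this
 have "integrable M (%h. (B t h - B s h)^2) \<and> expectation (%h. B t h - B s h) = 0
   \<and> expectation (%h. (B t h - B s h)^2) = t - s"
 proof (cases "s = t")
  case False
  then have lt: "s < t" and pos: "0 < sqrt (t - s)" using st by auto
  have D: "distributed M lborel (%h. B t h - B s h) (normal_density 0 (sqrt (t - s)))"
   using B st lt by (auto simp: standard_BM_def)
  have 1: "integrable M (%h. (B t h - B s h)^2)"
   using distributed_integrable[OF D, of "%x. x^2"] integrable_normal_moment[OF pos, of 0 2] by simp
  have 2: "expectation (%h. B t h - B s h) = 0" using normal_distributed_expectation[OF pos D] .
  have 3: "expectation (%h. (B t h - B s h)^2) = t - s"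
   using normal_distributed_variance[OF pos D] 2 lt by simp
  show ?thesis using 1 2 3 by blast
 qed simp
 then show "integrable M (%h. (B t h - B s h)^2)" "expectation (%h. B t h - B s h) = 0"
   "expectation (%h. (B t h - B s h)^2) = t - s" by auto
 from this(1) show "integrable M (%h. B t h - B s h)"
  by (intro square_integrable_imp_integrable[OF _ \<open>integrable M (%h. (B t h - B s h)^2)\<close>]) measurable
qed

text \<open>\<open>standard_BM\<close> speaks of independence of consecutive increments only. Along
  the sorted list of the past times every past value is a partial sum of increments, and the
  increment from \<open>s\<close> to \<open>t\<close> is one more of them; grouping the indices then
  gives independence of the past.\<close>

lemma standard_BM_increment_indep_past:
 fixes g :: "real => real"
 assumes B: "standard_BM M B" and st: "0 <= s" "s <= t" and R: "finite R" "R \<subseteq> {0..s}"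
  and A: "\<And>r. r \<in> R ==> A r \<in> sets borel" and g[measurable]: "g \<in> borel_measurable borel"
  and int: "integrable M (%y. g (B t y - B s y))"
 shows "expectation (%y. (if \<forall>r\<in>R. B r y \<in> A r then 1 else 0) * g (B t y - B s y))
    = expectation (%y. if \<forall>r\<in>R. B r y \<in> A r then 1 else 0) * expectation (%y. g (B t y - B s y))"
proof (cases "s = t")
 \<comment> \<open>Strictly increasing times require \<open>s < t\<close>; for \<open>s = t\<close>
   the second factor is the constant \<open>g 0\<close>.\<close>
 case True
 have "g (B t y - B s y) = g 0" for y by (simp add: True)
 then show ?thesis by (simp only: integral_mult_left_zero lebesgue_integral_const prob_space) simp
next
 case False
 then have lt: "s < t" using st by simp
 have Bm: "B r \<in> borel_measurable M" if "0 <= r" for r using B that unfolding standard_BM_def by blast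
 \<comment> \<open>Time 0 turns partial sums of increments into values of the path; time
   \<open>s\<close> makes the last increment start at \<open>s\<close>.\<close>
 define T where "T = insert 0 (insert s R)"
 define us where "us = sorted_list_of_set T"
 define L where "L = length us"
 have fT: "finite T" and T0: "\<And>r. r \<in> T ==> 0 <= r \<and> r <= s" using R st by (auto simp: T_def)
 have set_us: "set us = T" and sorted: "sorted_wrt (<) us"
  using fT by (auto simp: us_def)
 have nth_in: "us ! j \<in> T" if "j < L" for j using that set_us nth_mem unfolding L_def by blast
 have nth_less: "us ! i < us ! j" if "i < j" "j < L" for i j
  using sorted that unfolding L_def by (simp add: sorted_wrt_nth_less)
 have "\<exists>j<L. us ! j = r" if "r \<in> T" for r using that set_us unfolding L_def by (metis in_set_conv_nth)
 then obtain idx where idx: "\<And>r. r \<in> T ==> idx r < L \<and> us ! idx r = r" by metis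
 have L0: "0 < L" using idx[of 0] by (auto simp: T_def)
 have first: "us ! 0 = 0"
 proof (rule ccontr)
  assume *: "us ! 0 \<noteq> 0"
  have i0: "idx 0 < L" "us ! idx 0 = 0" using idx[of 0] by (auto simp: T_def)
  then have "idx 0 \<noteq> 0" using * by metis
  then have "us ! 0 < 0" using nth_less[of 0 "idx 0"] i0 by simp
  then show False using T0[OF nth_in[OF L0]] by simp
 qed
 have last: "us ! (L - 1) = s"
 proof (rule ccontr)
  assume *: "us ! (L - 1) \<noteq> s"
  have i0: "idx s < L" "us ! idx s = s" using idx[of s] by (auto simp: T_def)
  then have "idx s \<noteq> L - 1" using * by metis
  then have "s < us ! (L - 1)" using nth_less[of "idx s" "L - 1"] i0 by simp
  then show False using T0[OF nth_in[of "L - 1"]] L0 by simp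
 qed
 \<comment> \<open>Since \<open>us\<close> ends with \<open>s\<close>, the increment of index
   \<open>L - 1\<close> runs from \<open>s\<close> to \<open>t\<close>, whereas the value at
   \<open>r\<close> uses only indices below \<open>idx r\<close>, hence below
   \<open>L - 1\<close>.\<close>
 define u where "u j = (if j < L then us ! j else t)" for j
 have "0 <= u 0 \<and> (\<forall>j<L. u j < u (Suc j))"
 proof (intro conjI allI impI)
  show "0 <= u 0" using L0 first by (simp add: u_def)
  fix j assume "j < L"
  show "u j < u (Suc j)"
  proof (cases "Suc j < L")
   case True then show ?thesis using nth_less[of j "Suc j"] by (simp add: u_def)
  next
   case False then have "j = L - 1" using \<open>j < L\<close> by simp
   then show ?thesis using last lt \<open>j < L\<close> by (simp add: u_def)
  qed
 qed
 then have ind: "indep_vars (%_. borel) (%j y. B (u (Suc j)) y - B (u j) y) {..<L}"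
  using B unfolding standard_BM_def by blast
 let ?X = "%j y. B (u (Suc j)) y - B (u j) y"
 let ?h = "%p. if \<forall>r\<in>R. (\<Sum>j<idx r. p j) \<in> A r then 1 else 0 :: real"
 have idxR: "idx r < L" "us ! idx r = r" if "r \<in> R" for r using idx[of r] that by (auto simp: T_def)
 have "indep_var (PiM {..<L-1} (%_. borel)) (%y. restrict (%i. ?X i y) {..<L-1})
   (PiM {L-1} (%_. borel)) (%y. restrict (%i. ?X i y) {L-1})"
  by (rule indep_var_restrict[OF ind]) (use L0 in auto)
 moreover have hm: "?h \<in> borel_measurable (PiM {..<L-1} (%_. borel))"
 proof -
  have "(%p. \<Sum>j<idx r. p j) \<in> borel_measurable (PiM {..<L-1} (%_. borel :: real measure))" if "r \<in> R" for r
   by (intro borel_measurable_sum measurable_component_singleton) (use idxR[OF that] in auto)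
  then have "{p \<in> space (PiM {..<L-1} (%_. borel)). \<forall>r\<in>R. (\<Sum>j<idx r. p j) \<in> A r} \<in> sets (PiM {..<L-1} (%_. borel))"
   using A by (intro sets.sets_Collect_finite_All R) (auto intro!: measurable_sets_Collect[of _ _ borel] )
  then show ?thesis by (intro measurable_If) auto
 qed
 moreover have "(%p. g (p (L-1))) \<in> borel_measurable (PiM {L-1} (%_. borel))" by measurable
 ultimately have "indep_var borel (?h \<circ> (%y. restrict (%i. ?X i y) {..<L-1})) borel ((%p. g (p (L-1))) \<circ> (%y. restrict (%i. ?X i y) {L-1}))"
  by (rule indep_var_compose)
 moreover have "?h \<circ> (%y. restrict (%i. ?X i y) {..<L-1}) = (%y. ?h (%i. ?X i y))"
 proof
  fix y
  have "(\<Sum>j<idx r. restrict (%i. ?X i y) {..<L-1} j) = (\<Sum>j<idx r. ?X j y)" if "r \<in> R" for r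
   by (rule sum.cong) (use idxR[OF that] in auto)
  then show "(?h \<circ> (%y. restrict (%i. ?X i y) {..<L-1})) y = ?h (%i. ?X i y)" by (simp cong: if_cong)
 qed
 moreover have "(%p. g (p (L-1))) \<circ> (%y. restrict (%i. ?X i y) {L-1}) = (%y. g (B t y - B s y))"
  using L0 last by (auto simp: u_def fun_eq_iff)
 ultimately have ind2: "indep_var borel (%y. ?h (%i. ?X i y)) borel (%y. g (B t y - B s y))" by simp
 have ae: "AE y in M. ?h (%i. ?X i y) = (if \<forall>r\<in>R. B r y \<in> A r then 1 else 0)"
 proof -
  have "AE y in M. B 0 y = 0" using B by (auto simp: standard_BM_def)
  then show ?thesis
  proof eventually_elim
   case (elim y)
   have "(\<Sum>j<idx r. ?X j y) = B r y" if "r \<in> R" for r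
   proof -
    have "(\<Sum>j<idx r. ?X j y) = B (u (idx r)) y - B (u 0) y"
     by (rule sum_lessThan_telescope)
    then show ?thesis using idxR[OF that] L0 first elim by (simp add: u_def)
   qed
   then show ?case by simp
  qed
 qed
 have m1: "(%y. if \<forall>r\<in>R. B r y \<in> A r then 1 else 0 :: real) \<in> borel_measurable M"
 proof -
  have "{y\<in>space M. \<forall>r\<in>R. B r y \<in> A r} \<in> sets M"
  proof (intro sets.sets_Collect_finite_All R(1))
   fix r assume r: "r \<in> R"
   then have "B r \<in> borel_measurable M" using R(2) by (intro Bm) auto
   then show "{y\<in>space M. B r y \<in> A r} \<in> sets M"
    by (rule measurable_sets_Collect) (use A[OF r] in simp)
  qed
  then show ?thesis by (intro measurable_If) auto
 qed
 have m2: "(%y. ?h (%i. ?X i y)) \<in> borel_measurable M"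
  by (rule indep_var_rv1[OF ind2])
 have inth: "integrable M (%y. ?h (%i. ?X i y))"
  by (rule integrable_const_bound[of _ 1]) (auto intro: m2)
 have gm: "(%y. g (B t y - B s y)) \<in> borel_measurable M" using int by auto
 have "expectation (%y. (if \<forall>r\<in>R. B r y \<in> A r then 1 else 0) * g (B t y - B s y))
   = expectation (%y. ?h (%i. ?X i y) * g (B t y - B s y))"
  by (intro integral_cong_AE borel_measurable_times m1 m2 gm) (use ae in eventually_elim, simp only:)
 also have "\<dots> = expectation (%y. ?h (%i. ?X i y)) * expectation (%y. g (B t y - B s y))"
  by (rule indep_var_lebesgue_integral[OF ind2 inth int])
 also have "expectation (%y. ?h (%i. ?X i y)) = expectation (%y. if \<forall>r\<in>R. B r y \<in> A r then 1 else 0)"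
  by (rule integral_cong_AE[OF m2 m1 ae])
 finally show ?thesis .
qed

end

section \<open>The augmented filtration and its cylinder sets\<close>

lemma subalgebra_BM_filtration:
 assumes B: "independent_BMs M N B"
 shows "subalgebra M (BM_filtration M N B t)"
  and "s <= t ==> subalgebra (BM_filtration M N B t) (BM_filtration M N B s)"
proof -
 define G where "G t = {B i s -` A \<inter> space M | i s A. i \<in> {1..N} \<and> 0 <= s \<and> s <= t \<and> A \<in> sets borel} \<union> null_sets M" for t
 have G: "G t \<subseteq> sets M" for t
 proof -
  have "B i s \<in> borel_measurable M" if "i \<in> {1..N}" "0 <= s" for i s
   using B that unfolding independent_BMs_def standard_BM_def by blast
  then show ?thesis unfolding G_def by (auto intro: measurable_sets null_setsD2)
 qed
 then have GP: "G t \<subseteq> Pow (space M)" for t using sets.sets_into_space by blast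
 have F: "BM_filtration M N B t = sigma (space M) (G t)" for t
  unfolding BM_filtration_def G_def ..
 have space: "space (BM_filtration M N B t) = space M" and sets: "sets (BM_filtration M N B t) = sigma_sets (space M) (G t)" for t
  unfolding F using GP by (simp_all add: space_measure_of sets_measure_of)
 show "subalgebra M (BM_filtration M N B t)"
  unfolding subalgebra_def space sets using G sets.sigma_sets_subset by blast
 assume "s <= t"
 then have "G s \<subseteq> G t" unfolding G_def by fastforce
 then have "sigma_sets (space M) (G s) \<subseteq> sigma_sets (space M) (G t)" by (rule sigma_sets_mono')
 then show "subalgebra (BM_filtration M N B t) (BM_filtration M N B s)"
  unfolding subalgebra_def space sets by simp
qed

definition past_cylinder ::
 "'w measure => (nat => real => 'w => real) => (nat \<times> real) set => (nat \<times> real => real set) => 'w set" where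
 "past_cylinder M B R A = {h \<in> space M. \<forall>p\<in>R. B (fst p) (snd p) h \<in> A p}"

text \<open>The preimages that generate \<open>BM_filtration\<close> involve one coordinate and one
  time and are not stable under intersections. Cylinders over finitely many such pairs are, and
  together with the null sets they generate the same sigma algebra.\<close>

definition past_cylinders ::
 "'w measure => nat => (nat => real => 'w => real) => real => 'w set set" where
 "past_cylinders M N B s = {past_cylinder M B R A | R A.
   finite R \<and> R \<subseteq> {1..N} \<times> {0..s} \<and> (\<forall>p\<in>R. A p \<in> sets borel)}"

context prob_space
begin

lemma past_cylinder_sets:
 assumes B: "independent_BMs M N B" and R: "finite R" "R \<subseteq> {1..N} \<times> {0..s}" "\<forall>p\<in>R. A p \<in> sets borel"
 shows "past_cylinder M B R A \<in> sets (BM_filtration M N B s)"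
proof -
 let ?F = "BM_filtration M N B s"
 have sp: "space ?F = space M" using subalgebra_BM_filtration(1)[OF B] by (simp add: subalgebra_def)
 have "{h \<in> space ?F. \<forall>p\<in>R. B (fst p) (snd p) h \<in> A p} \<in> sets ?F"
 proof (intro sets.sets_Collect_finite_All R(1))
  fix p assume p: "p \<in> R"
  have "{h \<in> space ?F. B (fst p) (snd p) h \<in> A p} = B (fst p) (snd p) -` A p \<inter> space M" by (auto simp: sp)
  also have "\<dots> \<in> sets ?F"
  proof -
   have "B (fst p) (snd p) -` A p \<inter> space M \<in>
    {B i r -` A \<inter> space M | i r A. i \<in> {1..N} \<and> 0 <= r \<and> r <= s \<and> A \<in> sets borel} \<union> null_sets M"
    using p R by (intro UnI1 CollectI exI[of _ "fst p"] exI[of _ "snd p"] exI[of _ "A p"]) auto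
   moreover have "{B i r -` A \<inter> space M | i r A. i \<in> {1..N} \<and> 0 <= r \<and> r <= s \<and> A \<in> sets borel} \<union> null_sets M \<subseteq> Pow (space M)"
    by (auto dest: null_setsD2 sets.sets_into_space)
   ultimately show ?thesis unfolding BM_filtration_def by (simp only: sets_measure_of sigma_sets.Basic)
  qed
  finally show "{h \<in> space ?F. B (fst p) (snd p) h \<in> A p} \<in> sets ?F" .
 qed
 then show ?thesis by (simp add: past_cylinder_def sp)
qed

lemma sets_BM_filtration:
 assumes B: "independent_BMs M N B"
 shows "sets (BM_filtration M N B s) = sigma_sets (space M) (past_cylinders M N B s \<union> null_sets M)"
  and "Int_stable (past_cylinders M N B s \<union> null_sets M)"
  and "past_cylinders M N B s \<union> null_sets M \<subseteq> sets M"
proof -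
 let ?F = "BM_filtration M N B s"
 let ?G = "{B i r -` A \<inter> space M | i r A. i \<in> {1..N} \<and> 0 <= r \<and> r <= s \<and> A \<in> sets borel} \<union> null_sets M"
 have GP: "?G \<subseteq> Pow (space M)" by (auto dest: null_setsD2 sets.sets_into_space)
 have sub: "subalgebra M ?F" by (rule subalgebra_BM_filtration(1)[OF B])
 have cyl: "past_cylinders M N B s \<subseteq> sets ?F"
  unfolding past_cylinders_def using past_cylinder_sets[OF B] by blast
 show cylM: "past_cylinders M N B s \<union> null_sets M \<subseteq> sets M"
  using cyl sub by (auto simp: subalgebra_def)
 have F: "sets ?F = sigma_sets (space M) ?G" unfolding BM_filtration_def using GP by (rule sets_measure_of)
 show "sets ?F = sigma_sets (space M) (past_cylinders M N B s \<union> null_sets M)"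
 proof
  show "sigma_sets (space M) (past_cylinders M N B s \<union> null_sets M) \<subseteq> sets ?F"
  proof -
   have "null_sets M \<subseteq> sets ?F" unfolding F by (auto intro: sigma_sets.Basic)
   then have "past_cylinders M N B s \<union> null_sets M \<subseteq> sets ?F" using cyl by blast
   then have "sigma_sets (space ?F) (past_cylinders M N B s \<union> null_sets M) \<subseteq> sets ?F" by (rule sets.sigma_sets_subset)
   then show ?thesis using sub by (simp add: subalgebra_def)
  qed
  show "sets ?F \<subseteq> sigma_sets (space M) (past_cylinders M N B s \<union> null_sets M)"
   unfolding F
  proof (rule sigma_sets_mono')
   show "?G \<subseteq> past_cylinders M N B s \<union> null_sets M"
   proof
    fix C assume "C \<in> ?G"
    then consider i r A where "C = B i r -` A \<inter> space M" "i \<in> {1..N}" "0 <= r" "r <= s" "A \<in> sets borel"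
     | "C \<in> null_sets M" by blast
    then show "C \<in> past_cylinders M N B s \<union> null_sets M"
    proof cases
     case 1
     then have "C = past_cylinder M B {(i, r)} (%_. A)" by (auto simp: past_cylinder_def)
     then have "C \<in> past_cylinders M N B s" using 1 unfolding past_cylinders_def
      by (intro CollectI exI[of _ "{(i, r)}"] exI[of _ "%_. A"] conjI) auto
     then show ?thesis by simp
    qed simp
   qed
  qed
 qed
 show "Int_stable (past_cylinders M N B s \<union> null_sets M)"
 proof (rule Int_stableI)
  fix a b assume ab: "a \<in> past_cylinders M N B s \<union> null_sets M" "b \<in> past_cylinders M N B s \<union> null_sets M"
  then have m: "a \<in> sets M" "b \<in> sets M" using cylM by auto
  show "a \<inter> b \<in> past_cylinders M N B s \<union> null_sets M"
  proof (cases "a \<in> null_sets M \<or> b \<in> null_sets M")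
   case True
   then have "a \<inter> b \<in> null_sets M" using null_set_Int1[of a M b] null_set_Int2[of b M a] m by (auto simp: Int_commute)
   then show ?thesis by simp
  next
   case False
   then obtain R A R' A' where a: "a = past_cylinder M B R A" "finite R" "R \<subseteq> {1..N} \<times> {0..s}" "\<forall>p\<in>R. A p \<in> sets borel"
    and b: "b = past_cylinder M B R' A'" "finite R'" "R' \<subseteq> {1..N} \<times> {0..s}" "\<forall>p\<in>R'. A' p \<in> sets borel"
    using ab unfolding past_cylinders_def by blast
   \<comment> \<open>\<open>A\<close> and \<open>A'\<close> are arbitrary off \<open>R\<close> and
     \<open>R'\<close>, so an absent condition has to be replaced by \<open>UNIV\<close>.\<close>
   define A'' where "A'' p = (if p \<in> R then A p else UNIV) \<inter> (if p \<in> R' then A' p else UNIV)" for p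
   have "a \<inter> b = past_cylinder M B (R \<union> R') A''"
    unfolding a b past_cylinder_def A''_def by auto
   moreover have "\<forall>p\<in>R \<union> R'. A'' p \<in> sets borel" using a b by (auto simp: A''_def)
   ultimately have "a \<inter> b \<in> past_cylinders M N B s" using a b unfolding past_cylinders_def
    by (intro CollectI exI[of _ "R \<union> R'"] exI[of _ A''] conjI) auto
   then show ?thesis by simp
  qed
 qed
qed

text \<open>The weight functions \<open>w q\<close> allow one to insert up to two increments.\<close>

lemma independent_BMs_cylinder:
 fixes w :: "nat => real => real"
 assumes B: "independent_BMs M N B" and R: "finite R" "R \<subseteq> {1..N} \<times> {0..s}" "\<forall>p\<in>R. A p \<in> sets borel"
  and st: "0 <= s" "s <= t"
  and w: "\<And>q. q \<in> {1..N} ==> w q \<in> borel_measurable borel"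
   "\<And>q. q \<in> {1..N} ==> integrable M (%h. w q (B q t h - B q s h))"
 shows "(\<integral>h\<in>past_cylinder M B R A. (\<Prod>q\<in>{1..N}. w q (B q t h - B q s h)) \<partial>M)
  = (\<Prod>q\<in>{1..N}. expectation (%h. if \<forall>r\<in>{r. (q, r) \<in> R}. B q r h \<in> A (q, r) then 1 else 0)
     * expectation (%h. w q (B q t h - B q s h)))"
proof -
 define e where "e q h = (if \<forall>r\<in>{r. (q, r) \<in> R}. B q r h \<in> A (q, r) then 1 else 0 :: real)" for q h
 have BM: "standard_BM M (B q)" if "q \<in> {1..N}" for q using B that by (auto simp: independent_BMs_def)
 have Rq: "finite {r. (q, r) \<in> R}" "{r. (q, r) \<in> R} \<subseteq> {0..s}" for q
 proof -
  have "{r. (q, r) \<in> R} \<subseteq> snd ` R" by force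
  then show "finite {r. (q, r) \<in> R}" using R(1) by (meson finite_imageI finite_subset)
  show "{r. (q, r) \<in> R} \<subseteq> {0..s}" using R(2) by auto
 qed
 \<comment> \<open>Independence is assumed for whole paths, so the condition on the past and the
   weighted increment of coordinate \<open>q\<close> are packed into a single function of the path
   \<open>p\<close>.\<close>
 let ?Y = "%q p. (if \<forall>r\<in>{r. (q, r) \<in> R}. p r \<in> A (q, r) then 1 else 0 :: real) * w q (p t - p s)"
 have Ym: "?Y q \<in> borel_measurable (PiM {0..} (%_. borel))" if q: "q \<in> {1..N}" for q
 proof (rule borel_measurable_times)
  have c: "(%p. p r) \<in> borel_measurable (PiM {0..} (%_::real. borel :: real measure))" if "0 <= r" for r
   by (rule measurable_component_singleton) (use that in simp)
  have "{p \<in> space (PiM {0..} (%_. borel)). \<forall>r\<in>{r. (q, r) \<in> R}. p r \<in> A (q, r)} \<in> sets (PiM {0..} (%_::real. borel :: real measure))"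
  proof (intro sets.sets_Collect_finite_All Rq)
   fix r assume r: "r \<in> {r. (q, r) \<in> R}"
   then have "0 <= r" using Rq(2)[of q] by auto
   then show "{p \<in> space (PiM {0..} (%_. borel)). p r \<in> A (q, r)} \<in> sets (PiM {0..} (%_::real. borel :: real measure))"
    by (rule measurable_sets_Collect[OF c]) (use r R(3) in auto)
  qed
  then show "(%p. if \<forall>r\<in>{r. (q, r) \<in> R}. p r \<in> A (q, r) then 1 else 0 :: real) \<in> borel_measurable (PiM {0..} (%_. borel))"
   by (intro measurable_If) auto
  have "(%p. p t - p s) \<in> borel_measurable (PiM {0..} (%_::real. borel :: real measure))"
   using st by (intro borel_measurable_diff c) auto
  then show "(%p. w q (p t - p s)) \<in> borel_measurable (PiM {0..} (%_. borel))"
   by (rule measurable_compose[OF _ w(1)[OF q]])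
 qed
 have "indep_vars (%_. PiM {0..} (%_::real. borel)) (%i h. \<lambda>t\<in>{0..}. B i t h) {1..N}"
  using B by (auto simp: independent_BMs_def)
 then have "indep_vars (%_. borel) (%q h. ?Y q (\<lambda>t\<in>{0..}. B q t h)) {1..N}"
  by (rule indep_vars_compose2) (rule Ym)
 moreover have Yeq: "?Y q (\<lambda>t\<in>{0..}. B q t h) = e q h * w q (B q t h - B q s h)" for q h
  using Rq(2)[of q] st by (auto simp: e_def subset_eq)
 ultimately have ind: "indep_vars (%_. borel) (%q h. e q h * w q (B q t h - B q s h)) {1..N}" by simp
 have int: "integrable M (%h. e q h * w q (B q t h - B q s h))" if q: "q \<in> {1..N}" for q
 proof (rule Bochner_Integration.integrable_bound[OF w(2)[OF q]])
  show "(%h. e q h * w q (B q t h - B q s h)) \<in> borel_measurable M"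
   using ind q unfolding indep_vars_def by auto
 qed (simp add: e_def)
 have "(\<integral>h\<in>past_cylinder M B R A. (\<Prod>q\<in>{1..N}. w q (B q t h - B q s h)) \<partial>M)
   = expectation (%h. \<Prod>q\<in>{1..N}. e q h * w q (B q t h - B q s h))"
  unfolding set_lebesgue_integral_def
 proof (rule Bochner_Integration.integral_cong[OF refl])
  fix h assume h: "h \<in> space M"
  have "indicator (past_cylinder M B R A) h = (\<Prod>q\<in>{1..N}. e q h)"
  proof (cases "h \<in> past_cylinder M B R A")
   case True
   then have "e q h = 1" for q by (auto simp: e_def past_cylinder_def)
   then show ?thesis using True by simp
  next
   case False
   then obtain q r where "(q, r) \<in> R" "B q r h \<notin> A (q, r)" using h by (auto simp: past_cylinder_def)
   then have "q \<in> {1..N}" "e q h = 0" using R(2) by (auto simp: e_def)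
   then show ?thesis using False prod_zero[of "{1..N}" "%q. e q h"] by auto
  qed
  then show "indicat_real (past_cylinder M B R A) h *\<^sub>R (\<Prod>q\<in>{1..N}. w q (B q t h - B q s h))
    = (\<Prod>q\<in>{1..N}. e q h * w q (B q t h - B q s h))"
   by (simp add: prod.distrib)
 qed
 also have "\<dots> = (\<Prod>q\<in>{1..N}. expectation (%h. e q h * w q (B q t h - B q s h)))"
  by (rule indep_vars_lebesgue_integral[OF _ ind int]) auto
 also have "\<dots> = (\<Prod>q\<in>{1..N}. expectation (e q) * expectation (%h. w q (B q t h - B q s h)))"
 proof (rule prod.cong[OF refl])
  fix q assume q: "q \<in> {1..N}"
  show "expectation (%h. e q h * w q (B q t h - B q s h)) = expectation (e q) * expectation (%h. w q (B q t h - B q s h))"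
   unfolding e_def
   by (rule standard_BM_increment_indep_past[OF BM[OF q] st Rq, where A = "%r. A (q, r)"]) (use R(3) w q in auto)
 qed
 finally show ?thesis by (simp add: e_def[abs_def])
qed

text \<open>The martingale property and the bracket of the Brownian motions relative to their joint
  filtration. On a cylinder the expectation factorizes over the coordinates; null sets contribute
  nothing; the Dynkin argument extends both identities to all events of the past.\<close>

lemma independent_BMs_increments:
 assumes B: "independent_BMs M N B" and ij: "i \<in> {1..N}" "j \<in> {1..N}" and st: "0 <= s" "s <= t"
 shows "A \<in> sets (BM_filtration M N B s) ==> (\<integral>h\<in>A. (B i t h - B i s h) \<partial>M) = 0"
  and "integrable M (%h. (B i t h - B i s h) * (B j t h - B j s h))"
  and "A \<in> sets (BM_filtration M N B s) ==>
   (\<integral>h\<in>A. ((B i t h - B i s h) * (B j t h - B j s h) - (if i = j then t - s else 0)) \<partial>M) = 0"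
proof -
 have BM: "standard_BM M (B q)" if "q \<in> {1..N}" for q using B that by (auto simp: independent_BMs_def)
 note inc = standard_BM_increment[OF BM st]
 let ?D = "%q h. B q t h - B q s h"
 show int: "integrable M (%h. ?D i h * ?D j h)"
  using inc(1,2)[OF ij(1)] inc(1,2)[OF ij(2)] by (intro integrable_mult_of_squares) auto
 define e where "e R C q = expectation (%h. if \<forall>r\<in>{r. (q, r) \<in> R}. B q r h \<in> C (q, r) then 1 else 0 :: real)" for R C q
 have cyl1: "(\<integral>h\<in>past_cylinder M B R C. ?D i h \<partial>M) = 0"
  if R: "finite R" "R \<subseteq> {1..N} \<times> {0..s}" "\<forall>p\<in>R. C p \<in> sets borel" for R C
 proof -
  \<comment> \<open>The increment sits at coordinate \<open>i\<close>, every other coordinate has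
    weight 1.\<close>
  let ?w = "%q x. if q = i then x else 1 :: real"
  have wint: "integrable M (%h. ?w q (?D q h))" if q: "q \<in> {1..N}" for q
   using inc(2)[OF q] by (cases "q = i") auto
  have "(\<integral>h\<in>past_cylinder M B R C. (\<Prod>q\<in>{1..N}. ?w q (?D q h)) \<partial>M)
    = (\<Prod>q\<in>{1..N}. e R C q * expectation (%h. ?w q (?D q h)))"
   unfolding e_def by (rule independent_BMs_cylinder[OF B R st _ wint]) auto
  moreover have "\<dots> = 0" using ij inc(3)[OF ij(1)] by (intro prod_zero) (auto intro!: bexI[of _ i])
  ultimately show ?thesis using ij by (simp add: prod.delta)
 qed
 have cyl0: "measure M (past_cylinder M B R C) = (\<Prod>q\<in>{1..N}. e R C q)"
  if R: "finite R" "R \<subseteq> {1..N} \<times> {0..s}" "\<forall>p\<in>R. C p \<in> sets borel" for R C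
 proof -
  have [measurable]: "past_cylinder M B R C \<in> sets M"
   using past_cylinder_sets[OF B R] subalgebra_BM_filtration(1)[OF B] by (auto simp: subalgebra_def)
  have "(\<integral>h\<in>past_cylinder M B R C. (\<Prod>q\<in>{1..N}. (%q x. 1::real) q (?D q h)) \<partial>M)
    = (\<Prod>q\<in>{1..N}. e R C q * expectation (%h. (%q x. 1::real) q (?D q h)))"
   unfolding e_def by (rule independent_BMs_cylinder[OF B R st]) auto
  then show ?thesis by (simp add: set_lebesgue_integral_def prob_space)
 qed
 have cyl2: "(\<integral>h\<in>past_cylinder M B R C. ?D i h * ?D j h \<partial>M) = measure M (past_cylinder M B R C) * (if i = j then t - s else 0)"
  if R: "finite R" "R \<subseteq> {1..N} \<times> {0..s}" "\<forall>p\<in>R. C p \<in> sets borel" for R C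
 proof -
  \<comment> \<open>A product of two conditions, so that for \<open>i = j\<close> one coordinate
    carries the squared increment, while for \<open>i \<noteq> j\<close> each of the two carries a
    centred factor.\<close>
  let ?w = "%q x. (if q = i then x else 1) * (if q = j then x else 1 :: real)"
  have wint: "integrable M (%h. ?w q (?D q h))" if q: "q \<in> {1..N}" for q
   using inc(1,2)[OF q] by (cases "q = i"; cases "q = j") (auto simp: power2_eq_square)
  have "(\<integral>h\<in>past_cylinder M B R C. (\<Prod>q\<in>{1..N}. ?w q (?D q h)) \<partial>M)
    = (\<Prod>q\<in>{1..N}. e R C q * expectation (%h. ?w q (?D q h)))"
   unfolding e_def by (rule independent_BMs_cylinder[OF B R st _ wint]) auto
  moreover have "(\<Prod>q\<in>{1..N}. ?w q (?D q h)) = ?D i h * ?D j h" for h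
   using ij by (simp add: prod.distrib prod.delta)
  moreover have "(\<Prod>q\<in>{1..N}. e R C q * expectation (%h. ?w q (?D q h))) = measure M (past_cylinder M B R C) * (if i = j then t - s else 0)"
  proof (cases "i = j")
   case True
   have "expectation (%h. ?w q (?D q h)) = (if q = i then t - s else 1)" if q: "q \<in> {1..N}" for q
    using inc(4)[OF q] True by (auto simp: power2_eq_square prob_space)
   then show ?thesis using True ij by (simp add: prod.distrib prod.delta cyl0[OF R])
  next
   case False
   then show ?thesis using ij inc(3)[OF ij(1)] by (simp, intro disjI2 bexI[of _ i]) auto
  qed
  ultimately show ?thesis by simp
 qed
 have null: "(\<integral>h\<in>A. Y h \<partial>M) = 0" if "A \<in> null_sets M" for A and Y :: "'a => real"
 proof -
  have "AE h in M. h \<notin> A" using that by (rule AE_not_in)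
  then have "AE h in M. indicator A h *\<^sub>R Y h = 0" by eventually_elim simp
  then show ?thesis unfolding set_lebesgue_integral_def by (rule integral_eq_zero_AE)
 qed
 assume A: "A \<in> sets (BM_filtration M N B s)"
 then have A': "A \<in> sigma_sets (space M) (past_cylinders M N B s \<union> null_sets M)"
  by (simp add: sets_BM_filtration[OF B])
 show "(\<integral>h\<in>A. ?D i h \<partial>M) = 0"
  by (rule integral_indicator_zero_sigma_sets[OF sets_BM_filtration(2,3)[OF B] _ _ _ A'])
   (use inc(2,3)[OF ij(1)] null cyl1 in \<open>auto simp: past_cylinders_def\<close>)
 have z: "(\<integral>h\<in>C. (?D i h * ?D j h - (if i = j then t - s else 0)) \<partial>M) = 0"
  if C: "C \<in> past_cylinders M N B s" for C
 proof -
  obtain R D where R: "C = past_cylinder M B R D" "finite R" "R \<subseteq> {1..N} \<times> {0..s}" "\<forall>p\<in>R. D p \<in> sets borel"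
   using C unfolding past_cylinders_def by blast
  have [measurable]: "C \<in> sets M" using sets_BM_filtration(3)[OF B, of s] C by auto
  have [simp]: "past_cylinder M B R D \<inter> space M = past_cylinder M B R D" by (auto simp: past_cylinder_def)
  have "set_integrable M C (%h. ?D i h * ?D j h)" "set_integrable M C (%h. if i = j then t - s else 0)"
   unfolding set_integrable_def by (intro integrable_mult_indicator int; simp)+
  then show ?thesis
   using cyl2[OF R(2-4)] by (subst set_integral_diff) (auto simp: R(1) set_integral_const set_lebesgue_integral_def)
 qed
 have e0: "expectation (%h. ?D i h * ?D j h - (if i = j then t - s else 0)) = 0"
 proof -
  have "past_cylinder M B {} (%_. UNIV) = space M" by (simp add: past_cylinder_def)
  then have "space M \<in> past_cylinders M N B s" unfolding past_cylinders_def
   by (intro CollectI exI[of _ "{}"] exI[of _ "%_. UNIV"] conjI) simp_all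
  from z[OF this] show ?thesis by (subst (asm) set_integral_space) (use int in auto)
 qed
 show "(\<integral>h\<in>A. (?D i h * ?D j h - (if i = j then t - s else 0)) \<partial>M) = 0"
 proof (rule integral_indicator_zero_sigma_sets[OF sets_BM_filtration(2,3)[OF B] _ e0 _ A'])
  show "integrable M (%h. ?D i h * ?D j h - (if i = j then t - s else 0))"
   using int by (intro Bochner_Integration.integrable_diff) auto
  show "(\<integral>h\<in>C. (?D i h * ?D j h - (if i = j then t - s else 0)) \<partial>M) = 0"
   if "C \<in> past_cylinders M N B s \<union> null_sets M" for C
   using that by (elim UnE) (erule z, erule null)
 qed
qed

end

section \<open>The Ito isometry\<close>

lemma integral_indicator_Ioc_mult:
 fixes a b c d :: real
 shows "(\<integral>s. indicator {a<..b} s * indicator {c<..d} s \<partial>lborel) = max 0 (min b d - max a c)"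
proof -
 have "(%s. indicator {a<..b} s * indicator {c<..d} s :: real) = indicator {max a c<..min b d}"
  by (auto simp: indicator_def fun_eq_iff)
 then show ?thesis by (auto simp: max_def)
qed

lemma integrable_bounded_mult:
 fixes Z Y :: "'a => real"
 assumes Y: "integrable M Y" and [measurable]: "Z \<in> borel_measurable M" and Z: "\<And>x. x \<in> space M ==> \<bar>Z x\<bar> <= C"
 shows "integrable M (%x. Z x * Y x)"
proof (rule Bochner_Integration.integrable_bound)
 show "integrable M (%x. C * Y x)" using Y by simp
 show "(%x. Z x * Y x) \<in> borel_measurable M" using Y by measurable
 show "AE x in M. norm (Z x * Y x) <= norm (C * Y x)"
 proof (rule AE_I2)
  fix x assume "x \<in> space M"
  then have "\<bar>Z x\<bar> <= \<bar>C\<bar>" using Z[of x] by linarith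
  then show "norm (Z x * Y x) <= norm (C * Y x)" by (simp add: abs_mult mult_right_mono)
 qed
qed

lemma integral_double_sum:
 fixes f :: "'i => 'j => 'a => real"
 assumes "\<And>k l. k \<in> K ==> l \<in> L ==> integrable M (f k l)"
 shows "(\<integral>x. (\<Sum>k\<in>K. \<Sum>l\<in>L. f k l x) \<partial>M) = (\<Sum>k\<in>K. \<Sum>l\<in>L. (\<integral>x. f k l x \<partial>M))"
proof -
 have "(\<integral>x. (\<Sum>k\<in>K. \<Sum>l\<in>L. f k l x) \<partial>M) = (\<Sum>k\<in>K. (\<integral>x. (\<Sum>l\<in>L. f k l x) \<partial>M))"
  by (intro Bochner_Integration.integral_sum Bochner_Integration.integrable_sum assms)
 also have "\<dots> = (\<Sum>k\<in>K. \<Sum>l\<in>L. (\<integral>x. f k l x \<partial>M))"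
  by (intro sum.cong refl Bochner_Integration.integral_sum assms)
 finally show ?thesis .
qed

lemma integral_power2_diff:
 fixes f g :: "'a => real"
 assumes "integrable M (%x. f x * f x)" "integrable M (%x. f x * g x)" "integrable M (%x. g x * g x)"
 shows "(\<integral>x. (f x - g x)^2 \<partial>M) = (\<integral>x. f x * f x \<partial>M) - 2 * (\<integral>x. f x * g x \<partial>M) + (\<integral>x. g x * g x \<partial>M)"
proof -
 have "(%x. (f x - g x)^2) = (%x. f x * f x - 2 * (f x * g x) + g x * g x)"
  by (auto simp: power2_eq_square algebra_simps)
 then show ?thesis using assms by simp
qed

section \<open>The isometry for elementary integrands\<close>

locale BM_system = prob_space M for M :: "'w measure" +
 fixes N :: nat and B :: "nat => real => 'w => real"
 assumes indep_BMs: "independent_BMs M N B"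
begin

abbreviation F :: "real => 'w measure" where "F \<equiv> BM_filtration M N B"

lemma measurable_of_F: "Z \<in> borel_measurable (F t) ==> Z \<in> borel_measurable M"
 by (rule measurable_from_subalg[OF subalgebra_BM_filtration(1)[OF indep_BMs]])

lemma measurable_F_mono: "Z \<in> borel_measurable (F s) ==> s <= t ==> Z \<in> borel_measurable (F t)"
 by (rule measurable_from_subalg[OF subalgebra_BM_filtration(2)[OF indep_BMs]])

lemma space_F[simp]: "space (F t) = space M"
 using subalgebra_BM_filtration(1)[OF indep_BMs] by (simp add: subalgebra_def)

lemma BM: "i \<in> {1..N} ==> standard_BM M (B i)"
 using indep_BMs by (simp add: independent_BMs_def)

lemma BM_measurable: "i \<in> {1..N} ==> 0 <= s ==> B i s \<in> borel_measurable M"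
 using BM unfolding standard_BM_def by blast

lemma BM_adapted:
 assumes "i \<in> {1..N}" "0 <= s" "s <= t"
 shows "B i s \<in> borel_measurable (F t)"
proof (rule measurableI)
 fix A :: "real set" assume "A \<in> sets borel"
 then have "past_cylinder M B {(i, s)} (%_. A) \<in> sets (F t)"
  using assms by (intro past_cylinder_sets[OF indep_BMs]) auto
 moreover have "past_cylinder M B {(i, s)} (%_. A) = B i s -` A \<inter> space (F t)"
  by (auto simp: past_cylinder_def)
 ultimately show "B i s -` A \<inter> space (F t) \<in> sets (F t)" by simp
qed simp

lemma increment_square: "i \<in> {1..N} ==> 0 <= s ==> s <= t ==> integrable M (%h. (B i t h - B i s h)^2)"
 by (rule standard_BM_increment(1)[OF BM])

lemma bounded_increment_square:
 assumes "i \<in> {1..N}" "0 <= s" "s <= t" and Z: "Z \<in> borel_measurable M" "\<And>h. h \<in> space M ==> \<bar>Z h\<bar> <= C"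
 shows "integrable M (%h. (Z h * (B i t h - B i s h))^2)"
proof -
 have "integrable M (%h. (Z h)^2 * (B i t h - B i s h)^2)"
 proof (rule integrable_bounded_mult[where C = "C^2"])
  fix h assume "h \<in> space M"
  then have "\<bar>Z h\<bar>^2 <= C^2" by (intro power_mono Z) auto
  then show "\<bar>(Z h)^2\<bar> <= C^2" by simp
 qed (use assms increment_square in auto)
 then show ?thesis by (simp add: power_mult_distrib)
qed

text \<open>\<open>Z\<close> is merely square integrable, because in the application it contains a
  Brownian increment from before time \<open>s\<close>.\<close>

lemma increment_mult_zero:
 assumes i: "i \<in> {1..N}" "0 <= s" "s <= t" and Z: "Z \<in> borel_measurable (F s)" "integrable M (%h. (Z h)^2)"
 shows "expectation (%h. Z h * (B i t h - B i s h)) = 0"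
proof (rule integral_mult_subalgebra_zero[OF subalgebra_BM_filtration(1)[OF indep_BMs]])
 have m: "B i t \<in> borel_measurable M" "B i s \<in> borel_measurable M" using BM_measurable i by auto
 show "integrable M (%h. Z h * (B i t h - B i s h))"
  by (rule integrable_mult_of_squares[OF measurable_of_F[OF Z(1)] _ Z(2) increment_square[OF i]]) (use m in auto)
 show "integrable M (%h. B i t h - B i s h)" by (rule standard_BM_increment(2)[OF BM[OF i(1)] i(2,3)])
 show "A \<in> sets (F s) ==> (\<integral>h\<in>A. (B i t h - B i s h) \<partial>M) = 0" for A
  by (rule independent_BMs_increments(1)[OF indep_BMs i(1) i])
qed (rule Z)

lemma increment_mult_increment:
 assumes ij: "i \<in> {1..N}" "j \<in> {1..N}" "0 <= s" "s <= t"
  and Z: "Z \<in> borel_measurable (F s)" "\<And>h. h \<in> space M ==> \<bar>Z h\<bar> <= C"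
 shows "integrable M (%h. Z h * ((B i t h - B i s h) * (B j t h - B j s h)))"
  and "expectation (%h. Z h * ((B i t h - B i s h) * (B j t h - B j s h))) = (if i = j then t - s else 0) * expectation Z"
proof -
 let ?c = "if i = j then t - s else 0"
 let ?D = "%h. (B i t h - B i s h) * (B j t h - B j s h)"
 have Zi: "integrable M Z" by (rule integrable_const_bound[of _ C]) (use Z(2) measurable_of_F[OF Z(1)] in auto)
 have D: "integrable M ?D" by (rule independent_BMs_increments(2)[OF indep_BMs ij])
 show I: "integrable M (%h. Z h * ?D h)"
  by (rule integrable_bounded_mult[OF D measurable_of_F[OF Z(1)] Z(2)])
 have "expectation (%h. Z h * (?D h - ?c)) = 0"
 proof (rule integral_mult_subalgebra_zero[OF subalgebra_BM_filtration(1)[OF indep_BMs] _ _ Z(1)])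
  show "integrable M (%h. ?D h - ?c)" using D by (intro Bochner_Integration.integrable_diff) auto
  then show "integrable M (%h. Z h * (?D h - ?c))"
   by (rule integrable_bounded_mult[OF _ measurable_of_F[OF Z(1)] Z(2)])
  show "A \<in> sets (F s) ==> (\<integral>h\<in>A. (?D h - ?c) \<partial>M) = 0" for A
   by (rule independent_BMs_increments(3)[OF indep_BMs ij])
 qed
 moreover have "expectation (%h. Z h * (?D h - ?c)) = expectation (%h. Z h * ?D h - Z h * ?c)"
  by (rule Bochner_Integration.integral_cong[OF refl]) (rule right_diff_distrib)
 moreover have "\<dots> = expectation (%h. Z h * ?D h) - expectation (%h. Z h * ?c)"
  by (rule Bochner_Integration.integral_diff[OF I]) (use Zi in auto)
 ultimately show "expectation (%h. Z h * ?D h) = ?c * expectation Z" by simp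
qed

text \<open>The intervals are cut at \<open>c\<close> and at the end \<open>e\<close> of their
  overlap. A product in which one increment lies after all the other factors vanishes in
  expectation; only the product over the overlap can contribute, with the length of the
  overlap.\<close>

lemma increment_pair_ordered:
 assumes ij: "i \<in> {1..N}" "j \<in> {1..N}" and ab: "0 <= a" "a <= b" and cd: "c <= d" and ac: "a <= c"
  and Z: "\<xi> \<in> borel_measurable (F a)" "\<And>h. h \<in> space M ==> \<bar>\<xi> h\<bar> <= C"
  and E: "\<eta> \<in> borel_measurable (F c)" "\<And>h. h \<in> space M ==> \<bar>\<eta> h\<bar> <= C'"
 shows "expectation (%h. (\<xi> h * (B i b h - B i a h)) * (\<eta> h * (B j d h - B j c h)))
  = (if i = j then expectation (%h. \<xi> h * \<eta> h) * max 0 (min b d - max a c) else 0)"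
proof -
 define \<zeta> where "\<zeta> h = \<xi> h * \<eta> h" for h
 have \<zeta>m: "\<zeta> \<in> borel_measurable (F c)" unfolding \<zeta>_def using Z(1) E(1) ac by (intro borel_measurable_times measurable_F_mono[of \<xi> a c]) auto
 have \<zeta>b: "\<bar>\<zeta> h\<bar> <= C * C'" if "h \<in> space M" for h
  unfolding \<zeta>_def abs_mult using Z(2)[OF that] E(2)[OF that] by (intro mult_mono) auto
 have c0: "0 <= c" using ab ac by simp
 have zero: "expectation (%h. (\<zeta> h * (B p v h - B p u h)) * (B q w h - B q v' h)) = 0"
  and zint: "integrable M (%h. (\<zeta> h * (B p v h - B p u h)) * (B q w h - B q v' h))"
  if "p \<in> {1..N}" "q \<in> {1..N}" "0 <= u" "u <= v" "v <= v'" "c <= v'" "v' <= w" for p q u v v' w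
 proof -
  have sq: "integrable M (%h. (\<zeta> h * (B p v h - B p u h))^2)"
   by (rule bounded_increment_square[OF _ _ _ measurable_of_F[OF \<zeta>m] \<zeta>b]) (use that in auto)
  have m: "(%h. \<zeta> h * (B p v h - B p u h)) \<in> borel_measurable (F v')"
   using that by (intro borel_measurable_times borel_measurable_diff BM_adapted measurable_F_mono[OF \<zeta>m]) auto
  show "expectation (%h. (\<zeta> h * (B p v h - B p u h)) * (B q w h - B q v' h)) = 0"
   by (rule increment_mult_zero[OF _ _ _ m sq]) (use that in auto)
  have m2: "(%h. B q w h - B q v' h) \<in> borel_measurable M"
   using that by (intro borel_measurable_diff BM_measurable) auto
  show "integrable M (%h. (\<zeta> h * (B p v h - B p u h)) * (B q w h - B q v' h))"
   by (rule integrable_mult_of_squares[OF measurable_of_F[OF m] m2 sq increment_square]) (use that in auto)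
 qed
 have *: "(%h. (\<xi> h * (B i b h - B i a h)) * (\<eta> h * (B j d h - B j c h))) = (%h. (\<zeta> h * (B i b h - B i a h)) * (B j d h - B j c h))"
  by (simp add: \<zeta>_def fun_eq_iff mult_ac)
 show ?thesis
 proof (cases "b <= c")
  case True
  then have "max 0 (min b d - max a c) = 0" by auto
  then show ?thesis using True ij ab cd zero[of i j a b c d] unfolding * by simp
 next
  case False
  define e where "e = min b d"
  have e: "c <= e" "e <= b" "e <= d" "0 <= e" "e = b \<or> e = d" using False cd c0 by (auto simp: e_def)
  note inc2 = increment_mult_increment[OF ij c0 e(1) \<zeta>m \<zeta>b]
  let ?D = "%i u v h. B i v h - B i u h"
  \<comment> \<open>The product of the two parts after \<open>e\<close> is absent because
    \<open>e\<close> is \<open>b\<close> or \<open>d\<close>, so one of these parts is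
    empty.\<close>
  have "(%h. (\<zeta> h * ?D i a b h) * ?D j c d h) =
   (%h. (\<zeta> h * ?D i a c h) * ?D j c d h + \<zeta> h * (?D i c e h * ?D j c e h)
    + (\<zeta> h * ?D i c e h) * ?D j e d h + (\<zeta> h * ?D j c e h) * ?D i e b h)"
   using e(5) by (auto simp: fun_eq_iff algebra_simps)
  then have "expectation (%h. (\<zeta> h * ?D i a b h) * ?D j c d h) =
    expectation (%h. (\<zeta> h * ?D i a c h) * ?D j c d h + \<zeta> h * (?D i c e h * ?D j c e h)
    + (\<zeta> h * ?D i c e h) * ?D j e d h + (\<zeta> h * ?D j c e h) * ?D i e b h)" by simp
  also have "\<dots> = expectation (%h. (\<zeta> h * ?D i a c h) * ?D j c d h) + expectation (%h. \<zeta> h * (?D i c e h * ?D j c e h))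
    + expectation (%h. (\<zeta> h * ?D i c e h) * ?D j e d h) + expectation (%h. (\<zeta> h * ?D j c e h) * ?D i e b h)"
   using zint[of i j a c c d] inc2(1) zint[of i j c e e d] zint[of j i c e e b] ij ab cd ac c0 e
   by simp
  also have "\<dots> = (if i = j then e - c else 0) * expectation \<zeta>"
   using zero[of i j a c c d] inc2(2) zero[of i j c e e d] zero[of j i c e e b] ij ab cd ac c0 e
   by simp
  also have "\<dots> = (if i = j then expectation \<zeta> * max 0 (min b d - max a c) else 0)"
   using e ac by (simp add: e_def max_def)
  finally show ?thesis unfolding * by (simp add: \<zeta>_def[abs_def])
 qed
qed

lemma increment_pair:
 assumes ij: "i \<in> {1..N}" "j \<in> {1..N}" and ab: "0 <= a" "a <= b" and cd: "0 <= c" "c <= d"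
  and Z: "\<xi> \<in> borel_measurable (F a)" "\<And>h. h \<in> space M ==> \<bar>\<xi> h\<bar> <= C"
  and E: "\<eta> \<in> borel_measurable (F c)" "\<And>h. h \<in> space M ==> \<bar>\<eta> h\<bar> <= C'"
 shows "expectation (%h. (\<xi> h * (B i b h - B i a h)) * (\<eta> h * (B j d h - B j c h)))
  = (if i = j then expectation (%h. \<xi> h * \<eta> h) * max 0 (min b d - max a c) else 0)"
proof (cases "a <= c")
 case True
 then show ?thesis using increment_pair_ordered[OF ij ab cd(2) _ Z E] by simp
next
 case False
 then have "expectation (%h. (\<eta> h * (B j d h - B j c h)) * (\<xi> h * (B i b h - B i a h)))
  = (if j = i then expectation (%h. \<eta> h * \<xi> h) * max 0 (min d b - max c a) else 0)"
  by (intro increment_pair_ordered[OF ij(2,1) cd ab(2) _ E Z]) simp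
 moreover have "(%h. (\<xi> h * (B i b h - B i a h)) * (\<eta> h * (B j d h - B j c h)))
  = (%h. (\<eta> h * (B j d h - B j c h)) * (\<xi> h * (B i b h - B i a h)))"
  by (intro ext) (rule mult.commute)
 moreover have "(%h. \<xi> h * \<eta> h) = (%h. \<eta> h * \<xi> h)" by (intro ext) (rule mult.commute)
 moreover have "max 0 (min b d - max a c) = max 0 (min d b - max c a)" by (simp add: min.commute max.commute)
 ultimately show ?thesis by auto
qed

text \<open>The intervals form an unordered family and may overlap. Two integrands with different
  partitions can thus be multiplied term by term, without a common refinement.\<close>

definition elem_fam :: "nat set => (nat => 'w => real) => (nat => real) => (nat => real) => bool" where
 "elem_fam K \<xi> a b \<longleftrightarrow> finite K \<and> (\<forall>k\<in>K. 0 <= a k \<and> a k <= b k \<and> \<xi> k \<in> borel_measurable (F (a k))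
   \<and> (\<exists>C. \<forall>h\<in>space M. \<bar>\<xi> k h\<bar> <= C))"

definition elem_int :: "nat => nat set => (nat => 'w => real) => (nat => real) => (nat => real) => 'w => real" where
 "elem_int i K \<xi> a b h = (\<Sum>k\<in>K. \<xi> k h * (B i (b k) h - B i (a k) h))"

definition elem_val :: "nat set => (nat => 'w => real) => (nat => real) => (nat => real) => 'w \<times> real => real" where
 "elem_val K \<xi> a b p = (\<Sum>k\<in>K. \<xi> k (fst p) * indicator {a k<..b k} (snd p))"

lemma elem_int_measurable: "i \<in> {1..N} ==> elem_fam K \<xi> a b ==> elem_int i K \<xi> a b \<in> borel_measurable M"
 unfolding elem_int_def[abs_def]
 by (intro borel_measurable_sum borel_measurable_times borel_measurable_diff BM_measurable)
  (auto simp: elem_fam_def dest: measurable_of_F)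

lemma elem_val_measurable: "elem_fam K \<xi> a b ==> elem_val K \<xi> a b \<in> borel_measurable (M \<Otimes>\<^sub>M lborel)"
 unfolding elem_val_def[abs_def]
 by (intro borel_measurable_sum borel_measurable_times measurable_compose[OF measurable_fst] measurable_compose[OF measurable_snd])
  (auto simp: elem_fam_def dest: measurable_of_F)

lemma pair_sigma_finite_lborel: "pair_sigma_finite M (lborel :: real measure)" by unfold_locales

lemma product_integral_indicator:
 fixes \<zeta> :: "'w => real" and c d :: real
 assumes \<zeta>: "\<zeta> \<in> borel_measurable M" "\<And>h. h \<in> space M ==> \<bar>\<zeta> h\<bar> <= C" and cd: "c <= d"
 shows "integrable (M \<Otimes>\<^sub>M lborel) (%p. \<zeta> (fst p) * (indicator {a<..b} (snd p) * indicator {c<..d} (snd p)))"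
  and "(\<integral>p. \<zeta> (fst p) * (indicator {a<..b} (snd p) * indicator {c<..d} (snd p)) \<partial>(M \<Otimes>\<^sub>M lborel))
   = expectation \<zeta> * max 0 (min b d - max a c)"
proof -
 interpret P: pair_sigma_finite M "lborel :: real measure" by (rule pair_sigma_finite_lborel)
 note [measurable] = \<zeta>(1)
 show I: "integrable (M \<Otimes>\<^sub>M lborel) (%p. \<zeta> (fst p) * (indicator {a<..b} (snd p) * indicator {c<..d} (snd p)))"
 proof (rule integrableI_bounded_set[where A = "space M \<times> {c<..d}" and B = C])
  show "space M \<times> {c<..d} \<in> sets (M \<Otimes>\<^sub>M lborel)" by simp
  show "emeasure (M \<Otimes>\<^sub>M lborel) (space M \<times> {c<..d}) < \<infinity>"
   using cd by (subst lborel.emeasure_pair_measure_Times) (auto simp: emeasure_space_1)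
  show "AE p in M \<Otimes>\<^sub>M lborel. p \<in> space M \<times> {c<..d} \<longrightarrow> norm (\<zeta> (fst p) * (indicator {a<..b} (snd p) * indicator {c<..d} (snd p))) <= C"
   using \<zeta>(2) by (intro AE_I2) (auto simp: abs_mult indicator_def space_pair_measure intro: order_trans[OF abs_ge_zero])
  show "AE p in M \<Otimes>\<^sub>M lborel. p \<notin> space M \<times> {c<..d} \<longrightarrow> \<zeta> (fst p) * (indicator {a<..b} (snd p) * indicator {c<..d} (snd p)) = 0"
   by (intro AE_I2) (auto simp: indicator_def space_pair_measure)
 qed measurable
 have "(\<integral>p. \<zeta> (fst p) * (indicator {a<..b} (snd p) * indicator {c<..d} (snd p)) \<partial>(M \<Otimes>\<^sub>M lborel))
   = (\<integral>h. (\<integral>s. \<zeta> h * (indicator {a<..b} s * indicator {c<..d} s) \<partial>lborel) \<partial>M)"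
  using P.integral_fst'[OF I] by simp
 also have "\<dots> = expectation \<zeta> * max 0 (min b d - max a c)"
  by (simp add: integral_indicator_Ioc_mult)
 finally show "(\<integral>p. \<zeta> (fst p) * (indicator {a<..b} (snd p) * indicator {c<..d} (snd p)) \<partial>(M \<Otimes>\<^sub>M lborel))
   = expectation \<zeta> * max 0 (min b d - max a c)" .
qed

text \<open>By bilinearity it suffices to compare single terms: the overlap length in
  \<open>increment_pair\<close> is the Lebesgue integral of the product of the two indicators. The
  polarized form with two Brownian indices is the one that yields brackets of different
  particles.\<close>

lemma elem_isometry:
 assumes ij: "i \<in> {1..N}" "j \<in> {1..N}" and f: "elem_fam K \<xi> a b" and g: "elem_fam K' \<xi>' a' b'"
 shows "integrable M (%h. elem_int i K \<xi> a b h * elem_int j K' \<xi>' a' b' h)"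
  and "integrable (M \<Otimes>\<^sub>M lborel) (%p. elem_val K \<xi> a b p * elem_val K' \<xi>' a' b' p)"
  and "expectation (%h. elem_int i K \<xi> a b h * elem_int j K' \<xi>' a' b' h)
   = (if i = j then (\<integral>p. elem_val K \<xi> a b p * elem_val K' \<xi>' a' b' p \<partial>(M \<Otimes>\<^sub>M lborel)) else 0)"
proof -
 let ?t = "%k l h. (\<xi> k h * (B i (b k) h - B i (a k) h)) * (\<xi>' l h * (B j (b' l) h - B j (a' l) h))"
 let ?v = "%k l p. (\<xi> k (fst p) * \<xi>' l (fst p)) * (indicator {a k<..b k} (snd p) * indicator {a' l<..b' l} (snd p))"
 have J: "elem_int i K \<xi> a b h * elem_int j K' \<xi>' a' b' h = (\<Sum>k\<in>K. \<Sum>l\<in>K'. ?t k l h)" for h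
  by (simp add: elem_int_def sum_product)
 have V: "elem_val K \<xi> a b p * elem_val K' \<xi>' a' b' p = (\<Sum>k\<in>K. \<Sum>l\<in>K'. ?v k l p)" for p
  by (simp add: elem_val_def sum_product mult_ac)
 have "integrable M (?t k l) \<and> integrable (M \<Otimes>\<^sub>M lborel) (?v k l)
   \<and> expectation (?t k l) = (if i = j then (\<integral>p. ?v k l p \<partial>(M \<Otimes>\<^sub>M lborel)) else 0)"
  if kl: "k \<in> K" "l \<in> K'" for k l
 proof -
  obtain C C' where C: "\<And>h. h \<in> space M ==> \<bar>\<xi> k h\<bar> <= C" "\<And>h. h \<in> space M ==> \<bar>\<xi>' l h\<bar> <= C'"
   using f g kl unfolding elem_fam_def by meson
  have k: "0 <= a k" "a k <= b k" "\<xi> k \<in> borel_measurable (F (a k))" and l: "0 <= a' l" "a' l <= b' l" "\<xi>' l \<in> borel_measurable (F (a' l))"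
   using f g kl unfolding elem_fam_def by auto
  have m: "(%h. \<xi> k h * (B i (b k) h - B i (a k) h)) \<in> borel_measurable M" "(%h. \<xi>' l h * (B j (b' l) h - B j (a' l) h)) \<in> borel_measurable M"
   using k l ij by (intro borel_measurable_times borel_measurable_diff BM_measurable measurable_of_F[OF k(3)] measurable_of_F[OF l(3)]; simp)+
  have 1: "integrable M (?t k l)"
   by (rule integrable_mult_of_squares[OF m bounded_increment_square[OF ij(1) k(1,2) measurable_of_F[OF k(3)] C(1)]
      bounded_increment_square[OF ij(2) l(1,2) measurable_of_F[OF l(3)] C(2)]])
  have z: "(%h. \<xi> k h * \<xi>' l h) \<in> borel_measurable M" "\<And>h. h \<in> space M ==> \<bar>\<xi> k h * \<xi>' l h\<bar> <= C * C'"
  proof -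
   show "(%h. \<xi> k h * \<xi>' l h) \<in> borel_measurable M"
    by (intro borel_measurable_times measurable_of_F[OF k(3)] measurable_of_F[OF l(3)])
   fix h assume w: "h \<in> space M"
   show "\<bar>\<xi> k h * \<xi>' l h\<bar> <= C * C'"
    unfolding abs_mult using C(1)[OF w] C(2)[OF w] by (intro mult_mono) auto
  qed
  show ?thesis
   using 1 product_integral_indicator[OF z l(2)] increment_pair[OF ij k(1,2) l(1,2) k(3) C(1) l(3) C(2)] by simp
 qed
 note t = this
 show "integrable M (%h. elem_int i K \<xi> a b h * elem_int j K' \<xi>' a' b' h)"
  unfolding J by (intro Bochner_Integration.integrable_sum) (use t in blast)
 show "integrable (M \<Otimes>\<^sub>M lborel) (%p. elem_val K \<xi> a b p * elem_val K' \<xi>' a' b' p)"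
  unfolding V by (intro Bochner_Integration.integrable_sum) (use t in blast)
 have "expectation (%h. elem_int i K \<xi> a b h * elem_int j K' \<xi>' a' b' h) = (\<Sum>k\<in>K. \<Sum>l\<in>K'. expectation (?t k l))"
  unfolding J by (rule integral_double_sum) (use t in blast)
 also have "\<dots> = (\<Sum>k\<in>K. \<Sum>l\<in>K'. if i = j then (\<integral>p. ?v k l p \<partial>(M \<Otimes>\<^sub>M lborel)) else 0)"
  by (intro sum.cong refl) (use t in blast)
 also have "\<dots> = (if i = j then (\<integral>p. elem_val K \<xi> a b p * elem_val K' \<xi>' a' b' p \<partial>(M \<Otimes>\<^sub>M lborel)) else 0)"
 proof -
  have "(\<integral>p. (\<Sum>k\<in>K. \<Sum>l\<in>K'. ?v k l p) \<partial>(M \<Otimes>\<^sub>M lborel)) = (\<Sum>k\<in>K. \<Sum>l\<in>K'. (\<integral>p. ?v k l p \<partial>(M \<Otimes>\<^sub>M lborel)))"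
   by (rule integral_double_sum) (use t in blast)
  then show ?thesis unfolding V by (cases "i = j") simp_all
 qed
 finally show "expectation (%h. elem_int i K \<xi> a b h * elem_int j K' \<xi>' a' b' h)
   = (if i = j then (\<integral>p. elem_val K \<xi> a b p * elem_val K' \<xi>' a' b' p \<partial>(M \<Otimes>\<^sub>M lborel)) else 0)" .
qed

lemma elem_square:
 assumes i: "i \<in> {1..N}" and f: "elem_fam K \<xi> a b"
 shows "integrable M (%h. (elem_int i K \<xi> a b h)^2)" "integrable (M \<Otimes>\<^sub>M lborel) (%p. (elem_val K \<xi> a b p)^2)"
 using elem_isometry[OF i i f f] by (simp_all add: power2_eq_square)

lemma elem_isometry_diff:
 assumes i: "i \<in> {1..N}" and f: "elem_fam K \<xi> a b" and g: "elem_fam K' \<xi>' a' b'"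
 shows "expectation (%h. (elem_int i K \<xi> a b h - elem_int i K' \<xi>' a' b' h)^2)
   = (\<integral>p. (elem_val K \<xi> a b p - elem_val K' \<xi>' a' b' p)^2 \<partial>(M \<Otimes>\<^sub>M lborel))"
 unfolding integral_power2_diff[OF elem_isometry(1)[OF i i f f] elem_isometry(1)[OF i i f g] elem_isometry(1)[OF i i g g]]
  integral_power2_diff[OF elem_isometry(2)[OF i i f f] elem_isometry(2)[OF i i f g] elem_isometry(2)[OF i i g g]]
 using elem_isometry(3)[OF i i f f] elem_isometry(3)[OF i i f g] elem_isometry(3)[OF i i g g] by simp

end

section \<open>From simple processes to the Ito integral\<close>

lemma power2_diff3_le: "(x - y - z)^2 <= 3 * x^2 + 3 * y^2 + 3 * (z::real)^2"
proof -
 have "0 <= (x + y)^2 + (x + z)^2 + (y - z)^2" by simp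
 then show ?thesis by (simp add: power2_eq_square algebra_simps)
qed

context BM_system
begin

text \<open>The same expansion as in \<open>elem_isometry\<close>, but free of Brownian indices, for
  places where only integrands are compared.\<close>

lemma elem_val_mult_integrable:
 assumes f: "elem_fam K \<xi> a b" and g: "elem_fam K' \<xi>' a' b'"
 shows "integrable (M \<Otimes>\<^sub>M lborel) (%p. elem_val K \<xi> a b p * elem_val K' \<xi>' a' b' p)"
proof -
 let ?v = "%k l p. (\<xi> k (fst p) * \<xi>' l (fst p)) * (indicator {a k<..b k} (snd p) * indicator {a' l<..b' l} (snd p))"
 have V: "elem_val K \<xi> a b p * elem_val K' \<xi>' a' b' p = (\<Sum>k\<in>K. \<Sum>l\<in>K'. ?v k l p)" for p
  by (simp add: elem_val_def sum_product mult_ac)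
 have "integrable (M \<Otimes>\<^sub>M lborel) (?v k l)" if kl: "k \<in> K" "l \<in> K'" for k l
 proof -
  obtain C C' where C: "\<And>h. h \<in> space M ==> \<bar>\<xi> k h\<bar> <= C" "\<And>h. h \<in> space M ==> \<bar>\<xi>' l h\<bar> <= C'"
   using f g kl unfolding elem_fam_def by meson
  have m: "\<xi> k \<in> borel_measurable M" "\<xi>' l \<in> borel_measurable M" and l: "a' l <= b' l"
   using f g kl unfolding elem_fam_def by (auto dest: measurable_of_F)
  have b: "\<bar>\<xi> k h * \<xi>' l h\<bar> <= C * C'" if w: "h \<in> space M" for h
   unfolding abs_mult using C(1)[OF w] C(2)[OF w] by (intro mult_mono) auto
  show ?thesis by (rule product_integral_indicator(1)[OF borel_measurable_times[OF m] b l])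
 qed
 then show ?thesis unfolding V by (intro Bochner_Integration.integrable_sum)
qed

lemma elem_int_expectation:
 assumes i: "i \<in> {1..N}" and f: "elem_fam K \<xi> a b"
 shows "expectation (elem_int i K \<xi> a b) = 0"
proof -
 have "integrable M (%h. \<xi> k h * (B i (b k) h - B i (a k) h)) \<and> expectation (%h. \<xi> k h * (B i (b k) h - B i (a k) h)) = 0" if k: "k \<in> K" for k
 proof -
  obtain C where C: "\<And>h. h \<in> space M ==> \<bar>\<xi> k h\<bar> <= C" using f k unfolding elem_fam_def by meson
  have m: "\<xi> k \<in> borel_measurable (F (a k))" and ab: "0 <= a k" "a k <= b k" using f k unfolding elem_fam_def by auto
  have "\<bar>(\<xi> k h)^2\<bar> <= C^2" if "h \<in> space M" for h using power_mono[OF C[OF that], of 2] by simp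
  then have sq: "integrable M (%h. (\<xi> k h)^2)"
   by (intro integrable_const_bound[of _ "C^2"]) (use measurable_of_F[OF m] in auto)
  have d: "(%h. B i (b k) h - B i (a k) h) \<in> borel_measurable M"
   using ab by (intro borel_measurable_diff BM_measurable i) auto
  show ?thesis
   using increment_mult_zero[OF i ab m sq] integrable_mult_of_squares[OF measurable_of_F[OF m] d sq increment_square[OF i ab]] by simp
 qed
 then show ?thesis unfolding elem_int_def[abs_def] by (subst Bochner_Integration.integral_sum) auto
qed

text \<open>The restriction of a simple process to the interval from \<open>s\<close> to
  \<open>t\<close>, with an additional factor \<open>Z\<close> known at time \<open>s\<close>, in
  the form of an elementary family. Steps beginning at \<open>t\<close> or later are dropped, since
  their truncated ends could be out of order; steps ending before \<open>s\<close> become empty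
  intervals at \<open>s\<close>.\<close>

abbreviation cut_set :: "'w simple_process => real => nat set" where
 "cut_set X t \<equiv> {j. j < steps X \<and> time X j < t}"

abbreviation cut_fam :: "'w simple_process => ('w => real) => real => real => bool" where
 "cut_fam X Z s t \<equiv> elem_fam (cut_set X t) (%j h. Z h * coef X j h) (%j. max s (time X j)) (%j. max s (min t (time X (Suc j))))"

abbreviation cut_int :: "nat => 'w simple_process => ('w => real) => real => real => 'w => real" where
 "cut_int i X Z s t \<equiv> elem_int i (cut_set X t) (%j h. Z h * coef X j h) (%j. max s (time X j)) (%j. max s (min t (time X (Suc j))))"

abbreviation cut_val :: "'w simple_process => ('w => real) => real => real => 'w \<times> real => real" where
 "cut_val X Z s t \<equiv> elem_val (cut_set X t) (%j h. Z h * coef X j h) (%j. max s (time X j)) (%j. max s (min t (time X (Suc j))))"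

lemma simple_time:
 assumes "simple_predictable M F X"
 shows "j <= steps X ==> 0 <= time X j" and "j < steps X ==> time X j < time X (Suc j)"
proof -
 show lt: "j < steps X ==> time X j < time X (Suc j)" for j using assms by (simp add: simple_predictable_def)
 show "j <= steps X ==> 0 <= time X j"
 proof (induction j)
  case 0 then show ?case using assms by (simp add: simple_predictable_def)
 next
  case (Suc j) then show ?case using lt[of j] by simp
 qed
qed

lemma cut_fam:
 assumes X: "simple_predictable M F X" and st: "0 <= s" "s <= t"
  and Z: "Z \<in> borel_measurable (F s)" "\<And>h. h \<in> space M ==> \<bar>Z h\<bar> <= C"
 shows "cut_fam X Z s t"
 unfolding elem_fam_def
proof (intro conjI ballI)
 fix k assume "k \<in> cut_set X t"
 then have k: "k < steps X" "time X k < t" by auto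
 show "0 <= max s (time X k)" using st by simp
 show "max s (time X k) <= max s (min t (time X (Suc k)))" using k simple_time(2)[OF X k(1)] by simp
 have c: "coef X k \<in> borel_measurable (F (time X k))" "\<exists>C. \<forall>h\<in>space M. \<bar>coef X k h\<bar> <= C"
  using X k by (auto simp: simple_predictable_def)
 show "(%h. Z h * coef X k h) \<in> borel_measurable (F (max s (time X k)))"
  by (intro borel_measurable_times measurable_F_mono[OF Z(1)] measurable_F_mono[OF c(1)]) auto
 obtain C' where C': "\<And>h. h \<in> space M ==> \<bar>coef X k h\<bar> <= C'" using c(2) by blast
 show "\<exists>C. \<forall>h\<in>space M. \<bar>Z h * coef X k h\<bar> <= C"
 proof (intro exI ballI)
  fix h assume w: "h \<in> space M"
  show "\<bar>Z h * coef X k h\<bar> <= C * C'"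
   unfolding abs_mult using Z(2)[OF w] C'[OF w] by (intro mult_mono) auto
 qed
qed simp

lemma cut_fam_1: "simple_predictable M F X ==> 0 <= s ==> s <= t ==> cut_fam X (%_. 1) s t"
 by (rule cut_fam[where C = 1]) auto

lemma cut_int_mult: "cut_int i X Z s t h = Z h * cut_int i X (%_. 1) s t h"
 by (simp add: elem_int_def sum_distrib_left mult.assoc)

lemma cut_val_mult: "cut_val X Z s t p = Z (fst p) * cut_val X (%_. 1) s t p"
 by (simp only: elem_val_def sum_distrib_left mult.assoc mult_1)

lemma cut_int_eq:
 assumes X: "simple_predictable M F X" and st: "0 <= s" "s <= t"
 shows "cut_int i X (%_. 1) s t h = simple_integral_BM (B i) X t h - simple_integral_BM (B i) X s h"
proof -
 let ?f = "%j. coef X j h * (B i (min t (time X (Suc j))) h - B i (min t (time X j)) h)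
    - coef X j h * (B i (min s (time X (Suc j))) h - B i (min s (time X j)) h)"
 have "simple_integral_BM (B i) X t h - simple_integral_BM (B i) X s h = (\<Sum>j<steps X. ?f j)"
  by (simp add: simple_integral_BM_def sum_subtractf)
 also have "\<dots> = (\<Sum>j\<in>cut_set X t. ?f j)"
 proof (rule sum.mono_neutral_right)
  show "\<forall>j\<in>{..<steps X} - cut_set X t. ?f j = 0"
  proof
   fix j assume "j \<in> {..<steps X} - cut_set X t"
   then have j: "j < steps X" "t <= time X j" by auto
   then show "?f j = 0" using simple_time(2)[OF X j(1)] st by (simp add: min_def)
  qed
 qed auto
 also have "\<dots> = cut_int i X (%_. 1) s t h"
  unfolding elem_int_def
 proof (rule sum.cong[OF refl])
  fix j assume "j \<in> cut_set X t"
  then have j: "j < steps X" "time X j < t" by auto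
  consider "s <= time X j" | "time X j < s" "s <= time X (Suc j)" | "time X (Suc j) < s" by linarith
  then show "?f j = (1 * coef X j h) * (B i (max s (min t (time X (Suc j)))) h - B i (max s (time X j)) h)"
   using j simple_time(2)[OF X j(1)] st
   by cases (simp_all add: min_def max_def algebra_simps)
 qed
 finally show ?thesis by simp
qed

lemma cut_val_eq:
 assumes X: "simple_predictable M F X" and st: "0 <= s" "s <= t"
 shows "cut_val X (%_. 1) s t (h, r) = simple_value X r h * indicator {s<..t} r"
proof -
 have "simple_value X r h * indicator {s<..t} r = (\<Sum>j<steps X. coef X j h * (indicator {time X j<..time X (Suc j)} r * indicator {s<..t} r))"
  by (simp only: simple_value_def sum_distrib_right mult.assoc)
 also have "\<dots> = (\<Sum>j\<in>cut_set X t. coef X j h * (indicator {time X j<..time X (Suc j)} r * indicator {s<..t} r))"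
  by (rule sum.mono_neutral_right) (auto simp: indicator_def)
 also have "\<dots> = cut_val X (%_. 1) s t (h, r)"
  unfolding elem_val_def by (rule sum.cong) (auto simp: indicator_def)
 finally show ?thesis by simp
qed

lemma cut_val_tendsto:
 assumes X: "\<And>m::nat. simple_predictable M F (X m)" and H: "(%p. H (snd p) (fst p)) \<in> borel_measurable (M \<Otimes>\<^sub>M lborel)"
  and lim: "(%m. \<integral>\<^sup>+h. (\<integral>\<^sup>+r\<in>{0..t}. ennreal ((simple_value (X m) r h - H r h)^2) \<partial>lborel) \<partial>M) \<longlonglongrightarrow> 0"
  and st: "0 <= s" "s <= t'" "t' <= t"
 shows "integrable (M \<Otimes>\<^sub>M lborel) (%p. (H (snd p) (fst p) * indicator {s<..t'} (snd p))^2)"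
  and "(%m. \<integral>p. (cut_val (X m) (%_. 1) s t' p - H (snd p) (fst p) * indicator {s<..t'} (snd p))^2 \<partial>(M \<Otimes>\<^sub>M lborel)) \<longlonglongrightarrow> 0"
proof -
 have m1: "cut_val (X m) (%_. 1) s t' \<in> borel_measurable (M \<Otimes>\<^sub>M lborel)" for m
  by (rule elem_val_measurable[OF cut_fam_1[OF X st(1,2)]])
 have m2: "(%p. H (snd p) (fst p) * indicator {s<..t'} (snd p)) \<in> borel_measurable (M \<Otimes>\<^sub>M lborel)"
  using H by measurable
 have "(%m. \<integral>\<^sup>+p. ennreal ((cut_val (X m) (%_. 1) s t' p - H (snd p) (fst p) * indicator {s<..t'} (snd p))^2) \<partial>(M \<Otimes>\<^sub>M lborel)) \<longlonglongrightarrow> 0"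
 proof (rule tendsto_sandwich[OF _ _ tendsto_const lim])
  show "\<forall>\<^sub>F m in sequentially. (\<integral>\<^sup>+p. ennreal ((cut_val (X m) (%_. 1) s t' p - H (snd p) (fst p) * indicator {s<..t'} (snd p))^2) \<partial>(M \<Otimes>\<^sub>M lborel))
   <= (\<integral>\<^sup>+h. (\<integral>\<^sup>+r\<in>{0..t}. ennreal ((simple_value (X m) r h - H r h)^2) \<partial>lborel) \<partial>M)"
  proof (rule always_eventually, rule allI)
   fix m
   have "(\<integral>\<^sup>+p. ennreal ((cut_val (X m) (%_. 1) s t' p - H (snd p) (fst p) * indicator {s<..t'} (snd p))^2) \<partial>(M \<Otimes>\<^sub>M lborel))
    = (\<integral>\<^sup>+h. (\<integral>\<^sup>+r. ennreal ((cut_val (X m) (%_. 1) s t' (h, r) - H (snd (h, r)) (fst (h, r)) * indicator {s<..t'} (snd (h, r)))^2) \<partial>lborel) \<partial>M)"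
    by (rule lborel.nn_integral_fst[symmetric]) (use m1 m2 in measurable)
   also have "\<dots> <= (\<integral>\<^sup>+h. (\<integral>\<^sup>+r\<in>{0..t}. ennreal ((simple_value (X m) r h - H r h)^2) \<partial>lborel) \<partial>M)"
    by (intro nn_integral_mono, unfold cut_val_eq[OF X st(1,2)]) (use st in \<open>auto simp: indicator_def\<close>)
   finally show "(\<integral>\<^sup>+p. ennreal ((cut_val (X m) (%_. 1) s t' p - H (snd p) (fst p) * indicator {s<..t'} (snd p))^2) \<partial>(M \<Otimes>\<^sub>M lborel))
    <= (\<integral>\<^sup>+h. (\<integral>\<^sup>+r\<in>{0..t}. ennreal ((simple_value (X m) r h - H r h)^2) \<partial>lborel) \<partial>M)" .
  qed
 qed simp
 note L = L2_limit_of_nn_integral[OF m1 m2 _ this]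
 have sq: "integrable (M \<Otimes>\<^sub>M lborel) (%p. (cut_val (X m) (%_. 1) s t' p)^2)" for m
 proof -
  have "integrable (M \<Otimes>\<^sub>M lborel) (%p. cut_val (X m) (%_. 1) s t' p * cut_val (X m) (%_. 1) s t' p)"
   by (rule elem_val_mult_integrable[OF cut_fam_1[OF X st(1,2)] cut_fam_1[OF X st(1,2)]])
  then show ?thesis by (simp add: power2_eq_square)
 qed
 show "integrable (M \<Otimes>\<^sub>M lborel) (%p. (H (snd p) (fst p) * indicator {s<..t'} (snd p))^2)"
  by (rule L(1)[OF sq])
 show "(%m. \<integral>p. (cut_val (X m) (%_. 1) s t' p - H (snd p) (fst p) * indicator {s<..t'} (snd p))^2 \<partial>(M \<Otimes>\<^sub>M lborel)) \<longlonglongrightarrow> 0"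
  by (rule L(2)[OF sq])
qed

text \<open>In \<open>ito_integral\<close> the approximating sequence depends on the time, so an
  increment of \<open>I\<close> involves two unrelated sequences \<open>X\<close> and
  \<open>Y\<close>. Both approximate \<open>H\<close> up to time \<open>s\<close>; by the isometry
  their integrals up to \<open>s\<close> are asymptotically equal, and \<open>X\<close> alone can
  serve for the increment.\<close>

lemma ito_integral_approx:
 assumes i: "i \<in> {1..N}" and ito: "ito_integral M F (B i) H I"
  and H: "(%p. H (snd p) (fst p)) \<in> borel_measurable (M \<Otimes>\<^sub>M lborel)" and st: "0 <= s" "s <= t"
 obtains X where "\<And>m::nat. simple_predictable M F (X m)"
  "integrable M (%h. (I t h - I s h)^2)"
  "(%m. expectation (%h. (cut_int i (X m) (%_. 1) s t h - (I t h - I s h))^2)) \<longlonglongrightarrow> 0"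
  "integrable (M \<Otimes>\<^sub>M lborel) (%p. (H (snd p) (fst p) * indicator {s<..t} (snd p))^2)"
  "(%m. \<integral>p. (cut_val (X m) (%_. 1) s t p - H (snd p) (fst p) * indicator {s<..t} (snd p))^2 \<partial>(M \<Otimes>\<^sub>M lborel)) \<longlonglongrightarrow> 0"
proof -
 have ap: "\<exists>X. (\<forall>m::nat. simple_predictable M F (X m)) \<and>
    (%m. \<integral>\<^sup>+h. (\<integral>\<^sup>+r\<in>{0..t}. ennreal ((simple_value (X m) r h - H r h)^2) \<partial>lborel) \<partial>M) \<longlonglongrightarrow> 0 \<and>
    (%m. \<integral>\<^sup>+h. ennreal ((simple_integral_BM (B i) (X m) t h - I t h)^2) \<partial>M) \<longlonglongrightarrow> 0" if "0 <= t" for t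
  using ito that unfolding ito_integral_def by blast
 have t0: "0 <= t" using st by simp
 obtain X where X: "\<And>m. simple_predictable M F (X m)"
  and XH: "(%m. \<integral>\<^sup>+h. (\<integral>\<^sup>+r\<in>{0..t}. ennreal ((simple_value (X m) r h - H r h)^2) \<partial>lborel) \<partial>M) \<longlonglongrightarrow> 0"
  and XI: "(%m. \<integral>\<^sup>+h. ennreal ((simple_integral_BM (B i) (X m) t h - I t h)^2) \<partial>M) \<longlonglongrightarrow> 0"
  using ap[OF t0] by blast
 obtain Y where Y: "\<And>m. simple_predictable M F (Y m)"
  and YH: "(%m. \<integral>\<^sup>+h. (\<integral>\<^sup>+r\<in>{0..s}. ennreal ((simple_value (Y m) r h - H r h)^2) \<partial>lborel) \<partial>M) \<longlonglongrightarrow> 0"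
  and YI: "(%m. \<integral>\<^sup>+h. ennreal ((simple_integral_BM (B i) (Y m) s h - I s h)^2) \<partial>M) \<longlonglongrightarrow> 0"
  using ap[OF st(1)] by blast
 have Im: "I r \<in> borel_measurable M" if "0 <= r" for r
  using ito that by (auto simp: ito_integral_def intro: measurable_of_F)
 \<comment> \<open>The times of a simple process are nonnegative, so its integral up to 0 vanishes,
   and its integral up to \<open>r\<close> is a cut integral starting at 0.\<close>
 have zero: "simple_integral_BM (B i) X 0 h = 0" if X: "simple_predictable M F X" for X h
 proof -
  have "min 0 (time X j) = 0" if "j <= steps X" for j using simple_time(1)[OF X that] by simp
  then show ?thesis by (auto simp: simple_integral_BM_def intro!: sum.neutral)
 qed
 let ?J = "%X s t. cut_int i X (%_. 1) s t"
 have Jm: "?J X s t \<in> borel_measurable M" and Jsq: "integrable M (%h. (?J X s t h)^2)"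
  if "simple_predictable M F X" "0 <= s" "s <= t" for X s t
  using elem_int_measurable[OF i cut_fam_1[OF that]] elem_square(1)[OF i cut_fam_1[OF that]] by auto
 have J0: "simple_integral_BM (B i) X r h = ?J X 0 r h" if "simple_predictable M F X" "0 <= r" for X r h
  using cut_int_eq[OF that(1) order_refl that(2), of i h] zero[OF that(1)] by simp
 note lt = L2_limit_of_nn_integral[OF Jm[OF X order_refl t0] Im[OF t0] Jsq[OF X order_refl t0] XI[unfolded J0[OF X t0]]]
 note ls = L2_limit_of_nn_integral[OF Jm[OF Y order_refl st(1)] Im[OF st(1)] Jsq[OF Y order_refl st(1)] YI[unfolded J0[OF Y st(1)]]]
 have Isq: "integrable M (%h. (I t h - I s h)^2)"
  by (rule integrable_square_diff[OF Im[OF t0] Im[OF st(1)] lt(1) ls(1)])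
 note vX = cut_val_tendsto[OF X H XH order_refl st] and vY = cut_val_tendsto[OF Y H YH order_refl st(1) order_refl]
 let ?V = "%X. cut_val X (%_. 1) 0 s" and ?H = "%p. H (snd p) (fst p) * indicator {0<..s} (snd p)"
 have Vm: "?V X \<in> borel_measurable (M \<Otimes>\<^sub>M lborel)" if "simple_predictable M F X" for X
  by (rule elem_val_measurable[OF cut_fam_1[OF that order_refl st(1)]])
 have Vsq: "integrable (M \<Otimes>\<^sub>M lborel) (%p. (?V X p)^2)" if "simple_predictable M F X" for X
  by (rule elem_square(2)[OF i cut_fam_1[OF that order_refl st(1)]])
 have Hm: "?H \<in> borel_measurable (M \<Otimes>\<^sub>M lborel)" using H by measurable
 have diff0: "(%m. expectation (%h. (?J (X m) 0 s h - ?J (Y m) 0 s h)^2)) \<longlonglongrightarrow> 0"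
 proof (rule tendsto_sandwich[OF _ _ tendsto_const])
  let ?R = "%m. 2 * (\<integral>p. (?V (X m) p - ?H p)^2 \<partial>(M \<Otimes>\<^sub>M lborel)) + 2 * (\<integral>p. (?V (Y m) p - ?H p)^2 \<partial>(M \<Otimes>\<^sub>M lborel))"
  show "?R \<longlonglongrightarrow> 0"
   using tendsto_add[OF tendsto_mult_right_zero[OF vX(2), of 2] tendsto_mult_right_zero[OF vY(2), of 2]] by simp
  have "expectation (%h. (?J (X m) 0 s h - ?J (Y m) 0 s h)^2) <= ?R m" for m
  proof -
   have iX: "integrable (M \<Otimes>\<^sub>M lborel) (%p. (?V (X m) p - ?H p)^2)" and iY: "integrable (M \<Otimes>\<^sub>M lborel) (%p. (?V (Y m) p - ?H p)^2)"
    by (rule integrable_square_diff[OF Vm[OF X] Hm Vsq[OF X] vX(1)], rule integrable_square_diff[OF Vm[OF Y] Hm Vsq[OF Y] vX(1)])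
   have iXY: "integrable (M \<Otimes>\<^sub>M lborel) (%p. (?V (X m) p - ?V (Y m) p)^2)"
    by (rule integrable_square_diff[OF Vm[OF X] Vm[OF Y] Vsq[OF X] Vsq[OF Y]])
   have "expectation (%h. (?J (X m) 0 s h - ?J (Y m) 0 s h)^2) = (\<integral>p. (?V (X m) p - ?V (Y m) p)^2 \<partial>(M \<Otimes>\<^sub>M lborel))"
    by (rule elem_isometry_diff[OF i cut_fam_1[OF X order_refl st(1)] cut_fam_1[OF Y order_refl st(1)]])
   also have "\<dots> <= (\<integral>p. 2 * (?V (X m) p - ?H p)^2 + 2 * (?V (Y m) p - ?H p)^2 \<partial>(M \<Otimes>\<^sub>M lborel))"
   proof (rule integral_mono[OF iXY])
    show "integrable (M \<Otimes>\<^sub>M lborel) (%p. 2 * (?V (X m) p - ?H p)^2 + 2 * (?V (Y m) p - ?H p)^2)" using iX iY by simp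
    fix p
    show "(?V (X m) p - ?V (Y m) p)^2 <= 2 * (?V (X m) p - ?H p)^2 + 2 * (?V (Y m) p - ?H p)^2"
     using sum_power2_le[of "?V (X m) p - ?H p" "?H p - ?V (Y m) p"] by (simp add: power2_commute[of "?H p"])
   qed
   also have "\<dots> = ?R m" using iX iY by simp
   finally show ?thesis .
  qed
  then show "\<forall>\<^sub>F m in sequentially. expectation (%h. (?J (X m) 0 s h - ?J (Y m) 0 s h)^2) <= ?R m" by simp
 qed simp
 have main: "(%m. expectation (%h. (?J (X m) s t h - (I t h - I s h))^2)) \<longlonglongrightarrow> 0"
 proof (rule tendsto_sandwich[OF _ _ tendsto_const])
  let ?x = "%m h. ?J (X m) 0 t h - I t h" and ?y = "%m h. ?J (Y m) 0 s h - I s h"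
   and ?z = "%m h. ?J (X m) 0 s h - ?J (Y m) 0 s h"
  let ?R = "%m. 3 * expectation (%h. (?x m h)^2) + 3 * expectation (%h. (?y m h)^2) + 3 * expectation (%h. (?z m h)^2)"
  show "?R \<longlonglongrightarrow> 0"
   using tendsto_add[OF tendsto_add[OF tendsto_mult_right_zero[OF lt(2), of 3] tendsto_mult_right_zero[OF ls(2), of 3]]
     tendsto_mult_right_zero[OF diff0, of 3]] by simp
  have "expectation (%h. (?J (X m) s t h - (I t h - I s h))^2) <= ?R m" for m
  proof -
   have i1: "integrable M (%h. (?x m h)^2)"
    by (rule integrable_square_diff[OF Jm[OF X order_refl t0] Im[OF t0] Jsq[OF X order_refl t0] lt(1)])
   have i2: "integrable M (%h. (?y m h)^2)"
    by (rule integrable_square_diff[OF Jm[OF Y order_refl st(1)] Im[OF st(1)] Jsq[OF Y order_refl st(1)] ls(1)])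
   have i3: "integrable M (%h. (?z m h)^2)"
    by (rule integrable_square_diff[OF Jm[OF X order_refl st(1)] Jm[OF Y order_refl st(1)] Jsq[OF X order_refl st(1)] Jsq[OF Y order_refl st(1)]])
   have "expectation (%h. (?J (X m) s t h - (I t h - I s h))^2) <= expectation (%h. 3 * (?x m h)^2 + 3 * (?y m h)^2 + 3 * (?z m h)^2)"
   proof (rule integral_mono)
    show "integrable M (%h. (?J (X m) s t h - (I t h - I s h))^2)"
     by (rule integrable_square_diff[OF Jm[OF X st] borel_measurable_diff[OF Im[OF t0] Im[OF st(1)]] Jsq[OF X st] Isq])
    show "integrable M (%h. 3 * (?x m h)^2 + 3 * (?y m h)^2 + 3 * (?z m h)^2)" using i1 i2 i3 by simp
    fix h
    \<comment> \<open>The error at \<open>t\<close>, the error at \<open>s\<close>, and the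
      discrepancy of the two approximations at \<open>s\<close>.\<close>
    have "?J (X m) s t h - (I t h - I s h) = ?x m h - ?y m h - ?z m h"
     using cut_int_eq[OF X st, of i m h] J0[OF X t0, of m h] J0[OF X st(1), of m h] by simp
    then show "(?J (X m) s t h - (I t h - I s h))^2 <= 3 * (?x m h)^2 + 3 * (?y m h)^2 + 3 * (?z m h)^2"
     using power2_diff3_le[of "?x m h" "?y m h" "?z m h"] by (simp only:)
   qed
   also have "\<dots> = ?R m" using i1 i2 i3 by simp
   finally show ?thesis .
  qed
  then show "\<forall>\<^sub>F m in sequentially. expectation (%h. (?J (X m) s t h - (I t h - I s h))^2) <= ?R m" by simp
 qed simp
 note fin = cut_val_tendsto[OF X H XH st order_refl]
 show ?thesis by (rule that[OF X Isq main fin])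
qed

lemma L2_bounded_mult_tendsto:
 fixes f :: "'b => real"
 assumes m: "\<And>m. fm m \<in> borel_measurable A" "f \<in> borel_measurable A" "Z \<in> borel_measurable A"
  and Z: "\<And>x. x \<in> space A ==> \<bar>Z x\<bar> <= C"
  and sq: "\<And>m::nat. integrable A (%x. (fm m x)^2)" "integrable A (%x. (f x)^2)"
  and lim: "(%m. \<integral>x. (fm m x - f x)^2 \<partial>A) \<longlonglongrightarrow> 0"
 shows "integrable A (%x. (Z x * fm m x)^2)" "integrable A (%x. (Z x * f x)^2)"
  "(%m. \<integral>x. (Z x * fm m x - Z x * f x)^2 \<partial>A) \<longlonglongrightarrow> 0"
proof -
 have Zsq: "\<bar>(Z x)^2\<bar> <= C^2" if "x \<in> space A" for x
  using power_mono[OF Z[OF that], of 2] by simp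
 have Zm: "(%x. (Z x)^2) \<in> borel_measurable A" using m by measurable
 have I: "integrable A (%x. (Z x * g x)^2)" if "integrable A (%x. (g x)^2)" for g
  using integrable_bounded_mult[OF that Zm Zsq] by (simp add: power_mult_distrib)
 show "integrable A (%x. (Z x * fm m x)^2)" "integrable A (%x. (Z x * f x)^2)" by (rule I, rule sq)+
 show "(%m. \<integral>x. (Z x * fm m x - Z x * f x)^2 \<partial>A) \<longlonglongrightarrow> 0"
 proof (rule tendsto_sandwich[OF _ _ tendsto_const tendsto_mult_right_zero[OF lim, of "C^2"]])
  have "(\<integral>x. (Z x * fm m x - Z x * f x)^2 \<partial>A) <= C^2 * (\<integral>x. (fm m x - f x)^2 \<partial>A)" for m
  proof -
   have d: "integrable A (%x. (fm m x - f x)^2)" by (rule integrable_square_diff[OF m(1,2) sq])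
   have "(\<integral>x. (Z x * fm m x - Z x * f x)^2 \<partial>A) = (\<integral>x. (Z x)^2 * (fm m x - f x)^2 \<partial>A)"
    by (intro Bochner_Integration.integral_cong refl) (simp add: power_mult_distrib flip: right_diff_distrib)
   also have "\<dots> <= (\<integral>x. C^2 * (fm m x - f x)^2 \<partial>A)"
    using Zsq by (intro integral_mono integrable_bounded_mult[OF d Zm Zsq] integrable_mult_right d mult_right_mono) auto
   finally show ?thesis by simp
  qed
  then show "\<forall>\<^sub>F m in sequentially. (\<integral>x. (Z x * fm m x - Z x * f x)^2 \<partial>A) <= C^2 * (\<integral>x. (fm m x - f x)^2 \<partial>A)" by simp
 qed simp
qed

text \<open>\<open>Z\<close> is absorbed into the coefficients of the elementary family for
  \<open>I\<close>, which stays adapted since \<open>Z\<close> is known at time \<open>s\<close>.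
  Isometry and zero expectation then pass to the \<open>L2\<close> limit, and Fubini turns the
  integral over the product space into the expectation of a time integral.\<close>

lemma ito_increment_product:
 assumes ij: "i \<in> {1..N}" "j \<in> {1..N}" and ito: "ito_integral M F (B i) H I" "ito_integral M F (B j) H' I'"
  and H: "(%p. H (snd p) (fst p)) \<in> borel_measurable (M \<Otimes>\<^sub>M lborel)" "(%p. H' (snd p) (fst p)) \<in> borel_measurable (M \<Otimes>\<^sub>M lborel)"
  and st: "0 <= s" "s <= t" and Z: "Z \<in> borel_measurable (F s)" "\<And>h. h \<in> space M ==> \<bar>Z h\<bar> <= C"
 shows "integrable M (%h. (I t h - I s h)^2)"
  and "expectation (%h. Z h * (I t h - I s h)) = 0"
  and "expectation (%h. Z h * ((I t h - I s h) * (I' t h - I' s h)))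
   = (if i = j then expectation (%h. Z h * (\<integral>u\<in>{s<..t}. H u h * H' u h \<partial>lborel)) else 0)"
proof -
 interpret P: pair_sigma_finite M "lborel :: real measure" by (rule pair_sigma_finite_lborel)
 have t0: "0 <= t" using st by simp
 have Im: "I r \<in> borel_measurable M" "I' r \<in> borel_measurable M" if "0 <= r" for r
  using ito that by (auto simp: ito_integral_def intro: measurable_of_F)
 obtain X where X: "\<And>m::nat. simple_predictable M F (X m)"
  and XI: "integrable M (%h. (I t h - I s h)^2)"
   "(%m. expectation (%h. (cut_int i (X m) (%_. 1) s t h - (I t h - I s h))^2)) \<longlonglongrightarrow> 0"
  and XH: "integrable (M \<Otimes>\<^sub>M lborel) (%p. (H (snd p) (fst p) * indicator {s<..t} (snd p))^2)"
   "(%m. \<integral>p. (cut_val (X m) (%_. 1) s t p - H (snd p) (fst p) * indicator {s<..t} (snd p))^2 \<partial>(M \<Otimes>\<^sub>M lborel)) \<longlonglongrightarrow> 0"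
  by (rule ito_integral_approx[OF ij(1) ito(1) H(1) st]) blast
 obtain Y where Y: "\<And>m::nat. simple_predictable M F (Y m)"
  and YI: "integrable M (%h. (I' t h - I' s h)^2)"
   "(%m. expectation (%h. (cut_int j (Y m) (%_. 1) s t h - (I' t h - I' s h))^2)) \<longlonglongrightarrow> 0"
  and YH: "integrable (M \<Otimes>\<^sub>M lborel) (%p. (H' (snd p) (fst p) * indicator {s<..t} (snd p))^2)"
   "(%m. \<integral>p. (cut_val (Y m) (%_. 1) s t p - H' (snd p) (fst p) * indicator {s<..t} (snd p))^2 \<partial>(M \<Otimes>\<^sub>M lborel)) \<longlonglongrightarrow> 0"
  by (rule ito_integral_approx[OF ij(2) ito(2) H(2) st]) blast
 show "integrable M (%h. (I t h - I s h)^2)" by (rule XI)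
 let ?J = "%m. cut_int i (X m) (%_. 1) s t" and ?J' = "%m. cut_int j (Y m) (%_. 1) s t"
 let ?V = "%m. cut_val (X m) (%_. 1) s t" and ?V' = "%m. cut_val (Y m) (%_. 1) s t"
 let ?H = "%p. H (snd p) (fst p) * indicator {s<..t} (snd p)" and ?H' = "%p. H' (snd p) (fst p) * indicator {s<..t} (snd p)"
 have fX: "cut_fam (X m) (%_. 1) s t" and fY: "cut_fam (Y m) (%_. 1) s t" for m
  by (rule cut_fam_1[OF X st], rule cut_fam_1[OF Y st])
 have fZ: "cut_fam (X m) Z s t" for m by (rule cut_fam[OF X st Z])
 have Jm: "?J m \<in> borel_measurable M" "?J' m \<in> borel_measurable M" for m
  by (rule elem_int_measurable[OF ij(1) fX], rule elem_int_measurable[OF ij(2) fY])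
 have Jsq: "integrable M (%h. (?J m h)^2)" "integrable M (%h. (?J' m h)^2)" for m
  by (rule elem_square(1)[OF ij(1) fX], rule elem_square(1)[OF ij(2) fY])
 have Vm: "?V m \<in> borel_measurable (M \<Otimes>\<^sub>M lborel)" "?V' m \<in> borel_measurable (M \<Otimes>\<^sub>M lborel)" for m
  by (rule elem_val_measurable[OF fX], rule elem_val_measurable[OF fY])
 have Vsq: "integrable (M \<Otimes>\<^sub>M lborel) (%p. (?V m p)^2)" "integrable (M \<Otimes>\<^sub>M lborel) (%p. (?V' m p)^2)" for m
  by (rule elem_square(2)[OF ij(1) fX], rule elem_square(2)[OF ij(2) fY])
 have Hm: "?H \<in> borel_measurable (M \<Otimes>\<^sub>M lborel)" "?H' \<in> borel_measurable (M \<Otimes>\<^sub>M lborel)"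
  using H by measurable
 have Dm: "(%h. I t h - I s h) \<in> borel_measurable M" "(%h. I' t h - I' s h) \<in> borel_measurable M"
  by (intro borel_measurable_diff Im t0 st)+
 have Zm: "Z \<in> borel_measurable M" by (rule measurable_of_F[OF Z(1)])
 have ZPm: "(%p. Z (fst p)) \<in> borel_measurable (M \<Otimes>\<^sub>M lborel)" using Zm by measurable
 have ZPb: "\<bar>Z (fst p)\<bar> <= C" if "p \<in> space (M \<Otimes>\<^sub>M lborel)" for p
  using that Z(2) by (auto simp: space_pair_measure)
 note ZJ = L2_bounded_mult_tendsto[OF Jm(1) Dm(1) Zm Z(2) Jsq(1) XI]
 note ZV = L2_bounded_mult_tendsto[OF Vm(1) Hm(1) ZPm ZPb Vsq(1) XH]
 have ZJm: "(%h. Z h * ?J m h) \<in> borel_measurable M" for m by (intro borel_measurable_times Zm Jm)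
 have ZDm: "(%h. Z h * (I t h - I s h)) \<in> borel_measurable M" by (intro borel_measurable_times Zm Dm)
 have "(%m. expectation (%h. ?J m h * Z h)) \<longlonglongrightarrow> expectation (%h. (I t h - I s h) * Z h)"
 proof (rule L2_mult_tendsto[OF Jm(1) Zm Dm(1) Zm Jsq(1) _ XI(1) _ XI(2)])
  have "\<bar>(Z h)^2\<bar> <= C^2" if "h \<in> space M" for h using power_mono[OF Z(2)[OF that], of 2] by simp
  then show "integrable M (%h. (Z h)^2)" by (intro integrable_const_bound[of _ "C^2"]) (use Zm in auto)
  then show "integrable M (%h. (Z h)^2)" .
 qed simp
 moreover have "expectation (%h. ?J m h * Z h) = 0" for m
 proof -
  have "(%h. ?J m h * Z h) = cut_int i (X m) Z s t"
   by (rule ext, subst cut_int_mult[where Z = Z]) (rule mult.commute)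
  then show ?thesis using elem_int_expectation[OF ij(1) fZ] by simp
 qed
 ultimately have "expectation (%h. (I t h - I s h) * Z h) = 0"
  by (simp add: LIMSEQ_const_iff)
 then show "expectation (%h. Z h * (I t h - I s h)) = 0" by (simp add: mult.commute)
 have limJ: "(%m. expectation (%h. (Z h * ?J m h) * ?J' m h)) \<longlonglongrightarrow> expectation (%h. (Z h * (I t h - I s h)) * (I' t h - I' s h))"
  by (rule L2_mult_tendsto[OF ZJm Jm(2) ZDm Dm(2) ZJ(1) Jsq(2) ZJ(2) YI(1) ZJ(3) YI(2)])
 have ZVm: "(%p. Z (fst p) * ?V m p) \<in> borel_measurable (M \<Otimes>\<^sub>M lborel)" for m by (intro borel_measurable_times ZPm Vm)
 have ZHm: "(%p. Z (fst p) * ?H p) \<in> borel_measurable (M \<Otimes>\<^sub>M lborel)" by (rule borel_measurable_times[OF ZPm Hm(1)])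
 have limV: "(%m. \<integral>p. (Z (fst p) * ?V m p) * ?V' m p \<partial>(M \<Otimes>\<^sub>M lborel)) \<longlonglongrightarrow> (\<integral>p. (Z (fst p) * ?H p) * ?H' p \<partial>(M \<Otimes>\<^sub>M lborel))"
  by (rule L2_mult_tendsto[OF ZVm Vm(2) ZHm Hm(2) ZV(1) Vsq(2) ZV(2) YH(1) ZV(3) YH(2)])
 have iso: "expectation (%h. (Z h * ?J m h) * ?J' m h)
   = (if i = j then (\<integral>p. (Z (fst p) * ?V m p) * ?V' m p \<partial>(M \<Otimes>\<^sub>M lborel)) else 0)" for m
  using elem_isometry(3)[OF ij fZ[of m] fY[of m]] by (simp only: cut_int_mult[where Z = Z] cut_val_mult[where Z = Z])
 have intH: "integrable (M \<Otimes>\<^sub>M lborel) (%p. (Z (fst p) * ?H p) * ?H' p)"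
  by (rule integrable_mult_of_squares[OF ZHm Hm(2) ZV(2) YH(1)])
 have "(\<integral>p. (Z (fst p) * ?H p) * ?H' p \<partial>(M \<Otimes>\<^sub>M lborel)) = expectation (%h. (\<integral>u. (Z h * (H u h * indicator {s<..t} u)) * (H' u h * indicator {s<..t} u) \<partial>lborel))"
  using P.integral_fst'[OF intH] by simp
 also have "\<dots> = expectation (%h. Z h * (\<integral>u\<in>{s<..t}. H u h * H' u h \<partial>lborel))"
 proof (rule Bochner_Integration.integral_cong[OF refl])
  fix h
  have "(%u. (Z h * (H u h * indicator {s<..t} u)) * (H' u h * indicator {s<..t} u)) = (%u. Z h * (indicator {s<..t} u *\<^sub>R (H u h * H' u h)))"
   by (auto simp: indicator_def fun_eq_iff)
  then show "(\<integral>u. (Z h * (H u h * indicator {s<..t} u)) * (H' u h * indicator {s<..t} u) \<partial>lborel) = Z h * (\<integral>u\<in>{s<..t}. H u h * H' u h \<partial>lborel)"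
   by (simp add: set_lebesgue_integral_def)
 qed
 finally have fub: "(\<integral>p. (Z (fst p) * ?H p) * ?H' p \<partial>(M \<Otimes>\<^sub>M lborel)) = expectation (%h. Z h * (\<integral>u\<in>{s<..t}. H u h * H' u h \<partial>lborel))" .
 have "expectation (%h. (Z h * (I t h - I s h)) * (I' t h - I' s h))
   = (if i = j then expectation (%h. Z h * (\<integral>u\<in>{s<..t}. H u h * H' u h \<partial>lborel)) else 0)"
 proof (cases "i = j")
  case True
  then show ?thesis using LIMSEQ_unique[OF limJ[unfolded iso]] limV fub by simp
 next
  case False
  then show ?thesis using limJ unfolding iso by (simp add: LIMSEQ_const_iff)
 qed
 then show "expectation (%h. Z h * ((I t h - I s h) * (I' t h - I' s h)))
   = (if i = j then expectation (%h. Z h * (\<integral>u\<in>{s<..t}. H u h * H' u h \<partial>lborel)) else 0)"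
  by (simp only: mult.assoc)
qed

end

section \<open>Riemann sums along uniform grids\<close>

text \<open>For \<open>n = 0\<close> division by zero makes every point equal to \<open>s\<close>,
  so monotonicity and the step width below hold without excluding this case.\<close>

definition grid :: "real => real => nat => nat => real" where
 "grid s t n k = s + (t - s) * real k / real n"

lemma grid_0[simp]: "grid s t n 0 = s" and grid_n[simp]: "0 < n ==> grid s t n n = t"
 by (simp_all add: grid_def)

lemma grid_mono: "s <= t ==> k <= l ==> grid s t n k <= grid s t n l"
 unfolding grid_def by (intro add_left_mono divide_right_mono mult_left_mono) auto

lemma grid_ge: "s <= t ==> s <= grid s t n k"
 using grid_mono[of s t 0 k n] by simp

lemma grid_le: "s <= t ==> k <= n ==> 0 < n ==> grid s t n k <= t"
 using grid_mono[of s t k n n] by simp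

lemma grid_Suc_diff: "grid s t n (Suc k) - grid s t n k = (t - s) / real n"
 unfolding grid_def of_nat_Suc distrib_left add_divide_distrib by simp

lemma grid_Ioc_subset: "s <= t ==> k < n ==> {grid s t n k<..grid s t n (Suc k)} \<subseteq> {s<..t}"
 using grid_ge[of s t n k] grid_le[of s t "Suc k" n] by auto

lemma set_integral_Ioc_add:
 fixes f :: "real => real"
 assumes "a <= b" "b <= c" "set_integrable lborel {a<..c} f"
 shows "(LINT u:{a<..c}|lborel. f u) = (LINT u:{a<..b}|lborel. f u) + (LINT u:{b<..c}|lborel. f u)"
proof -
 have "{a<..c} = {a<..b} \<union> {b<..c}" "{a<..b} \<inter> {b<..c} = {}" using assms by auto
 then show ?thesis
  using assms by (simp only:) (rule set_integral_Un; auto intro: set_integrable_subset[OF assms(3)])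
qed

lemma sum_grid_integral:
 fixes f :: "real => real"
 assumes st: "s <= t" and n: "0 < n" and f: "set_integrable lborel {s<..t} f"
 shows "(\<Sum>k<n. LINT u:{grid s t n k<..grid s t n (Suc k)}|lborel. f u) = (LINT u:{s<..t}|lborel. f u)"
proof -
 have "(\<Sum>k<m. LINT u:{grid s t n k<..grid s t n (Suc k)}|lborel. f u) = (LINT u:{s<..grid s t n m}|lborel. f u)" if "m <= n" for m
  using that
 proof (induction m)
  case (Suc m)
  have "{s<..grid s t n (Suc m)} \<subseteq> {s<..t}" using grid_le[OF st Suc.prems n] by auto
  then have "set_integrable lborel {s<..grid s t n (Suc m)} f" by (intro set_integrable_subset[OF f]) auto
  then have "(LINT u:{s<..grid s t n (Suc m)}|lborel. f u) =
   (LINT u:{s<..grid s t n m}|lborel. f u) + (LINT u:{grid s t n m<..grid s t n (Suc m)}|lborel. f u)"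
   by (intro set_integral_Ioc_add grid_ge st grid_mono) auto
  then show ?case using Suc by simp
 qed (simp add: set_lebesgue_integral_def)
 from this[of n] show ?thesis using n by simp
qed

lemma grid_oscillation:
 fixes f :: "real => real"
 assumes st: "s <= t" and f: "continuous_on {s..t} f" and e: "0 < e"
 shows "\<forall>\<^sub>F n in sequentially. \<forall>k<n. \<forall>u\<in>{grid s t n k..grid s t n (Suc k)}. \<bar>f u - f (grid s t n k)\<bar> < e"
proof -
 have "uniformly_continuous_on {s..t} f" by (rule compact_uniformly_continuous[OF f]) simp
 then obtain d where d: "d > 0" "\<And>x y. x \<in> {s..t} ==> y \<in> {s..t} ==> \<bar>y - x\<bar> < d ==> \<bar>f y - f x\<bar> < e"
  using e unfolding uniformly_continuous_on_def dist_real_def by metis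
 have "(%n. (t - s) / real n) \<longlonglongrightarrow> 0" by (rule lim_const_over_n)
 then have "\<forall>\<^sub>F n in sequentially. (t - s) / real n < d" using d(1) by (rule order_tendstoD(2))
 then show ?thesis
 proof (rule eventually_mono, intro allI impI ballI)
  fix n k u assume n: "(t - s) / real n < d" "k < n" and u: "u \<in> {grid s t n k..grid s t n (Suc k)}"
  have g: "s <= grid s t n k" "grid s t n (Suc k) <= t" using grid_ge[OF st] grid_le[OF st, of "Suc k" n] n by auto
  show "\<bar>f u - f (grid s t n k)\<bar> < e"
   using u g n(1) grid_Suc_diff[of s t n k] by (intro d(2)) auto
 qed
qed

lemma continuous_on_primitive_Ioc:
 fixes D :: "real => real"
 assumes D: "set_integrable lborel {s<..t} D"
 shows "continuous_on {s..t} (%r. LINT u:{s<..r}|lborel. D u)"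
 unfolding continuous_on_sequentially comp_def
proof (intro allI ballI impI)
 fix x :: "nat => real" and a assume a: "a \<in> {s..t}" and x: "(\<forall>n. x n \<in> {s..t}) \<and> x \<longlonglongrightarrow> a"
 have Di: "integrable lborel (%u. indicator {s<..t} u *\<^sub>R D u)" using D by (simp add: set_integrable_def)
 have eq: "indicator {s<..r} u *\<^sub>R D u = indicator {s<..r} u *\<^sub>R (indicator {s<..t} u *\<^sub>R D u)" if "r \<in> {s..t}" for r u
  using that by (auto simp: indicator_def)
 have m: "(%u. indicator {s<..r} u *\<^sub>R D u) \<in> borel_measurable lborel" if "r \<in> {s..t}" for r
  unfolding eq[OF that] using borel_measurable_integrable[OF Di] by measurable
 show "(%n. LINT u:{s<..x n}|lborel. D u) \<longlonglongrightarrow> (LINT u:{s<..a}|lborel. D u)"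
  unfolding set_lebesgue_integral_def
 proof (rule integral_dominated_convergence[where w = "%u. \<bar>indicator {s<..t} u *\<^sub>R D u\<bar>"])
  show "integrable lborel (%u. \<bar>indicator {s<..t} u *\<^sub>R D u\<bar>)" using Di by (rule integrable_abs)
  show "AE u in lborel. norm (indicator {s<..x n} u *\<^sub>R D u) <= \<bar>indicator {s<..t} u *\<^sub>R D u\<bar>" for n
  proof (intro AE_I2)
   have "x n <= t" using x by simp
   then show "norm (indicator {s<..x n} u *\<^sub>R D u) <= \<bar>indicator {s<..t} u *\<^sub>R D u\<bar>" for u
    by (auto simp: indicator_def)
  qed
  have "AE u in lborel. u \<noteq> a" by (rule AE_lborel_singleton)
  then show "AE u in lborel. (%n. indicator {s<..x n} u *\<^sub>R D u) \<longlonglongrightarrow> indicator {s<..a} u *\<^sub>R D u"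
  proof eventually_elim
   case (elim u)
   have "\<forall>\<^sub>F n in sequentially. indicator {s<..x n} u *\<^sub>R D u = indicator {s<..a} u *\<^sub>R D u"
   proof (cases "u < a")
    case True
    then have "\<forall>\<^sub>F n in sequentially. u < x n" using x by (intro order_tendstoD(1)[of x a]) auto
    then show ?thesis by eventually_elim (use True in \<open>auto simp: indicator_def\<close>)
   next
    case False
    with elim have ua: "a < u" by simp
    then have "\<forall>\<^sub>F n in sequentially. x n < u" using x elim by (intro order_tendstoD(2)[of x a]) auto
    then show ?thesis by eventually_elim (use ua in \<open>auto simp: indicator_def\<close>)
   qed
   then show ?case by (rule tendsto_eventually)
  qed
 qed (use m a x in auto)
qed

lemma set_integrable_mult_continuous:
 fixes f D :: "real => real"
 assumes f: "continuous_on {s..t} f" and D: "set_integrable lborel {s<..t} D"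
 shows "set_integrable lborel {s<..t} (%u. f u * D u)"
proof -
 obtain C where "\<forall>u\<in>{s..t}. \<bar>f u\<bar> <= C"
  using compact_imp_bounded[OF compact_continuous_image[OF f compact_Icc]] by (auto simp: bounded_iff)
 then have C: "\<bar>f u\<bar> <= C" if "u \<in> {s..t}" for u using that by blast
 have "continuous_on {s<..t} f" using f by (rule continuous_on_subset) auto
 then have m: "(%u. indicator {s<..t} u *\<^sub>R f u) \<in> borel_measurable borel"
  by (intro borel_measurable_continuous_on_indicator) auto
 have "integrable lborel (%u. (indicator {s<..t} u *\<^sub>R f u) * (indicator {s<..t} u *\<^sub>R D u))"
 proof (rule integrable_bounded_mult[where C = "\<bar>C\<bar>"])
  show "integrable lborel (%u. indicator {s<..t} u *\<^sub>R D u)" using D by (simp add: set_integrable_def)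
  show "\<bar>indicator {s<..t} u *\<^sub>R f u\<bar> <= \<bar>C\<bar>" for u using C[of u] by (auto simp: indicator_def)
 qed (use m in simp)
 moreover have "(%u. (indicator {s<..t} u *\<^sub>R f u) * (indicator {s<..t} u *\<^sub>R D u)) = (%u. indicator {s<..t} u *\<^sub>R (f u * D u))"
  by (auto simp: indicator_def fun_eq_iff)
 ultimately show ?thesis by (simp add: set_integrable_def)
qed

lemma abs_set_integral_le:
 fixes f g :: "'a => real"
 assumes "set_integrable M A f" "set_integrable M A g" "\<And>x. x \<in> A ==> \<bar>f x\<bar> <= g x"
 shows "\<bar>LINT x:A|M. f x\<bar> <= (LINT x:A|M. g x)"
proof -
 have "\<bar>LINT x:A|M. f x\<bar> <= (LINT x:A|M. \<bar>f x\<bar>)"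
  using set_integral_norm_bound[OF assms(1)] by simp
 also have "\<dots> <= (LINT x:A|M. g x)"
  by (rule set_integral_mono[OF set_integrable_abs[OF assms(1)] assms(2,3)])
 finally show ?thesis .
qed

text \<open>The increments of a primitive of \<open>D\<close> are weighted with left endpoint
  values. On a fine grid \<open>f\<close> varies by less than \<open>d\<close> within each cell, so
  the total error is at most \<open>d\<close> times the integral of \<open>\<bar>D\<bar>\<close>;
  integrability of \<open>D\<close> suffices.\<close>

lemma grid_sum_tendsto:
 fixes f D :: "real => real"
 assumes st: "s <= t" and f: "continuous_on {s..t} f" and D: "set_integrable lborel {s<..t} D"
 shows "(%n. \<Sum>k<n. f (grid s t n k) * (LINT u:{grid s t n k<..grid s t n (Suc k)}|lborel. D u)) \<longlonglongrightarrow> (LINT u:{s<..t}|lborel. f u * D u)"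
proof (rule LIMSEQ_I)
 fix e :: real assume e: "0 < e"
 define V where "V = (LINT u:{s<..t}|lborel. \<bar>D u\<bar>)"
 have V0: "0 <= V" unfolding V_def set_lebesgue_integral_def by simp
 define d where "d = e / (V + 1)"
 have d: "0 < d" "d * V < e" using e V0 by (auto simp: d_def field_simps)
 have "\<forall>\<^sub>F n in sequentially. \<bar>(\<Sum>k<n. f (grid s t n k) * (LINT u:{grid s t n k<..grid s t n (Suc k)}|lborel. D u)) - (LINT u:{s<..t}|lborel. f u * D u)\<bar> < e"
  using grid_oscillation[OF st f d(1)] eventually_gt_at_top[of 0]
 proof eventually_elim
  case (elim n)
  let ?I = "%k. {grid s t n k<..grid s t n (Suc k)}"
  have sub: "set_integrable lborel (?I k) g" if "k < n" "set_integrable lborel {s<..t} g" for k and g :: "real => real"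
   by (rule set_integrable_subset[OF that(2)]) (use grid_Ioc_subset[OF st that(1)] in auto)
  have fD: "set_integrable lborel {s<..t} (%u. f u * D u)" by (rule set_integrable_mult_continuous[OF f D])
  have aD: "set_integrable lborel {s<..t} (%u. \<bar>D u\<bar>)" by (rule set_integrable_abs[OF D])
  have k: "\<bar>f (grid s t n k) * (LINT u:?I k|lborel. D u) - (LINT u:?I k|lborel. f u * D u)\<bar> <= d * (LINT u:?I k|lborel. \<bar>D u\<bar>)" if k: "k < n" for k
  proof -
   have "f (grid s t n k) * (LINT u:?I k|lborel. D u) - (LINT u:?I k|lborel. f u * D u) = (LINT u:?I k|lborel. f (grid s t n k) * D u - f u * D u)"
    using sub[OF k D] sub[OF k fD] by (subst set_integral_diff) auto
   also have "\<bar>\<dots>\<bar> <= (LINT u:?I k|lborel. d * \<bar>D u\<bar>)"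
   proof (rule abs_set_integral_le)
    show "set_integrable lborel (?I k) (%u. f (grid s t n k) * D u - f u * D u)" using sub[OF k D] sub[OF k fD] by (intro set_integral_diff) auto
    show "set_integrable lborel (?I k) (%u. d * \<bar>D u\<bar>)" using sub[OF k aD] by auto
    fix u assume "u \<in> ?I k"
    then have "\<bar>f u - f (grid s t n k)\<bar> < d" using elim(1) k by (auto dest!: spec[of _ k])
    then have "\<bar>f (grid s t n k) - f u\<bar> * \<bar>D u\<bar> <= d * \<bar>D u\<bar>" by (intro mult_right_mono) auto
    then show "\<bar>f (grid s t n k) * D u - f u * D u\<bar> <= d * \<bar>D u\<bar>" by (simp add: abs_mult flip: left_diff_distrib)
   qed
   also have "\<dots> = d * (LINT u:?I k|lborel. \<bar>D u\<bar>)" by simp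
   finally show ?thesis .
  qed
  have eq: "(\<Sum>k<n. f (grid s t n k) * (LINT u:?I k|lborel. D u)) - (LINT u:{s<..t}|lborel. f u * D u)
   = (\<Sum>k<n. f (grid s t n k) * (LINT u:?I k|lborel. D u) - (LINT u:?I k|lborel. f u * D u))"
   by (simp add: sum_subtractf sum_grid_integral[OF st elim(2) fD])
  have "\<bar>\<Sum>k<n. f (grid s t n k) * (LINT u:?I k|lborel. D u) - (LINT u:?I k|lborel. f u * D u)\<bar> <= (\<Sum>k<n. d * (LINT u:?I k|lborel. \<bar>D u\<bar>))"
  proof (rule order_trans[OF sum_abs sum_mono])
   fix l assume "l \<in> {..<n}"
   then show "\<bar>f (grid s t n l) * (LINT u:?I l|lborel. D u) - (LINT u:?I l|lborel. f u * D u)\<bar> <= d * (LINT u:?I l|lborel. \<bar>D u\<bar>)"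
    by (intro k) simp
  qed
  also have "\<dots> = d * V" unfolding sum_distrib_left[symmetric] sum_grid_integral[OF st elim(2) aD] V_def ..
  finally show ?case unfolding eq using d(2) by (rule le_less_trans)
 qed
 then show "\<exists>no. \<forall>n\<ge>no. norm ((\<Sum>k<n. f (grid s t n k) * (LINT u:{grid s t n k<..grid s t n (Suc k)}|lborel. D u)) - (LINT u:{s<..t}|lborel. f u * D u)) < e"
  unfolding eventually_sequentially real_norm_def .
qed

lemma grid_oscillation_sum_tendsto:
 fixes f D :: "real => real"
 assumes st: "s <= t" and f: "continuous_on {s..t} f" and D: "set_integrable lborel {s<..t} D"
 shows "(%n. \<Sum>k<n. \<bar>f (grid s t n (Suc k)) - f (grid s t n k)\<bar> * (LINT u:{grid s t n k<..grid s t n (Suc k)}|lborel. \<bar>D u\<bar>)) \<longlonglongrightarrow> 0"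
proof (rule LIMSEQ_I)
 fix e :: real assume e: "0 < e"
 define V where "V = (LINT u:{s<..t}|lborel. \<bar>D u\<bar>)"
 have V0: "0 <= V" unfolding V_def set_lebesgue_integral_def by simp
 define d where "d = e / (V + 1)"
 have d: "0 < d" "d * V < e" using e V0 by (auto simp: d_def field_simps)
 have aD: "set_integrable lborel {s<..t} (%u. \<bar>D u\<bar>)" by (rule set_integrable_abs[OF D])
 have nn: "0 <= (LINT u:A|lborel. \<bar>D u\<bar>)" for A unfolding set_lebesgue_integral_def by simp
 have "\<forall>\<^sub>F n in sequentially. \<bar>\<Sum>k<n. \<bar>f (grid s t n (Suc k)) - f (grid s t n k)\<bar> * (LINT u:{grid s t n k<..grid s t n (Suc k)}|lborel. \<bar>D u\<bar>)\<bar> < e"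
  using grid_oscillation[OF st f d(1)] eventually_gt_at_top[of 0]
 proof eventually_elim
  case (elim n)
  let ?I = "%k. {grid s t n k<..grid s t n (Suc k)}"
  have "(\<Sum>k<n. \<bar>f (grid s t n (Suc k)) - f (grid s t n k)\<bar> * (LINT u:?I k|lborel. \<bar>D u\<bar>)) <= (\<Sum>k<n. d * (LINT u:?I k|lborel. \<bar>D u\<bar>))"
  proof (intro sum_mono mult_right_mono nn)
   fix k assume "k \<in> {..<n}"
   then show "\<bar>f (grid s t n (Suc k)) - f (grid s t n k)\<bar> <= d"
    using elim(1) grid_mono[OF st, of k "Suc k" n] by (auto dest!: spec[of _ k] intro!: less_imp_le)
  qed
  also have "\<dots> = d * V" unfolding sum_distrib_left[symmetric] sum_grid_integral[OF st elim(2) aD] V_def ..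
  moreover have "0 <= (\<Sum>k<n. \<bar>f (grid s t n (Suc k)) - f (grid s t n k)\<bar> * (LINT u:?I k|lborel. \<bar>D u\<bar>))"
   by (intro sum_nonneg mult_nonneg_nonneg nn) auto
  ultimately show ?case using d by linarith
 qed
 then show "\<exists>no. \<forall>n\<ge>no. norm ((\<Sum>k<n. \<bar>f (grid s t n (Suc k)) - f (grid s t n k)\<bar> * (LINT u:{grid s t n k<..grid s t n (Suc k)}|lborel. \<bar>D u\<bar>)) - 0) < e"
  by (simp add: eventually_sequentially)
qed

text \<open>A continuous function of bounded variation has no quadratic variation: one factor of
  each square is read as the increment of the continuous primitive of \<open>\<bar>D\<bar>\<close>,
  and \<open>grid_oscillation_sum_tendsto\<close> applies.\<close>

lemma grid_primitive_square_tendsto: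
 fixes D :: "real => real"
 assumes st: "s <= t" and D: "set_integrable lborel {s<..t} D"
 shows "(%n. \<Sum>k<n. (LINT u:{grid s t n k<..grid s t n (Suc k)}|lborel. \<bar>D u\<bar>)^2) \<longlonglongrightarrow> 0"
proof -
 let ?V = "%r. LINT u:{s<..r}|lborel. \<bar>D u\<bar>"
 have aD: "set_integrable lborel {s<..t} (%u. \<bar>D u\<bar>)" by (rule set_integrable_abs[OF D])
 have c: "continuous_on {s..t} ?V" by (rule continuous_on_primitive_Ioc[OF aD])
 have "?V (grid s t n (Suc k)) - ?V (grid s t n k) = (LINT u:{grid s t n k<..grid s t n (Suc k)}|lborel. \<bar>D u\<bar>)" if "k < n" for n k
 proof -
  have "set_integrable lborel {s<..grid s t n (Suc k)} (%u. \<bar>D u\<bar>)"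
   by (rule set_integrable_subset[OF aD]) (use grid_le[OF st, of "Suc k" n] that in auto)
  then show ?thesis
   using set_integral_Ioc_add[OF grid_ge[OF st, of n k] grid_mono[OF st, of k "Suc k" n]] by simp
 qed
 moreover have nn: "0 <= (LINT u:A|lborel. \<bar>D u\<bar>)" for A unfolding set_lebesgue_integral_def by simp
 ultimately have "(\<Sum>k<n. (LINT u:{grid s t n k<..grid s t n (Suc k)}|lborel. \<bar>D u\<bar>)^2)
   = (\<Sum>k<n. \<bar>?V (grid s t n (Suc k)) - ?V (grid s t n k)\<bar> * (LINT u:{grid s t n k<..grid s t n (Suc k)}|lborel. \<bar>D u\<bar>))" for n
  by (intro sum.cong refl) (simp add: power2_eq_square)
 then show ?thesis using grid_oscillation_sum_tendsto[OF st c D] by simp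
qed

section \<open>Taylor expansion of powers with a uniform remainder\<close>

lemma power_taylor1:
 assumes K: "0 <= K"
 shows "\<exists>C\<ge>0. \<forall>x y::real. \<bar>x\<bar> <= K \<longrightarrow> \<bar>y\<bar> <= K \<longrightarrow> \<bar>y ^ m - x ^ m - real m * x ^ (m - 1) * (y - x)\<bar> <= C * (y - x)^2"
proof (induction m)
 case (Suc m)
 then obtain C where C: "0 <= C" "\<And>x y. \<bar>x\<bar> <= K ==> \<bar>y\<bar> <= K ==> \<bar>y ^ m - x ^ m - real m * x ^ (m - 1) * (y - x)\<bar> <= C * (y - x)^2" by blast
 show ?case
 proof (intro exI[of _ "real m * K ^ (m - 1) + K * C"] conjI allI impI)
  show "0 <= real m * K ^ (m - 1) + K * C" using K C by simp
  fix x y assume xy: "\<bar>x\<bar> <= K" "\<bar>y\<bar> <= K"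
  let ?r = "y ^ m - x ^ m - real m * x ^ (m - 1) * (y - x)"
  have e: "real m * x ^ m = real m * (x * x ^ (m - 1))" by (cases m) auto
  have "y ^ Suc m - x ^ Suc m - real (Suc m) * x ^ (Suc m - 1) * (y - x) = real m * x ^ (m - 1) * (y - x)^2 + y * ?r"
  proof -
   define h where "h = y - x"
   have y: "y = x + h" by (simp add: h_def)
   have "y ^ Suc m - x ^ Suc m - real (Suc m) * x ^ m * h = real m * x ^ (m - 1) * h^2
     + y * (y ^ m - x ^ m - real m * x ^ (m - 1) * h) + h * (real m * (x * x ^ (m - 1)) - real m * x ^ m)"
    by (simp add: y algebra_simps power2_eq_square)
   then show ?thesis unfolding e h_def diff_self mult_zero_right add_0_right by simp
  qed
  also have "\<bar>\<dots>\<bar> <= \<bar>real m * x ^ (m - 1) * (y - x)^2\<bar> + \<bar>y * ?r\<bar>" by (rule abs_triangle_ineq)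
  also have "\<dots> <= real m * K ^ (m - 1) * (y - x)^2 + K * (C * (y - x)^2)"
  proof (rule add_mono)
   show "\<bar>real m * x ^ (m - 1) * (y - x)^2\<bar> <= real m * K ^ (m - 1) * (y - x)^2"
    using xy by (simp add: abs_mult power_abs mult_left_mono mult_right_mono power_mono)
   show "\<bar>y * ?r\<bar> <= K * (C * (y - x)^2)"
    unfolding abs_mult using C xy K by (intro mult_mono) auto
  qed
  finally show "\<bar>y ^ Suc m - x ^ Suc m - real (Suc m) * x ^ (Suc m - 1) * (y - x)\<bar> <= (real m * K ^ (m - 1) + K * C) * (y - x)^2"
   by (simp add: algebra_simps)
 qed
qed (auto intro!: exI[of _ 0])

text \<open>As for the first order, by induction on the exponent: with \<open>h = y - x\<close>, the
  new remainder is \<open>y\<close> times the old one plus one explicit term of order 3 in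
  \<open>h\<close>. Exponents truncated at 0 are harmless because their coefficients vanish.\<close>

lemma power_taylor2:
 assumes K: "0 <= K"
 shows "\<exists>C\<ge>0. \<forall>x y::real. \<bar>x\<bar> <= K \<longrightarrow> \<bar>y\<bar> <= K \<longrightarrow>
  \<bar>y ^ m - x ^ m - real m * x ^ (m - 1) * (y - x) - real m * (real m - 1) / 2 * x ^ (m - 2) * (y - x)^2\<bar> <= C * \<bar>y - x\<bar> ^ 3"
proof (induction m)
 case (Suc m)
 let ?r = "%x y. y ^ m - x ^ m - real m * x ^ (m - 1) * (y - x) - real m * (real m - 1) / 2 * x ^ (m - 2) * (y - x)^2"
 from Suc obtain C where C: "0 <= C" "\<And>x y. \<bar>x\<bar> <= K ==> \<bar>y\<bar> <= K ==> \<bar>?r x y\<bar> <= C * \<bar>y - x\<bar> ^ 3" by blast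
 define c where "c = real m * (real m - 1) / 2"
 have c0: "0 <= c" unfolding c_def by (cases m) auto
 show ?case
 proof (intro exI[of _ "c * K ^ (m - 2) + K * C"] conjI allI impI)
  show "0 <= c * K ^ (m - 2) + K * C" using K C c0 by simp
  fix x y assume xy: "\<bar>x\<bar> <= K" "\<bar>y\<bar> <= K"
  have e1: "real m * x ^ m = real m * (x * x ^ (m - 1))" by (cases m) auto
  have e2: "c * x ^ (m - 1) = c * (x * x ^ (m - 2))"
  proof (cases "m <= 1")
   case True then have "c = 0" by (auto simp: c_def le_Suc_eq) then show ?thesis by simp
  next
   case False
   then have "m - 1 = Suc (m - 2)" by simp
   then show ?thesis by (simp only: power_Suc)
  qed
  have cS: "real (Suc m) * (real (Suc m) - 1) / 2 = c + real m" by (simp add: c_def field_simps)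
  have S: "Suc m - 2 = m - 1" "Suc m - 1 = m" by simp_all
  define h where "h = y - x"
  have y: "y = x + h" by (simp add: h_def)
  have "y ^ Suc m - x ^ Suc m - real (Suc m) * x ^ (Suc m - 1) * (y - x) - real (Suc m) * (real (Suc m) - 1) / 2 * x ^ (Suc m - 2) * (y - x)^2
    = c * x ^ (m - 2) * h ^ 3 + y * ?r x y"
  proof -
   have "y ^ Suc m - x ^ Suc m - real (Suc m) * x ^ m * h - (c + real m) * x ^ (m - 1) * h^2
    = c * x ^ (m - 2) * h ^ 3 + y * (y ^ m - x ^ m - real m * x ^ (m - 1) * h - c * x ^ (m - 2) * h^2)
     + h * (real m * (x * x ^ (m - 1)) - real m * x ^ m) + h^2 * (c * (x * x ^ (m - 2)) - c * x ^ (m - 1))"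
    by (simp add: y algebra_simps power2_eq_square power3_eq_cube)
   then have "y ^ Suc m - x ^ Suc m - real (Suc m) * x ^ m * h - (c + real m) * x ^ (m - 1) * h^2
    = c * x ^ (m - 2) * h ^ 3 + y * (y ^ m - x ^ m - real m * x ^ (m - 1) * h - c * x ^ (m - 2) * h^2)"
    unfolding e1 e2 by simp
   then show ?thesis unfolding cS S c_def[symmetric] h_def[symmetric] .
  qed
  also have "\<bar>\<dots>\<bar> <= \<bar>c * x ^ (m - 2) * h ^ 3\<bar> + \<bar>y * ?r x y\<bar>" by (rule abs_triangle_ineq)
  also have "\<dots> <= c * K ^ (m - 2) * \<bar>h\<bar> ^ 3 + K * (C * \<bar>h\<bar> ^ 3)"
  proof (rule add_mono)
   show "\<bar>c * x ^ (m - 2) * h ^ 3\<bar> <= c * K ^ (m - 2) * \<bar>h\<bar> ^ 3"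
    using xy c0 by (simp add: abs_mult power_abs mult_left_mono mult_right_mono power_mono)
   show "\<bar>y * ?r x y\<bar> <= K * (C * \<bar>h\<bar> ^ 3)"
    unfolding abs_mult h_def using C xy K by (intro mult_mono) auto
  qed
  finally show "\<bar>y ^ Suc m - x ^ Suc m - real (Suc m) * x ^ (Suc m - 1) * (y - x) - real (Suc m) * (real (Suc m) - 1) / 2 * x ^ (Suc m - 2) * (y - x)^2\<bar>
    <= (c * K ^ (m - 2) + K * C) * \<bar>y - x\<bar> ^ 3"
   by (simp add: algebra_simps h_def)
 qed
qed (auto intro!: exI[of _ 0])

text \<open>Ordering each mixed product by its earlier index prepares for conditioning:
  \<open>a k\<close> is already known when the later sum is estimated.\<close>

lemma power2_sum_split:
 fixes a :: "nat => real"
 shows "(\<Sum>k<n. a k)^2 = (\<Sum>k<n. (a k)^2) + 2 * (\<Sum>k<n. a k * (\<Sum>l\<in>{Suc k..<n}. a l))"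
proof (induction n)
 case (Suc n)
 have "(\<Sum>k<Suc n. a k * (\<Sum>l\<in>{Suc k..<Suc n}. a l)) = (\<Sum>k<n. a k * (\<Sum>l\<in>{Suc k..<n}. a l) + a k * a n)"
  by (simp add: distrib_left)
 then have "(\<Sum>k<Suc n. a k * (\<Sum>l\<in>{Suc k..<Suc n}. a l)) = (\<Sum>k<n. a k * (\<Sum>l\<in>{Suc k..<n}. a l)) + (\<Sum>k<n. a k) * a n"
  by (simp add: sum.distrib sum_distrib_right)
 then show ?case using Suc by (simp add: power2_sum algebra_simps)
qed simp

section \<open>A weak Ito formula for power sums\<close>

lemma set_integrable_const_Ioc: "set_integrable lborel {s<..t::real} (%_. c :: real)"
proof -
 have "integrable lborel (indicator {s<..t} :: real => real)"
  by (rule integrable_real_indicator) (cases "s <= t"; simp)+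
 then show ?thesis unfolding set_integrable_def by (simp add: mult.commute)
qed

lemma (in prob_space) integrable_bounded:
 fixes Y :: "'a => real"
 assumes "Y \<in> borel_measurable M" "\<And>h. h \<in> space M ==> \<bar>Y h\<bar> <= C"
 shows "integrable M Y"
 by (rule integrable_const_bound[of _ C]) (use assms in auto)

text \<open>What is retained of the stochastic equation: the increments of \<open>X\<close> minus
  those of the drift are orthogonal to bounded functions of the past and have bracket density
  \<open>Q\<close>. Brownian motions and stochastic integrals no longer appear. The rates
  \<open>D\<close> may be unbounded; what is controlled is their total variation over bounded times,
  in \<open>L2\<close>.\<close>

locale ito_system = prob_space M for M :: "'w measure" +
 fixes F :: "real => 'w measure" and J :: "nat set" and X D Q :: "nat => real => 'w => real" and K KQ :: real
 assumes finite_J: "finite J"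
  and subalg: "0 <= t ==> subalgebra M (F t)"
  and subalg_mono: "0 <= s ==> s <= t ==> subalgebra (F t) (F s)"
  and X_adapted: "i \<in> J ==> 0 <= t ==> X i t \<in> borel_measurable (F t)"
  and X_continuous: "i \<in> J ==> h \<in> space M ==> continuous_on {0..} (%t. X i t h)"
  and K_nonneg: "0 <= K"
  and X_bounded: "i \<in> J ==> 0 <= t ==> h \<in> space M ==> \<bar>X i t h\<bar> <= K"
  and D_measurable: "i \<in> J ==> (%p. D i (snd p) (fst p)) \<in> borel_measurable (M \<Otimes>\<^sub>M lborel)"
  and Q_measurable: "i \<in> J ==> (%p. Q i (snd p) (fst p)) \<in> borel_measurable (M \<Otimes>\<^sub>M lborel)"
  and KQ_nonneg: "0 <= KQ"
  and Q_bounded: "i \<in> J ==> h \<in> space M ==> \<bar>Q i u h\<bar> <= KQ"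
  and D_integrable: "i \<in> J ==> 0 <= t ==> AE h in M. set_integrable lborel {0<..t} (%u. D i u h)"
  and V_square: "i \<in> J ==> 0 <= t ==> integrable M (%h. (LINT u:{0<..t}|lborel. \<bar>D i u h\<bar>)^2)"
  and martingale: "i \<in> J ==> 0 <= s ==> s <= t ==> Z \<in> borel_measurable (F s) ==> (\<And>h. h \<in> space M ==> \<bar>Z h\<bar> <= C) ==>
   expectation (%h. Z h * (X i t h - X i s h - (LINT u:{s<..t}|lborel. D i u h))) = 0"
  and bracket: "i \<in> J ==> j \<in> J ==> 0 <= s ==> s <= t ==> Z \<in> borel_measurable (F s) ==> (\<And>h. h \<in> space M ==> \<bar>Z h\<bar> <= C) ==>
   expectation (%h. Z h * ((X i t h - X i s h - (LINT u:{s<..t}|lborel. D i u h)) * (X j t h - X j s h - (LINT u:{s<..t}|lborel. D j u h))))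
    = (if i = j then expectation (%h. Z h * (LINT u:{s<..t}|lborel. Q i u h)) else 0)"
begin

definition dA :: "nat => real => real => 'w => real" where
 "dA i s t h = (LINT u:{s<..t}|lborel. D i u h)"
definition dV :: "nat => real => real => 'w => real" where
 "dV i s t h = (LINT u:{s<..t}|lborel. \<bar>D i u h\<bar>)"
definition dQ :: "nat => real => real => 'w => real" where
 "dQ i s t h = (LINT u:{s<..t}|lborel. Q i u h)"
definition dI :: "nat => real => real => 'w => real" where
 "dI i s t h = X i t h - X i s h - dA i s t h"

lemma X_measurable: "i \<in> J ==> 0 <= t ==> X i t \<in> borel_measurable M"
 by (rule measurable_from_subalg[OF subalg X_adapted])

lemma F_measurable: "0 <= t ==> Z \<in> borel_measurable (F t) ==> Z \<in> borel_measurable M"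
 by (rule measurable_from_subalg[OF subalg])

lemma F_mono: "0 <= s ==> s <= t ==> Z \<in> borel_measurable (F s) ==> Z \<in> borel_measurable (F t)"
 by (rule measurable_from_subalg[OF subalg_mono])

lemma X_adapted': "i \<in> J ==> 0 <= s ==> s <= t ==> X i s \<in> borel_measurable (F t)"
 by (rule F_mono[OF _ _ X_adapted])

lemma set_integral_measurable:
 assumes "(%p. f (snd p) (fst p)) \<in> borel_measurable (M \<Otimes>\<^sub>M lborel)"
 shows "(%h. LINT u:{s<..t::real}|lborel. (f u h :: real)) \<in> borel_measurable M"
 unfolding set_lebesgue_integral_def
proof (rule lborel.borel_measurable_lebesgue_integral)
 have "(%p. indicator {s<..t} (snd p) *\<^sub>R f (snd p) (fst p)) \<in> borel_measurable (M \<Otimes>\<^sub>M lborel)"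
  using assms by measurable
 then show "case_prod (%h u. indicator {s<..t} u *\<^sub>R f u h) \<in> borel_measurable (M \<Otimes>\<^sub>M lborel)"
  by (simp add: split_beta')
qed

lemma dA_measurable: "i \<in> J ==> dA i s t \<in> borel_measurable M"
 unfolding dA_def[abs_def] by (rule set_integral_measurable[OF D_measurable])

lemma dV_measurable: "i \<in> J ==> dV i s t \<in> borel_measurable M"
 unfolding dV_def[abs_def] using D_measurable by (intro set_integral_measurable[where f = "%u h. \<bar>D i u h\<bar>"] borel_measurable_abs)

lemma dQ_measurable: "i \<in> J ==> dQ i s t \<in> borel_measurable M"
 unfolding dQ_def[abs_def] by (rule set_integral_measurable[OF Q_measurable])

lemma dI_measurable: "i \<in> J ==> 0 <= s ==> s <= t ==> dI i s t \<in> borel_measurable M"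
 unfolding dI_def[abs_def] by (intro borel_measurable_diff X_measurable dA_measurable) auto

lemma dV_nonneg: "0 <= dV i s t h"
 by (simp add: dV_def set_lebesgue_integral_def)

lemma dA_le_dV: "\<bar>dA i s t h\<bar> <= dV i s t h"
 using integral_norm_bound[of lborel "%u. indicator {s<..t} u *\<^sub>R D i u h"]
 by (simp add: dA_def dV_def set_lebesgue_integral_def abs_mult)

lemma dQ_le: "i \<in> J ==> s <= t ==> h \<in> space M ==> \<bar>dQ i s t h\<bar> <= KQ * (t - s)"
proof -
 assume a: "i \<in> J" "s <= t" "h \<in> space M"
 have m: "(%u. Q i u h) \<in> borel_measurable lborel"
  using measurable_compose[OF measurable_Pair1' Q_measurable[OF a(1)], OF a(3)] by simp
 have 1: "set_integrable lborel {s<..t} (%u. KQ)" by (rule set_integrable_const_Ioc)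
 have 2: "set_integrable lborel {s<..t} (%u. Q i u h)"
  by (rule set_integrable_bound[OF 1]) (use m Q_bounded[OF a(1,3)] KQ_nonneg in \<open>auto simp: set_borel_measurable_def\<close>)
 have "\<bar>dQ i s t h\<bar> <= (LINT u:{s<..t}|lborel. KQ)"
  unfolding dQ_def by (rule abs_set_integral_le[OF 2 1]) (use Q_bounded[OF a(1,3)] in simp)
 also have "\<dots> = KQ * (t - s)" using a by (simp add: set_lebesgue_integral_def mult.commute)
 finally show ?thesis .
qed

lemma Q_integrable: "i \<in> J ==> s <= t ==> h \<in> space M ==> set_integrable lborel {s<..t} (%u. Q i u h)"
proof -
 assume a: "i \<in> J" "s <= t" "h \<in> space M"
 have m: "(%u. Q i u h) \<in> borel_measurable lborel"
  using measurable_compose[OF measurable_Pair1' Q_measurable[OF a(1)], OF a(3)] by simp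
 have 1: "set_integrable lborel {s<..t} (%u. KQ)" by (rule set_integrable_const_Ioc)
 show "set_integrable lborel {s<..t} (%u. Q i u h)"
  by (rule set_integrable_bound[OF 1]) (use m Q_bounded[OF a(1,3)] KQ_nonneg in \<open>auto simp: set_borel_measurable_def\<close>)
qed

lemma D_integrable': "i \<in> J ==> 0 <= s ==> s <= t ==> AE h in M. set_integrable lborel {s<..t} (%u. D i u h)"
proof -
 assume a: "i \<in> J" "0 <= s" "s <= t"
 then have "AE h in M. set_integrable lborel {0<..t} (%u. D i u h)" by (intro D_integrable) auto
 then show ?thesis by eventually_elim (rule set_integrable_subset, use a in auto)
qed

lemma dV_square: assumes a: "i \<in> J" "0 <= s" "s <= t" shows "integrable M (%h. (dV i s t h)^2)"
proof (rule Bochner_Integration.integrable_bound)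
 show "integrable M (%h. (dV i 0 t h)^2)" unfolding dV_def by (rule V_square) (use a in auto)
 show "(%h. (dV i s t h)^2) \<in> borel_measurable M" using dV_measurable[OF a(1)] by measurable
 have "AE h in M. set_integrable lborel {0<..t} (%u. D i u h)" using a by (intro D_integrable) auto
 then show "AE h in M. norm ((dV i s t h)^2) <= norm ((dV i 0 t h)^2)"
 proof eventually_elim
  case (elim h)
  have "dV i 0 t h = dV i 0 s h + dV i s t h"
   unfolding dV_def by (rule set_integral_Ioc_add[OF a(2,3) set_integrable_abs[OF elim]])
  then have "dV i s t h <= dV i 0 t h" using dV_nonneg[of i 0 s h] by simp
  then show ?case using dV_nonneg by (simp add: power_mono)
 qed
qed

lemma dV_integrable: "i \<in> J ==> 0 <= s ==> s <= t ==> integrable M (dV i s t)"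
 by (rule square_integrable_imp_integrable[OF dV_measurable dV_square])

lemma dA_square: assumes a: "i \<in> J" "0 <= s" "s <= t" shows "integrable M (%h. (dA i s t h)^2)"
proof (rule Bochner_Integration.integrable_bound[OF dV_square[OF a]])
 show "(%h. (dA i s t h)^2) \<in> borel_measurable M" using dA_measurable[OF a(1)] by measurable
 show "AE h in M. norm ((dA i s t h)^2) <= norm ((dV i s t h)^2)"
 proof (rule AE_I2)
  fix h
  have "\<bar>dA i s t h\<bar>^2 <= (dV i s t h)^2" by (rule power_mono[OF dA_le_dV]) simp
  then show "norm ((dA i s t h)^2) <= norm ((dV i s t h)^2)" by simp
 qed
qed

lemma dA_integrable: "i \<in> J ==> 0 <= s ==> s <= t ==> integrable M (dA i s t)"
 by (rule square_integrable_imp_integrable[OF dA_measurable dA_square])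

lemma X_diff_bounded: "i \<in> J ==> 0 <= s ==> s <= t ==> h \<in> space M ==> \<bar>X i t h - X i s h\<bar> <= 2 * K"
 using X_bounded[of i s h] X_bounded[of i t h] by linarith

lemma dI_square: assumes a: "i \<in> J" "0 <= s" "s <= t" shows "integrable M (%h. (dI i s t h)^2)"
 unfolding dI_def
proof (rule integrable_square_diff[OF _ dA_measurable[OF a(1)] _ dA_square[OF a]])
 show m: "(%h. X i t h - X i s h) \<in> borel_measurable M" using a by (intro borel_measurable_diff X_measurable) auto
 show "integrable M (%h. (X i t h - X i s h)^2)"
 proof (rule integrable_bounded)
  show "(%h. (X i t h - X i s h)^2) \<in> borel_measurable M" using m by measurable
  show "\<bar>(X i t h - X i s h)^2\<bar> <= (2 * K)^2" if "h \<in> space M" for h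
   using power_mono[OF X_diff_bounded[OF a that], of 2] by simp
 qed
qed

lemma dI_integrable: "i \<in> J ==> 0 <= s ==> s <= t ==> integrable M (dI i s t)"
 by (rule square_integrable_imp_integrable[OF dI_measurable dI_square])

lemma dI_zero:
 assumes a: "i \<in> J" "0 <= s" "s <= t" and Z: "Z \<in> borel_measurable (F s)" "\<And>h. h \<in> space M ==> \<bar>Z h\<bar> <= C"
 shows "integrable M (%h. Z h * dI i s t h)" "expectation (%h. Z h * dI i s t h) = 0"
proof -
 show "integrable M (%h. Z h * dI i s t h)"
  by (rule integrable_bounded_mult[OF dI_integrable[OF a] F_measurable[OF a(2) Z(1)] Z(2)])
 show "expectation (%h. Z h * dI i s t h) = 0"
  unfolding dI_def dA_def by (rule martingale[OF a Z])
qed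

lemma dI_mult:
 assumes a: "i \<in> J" "j \<in> J" "0 <= s" "s <= t" and Z: "Z \<in> borel_measurable (F s)" "\<And>h. h \<in> space M ==> \<bar>Z h\<bar> <= C"
 shows "integrable M (%h. Z h * (dI i s t h * dI j s t h))"
  "expectation (%h. Z h * (dI i s t h * dI j s t h)) = (if i = j then expectation (%h. Z h * dQ i s t h) else 0)"
proof -
 have "integrable M (%h. dI i s t h * dI j s t h)"
  by (rule integrable_mult_of_squares[OF dI_measurable[OF a(1,3,4)] dI_measurable[OF a(2,3,4)] dI_square[OF a(1,3,4)] dI_square[OF a(2,3,4)]])
 then show "integrable M (%h. Z h * (dI i s t h * dI j s t h))"
  by (rule integrable_bounded_mult[OF _ F_measurable[OF a(3) Z(1)] Z(2)])
 show "expectation (%h. Z h * (dI i s t h * dI j s t h)) = (if i = j then expectation (%h. Z h * dQ i s t h) else 0)"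
  unfolding dI_def dA_def dQ_def by (rule bracket[OF a Z])
qed

lemma dV_grid_sum:
 assumes a: "i \<in> J" "0 <= s" "s <= t" "0 < n"
 shows "AE h in M. (\<Sum>k<n. dV i (grid s t n k) (grid s t n (Suc k)) h) = dV i s t h"
 using D_integrable'[OF a(1-3)]
 by eventually_elim (unfold dV_def, rule sum_grid_integral[OF a(3,4) set_integrable_abs])

text \<open>Uniform integrability of the quadratic variation along partitions: conditioning on the past,
 the remaining variation is bounded by the remaining mass of the drift.\<close>

lemma quadratic_variation_remainder:
 assumes a: "i \<in> J" "0 <= s" "s <= t" and n: "0 < n" and k: "k <= n"
  and Z: "Z \<in> borel_measurable (F (grid s t n k))" "\<And>h. h \<in> space M ==> 0 <= Z h" "\<And>h. h \<in> space M ==> Z h <= C"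
 shows "expectation (%h. Z h * (\<Sum>l\<in>{k..<n}. (X i (grid s t n (Suc l)) h - X i (grid s t n l) h)^2))
  <= expectation (%h. Z h * (K^2 + 2 * K * dV i s t h))"
proof -
 let ?g = "grid s t n"
 let ?x = "%l. X i (?g l)"
 have g0: "0 <= ?g l" for l using grid_ge[OF a(3), of n l] a(2) by linarith
 have gm: "?g l <= ?g l'" if "l <= l'" for l l' by (rule grid_mono[OF a(3) that])
 have Zb: "\<bar>Z h\<bar> <= C" if "h \<in> space M" for h using Z that by auto
 have Zl: "(%h. Z h * ?x l h) \<in> borel_measurable (F (?g l))" if "k <= l" for l
  by (intro borel_measurable_times F_mono[OF g0 gm[OF that] Z(1)] X_adapted a(1) g0)
 have Zlb: "\<bar>Z h * ?x l h\<bar> <= C * K" if "h \<in> space M" for l h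
  unfolding abs_mult using Zb[OF that] X_bounded[OF a(1) g0 that, of l] by (intro mult_mono) auto
 have ZM: "Z \<in> borel_measurable M" by (rule F_measurable[OF g0 Z(1)])
 let ?U = "%h. Z h * ((?x n h)^2 - (?x k h)^2) - 2 * (\<Sum>l\<in>{k..<n}. (Z h * ?x l h) * dA i (?g l) (?g (Suc l)) h)"
 let ?R = "%h. (\<Sum>l\<in>{k..<n}. (Z h * ?x l h) * dI i (?g l) (?g (Suc l)) h)"
 have eq: "Z h * (\<Sum>l\<in>{k..<n}. (?x (Suc l) h - ?x l h)^2) = ?U h - 2 * ?R h" for h
 proof -
  \<comment> \<open>A squared increment is the increment of the square minus \<open>2 * ?x l\<close>
    times the increment. The squares telescope to at most \<open>K^2\<close>, the drift part of the
    rest is bounded through \<open>dV\<close>, and its martingale part vanishes in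
    expectation.\<close>
  have "(\<Sum>l\<in>{k..<n}. (?x (Suc l) h - ?x l h)^2) = (\<Sum>l\<in>{k..<n}. ((?x (Suc l) h)^2 - (?x l h)^2) - 2 * (?x l h * dA i (?g l) (?g (Suc l)) h) - 2 * (?x l h * dI i (?g l) (?g (Suc l)) h))"
   by (intro sum.cong refl) (simp add: dI_def power2_eq_square algebra_simps)
  also have "\<dots> = (?x n h)^2 - (?x k h)^2 - 2 * (\<Sum>l\<in>{k..<n}. ?x l h * dA i (?g l) (?g (Suc l)) h) - 2 * (\<Sum>l\<in>{k..<n}. ?x l h * dI i (?g l) (?g (Suc l)) h)"
   unfolding sum_subtractf sum_distrib_left using sum_Suc_diff'[OF k, of "%l. (?x l h)^2"]
   unfolding sum_subtractf by linarith
  finally show ?thesis by (simp only: right_diff_distrib mult.assoc mult.left_commute[of "Z h"] sum_distrib_left)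
 qed
 have iR: "integrable M ?R"
  by (intro Bochner_Integration.integrable_sum dI_zero(1)[OF a(1) g0 gm Zl Zlb]) auto
 have iA: "integrable M (%h. (Z h * ?x l h) * dA i (?g l) (?g (Suc l)) h)" if "l \<in> {k..<n}" for l
  by (rule integrable_bounded_mult[OF dA_integrable[OF a(1) g0 gm] F_measurable[OF g0 Zl] Zlb]) (use that in auto)
 have i1: "integrable M (%h. Z h * ((?x n h)^2 - (?x k h)^2))"
 proof (rule integrable_bounded_mult[OF _ ZM Zb])
  show "integrable M (%h. (?x n h)^2 - (?x k h)^2)"
  proof (intro Bochner_Integration.integrable_diff integrable_bounded)
   show "(%h. (?x l h)^2) \<in> borel_measurable M" for l by (intro borel_measurable_power X_measurable a(1) g0)
   then show "(%h. (?x k h)^2) \<in> borel_measurable M" .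
   show "\<bar>(?x l h)^2\<bar> <= K^2" if "h \<in> space M" for l h using power_mono[OF X_bounded[OF a(1) g0 that, of l], of 2] by simp
   then show "\<bar>(?x k h)^2\<bar> <= K^2" if "h \<in> space M" for h using that .
  qed
 qed
 have iU: "integrable M ?U"
  by (intro Bochner_Integration.integrable_diff i1 integrable_mult_right Bochner_Integration.integrable_sum iA)
 have "expectation ?R = (\<Sum>l\<in>{k..<n}. expectation (%h. (Z h * ?x l h) * dI i (?g l) (?g (Suc l)) h))"
  by (intro Bochner_Integration.integral_sum dI_zero(1)[OF a(1) g0 gm Zl Zlb]) auto
 also have "\<dots> = 0"
 proof (rule sum.neutral, rule ballI)
  fix l assume "l \<in> {k..<n}"
  then show "expectation (%h. (Z h * ?x l h) * dI i (?g l) (?g (Suc l)) h) = 0"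
   by (intro dI_zero(2)[OF a(1) g0 gm Zl Zlb]) auto
 qed
 finally have R0: "expectation ?R = 0" .
 have "expectation (%h. Z h * (\<Sum>l\<in>{k..<n}. (?x (Suc l) h - ?x l h)^2)) = expectation ?U - 2 * expectation ?R"
  unfolding eq using iU iR by simp
 also have "\<dots> = expectation ?U" using R0 by simp
 also have "\<dots> <= expectation (%h. Z h * (K^2 + 2 * K * dV i s t h))"
 proof (rule integral_mono_AE[OF iU])
  show "integrable M (%h. Z h * (K^2 + 2 * K * dV i s t h))"
   by (rule integrable_bounded_mult[OF _ ZM Zb]) (use dV_integrable[OF a] in simp_all)
  show "AE h in M. ?U h <= Z h * (K^2 + 2 * K * dV i s t h)"
   using dV_grid_sum[OF a n] AE_space
  proof eventually_elim
   case (elim h)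
   have Zn: "0 <= Z h" using Z(2) elim by simp
   have "\<bar>\<Sum>l\<in>{k..<n}. ?x l h * dA i (?g l) (?g (Suc l)) h\<bar> <= (\<Sum>l\<in>{k..<n}. K * dV i (?g l) (?g (Suc l)) h)"
   proof (rule order_trans[OF sum_abs sum_mono])
    fix l
    show "\<bar>?x l h * dA i (?g l) (?g (Suc l)) h\<bar> <= K * dV i (?g l) (?g (Suc l)) h"
     unfolding abs_mult by (rule mult_mono[OF X_bounded[OF a(1) g0 elim(2)] dA_le_dV]) (use K_nonneg in auto)
   qed
   also have "\<dots> <= (\<Sum>l<n. K * dV i (?g l) (?g (Suc l)) h)"
    by (rule sum_mono2) (use K_nonneg dV_nonneg in auto)
   also have "\<dots> = K * dV i s t h" using elim(1) by (simp flip: sum_distrib_left)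
   finally have 1: "\<bar>\<Sum>l\<in>{k..<n}. ?x l h * dA i (?g l) (?g (Suc l)) h\<bar> <= K * dV i s t h" .
   have 2: "(?x n h)^2 <= K^2" using power_mono[OF X_bounded[OF a(1) g0 elim(2), of n], of 2] by simp
   have 3: "0 <= (?x k h)^2" by simp
   have "?U h = Z h * ((?x n h)^2 - (?x k h)^2 - 2 * (\<Sum>l\<in>{k..<n}. ?x l h * dA i (?g l) (?g (Suc l)) h))"
    by (simp only: right_diff_distrib mult.assoc mult.left_commute[of "Z h"] sum_distrib_left)
   also have "\<dots> <= Z h * (K^2 + 2 * K * dV i s t h)"
    using 1 2 3 by (intro mult_left_mono Zn) linarith
   finally show ?case .
  qed
 qed
 finally show ?thesis .
qed

end

text \<open>Time is rounded down to a multiple of \<open>1 / Suc n\<close>, which leaves countably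
  many measurable pieces, and continuity gives the limit. \<open>max 0\<close> extends the process
  to negative times because the second factor is all of \<open>lborel\<close>.\<close>

lemma continuous_process_jointly_measurable:
 fixes Y :: "real => 'w => real"
 assumes m: "\<And>t. 0 <= t ==> Y t \<in> borel_measurable M"
  and c: "\<And>h. h \<in> space M ==> continuous_on {0..} (%t. Y t h)"
 shows "(%p. Y (max 0 (snd p)) (fst p)) \<in> borel_measurable (M \<Otimes>\<^sub>M lborel)"
proof -
 define r where "r n u = real (nat \<lfloor>real (Suc n) * max 0 u\<rfloor>) / real (Suc n)" for n and u :: real
 have rm: "(%p. Y (r n (snd p)) (fst p)) \<in> borel_measurable (M \<Otimes>\<^sub>M lborel)" for n
 proof -
  have f: "(%p. Y (real k / real (Suc n)) (fst p)) \<in> borel_measurable (M \<Otimes>\<^sub>M lborel)" for k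
   by (rule measurable_compose[OF measurable_fst m]) simp
  have g: "(%p. nat \<lfloor>real (Suc n) * max 0 (snd p)\<rfloor>) \<in> measurable (M \<Otimes>\<^sub>M lborel) (count_space UNIV)"
   by measurable
  show ?thesis unfolding r_def by (rule measurable_compose_countable[OF f g])
 qed
 have rlim: "(%n. r n u) \<longlonglongrightarrow> max 0 u" for u
 proof (rule LIM_zero_cancel, rule Lim_null_comparison)
  show "(%n. 1 / real (Suc n)) \<longlonglongrightarrow> 0" using LIMSEQ_inverse_real_of_nat by (simp add: inverse_eq_divide)
  have "\<bar>r n u - max 0 u\<bar> <= 1 / real (Suc n)" for n
  proof -
   define z where "z = real (Suc n) * max 0 u"
   have z0: "0 <= z" unfolding z_def by (rule mult_nonneg_nonneg) auto
   then have "real (nat \<lfloor>z\<rfloor>) = of_int \<lfloor>z\<rfloor>" by simp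
   then have "\<bar>real (nat \<lfloor>z\<rfloor>) - z\<bar> <= 1" by linarith
   moreover have "r n u - max 0 u = (real (nat \<lfloor>z\<rfloor>) - z) / real (Suc n)"
    unfolding r_def z_def by (simp add: diff_divide_distrib)
   ultimately show ?thesis by (simp add: abs_divide divide_right_mono)
  qed
  then show "\<forall>\<^sub>F n in sequentially. norm (r n u - max 0 u) <= 1 / real (Suc n)" by simp
 qed
 show ?thesis
 proof (rule borel_measurable_LIMSEQ_real[OF _ rm])
  fix p :: "'w \<times> real" assume p: "p \<in> space (M \<Otimes>\<^sub>M lborel)"
  then have w: "fst p \<in> space M" by (auto simp: space_pair_measure)
  have r0: "r n (snd p) \<in> {0..}" for n unfolding r_def by simp
  show "(%n. Y (r n (snd p)) (fst p)) \<longlonglongrightarrow> Y (max 0 (snd p)) (fst p)"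
   using continuous_on_tendsto_compose[OF c[OF w] rlim[of "snd p"]] r0 by simp
 qed
qed

section \<open>Variation along grids and Ito's formula in expectation\<close>

context ito_system
begin

lemma X_joint: "i \<in> J ==> (%p. X i (max 0 (snd p)) (fst p)) \<in> borel_measurable (M \<Otimes>\<^sub>M lborel)"
 by (rule continuous_process_jointly_measurable[OF X_measurable X_continuous])

lemma drift_measurable:
 assumes i: "i \<in> J" and s: "0 <= s"
 shows "(%h. LINT u:{s<..t}|lborel. c1 * X i u h ^ k * D i u h + c2 * X i u h ^ l * Q i u h) \<in> borel_measurable M"
proof -
 have "(%p. c1 * X i (max 0 (snd p)) (fst p) ^ k * D i (snd p) (fst p) + c2 * X i (max 0 (snd p)) (fst p) ^ l * Q i (snd p) (fst p)) \<in> borel_measurable (M \<Otimes>\<^sub>M lborel)"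
  by (intro borel_measurable_add borel_measurable_times borel_measurable_power borel_measurable_const X_joint D_measurable Q_measurable i)
 from set_integral_measurable[OF this, of s t]
 have "(%h. LINT u:{s<..t}|lborel. c1 * X i (max 0 u) h ^ k * D i u h + c2 * X i (max 0 u) h ^ l * Q i u h) \<in> borel_measurable M" .
 moreover have "(LINT u:{s<..t}|lborel. c1 * X i (max 0 u) h ^ k * D i u h + c2 * X i (max 0 u) h ^ l * Q i u h)
   = (LINT u:{s<..t}|lborel. c1 * X i u h ^ k * D i u h + c2 * X i u h ^ l * Q i u h)" for h
  by (rule set_lebesgue_integral_cong) (use s in \<open>auto simp: max_def\<close>)
 ultimately show ?thesis by simp
qed

definition dX :: "nat => real => real => nat => nat => 'w => real" where
 "dX i s t n k h = X i (grid s t n (Suc k)) h - X i (grid s t n k) h"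

text \<open>All that is left over in Ito's formula along a grid: the first two terms arise when the
  squared increment of \<open>X\<close> is replaced by the squared increment of its martingale part,
  the third is the Taylor remainder.\<close>

definition mesh_error :: "nat => real => real => nat => 'w => real" where
 "mesh_error i s t n h = (\<Sum>k<n. \<bar>dX i s t n k h\<bar> * dV i (grid s t n k) (grid s t n (Suc k)) h
   + (dV i (grid s t n k) (grid s t n (Suc k)) h)^2 + \<bar>dX i s t n k h\<bar> ^ 3)"

lemma grid_nonneg: "0 <= s ==> s <= t ==> 0 <= grid s t n k"
 using grid_ge[of s t n k] by linarith

lemma dX_measurable: "i \<in> J ==> 0 <= s ==> s <= t ==> dX i s t n k \<in> borel_measurable M"
 unfolding dX_def[abs_def] by (intro borel_measurable_diff X_measurable grid_nonneg)

lemma dX_adapted: "i \<in> J ==> 0 <= s ==> s <= t ==> dX i s t n k \<in> borel_measurable (F (grid s t n (Suc k)))"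
 unfolding dX_def[abs_def] by (intro borel_measurable_diff X_adapted' grid_nonneg grid_mono) auto

lemma dX_bounded: "i \<in> J ==> 0 <= s ==> s <= t ==> h \<in> space M ==> \<bar>dX i s t n k h\<bar> <= 2 * K"
 unfolding dX_def by (rule X_diff_bounded[OF _ grid_nonneg grid_mono]) auto

lemma dX_square_bounded: "i \<in> J ==> 0 <= s ==> s <= t ==> h \<in> space M ==> (dX i s t n k h)^2 <= 4 * K^2"
 using power_mono[OF dX_bounded[of i s t h n k], of 2] by (simp add: power_mult_distrib)

text \<open>The bound does not depend on \<open>n\<close>. Each mixed product is conditioned at its
  earlier increment, where \<open>quadratic_variation_remainder\<close> bounds the later sum; the
  diagonal uses that a squared increment is at most \<open>4 * K^2\<close>. Together, the second
  moment of the quadratic variation is bounded by its product with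
  \<open>6 * K^2 + 4 * K * dV\<close> in mean.\<close>

lemma quadratic_variation_square_bounded:
 assumes a: "i \<in> J" "0 <= s" "s <= t" and n: "0 < n"
 shows "integrable M (%h. (\<Sum>k<n. (dX i s t n k h)^2)^2)"
  and "expectation (%h. (\<Sum>k<n. (dX i s t n k h)^2)^2) <= expectation (%h. (6 * K^2 + 4 * K * dV i s t h)^2)"
proof -
 let ?Q = "%h. \<Sum>k<n. (dX i s t n k h)^2"
 let ?W = "%h. K^2 + 2 * K * dV i s t h"
 let ?R = "%k h. \<Sum>l\<in>{Suc k..<n}. (dX i s t n l h)^2"
 have dm: "(%h. (dX i s t n k h)^2) \<in> borel_measurable M" for k by (intro borel_measurable_power dX_measurable a)
 have d4: "(dX i s t n k h)^2 <= 4 * K^2" if "h \<in> space M" for k h by (rule dX_square_bounded[OF a that])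
 have sb: "\<bar>\<Sum>l\<in>A. (dX i s t n l h)^2\<bar> <= real (card A) * (4 * K^2)" if "h \<in> space M" for A h
 proof -
  have "(\<Sum>l\<in>A. (dX i s t n l h)^2) <= (\<Sum>l\<in>A. 4 * K^2)" by (intro sum_mono d4 that)
  then show ?thesis by (simp add: sum_nonneg)
 qed
 have sm: "(%h. \<Sum>l\<in>A. (dX i s t n l h)^2) \<in> borel_measurable M" for A by (intro borel_measurable_sum dm)
 have si: "integrable M (%h. \<Sum>l\<in>A. (dX i s t n l h)^2)" for A by (rule integrable_bounded[OF sm sb])
 show iQ: "integrable M (%h. (?Q h)^2)"
  using integrable_bounded_mult[OF si sm sb] by (simp only: power2_eq_square)
 have iV: "integrable M (%h. (6 * K^2 + 4 * K * dV i s t h)^2)"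
 proof (rule integrable_square_add)
  show "integrable M (%h. (4 * K * dV i s t h)^2)" using dV_square[OF a] by (simp add: power_mult_distrib)
  show "(%h. 4 * K * dV i s t h) \<in> borel_measurable M" using dV_measurable[OF a(1)] by measurable
 qed simp_all
 have iW: "integrable M ?W" using dV_integrable[OF a] by simp
 have i1: "integrable M (%h. ((dX i s t n k h)^2)^2)" for k
 proof (rule integrable_bounded)
  show "(%h. ((dX i s t n k h)^2)^2) \<in> borel_measurable M" by (intro borel_measurable_power dX_measurable a)
  show "\<bar>((dX i s t n k h)^2)^2\<bar> <= (4 * K^2)^2" if "h \<in> space M" for h
   using power_mono[OF d4[OF that, of k], of 2] by simp
 qed
 have d4': "\<bar>(dX i s t n k h)^2\<bar> <= 4 * K^2" if "h \<in> space M" for k h using d4[OF that] by simp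
 have i2: "integrable M (%h. (dX i s t n k h)^2 * ?R k h)" for k by (rule integrable_bounded_mult[OF si dm d4'])
 have i3: "integrable M (%h. (dX i s t n k h)^2 * ?W h)" for k by (rule integrable_bounded_mult[OF iW dm d4'])
 have i4: "integrable M (%h. (dX i s t n k h)^2)" for k by (rule integrable_bounded[OF dm d4'])
 have "expectation (%h. (?Q h)^2) = expectation (%h. (\<Sum>k<n. ((dX i s t n k h)^2)^2) + 2 * (\<Sum>k<n. (dX i s t n k h)^2 * ?R k h))"
  by (intro Bochner_Integration.integral_cong refl) (rule power2_sum_split)
 also have "\<dots> = (\<Sum>k<n. expectation (%h. ((dX i s t n k h)^2)^2)) + 2 * (\<Sum>k<n. expectation (%h. (dX i s t n k h)^2 * ?R k h))"
  using i1 i2 by (simp only: Bochner_Integration.integral_add Bochner_Integration.integrable_sum integrable_mult_right integral_mult_right_zero Bochner_Integration.integral_sum)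
 also have "\<dots> <= (\<Sum>k<n. expectation (%h. 4 * K^2 * (dX i s t n k h)^2)) + 2 * (\<Sum>k<n. expectation (%h. (dX i s t n k h)^2 * ?W h))"
 proof (intro add_mono mult_left_mono sum_mono)
  fix k assume k: "k \<in> {..<n}"
  show "expectation (%h. ((dX i s t n k h)^2)^2) <= expectation (%h. 4 * K^2 * (dX i s t n k h)^2)"
  proof (rule integral_mono[OF i1])
   show "integrable M (%h. 4 * K^2 * (dX i s t n k h)^2)" using i4 by simp
   show "((dX i s t n k h)^2)^2 <= 4 * K^2 * (dX i s t n k h)^2" if "h \<in> space M" for h
    unfolding power2_eq_square[of "(dX i s t n k h)^2"] by (rule mult_right_mono[OF d4[OF that]]) simp
  qed
  have "(%h. (dX i s t n k h)^2) \<in> borel_measurable (F (grid s t n (Suc k)))" by (intro borel_measurable_power dX_adapted a)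
  then show "expectation (%h. (dX i s t n k h)^2 * ?R k h) <= expectation (%h. (dX i s t n k h)^2 * ?W h)"
   using quadratic_variation_remainder[OF a n, of "Suc k" "%h. (dX i s t n k h)^2" "4 * K^2"] d4 k
   unfolding dX_def by simp
 qed simp
 also have "\<dots> = expectation (%h. (\<Sum>k<n. 4 * K^2 * (dX i s t n k h)^2) + 2 * (\<Sum>k<n. (dX i s t n k h)^2 * ?W h))"
  using i3 i4 by (simp only: Bochner_Integration.integral_add Bochner_Integration.integrable_sum integrable_mult_right integral_mult_right_zero Bochner_Integration.integral_sum)
 \<comment> \<open>Half of the squared quadratic variation is absorbed by the left-hand side, which
   is finite because the increments are bounded.\<close>
 also have "\<dots> <= expectation (%h. (1/2) * (?Q h)^2 + (1/2) * (6 * K^2 + 4 * K * dV i s t h)^2)"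
 proof (rule integral_mono)
  show "integrable M (%h. (\<Sum>k<n. 4 * K^2 * (dX i s t n k h)^2) + 2 * (\<Sum>k<n. (dX i s t n k h)^2 * ?W h))"
   using i3 i4 by (intro Bochner_Integration.integrable_add Bochner_Integration.integrable_sum integrable_mult_right)
  show "integrable M (%h. (1/2) * (?Q h)^2 + (1/2) * (6 * K^2 + 4 * K * dV i s t h)^2)"
   by (intro Bochner_Integration.integrable_add integrable_mult_right iQ iV)
  fix h
  have "(\<Sum>k<n. 4 * K^2 * (dX i s t n k h)^2) + 2 * (\<Sum>k<n. (dX i s t n k h)^2 * ?W h) = ?Q h * (4 * K^2 + 2 * ?W h)"
   unfolding sum_distrib_left[symmetric] sum_distrib_right[symmetric] by (simp add: algebra_simps)
  also have "4 * K^2 + 2 * ?W h = 6 * K^2 + 4 * K * dV i s t h" by simp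
  also have "?Q h * (6 * K^2 + 4 * K * dV i s t h) <= (1/2) * (?Q h)^2 + (1/2) * (6 * K^2 + 4 * K * dV i s t h)^2"
   using sum_squares_bound[of "?Q h" "6 * K^2 + 4 * K * dV i s t h"] by linarith
  finally show "(\<Sum>k<n. 4 * K^2 * (dX i s t n k h)^2) + 2 * (\<Sum>k<n. (dX i s t n k h)^2 * ?W h)
    <= (1/2) * (?Q h)^2 + (1/2) * (6 * K^2 + 4 * K * dV i s t h)^2" .
 qed
 also have "\<dots> = (1/2) * expectation (%h. (?Q h)^2) + (1/2) * expectation (%h. (6 * K^2 + 4 * K * dV i s t h)^2)"
  using iQ iV by simp
 finally show "expectation (%h. (?Q h)^2) <= expectation (%h. (6 * K^2 + 4 * K * dV i s t h)^2)" by linarith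
qed

lemma X_continuous_Icc: "i \<in> J ==> 0 <= s ==> h \<in> space M ==> continuous_on {s..t} (%u. X i u h)"
 by (rule continuous_on_subset[OF X_continuous]) auto

text \<open>Pathwise by uniform continuity, then by dominated convergence, since increments are at
  most \<open>2 * K\<close>. \<open>Suc n\<close> keeps the set under \<open>Max\<close>
  nonempty.\<close>

lemma max_increment_tendsto:
 assumes a: "i \<in> J" "0 <= s" "s <= t"
 shows "(%n. expectation (%h. (Max ((%k. \<bar>dX i s t (Suc n) k h\<bar>) ` {..<Suc n}))^2)) \<longlonglongrightarrow> 0"
  and "integrable M (%h. (Max ((%k. \<bar>dX i s t (Suc n) k h\<bar>) ` {..<Suc n}))^2)"
  and "(%h. Max ((%k. \<bar>dX i s t (Suc n) k h\<bar>) ` {..<Suc n})) \<in> borel_measurable M"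
proof -
 let ?w = "%n h. Max ((%k. \<bar>dX i s t (Suc n) k h\<bar>) ` {..<Suc n})"
 show m: "?w n \<in> borel_measurable M" for n
  by (rule borel_measurable_Max) (auto intro!: borel_measurable_abs dX_measurable a)
 have in1: "?w n h \<in> (%k. \<bar>dX i s t (Suc n) k h\<bar>) ` {..<Suc n}" for n h
  by (rule Max_in) auto
 have b: "\<bar>?w n h\<bar> <= 2 * K" if "h \<in> space M" for n h
  using in1[of n h] dX_bounded[OF a that] by auto
 have b2: "(?w n h)^2 <= (2 * K)^2" if "h \<in> space M" for n h
  using power_mono[OF b[OF that, of n], of 2] by simp
 show "integrable M (%h. (?w n h)^2)"
 proof (rule integrable_bounded)
  show "(%h. (?w n h)^2) \<in> borel_measurable M" by (intro borel_measurable_power m)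
  show "\<bar>(?w n h)^2\<bar> <= (2 * K)^2" if "h \<in> space M" for h using b2[OF that] by simp
 qed
 have lim: "(%n. (?w n h)^2) \<longlonglongrightarrow> 0" if h: "h \<in> space M" for h
 proof -
  have "(%n. ?w n h) \<longlonglongrightarrow> 0"
  proof (rule LIMSEQ_I)
   fix e :: real assume e: "0 < e"
   have "\<forall>\<^sub>F n in sequentially. \<forall>k<n. \<forall>u\<in>{grid s t n k..grid s t n (Suc k)}. \<bar>X i u h - X i (grid s t n k) h\<bar> < e"
    by (rule grid_oscillation[OF a(3) X_continuous_Icc[OF a(1,2) h] e])
   then obtain no where no: "\<And>n k u. n \<ge> no ==> k < n ==> u \<in> {grid s t n k..grid s t n (Suc k)} ==> \<bar>X i u h - X i (grid s t n k) h\<bar> < e"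
    unfolding eventually_sequentially by blast
   show "\<exists>no. \<forall>n\<ge>no. norm (?w n h - 0) < e"
   proof (intro exI allI impI)
    fix n assume n: "n \<ge> no"
    obtain k where k: "k < Suc n" "?w n h = \<bar>dX i s t (Suc n) k h\<bar>" using in1[of n h] by blast
    have "\<bar>dX i s t (Suc n) k h\<bar> < e" unfolding dX_def
     using n k(1) grid_mono[OF a(3), of k "Suc k" "Suc n"] by (intro no) auto
    then show "norm (?w n h - 0) < e" unfolding k(2) by simp
   qed
  qed
  then show ?thesis using tendsto_power[of "%n. ?w n h" 0 sequentially 2] by simp
 qed
 have "(%n. expectation (%h. (?w n h)^2)) \<longlonglongrightarrow> expectation (%h. 0)"
 proof (rule integral_dominated_convergence[where w = "%_. (2 * K)^2"])
  show "(%h. (?w n h)^2) \<in> borel_measurable M" for n by (intro borel_measurable_power m)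
  show "AE h in M. (%n. (?w n h)^2) \<longlonglongrightarrow> 0" by (rule AE_I2[OF lim])
  show "AE h in M. norm ((?w n h)^2) <= (2 * K)^2" for n by (rule AE_I2) (use b2 in simp)
 qed simp_all
 then show "(%n. expectation (%h. (?w n h)^2)) \<longlonglongrightarrow> 0" by simp
qed

text \<open>The cubes sum to at most the largest increment times the quadratic variation. In the
  Cauchy-Schwarz inequality the first factor tends to 0 in \<open>L2\<close> while the second stays
  bounded there.\<close>

lemma cubic_variation_tendsto:
 assumes a: "i \<in> J" "0 <= s" "s <= t"
 shows "(%n. expectation (%h. \<Sum>k<n. \<bar>dX i s t n k h\<bar> ^ 3)) \<longlonglongrightarrow> 0"
  and "integrable M (%h. \<bar>dX i s t n k h\<bar> ^ 3)"
proof -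
 show i3: "integrable M (%h. \<bar>dX i s t n k h\<bar> ^ 3)" for n k
 proof (rule integrable_bounded)
  show "(%h. \<bar>dX i s t n k h\<bar> ^ 3) \<in> borel_measurable M" by (intro borel_measurable_power borel_measurable_abs dX_measurable a)
  show "\<bar>\<bar>dX i s t n k h\<bar> ^ 3\<bar> <= (2 * K) ^ 3" if "h \<in> space M" for h
   using power_mono[OF dX_bounded[OF a that, of n k], of 3] by simp
 qed
 let ?w = "%n h. Max ((%k. \<bar>dX i s t (Suc n) k h\<bar>) ` {..<Suc n})"
 let ?Q = "%n h. \<Sum>k<Suc n. (dX i s t (Suc n) k h)^2"
 define C where "C = expectation (%h. (6 * K^2 + 4 * K * dV i s t h)^2)"
 have Qm: "?Q n \<in> borel_measurable M" for n by (intro borel_measurable_sum borel_measurable_power dX_measurable a)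
 note Q2 = quadratic_variation_square_bounded[OF a zero_less_Suc]
 note w = max_increment_tendsto[OF a]
 have bound: "expectation (%h. \<Sum>k<Suc n. \<bar>dX i s t (Suc n) k h\<bar> ^ 3) <= sqrt (expectation (%h. (?w n h)^2)) * sqrt C" for n
 proof -
  have iwQ: "integrable M (%h. ?w n h * ?Q n h)"
   by (rule integrable_mult_of_squares[OF w(3) Qm w(2) Q2(1)])
  have "expectation (%h. \<Sum>k<Suc n. \<bar>dX i s t (Suc n) k h\<bar> ^ 3) <= expectation (%h. ?w n h * ?Q n h)"
  proof (rule integral_mono[OF Bochner_Integration.integrable_sum[OF i3] iwQ])
   fix h
   have "\<bar>dX i s t (Suc n) k h\<bar> ^ 3 <= ?w n h * (dX i s t (Suc n) k h)^2" if "k < Suc n" for k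
   proof -
    have "\<bar>dX i s t (Suc n) k h\<bar> ^ 3 = \<bar>dX i s t (Suc n) k h\<bar> * (dX i s t (Suc n) k h)^2"
     by (simp add: power3_eq_cube power2_eq_square mult.assoc)
    also have "\<dots> <= ?w n h * (dX i s t (Suc n) k h)^2"
     by (rule mult_right_mono[OF Max_ge]) (use that in auto)
    finally show ?thesis .
   qed
   then have "(\<Sum>k<Suc n. \<bar>dX i s t (Suc n) k h\<bar> ^ 3) <= (\<Sum>k<Suc n. ?w n h * (dX i s t (Suc n) k h)^2)"
    by (intro sum_mono) auto
   then show "(\<Sum>k<Suc n. \<bar>dX i s t (Suc n) k h\<bar> ^ 3) <= ?w n h * ?Q n h" unfolding sum_distrib_left .
  qed
  also have "\<dots> <= sqrt (expectation (%h. (?w n h)^2)) * sqrt (expectation (%h. (?Q n h)^2))"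
   using Cauchy_Schwarz_integral[OF w(3) Qm w(2) Q2(1), of n n] by (rule order_trans[OF abs_ge_self])
  also have "\<dots> <= sqrt (expectation (%h. (?w n h)^2)) * sqrt C"
   unfolding C_def by (intro mult_left_mono real_sqrt_le_mono Q2(2)) simp
  finally show ?thesis .
 qed
 have "(%n. sqrt (expectation (%h. (?w n h)^2)) * sqrt C) \<longlonglongrightarrow> sqrt 0 * sqrt C"
  by (intro tendsto_intros w(1))
 then have lim: "(%n. sqrt (expectation (%h. (?w n h)^2)) * sqrt C) \<longlonglongrightarrow> 0" by simp
 have "(%n. expectation (%h. \<Sum>k<Suc n. \<bar>dX i s t (Suc n) k h\<bar> ^ 3)) \<longlonglongrightarrow> 0"
 proof (rule tendsto_sandwich[OF _ _ tendsto_const lim])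
  show "\<forall>\<^sub>F n in sequentially. expectation (%h. \<Sum>k<Suc n. \<bar>dX i s t (Suc n) k h\<bar> ^ 3) <= sqrt (expectation (%h. (?w n h)^2)) * sqrt C"
   by (rule always_eventually) (use bound in blast)
  show "\<forall>\<^sub>F n in sequentially. 0 <= expectation (%h. \<Sum>k<Suc n. \<bar>dX i s t (Suc n) k h\<bar> ^ 3)"
   by (intro always_eventually allI Bochner_Integration.integral_nonneg sum_nonneg) simp
 qed
 then show "(%n. expectation (%h. \<Sum>k<n. \<bar>dX i s t n k h\<bar> ^ 3)) \<longlonglongrightarrow> 0"
  by (rule LIMSEQ_imp_Suc)
qed

lemma mesh_error_tendsto:
 assumes a: "i \<in> J" "0 <= s" "s <= t"
 shows "(%n. expectation (mesh_error i s t n)) \<longlonglongrightarrow> 0" and "integrable M (mesh_error i s t n)"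
proof -
 let ?V = "%n k. dV i (grid s t n k) (grid s t n (Suc k))"
 have Vm: "?V n k \<in> borel_measurable M" for n k by (rule dV_measurable[OF a(1)])
 have gk: "0 <= grid s t n k" "grid s t n k <= grid s t n (Suc k)" for n k
  by (rule grid_nonneg[OF a(2,3)]) (rule grid_mono[OF a(3)], simp)
 have i1: "integrable M (%h. \<bar>dX i s t n k h\<bar> * ?V n k h)" for n k
  by (rule integrable_bounded_mult[OF dV_integrable[OF a(1) gk] borel_measurable_abs[OF dX_measurable[OF a]], where C = "2 * K"])
   (use dX_bounded[OF a] in simp)
 have i2: "integrable M (%h. (?V n k h)^2)" for n k by (rule dV_square[OF a(1) gk])
 note i3 = cubic_variation_tendsto(2)[OF a]
 show "integrable M (mesh_error i s t n)" for n
  unfolding mesh_error_def[abs_def] by (intro Bochner_Integration.integrable_sum Bochner_Integration.integrable_add i1 i2 i3)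
 have l1: "(%n. expectation (%h. \<Sum>k<n. \<bar>dX i s t n k h\<bar> * ?V n k h)) \<longlonglongrightarrow> expectation (%h. 0)"
 proof (rule integral_dominated_convergence[where w = "%h. 2 * K * dV i s t h"])
  show "integrable M (%h. 2 * K * dV i s t h)" using dV_integrable[OF a] by simp
  show "(%h. \<Sum>k<n. \<bar>dX i s t n k h\<bar> * ?V n k h) \<in> borel_measurable M" for n
   by (intro borel_measurable_sum borel_measurable_times borel_measurable_abs dX_measurable a Vm)
  show "AE h in M. (%n. \<Sum>k<n. \<bar>dX i s t n k h\<bar> * ?V n k h) \<longlonglongrightarrow> 0"
   using D_integrable'[OF a] AE_space
   by eventually_elim (unfold dX_def dV_def, rule grid_oscillation_sum_tendsto[OF a(3) X_continuous_Icc[OF a(1,2)]])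
  show "AE h in M. norm (\<Sum>k<n. \<bar>dX i s t n k h\<bar> * ?V n k h) <= 2 * K * dV i s t h" for n
  proof (cases "n = 0")
   case True then show ?thesis using K_nonneg dV_nonneg by simp
  next
   case False
   then have n: "0 < n" by simp
   show ?thesis using dV_grid_sum[OF a n] AE_space
   proof eventually_elim
    case (elim h)
    have "norm (\<Sum>k<n. \<bar>dX i s t n k h\<bar> * ?V n k h) <= (\<Sum>k<n. 2 * K * ?V n k h)"
    proof (rule order_trans[OF norm_sum sum_mono])
     fix k show "norm (\<bar>dX i s t n k h\<bar> * ?V n k h) <= 2 * K * ?V n k h"
      using mult_right_mono[OF dX_bounded[OF a elim(2), of n k] dV_nonneg[of i "grid s t n k" "grid s t n (Suc k)" h]] dV_nonneg
      by (simp add: abs_mult)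
    qed
    also have "\<dots> = 2 * K * dV i s t h" unfolding sum_distrib_left[symmetric] elim(1) ..
    finally show ?case .
   qed
  qed
 qed simp
 have l2: "(%n. expectation (%h. \<Sum>k<n. (?V n k h)^2)) \<longlonglongrightarrow> expectation (%h. 0)"
 proof (rule integral_dominated_convergence[where w = "%h. (dV i s t h)^2"])
  show "integrable M (%h. (dV i s t h)^2)" by (rule dV_square[OF a])
  show "(%h. \<Sum>k<n. (?V n k h)^2) \<in> borel_measurable M" for n
   by (intro borel_measurable_sum borel_measurable_power Vm)
  show "AE h in M. (%n. \<Sum>k<n. (?V n k h)^2) \<longlonglongrightarrow> 0"
   using D_integrable'[OF a] by eventually_elim (unfold dV_def, rule grid_primitive_square_tendsto[OF a(3)])
  show "AE h in M. norm (\<Sum>k<n. (?V n k h)^2) <= (dV i s t h)^2" for n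
  proof (cases "n = 0")
   case False
   then have n: "0 < n" by simp
   show ?thesis using dV_grid_sum[OF a n]
   proof eventually_elim
    case (elim h)
    have "(\<Sum>k<n. (?V n k h)^2) <= (\<Sum>k<n. ?V n k h)^2"
     unfolding power2_sum_split by (simp add: sum_nonneg dV_nonneg)
    then show ?case unfolding elim by (simp add: sum_nonneg)
   qed
  qed simp
 qed simp
 have "expectation (mesh_error i s t n) = expectation (%h. \<Sum>k<n. \<bar>dX i s t n k h\<bar> * ?V n k h) + expectation (%h. \<Sum>k<n. (?V n k h)^2)
   + expectation (%h. \<Sum>k<n. \<bar>dX i s t n k h\<bar> ^ 3)" for n
  unfolding mesh_error_def[abs_def] sum.distrib using i1 i2 i3
  by (simp only: Bochner_Integration.integral_add Bochner_Integration.integrable_sum Bochner_Integration.integrable_add)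
 then show "(%n. expectation (mesh_error i s t n)) \<longlonglongrightarrow> 0"
  using tendsto_add[OF tendsto_add[OF l1 l2] cubic_variation_tendsto(1)[OF a]] by simp
qed

lemma power_X_bounded: "i \<in> J ==> 0 <= t ==> h \<in> space M ==> \<bar>X i t h ^ m\<bar> <= K ^ m"
 unfolding power_abs by (rule power_mono[OF X_bounded]) auto

text \<open>Second order Taylor expansions are summed over a grid. The terms linear in
  \<open>dI\<close>, and \<open>dI^2\<close> minus its bracket, vanish against factors known at the
  left endpoint; the remaining Riemann sums \<open>Gn\<close> converge to the time integral, and
  everything else is dominated by \<open>mesh_error\<close>.\<close>

theorem Dynkin_power:
 assumes a: "i \<in> J" "0 <= s" "s <= t"
  and Z: "Z \<in> borel_measurable (F s)" "\<And>h. h \<in> space M ==> \<bar>Z h\<bar> <= C"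
 shows "expectation (%h. Z h * (X i t h ^ m - X i s h ^ m))
  = expectation (%h. Z h * (LINT u:{s<..t}|lborel. real m * X i u h ^ (m - 1) * D i u h
    + real m * (real m - 1) / 2 * X i u h ^ (m - 2) * Q i u h))"
  and "AE h in M. set_integrable lborel {s<..t} (%u. real m * X i u h ^ (m - 1) * D i u h
    + real m * (real m - 1) / 2 * X i u h ^ (m - 2) * Q i u h)"
proof -
 let ?g = "grid s t"
 define c2 where "c2 = real m * (real m - 1) / 2"
 have c20: "0 <= c2" unfolding c2_def by (cases m) auto
 define G where "G h = (LINT u:{s<..t}|lborel. real m * X i u h ^ (m - 1) * D i u h + c2 * X i u h ^ (m - 2) * Q i u h)" for h
 define p where "p n k h = real m * X i (?g n k) h ^ (m - 1)" for n k h
 define q where "q n k h = c2 * X i (?g n k) h ^ (m - 2)" for n k h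
 define A where "A n k = dA i (?g n k) (?g n (Suc k))" for n k
 define I where "I n k = dI i (?g n k) (?g n (Suc k))" for n k
 define V where "V n k = dV i (?g n k) (?g n (Suc k))" for n k
 define R where "R n k = dQ i (?g n k) (?g n (Suc k))" for n k
 have gk: "0 <= ?g n k" "?g n k <= ?g n (Suc k)" for n k
  by (rule grid_nonneg[OF a(2,3)]) (rule grid_mono[OF a(3)], simp)
 have ZM: "Z \<in> borel_measurable M" by (rule F_measurable[OF a(2) Z(1)])
 have Zg: "Z \<in> borel_measurable (F (?g n k))" for n k by (rule F_mono[OF a(2) grid_ge[OF a(3)] Z(1)])
 have pF: "(%h. Z h * p n k h) \<in> borel_measurable (F (?g n k))" and qF: "(%h. Z h * q n k h) \<in> borel_measurable (F (?g n k))" for n k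
  unfolding p_def q_def by (intro borel_measurable_times borel_measurable_power borel_measurable_const Zg X_adapted a(1) gk)+
 have pb: "\<bar>p n k h\<bar> <= real m * K ^ (m - 1)" and qb: "\<bar>q n k h\<bar> <= c2 * K ^ (m - 2)" if "h \<in> space M" for n k h
  unfolding p_def q_def abs_mult using power_X_bounded[OF a(1) gk(1) that] c20 by (simp_all add: mult_left_mono)
 have pm: "p n k \<in> borel_measurable M" and qm: "q n k \<in> borel_measurable M" for n k
  unfolding p_def[abs_def] q_def[abs_def] by (intro borel_measurable_times borel_measurable_power borel_measurable_const X_measurable a(1) gk)+
 have Zpb: "\<bar>Z h * p n k h\<bar> <= C * (real m * K ^ (m - 1))" and Zqb: "\<bar>Z h * q n k h\<bar> <= C * (c2 * K ^ (m - 2))" if "h \<in> space M" for n k h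
  using Z(2)[OF that] pb[OF that, of n k] qb[OF that, of n k] unfolding abs_mult by (intro mult_mono; force)+
 define Gn where "Gn n h = (\<Sum>k<n. p n k h * A n k h) + (\<Sum>k<n. q n k h * R n k h)" for n h
 have Gnm: "Gn n \<in> borel_measurable M" for n
  unfolding Gn_def[abs_def] A_def R_def
  by (intro borel_measurable_add borel_measurable_sum borel_measurable_times pm qm dA_measurable dQ_measurable a(1))
 have cX: "continuous_on {s..t} (%u. r * X i u h ^ l)" if "h \<in> space M" for r l h
  by (intro continuous_intros X_continuous_Icc[OF a(1,2) that])
 have si: "AE h in M. set_integrable lborel {s<..t} (%u. real m * X i u h ^ (m - 1) * D i u h)
   \<and> set_integrable lborel {s<..t} (%u. c2 * X i u h ^ (m - 2) * Q i u h)"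
  using D_integrable'[OF a] AE_space
  by eventually_elim (intro conjI set_integrable_mult_continuous[OF cX] Q_integrable[OF a(1,3)])
 then show "AE h in M. set_integrable lborel {s<..t} (%u. real m * X i u h ^ (m - 1) * D i u h
    + real m * (real m - 1) / 2 * X i u h ^ (m - 2) * Q i u h)"
  unfolding c2_def by eventually_elim (intro set_integral_add(1); blast)
 have limG: "AE h in M. (%n. Gn n h) \<longlonglongrightarrow> G h"
  using D_integrable'[OF a] AE_space si
 proof eventually_elim
  case (elim h)
  have "(%n. \<Sum>k<n. p n k h * A n k h) \<longlonglongrightarrow> (LINT u:{s<..t}|lborel. real m * X i u h ^ (m - 1) * D i u h)"
   unfolding p_def A_def dA_def by (rule grid_sum_tendsto[OF a(3) cX[OF elim(2)] elim(1)])
  moreover have "(%n. \<Sum>k<n. q n k h * R n k h) \<longlonglongrightarrow> (LINT u:{s<..t}|lborel. c2 * X i u h ^ (m - 2) * Q i u h)"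
   unfolding q_def R_def dQ_def by (rule grid_sum_tendsto[OF a(3) cX[OF elim(2)] Q_integrable[OF a(1,3) elim(2)]])
  moreover have "G h = (LINT u:{s<..t}|lborel. real m * X i u h ^ (m - 1) * D i u h) + (LINT u:{s<..t}|lborel. c2 * X i u h ^ (m - 2) * Q i u h)"
   unfolding G_def by (rule set_integral_add(2)) (use elim(3) in blast)+
  ultimately show ?case unfolding Gn_def by (simp add: tendsto_add)
 qed
 \<comment> \<open>An integrable bound for all \<open>Gn\<close> at once: coefficient bounds times
   the total masses of drift and bracket.\<close>
 define W where "W h = real m * K ^ (m - 1) * dV i s t h + c2 * K ^ (m - 2) * (KQ * (t - s))" for h
 have iW: "integrable M W" unfolding W_def[abs_def] using dV_integrable[OF a] by simp
 have W0: "0 <= W h" for h unfolding W_def using K_nonneg KQ_nonneg c20 dV_nonneg a by simp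
 have GnW: "AE h in M. \<bar>Gn n h\<bar> <= W h" for n
 proof (cases "n = 0")
  case True then show ?thesis using W0 by (simp add: Gn_def)
 next
  case False
  then have n: "0 < n" by simp
  show ?thesis using dV_grid_sum[OF a n] AE_space
  proof eventually_elim
   case (elim h)
   have "\<bar>\<Sum>k<n. p n k h * A n k h\<bar> <= (\<Sum>k<n. real m * K ^ (m - 1) * V n k h)"
   proof (rule order_trans[OF sum_abs sum_mono])
    fix k show "\<bar>p n k h * A n k h\<bar> <= real m * K ^ (m - 1) * V n k h"
     unfolding abs_mult A_def V_def using pb[OF elim(2)] K_nonneg by (intro mult_mono dA_le_dV) auto
   qed
   moreover have "(\<Sum>k<n. real m * K ^ (m - 1) * V n k h) = real m * K ^ (m - 1) * dV i s t h"
    unfolding sum_distrib_left[symmetric] V_def elim(1) ..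
   moreover have "\<bar>\<Sum>k<n. q n k h * R n k h\<bar> <= (\<Sum>k<n. c2 * K ^ (m - 2) * (KQ * ((t - s) / real n)))"
   proof (rule order_trans[OF sum_abs sum_mono])
    fix k
    have "\<bar>R n k h\<bar> <= KQ * ((t - s) / real n)"
     using dQ_le[OF a(1) gk(2) elim(2), of n k] by (simp add: R_def grid_Suc_diff)
    then show "\<bar>q n k h * R n k h\<bar> <= c2 * K ^ (m - 2) * (KQ * ((t - s) / real n))"
     unfolding abs_mult using qb[OF elim(2)] K_nonneg c20 by (intro mult_mono) auto
   qed
   moreover have "(\<Sum>k<n. c2 * K ^ (m - 2) * (KQ * ((t - s) / real n))) = c2 * K ^ (m - 2) * (KQ * (t - s))"
    using n by simp
   ultimately show ?case unfolding Gn_def W_def by linarith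
  qed
 qed
 have iGn: "integrable M (Gn n)" for n
  by (rule Bochner_Integration.integrable_bound[OF iW Gnm]) (use GnW[of n] W0 in auto)
 have iZGn: "integrable M (%h. Z h * Gn n h)" for n by (rule integrable_bounded_mult[OF iGn ZM Z(2)])
 have limE: "(%n. expectation (%h. Z h * Gn n h)) \<longlonglongrightarrow> expectation (%h. Z h * G h)"
 proof (rule integral_dominated_convergence[where w = "%h. C * W h"])
  show "(%h. Z h * Gn n h) \<in> borel_measurable M" for n by (rule borel_measurable_times[OF ZM Gnm])
  have "G \<in> borel_measurable M" unfolding G_def[abs_def] by (rule drift_measurable[OF a(1,2)])
  then show "(%h. Z h * G h) \<in> borel_measurable M" by (rule borel_measurable_times[OF ZM])
  show "integrable M (%h. C * W h)" using iW by simp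
  show "AE h in M. (%n. Z h * Gn n h) \<longlonglongrightarrow> Z h * G h"
   using limG by eventually_elim (intro tendsto_intros)
  show "AE h in M. norm (Z h * Gn n h) <= C * W h" for n
   using GnW[of n] AE_space
  proof eventually_elim
   case (elim h)
   have "\<bar>Z h\<bar> * \<bar>Gn n h\<bar> <= C * W h"
    using Z(2)[OF elim(2)] elim(1) by (intro mult_mono) auto
   then show ?case by (simp add: abs_mult)
  qed
 qed
 obtain C3 where C3: "0 <= C3" "\<And>x y. \<bar>x\<bar> <= K ==> \<bar>y\<bar> <= K ==>
   \<bar>y ^ m - x ^ m - real m * x ^ (m - 1) * (y - x) - real m * (real m - 1) / 2 * x ^ (m - 2) * (y - x)^2\<bar> <= C3 * \<bar>y - x\<bar> ^ 3"
  using power_taylor2[OF K_nonneg, of m] by blast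
 \<comment> \<open>\<open>2 * (c2 * K ^ (m - 2))\<close> pays for replacing the square of
   \<open>dX\<close> by the square of \<open>dI\<close>, \<open>C3\<close> is the Taylor constant,
   and \<open>C\<close> bounds \<open>Z\<close>.\<close>
 define B where "B = C * (2 * (c2 * K ^ (m - 2)) + C3)"
 let ?L = "%h. Z h * (X i t h ^ m - X i s h ^ m)"
 have iL: "integrable M ?L"
 proof (rule integrable_bounded_mult[OF _ ZM Z(2)])
  show "integrable M (%h. X i t h ^ m - X i s h ^ m)"
   using a by (intro Bochner_Integration.integrable_diff integrable_bounded[OF borel_measurable_power[OF X_measurable] power_X_bounded]) auto
 qed
 have claim: "\<bar>expectation ?L - expectation (%h. Z h * Gn n h)\<bar> <= B * expectation (mesh_error i s t n)" if n: "0 < n" for n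
 proof -
  \<comment> \<open>\<open>P\<close> is the part of the cell with expectation 0,
    \<open>\<rho>\<close> its remainder.\<close>
  define P where "P k h = (Z h * p n k h) * I n k h + ((Z h * q n k h) * (I n k h * I n k h) - (Z h * q n k h) * R n k h)" for k h
  define \<rho> where "\<rho> k h = Z h * (X i (?g n (Suc k)) h ^ m - X i (?g n k) h ^ m) - Z h * (p n k h * A n k h + q n k h * R n k h) - P k h" for k h
  have P: "integrable M (P k) \<and> expectation (P k) = 0" for k
  proof -
   note z = dI_zero[OF a(1) gk pF Zpb, of n k] and b = dI_mult[OF a(1) a(1) gk qF Zqb, of n k]
   have iR: "integrable M (%h. (Z h * q n k h) * R n k h)"
   proof (rule integrable_bounded_mult[OF _ borel_measurable_times[OF ZM qm] Zqb])
    show "integrable M (R n k)" unfolding R_def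
     by (rule integrable_bounded[OF dQ_measurable[OF a(1)] dQ_le[OF a(1) gk(2)]])
   qed
   show ?thesis unfolding P_def[abs_def] I_def R_def using z b iR[unfolded R_def] by simp
  qed
  have sum\<rho>: "?L h - Z h * Gn n h = (\<Sum>k<n. P k h) + (\<Sum>k<n. \<rho> k h)" for h
  proof -
   have tel: "X i t h ^ m - X i s h ^ m = (\<Sum>k<n. X i (?g n (Suc k)) h ^ m - X i (?g n k) h ^ m)"
    using sum_lessThan_telescope[of "%k. X i (?g n k) h ^ m" n] n by simp
   have "?L h - Z h * Gn n h = (\<Sum>k<n. Z h * (X i (?g n (Suc k)) h ^ m - X i (?g n k) h ^ m)) - (\<Sum>k<n. Z h * (p n k h * A n k h + q n k h * R n k h))"
    by (simp only: tel Gn_def sum_distrib_left[symmetric] sum.distrib)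
   also have "\<dots> = (\<Sum>k<n. P k h + \<rho> k h)"
    unfolding sum_subtractf[symmetric] by (intro sum.cong refl) (simp add: \<rho>_def)
   finally show ?thesis by (simp only: sum.distrib)
  qed
  have isP: "integrable M (%h. \<Sum>k<n. P k h)" using P by (intro Bochner_Integration.integrable_sum) blast
  have "integrable M (%h. ?L h - Z h * Gn n h - (\<Sum>k<n. P k h))"
   by (intro Bochner_Integration.integrable_diff iL iZGn isP)
  then have is\<rho>: "integrable M (%h. \<Sum>k<n. \<rho> k h)" unfolding sum\<rho> by simp
  have eP: "expectation (%h. \<Sum>k<n. P k h) = 0"
   using P by (subst Bochner_Integration.integral_sum) auto
  have "expectation ?L - expectation (%h. Z h * Gn n h) = expectation (%h. (\<Sum>k<n. P k h) + (\<Sum>k<n. \<rho> k h))"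
   unfolding sum\<rho>[symmetric] by (rule Bochner_Integration.integral_diff[OF iL iZGn, symmetric])
  then have e: "expectation ?L - expectation (%h. Z h * Gn n h) = expectation (%h. \<Sum>k<n. \<rho> k h)"
   using isP is\<rho> eP by simp
  have "\<bar>expectation (%h. \<Sum>k<n. \<rho> k h)\<bar> <= expectation (%h. B * mesh_error i s t n h)"
  proof (rule order_trans[OF integral_abs_bound integral_mono])
   show "integrable M (%h. \<bar>\<Sum>k<n. \<rho> k h\<bar>)" using is\<rho> by (rule integrable_abs)
   show "integrable M (%h. B * mesh_error i s t n h)" using mesh_error_tendsto(2)[OF a] by simp
   fix h assume h: "h \<in> space M"
   have C0: "0 <= C" using Z(2)[OF h] by linarith
   have "\<bar>\<rho> k h\<bar> <= B * (\<bar>dX i s t n k h\<bar> * V n k h + (V n k h)^2 + \<bar>dX i s t n k h\<bar> ^ 3)" for k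
   proof -
    define x y where "x = X i (?g n k) h" and "y = X i (?g n (Suc k)) h"
    define r where "r = y ^ m - x ^ m - real m * x ^ (m - 1) * (y - x) - c2 * x ^ (m - 2) * (y - x)^2"
    have r: "\<bar>r\<bar> <= C3 * \<bar>y - x\<bar> ^ 3"
     unfolding r_def c2_def by (rule C3(2)) (auto simp: x_def y_def intro!: X_bounded a gk h)
    have yx: "y - x = I n k h + A n k h" by (simp add: x_def y_def I_def A_def dI_def)
    have dXe: "dX i s t n k h = y - x" by (simp add: dX_def x_def y_def)
    have "\<rho> k h = Z h * (q n k h * (2 * (y - x) * A n k h - (A n k h)^2) + r)"
    proof -
     have I: "I n k h = y - x - A n k h" using yx by simp
     have pq: "p n k h = real m * x ^ (m - 1)" "q n k h = c2 * x ^ (m - 2)" by (simp_all add: p_def q_def x_def)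
     have "r = y ^ m - x ^ m - p n k h * (y - x) - q n k h * (y - x)^2" unfolding r_def pq ..
     then show ?thesis unfolding \<rho>_def P_def I x_def[symmetric] y_def[symmetric]
      by (simp only:) (simp add: algebra_simps power2_eq_square)
    qed
    moreover have "\<bar>q n k h * (2 * (y - x) * A n k h - (A n k h)^2)\<bar> <= (c2 * K ^ (m - 2)) * (2 * (\<bar>y - x\<bar> * V n k h) + (V n k h)^2)"
     unfolding abs_mult[of "q n k h"]
    proof (rule mult_mono[OF qb[OF h]])
     have AV: "\<bar>A n k h\<bar> <= V n k h" unfolding A_def V_def by (rule dA_le_dV)
     define z where "z = (y - x) * A n k h"
     have e: "2 * (y - x) * A n k h = 2 * z" unfolding z_def by (rule mult.assoc)
     have "\<bar>z\<bar> <= \<bar>y - x\<bar> * V n k h" unfolding z_def abs_mult by (rule mult_left_mono[OF AV]) simp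
     moreover have "(A n k h)^2 <= (V n k h)^2" using power_mono[OF AV, of 2] by simp
     moreover have "0 <= (A n k h)^2" by simp
     ultimately show "\<bar>2 * (y - x) * A n k h - (A n k h)^2\<bar> <= 2 * (\<bar>y - x\<bar> * V n k h) + (V n k h)^2"
      unfolding e by linarith
    qed (use c20 K_nonneg in auto)
    ultimately have "\<bar>\<rho> k h\<bar> <= C * ((c2 * K ^ (m - 2)) * (2 * (\<bar>y - x\<bar> * V n k h) + (V n k h)^2) + C3 * \<bar>y - x\<bar> ^ 3)"
     using r by (simp only: abs_mult[of "Z h"]) (intro mult_mono Z(2)[OF h] C0 abs_ge_zero order_trans[OF abs_triangle_ineq] add_mono)
    also have "\<dots> <= B * (\<bar>y - x\<bar> * V n k h + (V n k h)^2 + \<bar>y - x\<bar> ^ 3)"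
    proof -
     define u where "u = c2 * K ^ (m - 2)"
     have u0: "0 <= u" unfolding u_def using c20 K_nonneg by simp
     have V0: "0 <= V n k h" unfolding V_def by (rule dV_nonneg)
     have t: "0 <= \<bar>y - x\<bar> * V n k h" "0 <= (V n k h)^2" "0 <= \<bar>y - x\<bar> ^ 3" using V0 by auto
     have "u * (2 * (\<bar>y - x\<bar> * V n k h) + (V n k h)^2) + C3 * \<bar>y - x\<bar> ^ 3 <= (2 * u + C3) * (\<bar>y - x\<bar> * V n k h + (V n k h)^2 + \<bar>y - x\<bar> ^ 3)"
      using mult_nonneg_nonneg[OF u0 t(2)] mult_nonneg_nonneg[OF u0 t(3)] mult_nonneg_nonneg[OF C3(1) t(1)] mult_nonneg_nonneg[OF C3(1) t(2)]
      by (simp add: algebra_simps)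
     then show ?thesis unfolding B_def u_def[symmetric] mult.assoc[of C] by (rule mult_left_mono[OF _ C0])
    qed
    finally show ?thesis unfolding dXe .
   qed
   then have "(\<Sum>k<n. \<bar>\<rho> k h\<bar>) <= (\<Sum>k<n. B * (\<bar>dX i s t n k h\<bar> * V n k h + (V n k h)^2 + \<bar>dX i s t n k h\<bar> ^ 3))"
    by (intro sum_mono)
   also have "\<dots> = B * mesh_error i s t n h" unfolding mesh_error_def V_def sum_distrib_left ..
   finally show "\<bar>\<Sum>k<n. \<rho> k h\<bar> <= B * mesh_error i s t n h" by (rule order_trans[OF sum_abs])
  qed
  then show ?thesis unfolding e by simp
 qed
 have "(%n. expectation ?L - expectation (%h. Z h * Gn n h)) \<longlonglongrightarrow> 0"
 proof (rule Lim_null_comparison)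
  show "\<forall>\<^sub>F n in sequentially. norm (expectation ?L - expectation (%h. Z h * Gn n h)) <= B * expectation (mesh_error i s t n)"
   using eventually_gt_at_top[of 0] by eventually_elim (use claim in simp)
  show "(%n. B * expectation (mesh_error i s t n)) \<longlonglongrightarrow> 0"
   by (rule tendsto_mult_right_zero[OF mesh_error_tendsto(1)[OF a]])
 qed
 moreover have "(%n. expectation ?L - expectation (%h. Z h * Gn n h)) \<longlonglongrightarrow> expectation ?L - expectation (%h. Z h * G h)"
  by (intro tendsto_intros limE)
 ultimately have "expectation ?L - expectation (%h. Z h * G h) = 0" by (rule LIMSEQ_unique[symmetric])
 then show "expectation ?L = expectation (%h. Z h * (LINT u:{s<..t}|lborel. real m * X i u h ^ (m - 1) * D i u h
    + real m * (real m - 1) / 2 * X i u h ^ (m - 2) * Q i u h))"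
  unfolding G_def c2_def by simp
qed

end

section \<open>Compensated power sums and their maximal inequality\<close>

lemma grid_cell:
 assumes st: "s <= t" and n: "0 < n" and u: "u \<in> {s..t}"
 obtains k where "k < n" "u \<in> {grid s t n k..grid s t n (Suc k)}"
proof -
 define k where "k = (LEAST k. u <= grid s t n (Suc k))"
 have ex: "u <= grid s t n (Suc (n - 1))" using u n by simp
 have k1: "u <= grid s t n (Suc k)" unfolding k_def by (rule LeastI[of _ "n - 1"]) (rule ex)
 have kn: "k <= n - 1" unfolding k_def by (rule Least_le) (rule ex)
 have "grid s t n k <= u"
 proof (cases k)
  case 0 then show ?thesis using u by simp
 next
  case (Suc l)
  then have "\<not> u <= grid s t n (Suc l)" unfolding k_def by (intro not_less_Least) simp
  then show ?thesis using Suc by simp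
 qed
 then show ?thesis using that[of k] k1 kn n by simp
qed

lemma set_integral_sum:
 fixes f :: "'i => 'a => real"
 assumes "\<And>i. i \<in> I ==> set_integrable M A (f i)"
 shows "set_integrable M A (%x. \<Sum>i\<in>I. f i x)" "(LINT x:A|M. (\<Sum>i\<in>I. f i x)) = (\<Sum>i\<in>I. LINT x:A|M. f i x)"
 using assms unfolding set_integrable_def set_lebesgue_integral_def scaleR_sum_right
 by (auto intro!: Bochner_Integration.integrable_sum Bochner_Integration.integral_sum)

text \<open>In the intended power sums the singular drifts cancel after summation over the
  particles. The total drift is therefore represented by a continuous bounded process
  \<open>b\<close>, which agrees with the singular sum outside null sets of outcomes and
  times.\<close>

locale power_functional = ito_system +
 fixes w :: real and m :: nat and b :: "real => 'a => real" and Cb :: real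
 assumes b_continuous: "h \<in> space M ==> continuous_on {0..} (%u. b u h)"
  and b_adapted: "0 <= u ==> b u \<in> borel_measurable (F u)"
  and b_bounded: "0 <= u ==> h \<in> space M ==> \<bar>b u h\<bar> <= Cb"
  and Cb_nonneg: "0 <= Cb"
  and drift_eq: "AE h in M. AE u in lborel. 0 < u \<longrightarrow>
   b u h = (\<Sum>i\<in>J. w * (real m * X i u h ^ (m - 1) * D i u h + real m * (real m - 1) / 2 * X i u h ^ (m - 2) * Q i u h))"
begin

definition psum :: "real => 'a => real" where
 "psum t h = (\<Sum>i\<in>J. w * X i t h ^ m)"
definition dB :: "real => real => 'a => real" where
 "dB s t h = (LINT u:{s<..t}|lborel. b u h)"
definition mart :: "real => 'a => real" where
 "mart t h = psum t h - psum 0 h - dB 0 t h"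

lemma b_integrable: "0 <= s ==> h \<in> space M ==> set_integrable lborel {s<..t} (%u. b u h)"
 using set_integrable_mult_continuous[OF continuous_on_subset[OF b_continuous] set_integrable_const_Ioc, of h s t 1] by simp

lemma dB_bounded: "0 <= s ==> s <= t ==> h \<in> space M ==> \<bar>dB s t h\<bar> <= Cb * (t - s)"
proof -
 assume a: "0 <= s" "s <= t" "h \<in> space M"
 have "\<bar>dB s t h\<bar> <= (LINT u:{s<..t}|lborel. Cb)"
  unfolding dB_def by (rule abs_set_integral_le[OF b_integrable[OF a(1,3)] set_integrable_const_Ioc]) (use b_bounded[OF _ a(3)] a in auto)
 also have "\<dots> = Cb * (t - s)" using a by (simp add: set_lebesgue_integral_def mult.commute)
 finally show ?thesis .
qed

lemma dB_add: "0 <= s ==> s <= t ==> h \<in> space M ==> dB 0 t h = dB 0 s h + dB s t h"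
 unfolding dB_def by (rule set_integral_Ioc_add[OF _ _ b_integrable]) auto

lemma mart_diff: "0 <= s ==> s <= t ==> h \<in> space M ==> mart t h - mart s h = psum t h - psum s h - dB s t h"
 unfolding mart_def using dB_add[of s t h] by simp

lemma mart_0: "mart 0 h = 0"
 by (simp add: mart_def dB_def set_lebesgue_integral_def)

lemma psum_adapted: "0 <= s ==> s <= t ==> psum s \<in> borel_measurable (F t)"
 unfolding psum_def[abs_def] by (intro borel_measurable_sum borel_measurable_times borel_measurable_power borel_measurable_const X_adapted')

text \<open>Measurability with respect to \<open>F t\<close>, not just \<open>M\<close>, makes the
  compensated sum adapted. It comes from Riemann sums for \<open>b\<close> whose nodes are all at
  most \<open>t\<close>.\<close>

lemma dB_adapted:
 assumes t: "0 <= t" shows "dB 0 t \<in> borel_measurable (F t)"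
proof (rule borel_measurable_LIMSEQ_real)
 let ?S = "%n h. \<Sum>k<n. b (grid 0 t n k) h * (LINT u:{grid 0 t n k<..grid 0 t n (Suc k)}|lborel. 1)"
 show "?S n \<in> borel_measurable (F t)" for n
 proof (intro borel_measurable_sum borel_measurable_times borel_measurable_const)
  fix k assume "k \<in> {..<n}"
  then show "b (grid 0 t n k) \<in> borel_measurable (F t)"
   using grid_le[OF t, of k n] by (intro F_mono[OF _ _ b_adapted] grid_nonneg t) auto
 qed
 fix h assume "h \<in> space (F t)"
 then have h: "h \<in> space M" using subalg[OF t] by (simp add: subalgebra_def)
 show "(%n. ?S n h) \<longlonglongrightarrow> dB 0 t h"
  using grid_sum_tendsto[OF t continuous_on_subset[OF b_continuous[OF h]] set_integrable_const_Ioc, of 1]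
  by (simp add: dB_def)
qed

lemma mart_adapted: "0 <= t ==> mart t \<in> borel_measurable (F t)"
 unfolding mart_def[abs_def] by (intro borel_measurable_diff psum_adapted dB_adapted) auto

lemma psum_bounded: "0 <= t ==> h \<in> space M ==> \<bar>psum t h\<bar> <= real (card J) * (\<bar>w\<bar> * K ^ m)"
proof -
 assume a: "0 <= t" "h \<in> space M"
 have "\<bar>psum t h\<bar> <= (\<Sum>i\<in>J. \<bar>w\<bar> * K ^ m)"
  unfolding psum_def
 proof (rule order_trans[OF sum_abs sum_mono])
  fix i assume "i \<in> J"
  then show "\<bar>w * X i t h ^ m\<bar> <= \<bar>w\<bar> * K ^ m" unfolding abs_mult by (intro mult_left_mono power_X_bounded a) auto
 qed
 then show ?thesis by simp
qed

lemma mart_bounded: "0 <= t ==> h \<in> space M ==> \<bar>mart t h\<bar> <= 2 * (real (card J) * (\<bar>w\<bar> * K ^ m)) + Cb * t"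
proof -
 assume a: "0 <= t" "h \<in> space M"
 have "\<bar>dB 0 t h\<bar> <= Cb * t" using dB_bounded[OF order_refl a] by simp
 then show ?thesis unfolding mart_def using psum_bounded[OF a] psum_bounded[OF order_refl a(2)] by linarith
qed

lemma mart_continuous: "h \<in> space M ==> continuous_on {0..T} (%t. mart t h)"
 unfolding mart_def[abs_def] psum_def dB_def
 by (intro continuous_on_diff continuous_on_sum continuous_on_mult continuous_on_power continuous_on_const
   continuous_on_primitive_Ioc b_integrable X_continuous_Icc) auto

lemma mart_measurable: "0 <= t ==> mart t \<in> borel_measurable M"
 by (rule F_measurable[OF _ mart_adapted])

text \<open>The sum of \<open>Dynkin_power\<close> over \<open>J\<close>, with the summed integrands
  replaced by \<open>b\<close> through \<open>drift_eq\<close>.\<close>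

theorem mart_increment_zero:
 assumes a: "0 <= s" "s <= t" and Z: "Z \<in> borel_measurable (F s)" "\<And>y. y \<in> space M ==> \<bar>Z y\<bar> <= C"
 shows "expectation (%y. Z y * (mart t y - mart s y)) = 0"
proof -
 let ?h = "%i u y. real m * X i u y ^ (m - 1) * D i u y + real m * (real m - 1) / 2 * X i u y ^ (m - 2) * Q i u y"
 let ?G = "%i y. LINT u:{s<..t}|lborel. ?h i u y"
 let ?d = "%i y. X i t y ^ m - X i s y ^ m"
 have ZM: "Z \<in> borel_measurable M" by (rule F_measurable[OF a(1) Z(1)])
 have t0: "0 <= t" using a by simp
 have int_all: "AE y in M. \<forall>i\<in>J. set_integrable lborel {s<..t} (%u. ?h i u y)"
  by (rule AE_finite_allI[OF finite_J]) (rule Dynkin_power(2)[OF _ a Z])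
 have eqB: "AE y in M. dB s t y = (\<Sum>i\<in>J. w * ?G i y)"
  using drift_eq int_all AE_space
 proof eventually_elim
  case (elim y)
  have "dB s t y = (LINT u:{s<..t}|lborel. (\<Sum>i\<in>J. w * ?h i u y))"
   unfolding dB_def set_lebesgue_integral_def
  proof (rule integral_cong_AE)
   show "AE u in lborel. indicator {s<..t} u *\<^sub>R b u y = indicator {s<..t} u *\<^sub>R (\<Sum>i\<in>J. w * ?h i u y)"
    using elim(1) by eventually_elim (use a in \<open>auto simp: indicator_def\<close>)
   show "(%u. indicator {s<..t} u *\<^sub>R (\<Sum>i\<in>J. w * ?h i u y)) \<in> borel_measurable lborel"
   proof -
    have "set_integrable lborel {s<..t} (%u. \<Sum>i\<in>J. w * ?h i u y)"
     using elim(2) by (intro set_integral_sum(1) set_integrable_mult_right) blast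
    then show ?thesis unfolding set_integrable_def by (rule borel_measurable_integrable)
   qed
   show "(%u. indicator {s<..t} u *\<^sub>R b u y) \<in> borel_measurable lborel"
    using b_integrable[OF a(1) elim(3)] unfolding set_integrable_def by (rule borel_measurable_integrable)
  qed
  also have "\<dots> = (\<Sum>i\<in>J. w * ?G i y)"
  proof -
   have "(LINT u:{s<..t}|lborel. (\<Sum>i\<in>J. w * ?h i u y)) = (\<Sum>i\<in>J. LINT u:{s<..t}|lborel. w * ?h i u y)"
    using elim(2) by (intro set_integral_sum(2) set_integrable_mult_right) blast
   then show ?thesis by simp
  qed
  finally show ?case .
 qed
 have dBm: "dB s t \<in> borel_measurable M"
 proof -
  have "(%y. dB 0 t y - dB 0 s y) \<in> borel_measurable M"
   by (intro borel_measurable_diff F_measurable[OF t0 dB_adapted[OF t0]] F_measurable[OF a(1) dB_adapted[OF a(1)]])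
  then show ?thesis by (subst measurable_cong[of M _ "%y. dB 0 t y - dB 0 s y"]) (use dB_add[OF a] in auto)
 qed
 have iB: "integrable M (%y. Z y * dB s t y)"
  by (rule integrable_bounded_mult[OF integrable_bounded[OF dBm dB_bounded[OF a]] ZM Z(2)])
 have id: "integrable M (%y. Z y * ?d i y)" if i: "i \<in> J" for i
  by (intro integrable_bounded_mult[OF _ ZM Z(2)] Bochner_Integration.integrable_diff integrable_bounded[OF borel_measurable_power[OF X_measurable] power_X_bounded] i a t0)
 have iZG: "integrable M (%y. Z y * ?G i y)" if i: "i \<in> J" for i
 proof (rule integrable_bounded_mult[OF _ ZM Z(2)])
  define W where "W y = real m * K ^ (m - 1) * dV i s t y + real m * (real m - 1) / 2 * K ^ (m - 2) * (KQ * (t - s))" for y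
  have c2: "0 <= real m * (real m - 1) / 2" by (cases m) auto
  have iW: "integrable M W" unfolding W_def[abs_def] using dV_integrable[OF i a] by simp
  show "integrable M (?G i)"
  proof (rule Bochner_Integration.integrable_bound[OF iW])
   show "?G i \<in> borel_measurable M" by (rule drift_measurable[OF i a(1)])
   show "AE y in M. norm (?G i y) <= norm (W y)"
    using int_all D_integrable'[OF i a] AE_space
   proof eventually_elim
    case (elim y)
    have "\<bar>?G i y\<bar> <= (LINT u:{s<..t}|lborel. real m * K ^ (m - 1) * \<bar>D i u y\<bar> + real m * (real m - 1) / 2 * K ^ (m - 2) * KQ)"
    proof (rule abs_set_integral_le)
     show "set_integrable lborel {s<..t} (%u. ?h i u y)" using elim(1) i by blast
     show "set_integrable lborel {s<..t} (%u. real m * K ^ (m - 1) * \<bar>D i u y\<bar> + real m * (real m - 1) / 2 * K ^ (m - 2) * KQ)"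
      by (intro set_integral_add(1) set_integrable_mult_right set_integrable_abs[OF elim(2)] set_integrable_const_Ioc) 
     fix u assume "u \<in> {s<..t}"
     then have u: "0 <= u" using a by simp
     have "\<bar>?h i u y\<bar> <= \<bar>real m * X i u y ^ (m - 1) * D i u y\<bar> + \<bar>real m * (real m - 1) / 2 * X i u y ^ (m - 2) * Q i u y\<bar>"
      by (rule abs_triangle_ineq)
     also have "\<dots> <= real m * K ^ (m - 1) * \<bar>D i u y\<bar> + real m * (real m - 1) / 2 * K ^ (m - 2) * KQ"
     proof (rule add_mono)
      show "\<bar>real m * X i u y ^ (m - 1) * D i u y\<bar> <= real m * K ^ (m - 1) * \<bar>D i u y\<bar>"
       unfolding abs_mult using power_X_bounded[OF i u elim(3), of "m - 1"] by (intro mult_right_mono) (auto intro!: mult_left_mono)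
      show "\<bar>real m * (real m - 1) / 2 * X i u y ^ (m - 2) * Q i u y\<bar> <= real m * (real m - 1) / 2 * K ^ (m - 2) * KQ"
       unfolding abs_mult[of "_ * _" "Q i u y"] abs_mult[of _ "X i u y ^ (m - 2)"] abs_of_nonneg[OF c2]
       using power_X_bounded[OF i u elim(3), of "m - 2"] Q_bounded[OF i elim(3)] c2 K_nonneg
       by (intro mult_mono mult_nonneg_nonneg mult_left_mono) auto
     qed
     finally show "\<bar>?h i u y\<bar> <= real m * K ^ (m - 1) * \<bar>D i u y\<bar> + real m * (real m - 1) / 2 * K ^ (m - 2) * KQ" .
    qed
    also have "\<dots> = W y"
     unfolding W_def dV_def
     by (subst set_integral_add(2)) (use a in \<open>auto intro!: set_integrable_abs[OF elim(2)] set_integrable_const_Ioc simp: set_lebesgue_integral_def\<close>)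
    finally show ?case by simp
   qed
  qed
 qed
 have "expectation (%y. Z y * (mart t y - mart s y)) = expectation (%y. (\<Sum>i\<in>J. w * (Z y * ?d i y)) - Z y * dB s t y)"
 proof (rule Bochner_Integration.integral_cong[OF refl])
  fix y assume y: "y \<in> space M"
  have "psum t y - psum s y = (\<Sum>i\<in>J. w * ?d i y)"
   by (simp add: psum_def sum_subtractf right_diff_distrib)
  then have "Z y * (mart t y - mart s y) = Z y * ((\<Sum>i\<in>J. w * ?d i y) - dB s t y)"
   using mart_diff[OF a y] by simp
  also have "\<dots> = (\<Sum>i\<in>J. w * (Z y * ?d i y)) - Z y * dB s t y"
   by (subst right_diff_distrib) (simp only: sum_distrib_left mult.left_commute[of "Z y" w])
  finally show "Z y * (mart t y - mart s y) = (\<Sum>i\<in>J. w * (Z y * ?d i y)) - Z y * dB s t y" .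
 qed
 also have "\<dots> = (\<Sum>i\<in>J. w * expectation (%y. Z y * ?d i y)) - expectation (%y. Z y * dB s t y)"
 proof -
  have "integrable M (%y. \<Sum>i\<in>J. w * (Z y * ?d i y))" by (intro Bochner_Integration.integrable_sum integrable_mult_right id)
  then have "expectation (%y. (\<Sum>i\<in>J. w * (Z y * ?d i y)) - Z y * dB s t y) = expectation (%y. \<Sum>i\<in>J. w * (Z y * ?d i y)) - expectation (%y. Z y * dB s t y)"
   by (rule Bochner_Integration.integral_diff[OF _ iB])
  moreover have "expectation (%y. \<Sum>i\<in>J. w * (Z y * ?d i y)) = (\<Sum>i\<in>J. expectation (%y. w * (Z y * ?d i y)))"
   by (intro Bochner_Integration.integral_sum integrable_mult_right id)
  ultimately show ?thesis by simp
 qed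
 also have "expectation (%y. Z y * dB s t y) = (\<Sum>i\<in>J. w * expectation (%y. Z y * ?G i y))"
 proof -
  have "expectation (%y. Z y * dB s t y) = expectation (%y. \<Sum>i\<in>J. w * (Z y * ?G i y))"
  proof (rule integral_cong_AE)
   show "(%y. Z y * dB s t y) \<in> borel_measurable M" using iB by auto
   show "(%y. \<Sum>i\<in>J. w * (Z y * ?G i y)) \<in> borel_measurable M"
    by (intro borel_measurable_integrable Bochner_Integration.integrable_sum integrable_mult_right iZG)
   show "AE y in M. Z y * dB s t y = (\<Sum>i\<in>J. w * (Z y * ?G i y))"
    using eqB by eventually_elim (simp only: sum_distrib_left mult.left_commute)
  qed
  also have "\<dots> = (\<Sum>i\<in>J. expectation (%y. w * (Z y * ?G i y)))"
   by (intro Bochner_Integration.integral_sum integrable_mult_right iZG)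
  finally show ?thesis by simp
 qed
 also have "(\<Sum>i\<in>J. w * expectation (%y. Z y * ?d i y)) = (\<Sum>i\<in>J. w * expectation (%y. Z y * ?G i y))"
  by (intro sum.cong refl arg_cong[where f = "%x. w * x"] Dynkin_power(1)[OF _ a Z])
 finally show ?thesis by simp
qed

text \<open>Kolmogorov's maximal inequality on a finite grid: decompose according to the first exit.\<close>

lemma grid_maximal_inequality:
 assumes T: "0 <= T" and n: "0 < n" and e: "0 < e"
 shows "{h \<in> space M. \<exists>k\<le>n. e < \<bar>mart (grid 0 T n k) h\<bar>} \<in> sets M"
  and "e^2 * prob {h \<in> space M. \<exists>k\<le>n. e < \<bar>mart (grid 0 T n k) h\<bar>} <= expectation (%h. (mart T h)^2)"
proof -
 let ?Y = "%k. mart (grid 0 T n k)"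
 define A where "A k = {h \<in> space M. e < \<bar>?Y k h\<bar> \<and> (\<forall>l\<in>{..<k}. \<not> e < \<bar>?Y l h\<bar>)}" for k
 have g0: "0 <= grid 0 T n k" for k by (rule grid_nonneg[OF order_refl T])
 have sp: "space (F t) = space M" if "0 <= t" for t using subalg[OF that] by (simp add: subalgebra_def)
 have YF: "?Y l \<in> borel_measurable (F (grid 0 T n k))" if "l <= k" for l k
  by (rule F_mono[OF g0 grid_mono[OF T that] mart_adapted[OF g0]])
 have AF: "A k \<in> sets (F (grid 0 T n k))" for k
 proof -
  have "{h \<in> space (F (grid 0 T n k)). e < \<bar>?Y k h\<bar>} \<in> sets (F (grid 0 T n k))"
   using YF[OF order_refl] by measurable
  moreover have "{h \<in> space (F (grid 0 T n k)). \<forall>l\<in>{..<k}. \<not> e < \<bar>?Y l h\<bar>} \<in> sets (F (grid 0 T n k))"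
  proof (intro sets.sets_Collect_finite_All finite_lessThan)
   fix l assume "l \<in> {..<k}"
   then have "?Y l \<in> borel_measurable (F (grid 0 T n k))" by (intro YF) simp
   then show "{h \<in> space (F (grid 0 T n k)). \<not> e < \<bar>?Y l h\<bar>} \<in> sets (F (grid 0 T n k))" by measurable
  qed
  ultimately have "{h \<in> space (F (grid 0 T n k)). e < \<bar>?Y k h\<bar>} \<inter> {h \<in> space (F (grid 0 T n k)). \<forall>l\<in>{..<k}. \<not> e < \<bar>?Y l h\<bar>} \<in> sets (F (grid 0 T n k))"
   by (rule sets.Int)
  moreover have "A k = {h \<in> space (F (grid 0 T n k)). e < \<bar>?Y k h\<bar>} \<inter> {h \<in> space (F (grid 0 T n k)). \<forall>l\<in>{..<k}. \<not> e < \<bar>?Y l h\<bar>}"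
   unfolding A_def sp[OF g0] by blast
  ultimately show ?thesis by simp
 qed
 have AM: "A k \<in> sets M" for k using AF[of k] subalg[OF g0] by (auto simp: subalgebra_def)
 have un: "{h \<in> space M. \<exists>k\<le>n. e < \<bar>?Y k h\<bar>} = (\<Union>k\<in>{..n}. A k)"
 proof (intro set_eqI iffI)
  fix h assume "h \<in> {h \<in> space M. \<exists>k\<le>n. e < \<bar>?Y k h\<bar>}"
  then obtain k where k: "h \<in> space M" "k <= n" "e < \<bar>?Y k h\<bar>" by blast
  define k0 where "k0 = (LEAST k. e < \<bar>?Y k h\<bar>)"
  have "e < \<bar>?Y k0 h\<bar>" unfolding k0_def using k(3) by (rule LeastI)
  moreover have "k0 <= n" using Least_le[of "%k. e < \<bar>?Y k h\<bar>" k] k by (simp add: k0_def)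
  moreover have "\<not> e < \<bar>?Y l h\<bar>" if "l < k0" for l using not_less_Least[of l "%k. e < \<bar>?Y k h\<bar>"] that by (simp add: k0_def)
  ultimately show "h \<in> (\<Union>k\<in>{..n}. A k)" using k(1) unfolding A_def by blast
 qed (auto simp: A_def)
 show "{h \<in> space M. \<exists>k\<le>n. e < \<bar>?Y k h\<bar>} \<in> sets M" unfolding un using AM by auto
 have disj: "disjoint_family_on A {..n}"
 proof (unfold disjoint_family_on_def, intro ballI impI)
  fix k l :: nat assume "k \<noteq> l"
  then consider "k < l" | "l < k" by linarith
  then show "A k \<inter> A l = {}" by cases (auto simp: A_def)
 qed
 have Ym: "?Y k \<in> borel_measurable M" for k by (rule mart_measurable[OF g0])
 define C where "C = 2 * (real (card J) * (\<bar>w\<bar> * K ^ m)) + Cb * T"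
 have Yb: "\<bar>?Y k h\<bar> <= C" if "k <= n" "h \<in> space M" for k h
 proof -
  have "Cb * grid 0 T n k <= Cb * T" by (intro mult_left_mono Cb_nonneg grid_le T that n)
  then show ?thesis using mart_bounded[OF g0 that(2), of k] unfolding C_def by linarith
 qed
 have Yi: "integrable M (%h. (?Y k h)^2)" if "k <= n" for k
 proof (rule integrable_bounded)
  show "(%h. (?Y k h)^2) \<in> borel_measurable M" using Ym by measurable
  show "\<bar>(?Y k h)^2\<bar> <= C^2" if "h \<in> space M" for h using power_mono[OF Yb[OF \<open>k <= n\<close> that], of 2] by simp
 qed
 have Yn: "?Y n = mart T" using n by simp
 have key: "e^2 * prob (A k) <= expectation (%h. indicator (A k) h * (mart T h)^2)" if k: "k <= n" for k
 proof -
  \<comment> \<open>The first exit is decided at index \<open>k\<close>, so \<open>?Z\<close> is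
    orthogonal to the later increment. Hence on \<open>A k\<close> the final square is in mean at
    least the square at the exit, which exceeds \<open>e^2\<close>.\<close>
  let ?Z = "%h. indicator (A k) h * ?Y k h"
  have Z: "?Z \<in> borel_measurable (F (grid 0 T n k))"
   by (intro borel_measurable_times borel_measurable_indicator AF YF order_refl)
  have Zb: "\<bar>?Z h\<bar> <= C" if "h \<in> space M" for h using Yb[OF k that] by (auto simp: indicator_def)
  have zero: "expectation (%h. ?Z h * (?Y n h - ?Y k h)) = 0"
   by (rule mart_increment_zero[OF g0 grid_mono[OF T k] Z Zb])
  have i0: "integrable M (%h. ?Y n h - ?Y k h)"
   using Yb[OF order_refl] Yb[OF k] by (intro Bochner_Integration.integrable_diff integrable_bounded[OF Ym, of _ C]) auto
  have iz: "integrable M (%h. ?Z h * (?Y n h - ?Y k h))"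
   by (rule integrable_bounded_mult[OF i0 F_measurable[OF g0 Z] Zb])
  have ii: "integrable M (%h. indicator (A k) h * (?Y l h)^2)" if "l <= n" for l
   using integrable_mult_indicator[OF AM Yi[OF that], of k] by simp
  have "e^2 * prob (A k) = expectation (%h. e^2 * indicator (A k) h)"
   using AM sets.sets_into_space[OF AM] by (simp add: Int_absorb2)
  also have "\<dots> <= expectation (%h. indicator (A k) h * (?Y n h)^2 - 2 * (?Z h * (?Y n h - ?Y k h)))"
  proof (rule integral_mono)
   show "integrable M (%h. e^2 * indicator (A k) h)"
    using AM by (intro integrable_mult_right integrable_real_indicator) (auto simp: emeasure_eq_measure)
   show "integrable M (%h. indicator (A k) h * (?Y n h)^2 - 2 * (?Z h * (?Y n h - ?Y k h)))"
    by (intro Bochner_Integration.integrable_diff ii order_refl integrable_mult_right iz)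
   fix h
   show "e^2 * indicator (A k) h <= indicator (A k) h * (?Y n h)^2 - 2 * (?Z h * (?Y n h - ?Y k h))"
   proof (cases "h \<in> A k")
    case True
    then have "e <= \<bar>?Y k h\<bar>" by (auto simp: A_def)
    then have "e^2 <= \<bar>?Y k h\<bar>^2" using e by (intro power_mono) auto
    moreover have "0 <= (?Y n h - ?Y k h)^2" by simp
    moreover have "(?Y n h)^2 - 2 * (?Y k h * (?Y n h - ?Y k h)) = (?Y n h - ?Y k h)^2 + (?Y k h)^2"
     by (simp add: power2_eq_square algebra_simps)
    ultimately have "e^2 <= (?Y n h)^2 - 2 * (?Y k h * (?Y n h - ?Y k h))"
     unfolding power2_abs by linarith
    then show ?thesis using True by simp
   qed simp
  qed
  also have "\<dots> = expectation (%h. indicator (A k) h * (?Y n h)^2)"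
   using ii[OF order_refl] iz zero by simp
  finally show ?thesis unfolding Yn .
 qed
 have iA: "integrable M (%h. indicator (A k) h * (mart T h)^2)" for k
  using integrable_mult_indicator[OF AM Yi[OF order_refl], of k] unfolding Yn by simp
 have "e^2 * prob (\<Union>k\<in>{..n}. A k) = (\<Sum>k\<le>n. e^2 * prob (A k))"
  using AM disj by (subst finite_measure_finite_Union) (auto simp: sum_distrib_left)
 also have "\<dots> <= (\<Sum>k\<le>n. expectation (%h. indicator (A k) h * (mart T h)^2))"
  by (intro sum_mono key) simp
 also have "\<dots> = expectation (%h. \<Sum>k\<le>n. indicator (A k) h * (mart T h)^2)"
  by (rule Bochner_Integration.integral_sum[symmetric]) (rule iA)
 also have "\<dots> <= expectation (%h. (mart T h)^2)"
 proof (rule integral_mono[OF Bochner_Integration.integrable_sum[OF iA]])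
  show "integrable M (%h. (mart T h)^2)" using Yi[OF order_refl] unfolding Yn .
  fix h
  have "(\<Sum>k\<le>n. indicator (A k) h :: real) = indicator (\<Union>k\<in>{..n}. A k) h"
   using disj by (subst indicator_UN_disjoint) auto
  then have "(\<Sum>k\<le>n. indicator (A k) h * (mart T h)^2) = indicator (\<Union>k\<in>{..n}. A k) h * (mart T h)^2"
   by (simp only: sum_distrib_right[symmetric])
  also have "\<dots> <= 1 * (mart T h)^2" by (intro mult_right_mono) (auto simp: indicator_def)
  finally show "(\<Sum>k\<le>n. indicator (A k) h * (mart T h)^2) <= (mart T h)^2" by simp
 qed
 finally show "e^2 * prob {h \<in> space M. \<exists>k\<le>n. e < \<bar>?Y k h\<bar>} <= expectation (%h. (mart T h)^2)" unfolding un .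
qed

text \<open>Dyadic grids are nested, so the exceedance events increase with the level. By continuity
  a strict exceedance at any time is seen on a sufficiently fine grid, and the common bound passes
  to the increasing union.\<close>

theorem maximal_inequality:
 assumes T: "0 <= T" and e: "0 < e"
 shows "{h \<in> space M. \<exists>t\<in>{0..T}. e < \<bar>mart t h\<bar>} \<in> sets M"
  and "e^2 * prob {h \<in> space M. \<exists>t\<in>{0..T}. e < \<bar>mart t h\<bar>} <= expectation (%h. (mart T h)^2)"
proof -
 define A where "A j = {h \<in> space M. \<exists>k\<le>2^j. e < \<bar>mart (grid 0 T (2^j) k) h\<bar>}" for j :: nat
 have A: "A j \<in> sets M" "e^2 * prob (A j) <= expectation (%h. (mart T h)^2)" for j
  unfolding A_def by (rule grid_maximal_inequality[OF T _ e], simp)+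
 have un: "{h \<in> space M. \<exists>t\<in>{0..T}. e < \<bar>mart t h\<bar>} = (\<Union>j. A j)"
 proof (intro set_eqI iffI)
  fix h assume "h \<in> (\<Union>j. A j)"
  then obtain j k where "h \<in> space M" "k <= 2^j" "e < \<bar>mart (grid 0 T (2^j) k) h\<bar>" unfolding A_def by blast
  then show "h \<in> {h \<in> space M. \<exists>t\<in>{0..T}. e < \<bar>mart t h\<bar>}"
   using grid_nonneg[OF order_refl T, of "2^j" k] grid_le[OF T, of k "2^j"] by auto
 next
  fix h assume "h \<in> {h \<in> space M. \<exists>t\<in>{0..T}. e < \<bar>mart t h\<bar>}"
  then obtain t where h: "h \<in> space M" and t: "t \<in> {0..T}" "e < \<bar>mart t h\<bar>" by blast
  then have "0 < \<bar>mart t h\<bar> - e" by simp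
  then obtain no where no: "\<And>n k u. n \<ge> no ==> k < n ==> u \<in> {grid 0 T n k..grid 0 T n (Suc k)} ==> \<bar>mart u h - mart (grid 0 T n k) h\<bar> < \<bar>mart t h\<bar> - e"
   using grid_oscillation[OF T mart_continuous[OF h]] unfolding eventually_sequentially by blast
  \<comment> \<open>The level \<open>no\<close> is itself fine enough, since its grid has
    \<open>2 ^ no\<close> cells and this is at least \<open>no\<close>.\<close>
  have n2: "no <= 2 ^ no" "0 < (2::nat) ^ no" by (simp_all add: less_imp_le)
  obtain k where k: "k < 2 ^ no" "t \<in> {grid 0 T (2 ^ no) k..grid 0 T (2 ^ no) (Suc k)}"
   by (rule grid_cell[OF T n2(2) t(1)])
  from no[OF n2(1) k] have "e < \<bar>mart (grid 0 T (2 ^ no) k) h\<bar>" by linarith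
  then have "h \<in> A no" using h k(1) unfolding A_def by (intro CollectI conjI exI[of _ k]) auto
  then show "h \<in> (\<Union>j. A j)" by blast
 qed
 show "{h \<in> space M. \<exists>t\<in>{0..T}. e < \<bar>mart t h\<bar>} \<in> sets M" unfolding un using A by auto
 have "incseq A"
 proof (rule incseq_SucI, rule subsetI)
  fix j h assume "h \<in> A j"
  then obtain k where k: "h \<in> space M" "k <= 2^j" "e < \<bar>mart (grid 0 T (2^j) k) h\<bar>" unfolding A_def by blast
  moreover have "grid 0 T (2^j) k = grid 0 T (2^Suc j) (2 * k)" by (simp add: grid_def)
  moreover have "2 * k <= 2 ^ Suc j" using k by simp
  ultimately show "h \<in> A (Suc j)" unfolding A_def by (intro CollectI conjI exI[of _ "2 * k"]) simp_all
 qed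
 then have "(%j. e^2 * prob (A j)) \<longlonglongrightarrow> e^2 * prob (\<Union>j. A j)"
  using A(1) by (intro tendsto_intros finite_Lim_measure_incseq) auto
 then show "e^2 * prob {h \<in> space M. \<exists>t\<in>{0..T}. e < \<bar>mart t h\<bar>} <= expectation (%h. (mart T h)^2)"
  unfolding un by (rule LIMSEQ_le_const2) (use A(2) in blast)
qed

end

section \<open>Variance of the compensated power sums\<close>

lemma nested_square_bound:
 fixes a p q r s t u v y :: real
 assumes "a <= 2 * p + 2 * q" "q <= 2 * r + 2 * s" "r <= t" "t <= u" "2 * u = v" "s <= y"
 shows "a <= 2 * p + 2 * (v + 2 * y)"
proof -
 have "r <= u" using assms(3,4) by (rule order_trans)
 then have "q <= v + 2 * y" using assms(2,5,6) by linarith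
 then have "2 * q <= 2 * (v + 2 * y)" by simp
 then show ?thesis by (rule order_trans[OF assms(1) add_left_mono])
qed

context power_functional
begin

text \<open>Pythagoras for the orthogonal increments, starting from \<open>mart_0\<close>.\<close>

lemma mart_square_telescope:
 assumes T: "0 <= T" and n: "0 < n"
 shows "expectation (%h. (mart T h)^2) = (\<Sum>k<n. expectation (%h. (mart (grid 0 T n (Suc k)) h - mart (grid 0 T n k) h)^2))"
  and "k < n ==> integrable M (%h. (mart (grid 0 T n (Suc k)) h - mart (grid 0 T n k) h)^2)"
proof -
 let ?Y = "%k. mart (grid 0 T n k)"
 have g0: "0 <= grid 0 T n k" for k by (rule grid_nonneg[OF order_refl T])
 define C where "C = 2 * (real (card J) * (\<bar>w\<bar> * K ^ m)) + Cb * T"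
 have Yb: "\<bar>?Y k h\<bar> <= C" if "k <= n" "h \<in> space M" for k h
 proof -
  have "Cb * grid 0 T n k <= Cb * T" by (intro mult_left_mono Cb_nonneg grid_le T that n)
  then show ?thesis using mart_bounded[OF g0 that(2), of k] unfolding C_def by linarith
 qed
 have Ym: "?Y k \<in> borel_measurable M" for k by (rule mart_measurable[OF g0])
 have dm: "(%h. ?Y (Suc k) h - ?Y k h) \<in> borel_measurable M" for k by (intro borel_measurable_diff Ym)
 have db: "\<bar>?Y (Suc k) h - ?Y k h\<bar> <= 2 * C" if "k < n" "h \<in> space M" for k h
  using Yb[of k h] Yb[of "Suc k" h] that by linarith
 have i2: "integrable M (%h. (?Y (Suc k) h - ?Y k h)^2)" if "k < n" for k
 proof (rule integrable_bounded)
  show "(%h. (?Y (Suc k) h - ?Y k h)^2) \<in> borel_measurable M" by (rule borel_measurable_power[OF dm])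
  show "\<bar>(?Y (Suc k) h - ?Y k h)^2\<bar> <= (2 * C)^2" if "h \<in> space M" for h using power_mono[OF db[OF \<open>k < n\<close> that], of 2] by simp
 qed
 then show "k < n ==> integrable M (%h. (?Y (Suc k) h - ?Y k h)^2)" .
 have i1: "integrable M (%h. ?Y k h * (?Y (Suc k) h - ?Y k h))" if k: "k < n" for k
  using integrable_bounded_mult[OF integrable_bounded[OF dm db[OF k]] Ym Yb[of k]] k by simp
 have z: "expectation (%h. ?Y k h * (?Y (Suc k) h - ?Y k h)) = 0" if k: "k < n" for k
  by (rule mart_increment_zero[OF g0 grid_mono[OF T] mart_adapted[OF g0] Yb]) (use k in auto)
 have "expectation (%h. (mart T h)^2) = expectation (%h. (\<Sum>k<n. (?Y (Suc k) h - ?Y k h)^2 + 2 * (?Y k h * (?Y (Suc k) h - ?Y k h))))"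
 proof (rule Bochner_Integration.integral_cong[OF refl])
  fix h
  have "(\<Sum>k<n. (?Y (Suc k) h)^2 - (?Y k h)^2) = (mart T h)^2"
   using sum_lessThan_telescope[of "%k. (?Y k h)^2" n] n by (simp add: mart_0)
  moreover have "(?Y (Suc k) h)^2 - (?Y k h)^2 = (?Y (Suc k) h - ?Y k h)^2 + 2 * (?Y k h * (?Y (Suc k) h - ?Y k h))" for k
   by (simp add: power2_eq_square algebra_simps)
  ultimately show "(mart T h)^2 = (\<Sum>k<n. (?Y (Suc k) h - ?Y k h)^2 + 2 * (?Y k h * (?Y (Suc k) h - ?Y k h)))" by simp
 qed
 also have "\<dots> = (\<Sum>k<n. expectation (%h. (?Y (Suc k) h - ?Y k h)^2 + 2 * (?Y k h * (?Y (Suc k) h - ?Y k h))))"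
  by (intro Bochner_Integration.integral_sum Bochner_Integration.integrable_add i2 integrable_mult_right i1) auto
 also have "\<dots> = (\<Sum>k<n. expectation (%h. (?Y (Suc k) h - ?Y k h)^2))"
 proof (rule sum.cong[OF refl])
  fix k assume "k \<in> {..<n}"
  then have k: "k < n" by simp
  have "expectation (%h. (?Y (Suc k) h - ?Y k h)^2 + 2 * (?Y k h * (?Y (Suc k) h - ?Y k h)))
   = expectation (%h. (?Y (Suc k) h - ?Y k h)^2) + expectation (%h. 2 * (?Y k h * (?Y (Suc k) h - ?Y k h)))"
   by (rule Bochner_Integration.integral_add[OF i2[OF k] integrable_mult_right[OF i1[OF k]]])
  then show "expectation (%h. (?Y (Suc k) h - ?Y k h)^2 + 2 * (?Y k h * (?Y (Suc k) h - ?Y k h))) = expectation (%h. (?Y (Suc k) h - ?Y k h)^2)"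
   using z[OF k] by simp
 qed
 finally show "expectation (%h. (mart T h)^2) = (\<Sum>k<n. expectation (%h. (?Y (Suc k) h - ?Y k h)^2))" .
qed

text \<open>Each increment is a linear martingale term \<open>P\<close> plus a remainder. The
  constant 2 comes from squaring this sum crudely: only the order in the number of particles matters
  later. Since the brackets of different particles vanish, \<open>P\<close> contributes a single sum
  over \<open>J\<close>; the remainders vanish with the mesh.\<close>

theorem mart_square_bound:
 assumes T: "0 <= T"
 shows "expectation (%h. (mart T h)^2) <= 2 * expectation (%h. \<Sum>i\<in>J. LINT u:{0<..T}|lborel. (w * (real m * X i u h ^ (m - 1)))^2 * Q i u h)"
proof -
 let ?g = "grid 0 T"
 define c where "c n k i h = w * (real m * X i (?g n k) h ^ (m - 1))" for n k i h
 define I where "I n k i = dI i (?g n k) (?g n (Suc k))" for n k i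
 define A where "A n k i = dA i (?g n k) (?g n (Suc k))" for n k i
 define V where "V n k i = dV i (?g n k) (?g n (Suc k))" for n k i
 define R where "R n k i = dQ i (?g n k) (?g n (Suc k))" for n k i
 define x where "x n k i = dX i 0 T n k" for n k i
 define P where "P n k h = (\<Sum>i\<in>J. c n k i h * I n k i h)" for n k h
 define N where "N n k h = mart (?g n (Suc k)) h - mart (?g n k) h" for n k h
 define Kc where "Kc = \<bar>w\<bar> * (real m * K ^ (m - 1))"
 have Kc0: "0 <= Kc" unfolding Kc_def using K_nonneg by simp
 obtain C1 where C1: "0 <= C1" "\<And>x y. \<bar>x\<bar> <= K ==> \<bar>y\<bar> <= K ==> \<bar>y ^ m - x ^ m - real m * x ^ (m - 1) * (y - x)\<bar> <= C1 * (y - x)^2"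
  using power_taylor1[OF K_nonneg, of m] by blast
 define B where "B = Kc + \<bar>w\<bar> * C1"
 have B0: "0 <= B" unfolding B_def using Kc0 C1 by simp
 \<comment> \<open>A factor 2 from separating the drift \<open>z\<close>, \<open>card J\<close> from
   squaring a sum over \<open>J\<close>, and \<open>2 * B^2 * (1 + 2 * K)\<close> from the square of
   one remainder.\<close>
 define B' where "B' = 4 * real (card J) * B^2 * (1 + 2 * K)"
 have B'0: "0 <= B'" unfolding B'_def using K_nonneg by simp
 have g0: "0 <= ?g n k" and gS: "?g n k <= ?g n (Suc k)" for n k
  by (rule grid_nonneg[OF order_refl T]) (rule grid_mono[OF T], simp)
 have cF: "c n k i \<in> borel_measurable (F (?g n k))" if "i \<in> J" for n k i
  unfolding c_def[abs_def] using that by (intro borel_measurable_times borel_measurable_power borel_measurable_const X_adapted g0)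
 have cb: "\<bar>c n k i h\<bar> <= Kc" if "i \<in> J" "h \<in> space M" for n k i h
  using mult_left_mono[OF mult_left_mono[OF power_X_bounded[OF that(1) g0 that(2), of n k "m - 1"], of "real m"], of "\<bar>w\<bar>"]
  by (simp add: c_def Kc_def abs_mult)
 have P2: "integrable M (%h. (P n k h)^2) \<and> expectation (%h. (P n k h)^2) = (\<Sum>i\<in>J. expectation (%h. (c n k i h)^2 * R n k i h))" for n k
 proof -
  have eq: "(P n k h)^2 = (\<Sum>i\<in>J. \<Sum>j\<in>J. (c n k i h * c n k j h) * (I n k i h * I n k j h))" for h
   unfolding P_def power2_eq_square sum_product by (intro sum.cong refl) (simp only: mult_ac)
  have zF: "(%h. c n k i h * c n k j h) \<in> borel_measurable (F (?g n k))" if "i \<in> J" "j \<in> J" for i j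
   by (intro borel_measurable_times cF that)
  have zb: "\<bar>c n k i h * c n k j h\<bar> <= Kc * Kc" if "i \<in> J" "j \<in> J" "h \<in> space M" for i j h
   unfolding abs_mult using that by (intro mult_mono cb Kc0) auto
  have t: "integrable M (%h. (c n k i h * c n k j h) * (I n k i h * I n k j h))"
   "expectation (%h. (c n k i h * c n k j h) * (I n k i h * I n k j h)) = (if i = j then expectation (%h. (c n k i h * c n k j h) * R n k i h) else 0)"
   if "i \<in> J" "j \<in> J" for i j
   unfolding I_def R_def by (rule dI_mult[OF that g0 gS zF[OF that] zb[OF that]]; assumption)+
  have "integrable M (%h. (P n k h)^2)"
   unfolding eq by (intro Bochner_Integration.integrable_sum t(1))
  moreover have "expectation (%h. (P n k h)^2) = (\<Sum>i\<in>J. \<Sum>j\<in>J. expectation (%h. (c n k i h * c n k j h) * (I n k i h * I n k j h)))"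
   unfolding eq by (rule integral_double_sum[OF t(1)])
  moreover have "\<dots> = (\<Sum>i\<in>J. \<Sum>j\<in>J. if i = j then expectation (%h. (c n k i h * c n k j h) * R n k i h) else 0)"
   by (intro sum.cong refl t(2))
  moreover have "\<dots> = (\<Sum>i\<in>J. expectation (%h. (c n k i h)^2 * R n k i h))"
   using finite_J by (intro sum.cong refl) (simp add: sum.delta power2_eq_square)
  ultimately show ?thesis by simp
 qed
 have step: "(N n k h)^2 <= 2 * (P n k h)^2 + 2 * (B' * (\<Sum>i\<in>J. (V n k i h)^2 + \<bar>x n k i h\<bar> ^ 3) + 2 * (Cb * (T / real n))^2)"
  if h: "h \<in> space M" for n k h
 proof -
  define r where "r i = w * (X i (?g n (Suc k)) h ^ m - X i (?g n k) h ^ m) - c n k i h * I n k i h" for i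
  define z where "z = dB (?g n k) (?g n (Suc k)) h"
  have N: "N n k h = P n k h + ((\<Sum>i\<in>J. r i) - z)"
   unfolding N_def mart_diff[OF g0 gS h] P_def r_def z_def psum_def
   by (simp add: sum_subtractf right_diff_distrib)
  have zb: "\<bar>z\<bar> <= Cb * (T / real n)" unfolding z_def using dB_bounded[OF g0 gS h, of n k] by (simp add: grid_Suc_diff)
  have rb: "\<bar>r i\<bar> <= B * (V n k i h + (x n k i h)^2)" if i: "i \<in> J" for i
  proof -
   define a y where "a = X i (?g n k) h" and "y = X i (?g n (Suc k)) h"
   have ya: "x n k i h = y - a" by (simp add: x_def dX_def a_def y_def)
   have Ia: "I n k i h = (y - a) - A n k i h" by (simp add: I_def A_def dI_def a_def y_def)
   have c: "c n k i h = w * (real m * a ^ (m - 1))" by (simp add: c_def a_def)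
   have ri: "r i = w * (y ^ m - a ^ m - real m * a ^ (m - 1) * (y - a)) + c n k i h * A n k i h"
    unfolding r_def Ia c a_def[symmetric] y_def[symmetric] by (simp add: algebra_simps)
   have "\<bar>r i\<bar> <= \<bar>w * (y ^ m - a ^ m - real m * a ^ (m - 1) * (y - a))\<bar> + \<bar>c n k i h * A n k i h\<bar>"
    unfolding ri by (rule abs_triangle_ineq)
   also have "\<dots> <= \<bar>w\<bar> * (C1 * (y - a)^2) + Kc * V n k i h"
   proof (rule add_mono)
    show "\<bar>w * (y ^ m - a ^ m - real m * a ^ (m - 1) * (y - a))\<bar> <= \<bar>w\<bar> * (C1 * (y - a)^2)"
     unfolding abs_mult[of w] by (intro mult_left_mono C1(2)) (auto simp: a_def y_def intro!: X_bounded i g0 h)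
    show "\<bar>c n k i h * A n k i h\<bar> <= Kc * V n k i h"
     unfolding abs_mult A_def V_def by (rule mult_mono[OF cb[OF i h] dA_le_dV Kc0 abs_ge_zero])
   qed
   also have "\<dots> <= B * (V n k i h + (x n k i h)^2)"
   proof -
    have "0 <= \<bar>w\<bar> * C1 * V n k i h" "0 <= Kc * (y - a)^2" unfolding V_def using C1 dV_nonneg Kc0 by simp_all
    then show ?thesis unfolding B_def ya by (simp add: algebra_simps)
   qed
   finally show ?thesis .
  qed
  have ri2: "(r i)^2 <= 2 * B^2 * (1 + 2 * K) * ((V n k i h)^2 + \<bar>x n k i h\<bar> ^ 3)" if i: "i \<in> J" for i
  proof -
   have "(r i)^2 <= (B * (V n k i h + (x n k i h)^2))^2" using power_mono[OF rb[OF i], of 2] by simp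
   also have "\<dots> = B^2 * (V n k i h + (x n k i h)^2)^2" by (rule power_mult_distrib)
   also have "\<dots> <= B^2 * (2 * (V n k i h)^2 + 2 * ((x n k i h)^2)^2)" by (intro mult_left_mono sum_power2_le) simp
   also have "\<dots> <= B^2 * (2 * (1 + 2 * K) * ((V n k i h)^2 + \<bar>x n k i h\<bar> ^ 3))"
   proof (intro mult_left_mono)
    have "((x n k i h)^2)^2 = \<bar>x n k i h\<bar> * \<bar>x n k i h\<bar> ^ 3"
     by (simp add: power2_eq_square power3_eq_cube)
    also have "\<dots> <= (2 * K) * \<bar>x n k i h\<bar> ^ 3"
     unfolding x_def by (intro mult_right_mono dX_bounded[OF i order_refl T h]) simp
    finally have 1: "((x n k i h)^2)^2 <= 2 * K * \<bar>x n k i h\<bar> ^ 3" by simp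
    have 2: "0 <= \<bar>x n k i h\<bar> ^ 3" "0 <= K * (V n k i h)^2" using K_nonneg by simp_all
    show "2 * (V n k i h)^2 + 2 * ((x n k i h)^2)^2 <= 2 * (1 + 2 * K) * ((V n k i h)^2 + \<bar>x n k i h\<bar> ^ 3)"
    proof -
     have "2 * v + 2 * q <= 2 * (1 + 2 * K) * (v + p)" if "q <= 2 * K * p" "0 <= p" "0 <= K * v" for v q p :: real
      using that by (simp add: algebra_simps)
     from this[OF 1 2] show ?thesis .
    qed
   qed simp
   finally show ?thesis by (simp only: mult_ac)
  qed
  have "(N n k h)^2 <= 2 * (P n k h)^2 + 2 * ((\<Sum>i\<in>J. r i) - z)^2" unfolding N by (rule sum_power2_le)
  moreover have "((\<Sum>i\<in>J. r i) - z)^2 <= 2 * (\<Sum>i\<in>J. r i)^2 + 2 * z^2" using sum_power2_le[of "\<Sum>i\<in>J. r i" "- z"] by simp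
  moreover have "(\<Sum>i\<in>J. r i)^2 <= (\<Sum>i\<in>J. (r i)^2) * real (card J)" by (rule sum_squared_le_sum_of_squares)
  moreover have "(\<Sum>i\<in>J. (r i)^2) * real (card J) <= (\<Sum>i\<in>J. 2 * B^2 * (1 + 2 * K) * ((V n k i h)^2 + \<bar>x n k i h\<bar> ^ 3)) * real (card J)"
   by (intro mult_right_mono sum_mono ri2) auto
  moreover have "2 * ((\<Sum>i\<in>J. 2 * B^2 * (1 + 2 * K) * ((V n k i h)^2 + \<bar>x n k i h\<bar> ^ 3)) * real (card J)) = B' * (\<Sum>i\<in>J. (V n k i h)^2 + \<bar>x n k i h\<bar> ^ 3)"
   unfolding sum_distrib_left[symmetric] B'_def by simp
  moreover have "z^2 <= (Cb * (T / real n))^2" using power_mono[OF zb, of 2] by simp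
  ultimately show ?thesis by (rule nested_square_bound)
 qed
 define H where "H n h = (\<Sum>i\<in>J. \<Sum>k<n. (c n k i h)^2 * R n k i h)" for n h
 have cRi: "integrable M (%h. (c n k i h)^2 * R n k i h)" if i: "i \<in> J" for n k i
 proof (rule integrable_bounded_mult)
  show "integrable M (R n k i)" unfolding R_def by (rule integrable_bounded[OF dQ_measurable[OF i] dQ_le[OF i gS]])
  show "(%h. (c n k i h)^2) \<in> borel_measurable M" by (intro borel_measurable_power F_measurable[OF g0 cF[OF i]])
  show "\<bar>(c n k i h)^2\<bar> <= Kc^2" if "h \<in> space M" for h using power_mono[OF cb[OF i that, of n k], of 2] by simp
 qed
 have bound: "expectation (%h. (mart T h)^2) <= 2 * expectation (H n) + 2 * (B' * (\<Sum>i\<in>J. expectation (mesh_error i 0 T n)) + 2 * (Cb * T)^2 / real n)"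
  if n: "0 < n" for n
 proof -
  let ?E = "%k h. \<Sum>i\<in>J. (V n k i h)^2 + \<bar>x n k i h\<bar> ^ 3"
  have iE: "integrable M (?E k)" for k
   unfolding V_def x_def by (intro Bochner_Integration.integrable_sum Bochner_Integration.integrable_add dV_square g0 gS cubic_variation_tendsto(2) order_refl T)
  have "expectation (%h. (N n k h)^2) <= 2 * expectation (%h. (P n k h)^2) + 2 * (B' * expectation (?E k) + 2 * (Cb * (T / real n))^2)" if k: "k < n" for k
  proof -
   have "expectation (%h. (N n k h)^2) <= expectation (%h. 2 * (P n k h)^2 + 2 * (B' * ?E k h + 2 * (Cb * (T / real n))^2))"
   proof (rule integral_mono)
    show "integrable M (%h. (N n k h)^2)" unfolding N_def by (rule mart_square_telescope(2)[OF T n k])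
    show "integrable M (%h. 2 * (P n k h)^2 + 2 * (B' * ?E k h + 2 * (Cb * (T / real n))^2))"
     using P2[of n k] iE[of k] by (intro Bochner_Integration.integrable_add integrable_mult_right) auto
   qed (rule step)
   also have "\<dots> = 2 * expectation (%h. (P n k h)^2) + 2 * (B' * expectation (?E k) + 2 * (Cb * (T / real n))^2)"
   proof -
    have 1: "integrable M (%h. B' * ?E k h)" using iE by (rule integrable_mult_right)
    have 2: "integrable M (%h. B' * ?E k h + 2 * (Cb * (T / real n))^2)" using 1 by (rule Bochner_Integration.integrable_add) simp
    have 3: "integrable M (%h. 2 * (P n k h)^2)" using P2[of n k] by (intro integrable_mult_right) blast
    have eq: "expectation (%h. B' * ?E k h + 2 * (Cb * (T / real n))^2) = B' * expectation (?E k) + 2 * (Cb * (T / real n))^2"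
     using Bochner_Integration.integral_add[OF 1, of "%_. 2 * (Cb * (T / real n))^2"] by (simp add: prob_space)
    show ?thesis
     by (subst Bochner_Integration.integral_add[OF 3 integrable_mult_right[OF 2]]) (simp only: integral_mult_right_zero eq)
   qed
   finally show ?thesis .
  qed
  then have "(\<Sum>k<n. expectation (%h. (N n k h)^2)) <= (\<Sum>k<n. 2 * expectation (%h. (P n k h)^2) + 2 * (B' * expectation (?E k) + 2 * (Cb * (T / real n))^2))"
   by (intro sum_mono) simp
  also have "\<dots> = 2 * (\<Sum>k<n. expectation (%h. (P n k h)^2)) + 2 * (B' * (\<Sum>k<n. expectation (?E k)) + (\<Sum>k<n. 2 * (Cb * (T / real n))^2))"
   unfolding sum.distrib sum_distrib_left[symmetric] ..
  also have "(\<Sum>k<n. 2 * (Cb * (T / real n))^2) = 2 * (Cb * T)^2 / real n"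
   using n by (simp add: power2_eq_square field_simps)
  also have "(\<Sum>k<n. expectation (%h. (P n k h)^2)) = expectation (H n)"
  proof -
   have "(\<Sum>k<n. expectation (%h. (P n k h)^2)) = (\<Sum>k<n. \<Sum>i\<in>J. expectation (%h. (c n k i h)^2 * R n k i h))"
    using P2 by (intro sum.cong refl) blast
   also have "\<dots> = (\<Sum>i\<in>J. \<Sum>k<n. expectation (%h. (c n k i h)^2 * R n k i h))" by (rule sum.swap)
   also have "\<dots> = expectation (H n)" unfolding H_def[abs_def] by (rule integral_double_sum[symmetric]) (rule cRi)
   finally show ?thesis .
  qed
  also have "B' * (\<Sum>k<n. expectation (?E k)) <= B' * (\<Sum>i\<in>J. expectation (mesh_error i 0 T n))"
  proof (rule mult_left_mono[OF _ B'0])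
   have "(\<Sum>k<n. expectation (?E k)) = expectation (%h. \<Sum>k<n. ?E k h)"
    by (rule Bochner_Integration.integral_sum[symmetric]) (rule iE)
   also have "\<dots> <= expectation (%h. \<Sum>i\<in>J. mesh_error i 0 T n h)"
   proof (rule integral_mono[OF Bochner_Integration.integrable_sum[OF iE] Bochner_Integration.integrable_sum[OF mesh_error_tendsto(2)[OF _ order_refl T]]])
    fix h
    have "(\<Sum>k<n. ?E k h) = (\<Sum>i\<in>J. \<Sum>k<n. (V n k i h)^2 + \<bar>x n k i h\<bar> ^ 3)" by (rule sum.swap)
    also have "\<dots> <= (\<Sum>i\<in>J. mesh_error i 0 T n h)"
     unfolding mesh_error_def V_def x_def using dV_nonneg by (intro sum_mono) simp
    finally show "(\<Sum>k<n. ?E k h) <= (\<Sum>i\<in>J. mesh_error i 0 T n h)" .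
   qed
   also have "\<dots> = (\<Sum>i\<in>J. expectation (mesh_error i 0 T n))"
    by (rule Bochner_Integration.integral_sum) (rule mesh_error_tendsto(2)[OF _ order_refl T])
   finally show "(\<Sum>k<n. expectation (?E k)) <= (\<Sum>i\<in>J. expectation (mesh_error i 0 T n))" .
  qed
  finally show ?thesis unfolding mart_square_telescope(1)[OF T n] N_def by simp
 qed
 let ?H = "%h. \<Sum>i\<in>J. LINT u:{0<..T}|lborel. (w * (real m * X i u h ^ (m - 1)))^2 * Q i u h"
 have Hm: "H n \<in> borel_measurable M" for n unfolding H_def[abs_def]
  by (intro borel_measurable_sum borel_measurable_integrable cRi)
 have Hlim: "(%n. H n h) \<longlonglongrightarrow> ?H h" if h: "h \<in> space M" for h
  unfolding H_def c_def R_def dQ_def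
  by (intro tendsto_sum grid_sum_tendsto[OF T, where f = "%u. (w * (real m * X i u h ^ (m - 1)))^2" for i] Q_integrable T h
    continuous_intros X_continuous_Icc order_refl)
 have "(%n. expectation (H n)) \<longlonglongrightarrow> expectation ?H"
 proof (rule integral_dominated_convergence[where w = "%_. real (card J) * (Kc^2 * (KQ * T))"])
  show "?H \<in> borel_measurable M" by (rule borel_measurable_LIMSEQ_real[OF Hlim Hm])
  show "AE h in M. (%n. H n h) \<longlonglongrightarrow> ?H h" by (rule AE_I2[OF Hlim])
  show "AE h in M. norm (H n h) <= real (card J) * (Kc^2 * (KQ * T))" for n
  proof (rule AE_I2)
   fix h assume h: "h \<in> space M"
   have "\<bar>\<Sum>k<n. (c n k i h)^2 * R n k i h\<bar> <= Kc^2 * (KQ * T)" if i: "i \<in> J" for i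
   proof -
    have "\<bar>\<Sum>k<n. (c n k i h)^2 * R n k i h\<bar> <= (\<Sum>k<n. Kc^2 * (KQ * (T / real n)))"
    proof (rule order_trans[OF sum_abs sum_mono])
     fix k
     have "\<bar>R n k i h\<bar> <= KQ * (T / real n)" using dQ_le[OF i gS h, of n k] by (simp add: R_def grid_Suc_diff)
     moreover have "\<bar>(c n k i h)^2\<bar> <= Kc^2" using power_mono[OF cb[OF i h, of n k], of 2] by simp
     ultimately show "\<bar>(c n k i h)^2 * R n k i h\<bar> <= Kc^2 * (KQ * (T / real n))"
      unfolding abs_mult by (intro mult_mono) auto
    qed
    also have "\<dots> <= Kc^2 * (KQ * T)" using KQ_nonneg T by (cases "n = 0") auto
    finally show ?thesis .
   qed
   then have "\<bar>H n h\<bar> <= (\<Sum>i\<in>J. Kc^2 * (KQ * T))"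
    unfolding H_def by (intro order_trans[OF sum_abs sum_mono])
   then show "norm (H n h) <= real (card J) * (Kc^2 * (KQ * T))" by simp
  qed
 qed (use Hm in simp_all)
 moreover have "(%n. \<Sum>i\<in>J. expectation (mesh_error i 0 T n)) \<longlonglongrightarrow> (\<Sum>i\<in>J. 0)"
  by (intro tendsto_sum mesh_error_tendsto(1)[OF _ order_refl T])
 ultimately have "(%n. 2 * expectation (H n) + 2 * (B' * (\<Sum>i\<in>J. expectation (mesh_error i 0 T n)) + 2 * (Cb * T)^2 / real n))
   \<longlonglongrightarrow> 2 * expectation ?H + 2 * (B' * (\<Sum>i\<in>J. 0) + 0)"
  by (elim tendsto_add[OF tendsto_mult_left tendsto_mult_left[OF tendsto_add[OF tendsto_mult_left lim_const_over_n]]])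
 then have lim: "(%n. 2 * expectation (H n) + 2 * (B' * (\<Sum>i\<in>J. expectation (mesh_error i 0 T n)) + 2 * (Cb * T)^2 / real n)) \<longlonglongrightarrow> 2 * expectation ?H"
  by simp
 show ?thesis
  by (rule LIMSEQ_le_const[OF lim]) (use bound in \<open>auto intro!: exI[of _ 1]\<close>)
qed

end

section \<open>The beta Jacobi process\<close>

lemma integrable_square_sum:
 fixes f :: "'i => 'a => real"
 assumes "finite I" "\<And>i. i \<in> I ==> f i \<in> borel_measurable M" "\<And>i. i \<in> I ==> integrable M (%x. (f i x)^2)"
 shows "integrable M (%x. (\<Sum>i\<in>I. f i x)^2)"
 using assms
proof (induction I rule: finite_induct)
 case (insert i I)
 have "integrable M (%x. (f i x + (\<Sum>i\<in>I. f i x))^2)"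
  by (intro integrable_square_add borel_measurable_sum insert) (use insert in auto)
 then show ?case using insert by simp
qed simp

text \<open>Only nonnegative times enter, which permits freezing an integrand before time 0.\<close>

lemma ito_integral_cong:
 assumes "\<And>s h. 0 <= s ==> H s h = H' s h" and "ito_integral M F B H I"
 shows "ito_integral M F B H' I"
proof -
 have "(\<integral>\<^sup>+s\<in>{0..t}. ennreal ((simple_value X s h - H s h)^2) \<partial>lborel) = (\<integral>\<^sup>+s\<in>{0..t}. ennreal ((simple_value X s h - H' s h)^2) \<partial>lborel)" for t X h
  by (intro nn_integral_cong) (auto simp: assms(1) indicator_def)
 then show ?thesis using assms(2) unfolding ito_integral_def by simp
qed

section \<open>Bounds for the singular drift\<close>

lemma sum_offdiagonal_symmetrize:
 fixes f :: "'i => 'i => real"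
 assumes "finite A"
 shows "(\<Sum>i\<in>A. \<Sum>j\<in>A - {i}. f i j) = 1/2 * (\<Sum>i\<in>A. \<Sum>j\<in>A - {i}. f i j + f j i)"
proof -
 have "(\<Sum>i\<in>A. \<Sum>j\<in>A - {i}. f j i) = (\<Sum>i\<in>A. \<Sum>j\<in>A - {i}. f i j)"
  using sum.swap_restrict[OF assms assms, of "%i j. f j i" "%i j. j \<noteq> i"]
 proof -
  have "A - {i} = {j \<in> A. j \<noteq> i}" "A - {i} = {j \<in> A. i \<noteq> j}" for i by auto
  then show ?thesis
   using sum.swap_restrict[OF assms assms, of "%i j. f j i" "%i j. j \<noteq> i"] by (simp only:)
 qed
 then show ?thesis by (simp add: sum.distrib)
qed

text \<open>At a collision division by zero gives 0, so the bounds below hold for every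
  configuration.\<close>

definition repulsion :: "(nat => real) => nat => nat => real" where
 "repulsion l i j = 2 * l i * (1 - l i) / (l i - l j)"

text \<open>The singularities of the two terms cancel: \<open>2 * y * (1 - y)\<close> is a quadratic
  polynomial in \<open>y\<close>, and its divided difference is
  \<open>2 * (1 - l i - l j)\<close>.\<close>

lemma repulsion_sum_bound:
 assumes "l i \<in> {0..1}" "l j \<in> {0..1}"
 shows "\<bar>repulsion l i j + repulsion l j i\<bar> <= 2"
proof (cases "l i = l j")
 case False
 define d where "d = l i - l j"
 have d: "d \<noteq> 0" "l j - l i = - d" using False by (simp_all add: d_def)
 have "repulsion l i j + repulsion l j i = (2 * l i * (1 - l i) - 2 * l j * (1 - l j)) / d"
  unfolding repulsion_def d(2) d_def[symmetric] by (simp add: diff_divide_distrib)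
 also have "2 * l i * (1 - l i) - 2 * l j * (1 - l j) = 2 * (1 - l i - l j) * d"
  unfolding d_def by (simp add: algebra_simps)
 also have "2 * (1 - l i - l j) * d / d = 2 * (1 - l i - l j)" using d(1) by simp
 finally show ?thesis using assms by auto
qed (simp add: repulsion_def)

lemma repulsion_nonneg:
 assumes "l i \<in> {0..1}" "l j <= l i"
 shows "0 <= repulsion l i j"
 unfolding repulsion_def using assms by (intro divide_nonneg_nonneg mult_nonneg_nonneg) auto

text \<open>The repulsion between a top block of particles and the rest has a sign, and the repulsion inside
 the block is bounded. Hence the total drift of the top blocks controls every single drift.\<close>

lemma jacobi_drift_bound:
 assumes l: "\<And>i. i \<in> {1..N} ==> l i \<in> {0..1}" and mono: "\<And>i j. i \<in> {1..N} ==> j \<in> {1..N} ==> i <= j ==> l i <= l j"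
  and \<beta>: "0 <= \<beta>" and i: "i \<in> {1..N}"
 shows "\<bar>jacobi_drift N a b \<beta> l i\<bar> <= (\<bar>a + 1\<bar> + \<bar>a + b + 2\<bar> + \<beta> * real N)
   + real N * (\<Sum>k=1..N. (\<Sum>i=k..N. jacobi_drift N a b \<beta> l i) + real N * (\<bar>a + 1\<bar> + \<bar>a + b + 2\<bar>) + \<beta> / 2 * (real N * real N))"
proof -
 let ?r = "repulsion l"
 define L where "L i = a + 1 - (a + b + 2) * l i" for i
 have D: "jacobi_drift N a b \<beta> l i = L i + \<beta> / 2 * (\<Sum>j\<in>{1..N} - {i}. ?r i j)" for i
  by (simp add: jacobi_drift_def L_def repulsion_def)
 have Lb: "\<bar>L i\<bar> <= \<bar>a + 1\<bar> + \<bar>a + b + 2\<bar>" if "i \<in> {1..N}" for i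
 proof -
  have "\<bar>(a + b + 2) * l i\<bar> <= \<bar>a + b + 2\<bar> * 1" unfolding abs_mult using l[OF that] by (intro mult_left_mono) auto
  then show ?thesis unfolding L_def using abs_triangle_ineq4[of "a + 1" "(a + b + 2) * l i"] by simp
 qed
 \<comment> \<open>The repulsion exerted on the top block \<open>{k..N}\<close> by all lower
   particles. Its terms are nonnegative, so it dominates each of them.\<close>
 define cross where "cross k = (\<Sum>i=k..N. \<Sum>j\<in>{1..<k}. ?r i j)" for k
 have nn: "0 <= ?r i j" if "i \<in> {1..N}" "j \<in> {1..N}" "j <= i" for i j
  using repulsion_nonneg[OF l[OF that(1)] mono[OF that(2,1,3)]] .
 have cross0: "0 <= cross k" if "1 <= k" for k
  unfolding cross_def using that by (intro sum_nonneg nn) auto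
 have in_cross: "?r i j <= cross i" if "i \<in> {1..N}" "j \<in> {1..N}" "j < i" for i j
 proof -
  have "?r i j <= (\<Sum>j\<in>{1..<i}. ?r i j)"
   by (rule member_le_sum) (use that in \<open>auto intro!: nn\<close>)
  also have "\<dots> <= cross i" unfolding cross_def
   by (rule member_le_sum[where f = "%i'. \<Sum>j\<in>{1..<i}. ?r i' j"]) (use that in \<open>auto intro!: sum_nonneg nn\<close>)
  finally show ?thesis .
 qed
 have block: "\<beta> / 2 * cross k <= (\<Sum>i=k..N. jacobi_drift N a b \<beta> l i) + real N * (\<bar>a + 1\<bar> + \<bar>a + b + 2\<bar>) + \<beta> / 2 * (real N * real N)"
  if k: "k \<in> {1..N}" for k
 proof -
  let ?inner = "\<Sum>i\<in>{k..N}. \<Sum>j\<in>{k..N} - {i}. ?r i j"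
  have split: "(\<Sum>j\<in>{1..N} - {i}. ?r i j) = (\<Sum>j\<in>{1..<k}. ?r i j) + (\<Sum>j\<in>{k..N} - {i}. ?r i j)" if "i \<in> {k..N}" for i
  proof -
   have e: "{1..N} - {i} = {1..<k} \<union> ({k..N} - {i})" using that k by auto
   show ?thesis unfolding e by (rule sum.union_disjoint) auto
  qed
  have "(\<Sum>i=k..N. jacobi_drift N a b \<beta> l i) = (\<Sum>i=k..N. L i) + \<beta> / 2 * (\<Sum>i=k..N. \<Sum>j\<in>{1..N} - {i}. ?r i j)"
   by (simp add: D sum.distrib sum_distrib_left)
  also have "(\<Sum>i=k..N. \<Sum>j\<in>{1..N} - {i}. ?r i j) = cross k + ?inner"
   unfolding cross_def sum.distrib[symmetric] by (rule sum.cong[OF refl split])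
  finally have eq: "(\<Sum>i=k..N. jacobi_drift N a b \<beta> l i) = (\<Sum>i=k..N. L i) + \<beta> / 2 * cross k + \<beta> / 2 * ?inner"
   by (simp add: distrib_left)
  have "\<bar>\<Sum>i=k..N. L i\<bar> <= (\<Sum>i=k..N. \<bar>a + 1\<bar> + \<bar>a + b + 2\<bar>)"
   by (rule order_trans[OF sum_abs sum_mono]) (use Lb k in auto)
  also have "\<dots> <= real N * (\<bar>a + 1\<bar> + \<bar>a + b + 2\<bar>)" using k by (simp add: mult_right_mono)
  finally have 1: "\<bar>\<Sum>i=k..N. L i\<bar> <= real N * (\<bar>a + 1\<bar> + \<bar>a + b + 2\<bar>)" .
  have "\<bar>\<Sum>i\<in>{k..N}. \<Sum>j\<in>{k..N} - {i}. ?r i j + ?r j i\<bar> <= (\<Sum>i\<in>{k..N}. \<Sum>j\<in>{k..N} - {i}. 2)"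
  proof (intro order_trans[OF sum_abs sum_mono])
   fix i j assume "i \<in> {k..N}" "j \<in> {k..N} - {i}"
   then show "\<bar>?r i j + ?r j i\<bar> <= 2" using k by (intro repulsion_sum_bound l) auto
  qed
  also have "\<dots> <= (\<Sum>i\<in>{k..N}. real N * 2)"
  proof (rule sum_mono)
   fix i assume i: "i \<in> {k..N}"
   have "card ({k..N} - {i}) <= card {1..N}" using k by (intro card_mono) auto
   then show "(\<Sum>j\<in>{k..N} - {i}. 2) <= real N * 2" by simp
  qed
  also have "\<dots> <= real N * (real N * 2)" using k by (simp add: mult_right_mono)
  finally have "\<bar>\<Sum>i\<in>{k..N}. \<Sum>j\<in>{k..N} - {i}. ?r i j + ?r j i\<bar> <= real N * (real N * 2)" .
  moreover have "?inner = 1/2 * (\<Sum>i\<in>{k..N}. \<Sum>j\<in>{k..N} - {i}. ?r i j + ?r j i)"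
   by (rule sum_offdiagonal_symmetrize[OF finite_atLeastAtMost])
  ultimately have "\<bar>?inner\<bar> <= real N * real N" by (simp only: abs_mult)
  then have "\<beta> / 2 * \<bar>?inner\<bar> <= \<beta> / 2 * (real N * real N)" using \<beta> by (intro mult_left_mono) auto
  then have 2: "\<bar>\<beta> / 2 * ?inner\<bar> <= \<beta> / 2 * (real N * real N)" using \<beta> by (simp add: abs_mult)
  have "c <= s + n + y" if "s = u + c + v" "\<bar>u\<bar> <= n" "\<bar>v\<bar> <= y" for c s n y u v :: real
   using that by linarith
  from this[OF eq 1 2] show ?thesis .
 qed
 \<comment> \<open>Every pair \<open>j < i\<close> is separated by the block that starts at
   \<open>i\<close>, so \<open>tot\<close> dominates all pair repulsions at once; the opposite
   orientation of a pair costs the additional 2 below.\<close>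
 define tot where "tot = (\<Sum>k=1..N. cross k)"
 have tot_ge: "cross k <= tot" if "k \<in> {1..N}" for k
  unfolding tot_def by (rule member_le_sum) (use that cross0 in auto)
 have tot0: "0 <= tot" unfolding tot_def by (intro sum_nonneg cross0) simp
 have rb: "\<bar>?r i j\<bar> <= 2 + tot" if j: "j \<in> {1..N}" "j \<noteq> i" for j
 proof (cases "j < i")
  case True
  then show ?thesis using in_cross[OF i j(1) True] tot_ge[OF i] nn[OF i j(1)] by linarith
 next
  case False
  then have "i < j" using j by simp
  then have "0 <= ?r j i" "?r j i <= tot" using nn[OF j(1) i] in_cross[OF j(1) i] tot_ge[OF j(1)] by auto
  then show ?thesis using repulsion_sum_bound[OF l[OF i] l[OF j(1)]] by linarith
 qed
 have "\<bar>\<Sum>j\<in>{1..N} - {i}. ?r i j\<bar> <= (\<Sum>j\<in>{1..N} - {i}. 2 + tot)"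
  by (rule order_trans[OF sum_abs sum_mono]) (use rb in auto)
 also have "\<dots> <= real N * (2 + tot)"
 proof -
  have "real (card ({1..N} - {i})) <= real N" using card_mono[of "{1..N}" "{1..N} - {i}"] by simp
  then have "real (card ({1..N} - {i})) * (2 + tot) <= real N * (2 + tot)" using tot0 by (intro mult_right_mono) auto
  then show ?thesis by simp
 qed
 finally have "\<beta> / 2 * \<bar>\<Sum>j\<in>{1..N} - {i}. ?r i j\<bar> <= \<beta> / 2 * (real N * (2 + tot))" using \<beta> by (intro mult_left_mono) auto
 then have "\<bar>\<beta> / 2 * (\<Sum>j\<in>{1..N} - {i}. ?r i j)\<bar> <= \<beta> * real N + real N * (\<beta> / 2 * tot)" using \<beta> by (simp add: abs_mult algebra_simps)
 moreover have "\<beta> / 2 * tot <= (\<Sum>k=1..N. (\<Sum>i=k..N. jacobi_drift N a b \<beta> l i) + real N * (\<bar>a + 1\<bar> + \<bar>a + b + 2\<bar>) + \<beta> / 2 * (real N * real N))"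
  unfolding tot_def sum_distrib_left by (intro sum_mono block)
 then have "real N * (\<beta> / 2 * tot) <= real N * (\<Sum>k=1..N. (\<Sum>i=k..N. jacobi_drift N a b \<beta> l i) + real N * (\<bar>a + 1\<bar> + \<bar>a + b + 2\<bar>) + \<beta> / 2 * (real N * real N))"
  by (intro mult_left_mono) auto
 moreover have "\<bar>u + v\<bar> <= n + x + z" if "\<bar>v\<bar> <= x + y" "y <= z" "\<bar>u\<bar> <= n" for u v n x y z :: real
  using that by linarith
 ultimately show ?thesis using Lb[OF i] unfolding D[of i] by blast
qed

section \<open>The particle system as an instance of the abstract equations\<close>

lemma set_integral_Icc_eq_Ioc:
 fixes f :: "real => real"
 shows "(LINT u:{a..b}|lborel. f u) = (LINT u:{a<..b}|lborel. f u)"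
  and "set_integrable lborel {a..b} f \<longleftrightarrow> set_integrable lborel {a<..b} f"
 unfolding set_lebesgue_integral_def set_integrable_def
 by (rule integral_discrete_difference[where X = "{a}"] integrable_discrete_difference[where X = "{a}"]; auto simp: indicator_def)+

text \<open>The number of particles is fixed and time is not yet rescaled. \<open>g\<close> and
  \<open>E\<close> are the factor and the centre of the affine change of the particles.\<close>

locale jacobi =
 fixes M :: "'w measure" and N :: nat and a b c :: real and B :: "nat => real => 'w => real"
  and l0 :: "nat => real" and l :: "nat => real => 'w => real" and g E :: real
 assumes N: "1 <= N" and c: "0 <= c" and g: "0 < g"
  and process: "beta_jacobi_process M N a b (2 * c / real N) B l0 l"
begin

lemma process_facts:
 shows "prob_space M" and "independent_BMs M N B"
  and "\<forall>i\<in>{1..N}. \<forall>h\<in>space M. continuous_on {0..} (%t. l i t h)"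
  and "\<forall>i\<in>{1..N}. \<forall>t\<ge>0. \<forall>h\<in>space M. 0 <= l i t h \<and> l i t h <= 1"
  and "\<forall>i\<in>{1..N}. \<forall>j\<in>{1..N}. i <= j \<longrightarrow> (\<forall>t\<ge>0. \<forall>h\<in>space M. l i t h <= l j t h)"
  and "\<forall>i\<in>{1..N}. \<forall>t\<ge>0. l i t \<in> borel_measurable (BM_filtration M N B t)"
  and "\<forall>i\<in>{1..N}. \<forall>h\<in>space M. l i 0 h = l0 i"
  and "\<forall>i\<in>{1..N}. \<forall>j\<in>{1..N}. i \<noteq> j \<longrightarrow> (AE h in M. AE s in lborel. 0 <= s \<longrightarrow> l i s h \<noteq> l j s h)"
  and "\<forall>i\<in>{1..N}. \<exists>I. ito_integral M (BM_filtration M N B) (B i) (%s h. sqrt (2 * l i s h * (1 - l i s h))) I \<and>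
    (AE h in M. \<forall>t\<ge>0. set_integrable lborel {0..t} (%s. jacobi_drift N a b (2 * c / real N) (%j. l j s h) i) \<and>
      l i t h = l0 i + I t h + (LINT s:{0..t}|lborel. jacobi_drift N a b (2 * c / real N) (%j. l j s h) i))"
 using process unfolding beta_jacobi_process_def by - (elim conjE, assumption)+

sublocale BM: BM_system M N B
 by (intro BM_system.intro BM_system_axioms.intro process_facts(1,2))

lemma l_continuous: "i \<in> {1..N} ==> h \<in> space M ==> continuous_on {0..} (%t. l i t h)"
 using process_facts(3) by blast
lemma l_range: "i \<in> {1..N} ==> 0 <= t ==> h \<in> space M ==> l i t h \<in> {0..1}"
 using process_facts(4) by simp
lemma l_mono: "i \<in> {1..N} ==> j \<in> {1..N} ==> i <= j ==> 0 <= t ==> h \<in> space M ==> l i t h <= l j t h"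
 using process_facts(5) by blast
lemma l_adapted: "i \<in> {1..N} ==> 0 <= t ==> l i t \<in> borel_measurable (BM.F t)"
 using process_facts(6) by blast
lemma l_initial: "i \<in> {1..N} ==> h \<in> space M ==> l i 0 h = l0 i"
 using process_facts(7) by blast
lemma l_distinct: "i \<in> {1..N} ==> j \<in> {1..N} ==> i \<noteq> j ==> AE h in M. AE s in lborel. 0 <= s \<longrightarrow> l i s h \<noteq> l j s h"
 using process_facts(8) by blast

text \<open>\<open>max 0 u\<close> freezes the configuration before time 0, which makes the rates
  measurable on the product with all of \<open>lborel\<close>. The same device is used in
  \<open>H\<close> and \<open>Q\<close>.\<close>

definition jd :: "nat => real => 'w => real" where
 "jd i u h = jacobi_drift N a b (2 * c / real N) (%j. l j (max 0 u) h) i"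
definition X :: "nat => real => 'w => real" where
 "X i t h = g * (l i t h - E)"
definition D :: "nat => real => 'w => real" where
 "D i u h = g * jd i u h"
definition H :: "nat => real => 'w => real" where
 "H i u h = sqrt (2 * l i (max 0 u) h * (1 - l i (max 0 u) h))"
definition Q :: "nat => real => 'w => real" where
 "Q i u h = g^2 * (2 * l i (max 0 u) h * (1 - l i (max 0 u) h))"

lemma l_measurable: "i \<in> {1..N} ==> 0 <= t ==> l i t \<in> borel_measurable M"
 by (rule BM.measurable_of_F[OF l_adapted])

lemma l_joint: "i \<in> {1..N} ==> (%p. l i (max 0 (snd p)) (fst p)) \<in> borel_measurable (M \<Otimes>\<^sub>M lborel)"
 by (rule continuous_process_jointly_measurable[OF l_measurable l_continuous])

lemma H_joint: "i \<in> {1..N} ==> (%p. H i (snd p) (fst p)) \<in> borel_measurable (M \<Otimes>\<^sub>M lborel)"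
 unfolding H_def using l_joint by measurable

lemma Q_joint: "i \<in> {1..N} ==> (%p. Q i (snd p) (fst p)) \<in> borel_measurable (M \<Otimes>\<^sub>M lborel)"
 unfolding Q_def using l_joint by measurable

lemma jd_joint: "i \<in> {1..N} ==> (%p. jd i (snd p) (fst p)) \<in> borel_measurable (M \<Otimes>\<^sub>M lborel)"
 unfolding jd_def jacobi_drift_def
 by (intro borel_measurable_add borel_measurable_diff borel_measurable_times borel_measurable_sum borel_measurable_divide borel_measurable_const l_joint) auto

lemma D_joint: "i \<in> {1..N} ==> (%p. D i (snd p) (fst p)) \<in> borel_measurable (M \<Otimes>\<^sub>M lborel)"
 unfolding D_def by (intro borel_measurable_times borel_measurable_const jd_joint)

lemma variance_range: "i \<in> {1..N} ==> h \<in> space M ==> 2 * l i (max 0 u) h * (1 - l i (max 0 u) h) \<in> {0..2}"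
proof -
 assume a: "i \<in> {1..N}" "h \<in> space M"
 have r: "0 <= l i (max 0 u) h" "l i (max 0 u) h <= 1" using l_range[OF a(1) _ a(2), of "max 0 u"] by auto
 then have "2 * l i (max 0 u) h * (1 - l i (max 0 u) h) <= 2 * 1" by (intro mult_mono) auto
 then show ?thesis using r by auto
qed

lemma H_square: "i \<in> {1..N} ==> h \<in> space M ==> H i u h * H i u h = 2 * l i (max 0 u) h * (1 - l i (max 0 u) h)"
 using variance_range[of i h u] by (simp add: H_def)

lemma stochastic_integrals:
 obtains I where "\<And>i. i \<in> {1..N} ==> ito_integral M BM.F (B i) (H i) (I i)"
  "\<And>i. i \<in> {1..N} ==> AE h in M. \<forall>t\<ge>0. set_integrable lborel {0<..t} (%u. jd i u h) \<and>
    l i t h = l0 i + I i t h + (LINT u:{0<..t}|lborel. jd i u h)"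
proof -
 have "\<exists>I. \<forall>i\<in>{1..N}. ito_integral M BM.F (B i) (%s h. sqrt (2 * l i s h * (1 - l i s h))) (I i) \<and>
    (AE h in M. \<forall>t\<ge>0. set_integrable lborel {0..t} (%s. jacobi_drift N a b (2 * c / real N) (%j. l j s h) i) \<and>
      l i t h = l0 i + I i t h + (LINT s:{0..t}|lborel. jacobi_drift N a b (2 * c / real N) (%j. l j s h) i))"
  using process_facts(9) by (rule bchoice)
 then obtain I where I: "\<And>i. i \<in> {1..N} ==> ito_integral M BM.F (B i) (%s h. sqrt (2 * l i s h * (1 - l i s h))) (I i)"
  "\<And>i. i \<in> {1..N} ==> AE h in M. \<forall>t\<ge>0. set_integrable lborel {0..t} (%s. jacobi_drift N a b (2 * c / real N) (%j. l j s h) i) \<and>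
      l i t h = l0 i + I i t h + (LINT s:{0..t}|lborel. jacobi_drift N a b (2 * c / real N) (%j. l j s h) i)"
  by blast
 show ?thesis
 proof (rule that)
  fix i assume i: "i \<in> {1..N}"
  show "ito_integral M BM.F (B i) (H i) (I i)"
   by (rule ito_integral_cong[OF _ I(1)[OF i]]) (simp add: H_def max_def)
  show "AE h in M. \<forall>t\<ge>0. set_integrable lborel {0<..t} (%u. jd i u h) \<and>
    l i t h = l0 i + I i t h + (LINT u:{0<..t}|lborel. jd i u h)"
   using I(2)[OF i]
  proof eventually_elim
   case (elim h)
   show ?case
   proof (intro allI impI)
    fix t :: real assume t: "0 <= t"
    let ?f = "%s. jacobi_drift N a b (2 * c / real N) (%j. l j s h) i"
    have e: "set_integrable lborel {0<..t} ?f" "l i t h = l0 i + I i t h + (LINT s:{0<..t}|lborel. ?f s)"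
     using elim t unfolding set_integral_Icc_eq_Ioc by blast+
    have "set_integrable lborel {0<..t} (%u. jd i u h) \<longleftrightarrow> set_integrable lborel {0<..t} ?f"
     by (rule set_integrable_cong) (auto simp: jd_def max_def)
    moreover have "(LINT u:{0<..t}|lborel. jd i u h) = (LINT s:{0<..t}|lborel. ?f s)"
     by (rule set_lebesgue_integral_cong) (auto simp: jd_def max_def)
    ultimately show "set_integrable lborel {0<..t} (%u. jd i u h) \<and> l i t h = l0 i + I i t h + (LINT u:{0<..t}|lborel. jd i u h)"
     using e by simp
   qed
  qed
 qed
qed

text \<open>The substantial obligation is the square integrability of the total drift variation.
  \<open>jacobi_drift_bound\<close> reduces it to integrated drifts of top blocks, and the equation
  itself expresses these through the bounded particles and the Ito integrals, which are square
  integrable.\<close>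

lemma ito_system: "ito_system M BM.F {1..N} X D Q (g * (1 + \<bar>E\<bar>)) (g^2 * 2)"
proof -
 obtain I where I: "\<And>i. i \<in> {1..N} ==> ito_integral M BM.F (B i) (H i) (I i)"
  and eq: "\<And>i. i \<in> {1..N} ==> AE h in M. \<forall>t\<ge>0. set_integrable lborel {0<..t} (%u. jd i u h) \<and>
    l i t h = l0 i + I i t h + (LINT u:{0<..t}|lborel. jd i u h)"
  using stochastic_integrals by blast
 have Im: "I i t \<in> borel_measurable M" if "i \<in> {1..N}" "0 <= t" for i t
  using I[OF that(1)] that(2) by (auto simp: ito_integral_def intro: BM.measurable_of_F)
 have Dint: "AE h in M. set_integrable lborel {0<..t} (%u. D i u h)" if i: "i \<in> {1..N}" and t: "0 <= t" for i t
  using eq[OF i] unfolding D_def by eventually_elim (use t in auto)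
 have incr: "AE h in M. X i t h - X i s h - (LINT u:{s<..t}|lborel. D i u h) = g * (I i t h - I i s h)"
  if i: "i \<in> {1..N}" and st: "0 <= s" "s <= t" for i s t
  using eq[OF i]
 proof eventually_elim
  case (elim h)
  have t0: "0 <= t" using st by simp
  have "(LINT u:{0<..t}|lborel. jd i u h) = (LINT u:{0<..s}|lborel. jd i u h) + (LINT u:{s<..t}|lborel. jd i u h)"
   using elim t0 by (intro set_integral_Ioc_add st) blast
  moreover have "l i t h = l0 i + I i t h + (LINT u:{0<..t}|lborel. jd i u h)" "l i s h = l0 i + I i s h + (LINT u:{0<..s}|lborel. jd i u h)"
   using elim t0 st by blast+
  ultimately have "l i t h - l i s h - (LINT u:{s<..t}|lborel. jd i u h) = I i t h - I i s h" by simp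
  moreover have "X i t h - X i s h - (LINT u:{s<..t}|lborel. D i u h) = g * (l i t h - l i s h - (LINT u:{s<..t}|lborel. jd i u h))"
   unfolding X_def D_def by (simp add: algebra_simps)
  ultimately show ?case by simp
 qed
 have intDm: "(%h. LINT u:{s<..t}|lborel. D i u h) \<in> borel_measurable M" if i: "i \<in> {1..N}" for i s t
  unfolding set_lebesgue_integral_def
 proof (rule lborel.borel_measurable_lebesgue_integral)
  have "(%p. indicator {s<..t} (snd p) *\<^sub>R D i (snd p) (fst p)) \<in> borel_measurable (M \<Otimes>\<^sub>M lborel)"
   using D_joint[OF i] by measurable
  then show "case_prod (%h u. indicator {s<..t} u *\<^sub>R D i u h) \<in> borel_measurable (M \<Otimes>\<^sub>M lborel)"
   by (simp add: split_beta')
 qed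
 have Xm: "X i t \<in> borel_measurable (BM.F t)" if "i \<in> {1..N}" "0 <= t" for i t
  unfolding X_def[abs_def] by (intro borel_measurable_times borel_measurable_diff borel_measurable_const l_adapted that)
 have incm: "(%h. X i t h - X i s h - (LINT u:{s<..t}|lborel. D i u h)) \<in> borel_measurable M" if "i \<in> {1..N}" "0 <= s" "s <= t" for i s t
  using that by (intro borel_measurable_diff intDm BM.measurable_of_F[OF Xm]) auto
 have Isq: "integrable M (%h. (I i t h - I i s h)^2)" if "i \<in> {1..N}" "0 <= s" "s <= t" for i s t
  using BM.ito_increment_product(1)[OF that(1) that(1) I[OF that(1)] I[OF that(1)] H_joint[OF that(1)] H_joint[OF that(1)] that(2,3), of "%_. 0" 0] by simp
 have Vsq: "integrable M (%h. (LINT u:{0<..t}|lborel. \<bar>D i u h\<bar>)^2)" if i: "i \<in> {1..N}" and t: "0 <= t" for i t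
 proof -
  define \<beta> where "\<beta> = 2 * c / real N"
  have \<beta>: "0 <= \<beta>" unfolding \<beta>_def using c by simp
  define C1 where "C1 = \<bar>a + 1\<bar> + \<bar>a + b + 2\<bar> + \<beta> * real N"
  define C2 where "C2 = real N * (\<bar>a + 1\<bar> + \<bar>a + b + 2\<bar>) + \<beta> / 2 * (real N * real N)"
  \<comment> \<open>The bound of \<open>jacobi_drift_bound\<close> after integration over time, with
    every integrated drift replaced by \<open>l j t h - l0 j - I j t h\<close>.\<close>
  define U where "U h = C1 * t + real N * (\<Sum>k=1..N. (\<Sum>j=k..N. l j t h - l0 j - I j t h) + C2 * t)" for h
  have key: "AE h in M. (LINT u:{0<..t}|lborel. \<bar>jd i u h\<bar>) <= U h"
  proof -
   have all: "AE h in M. \<forall>j\<in>{1..N}. set_integrable lborel {0<..t} (%u. jd j u h) \<and> l j t h = l0 j + I j t h + (LINT u:{0<..t}|lborel. jd j u h)"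
   proof (rule AE_finite_allI)
    fix j assume "j \<in> {1..N}"
    from eq[OF this] show "AE h in M. set_integrable lborel {0<..t} (%u. jd j u h) \<and> l j t h = l0 j + I j t h + (LINT u:{0<..t}|lborel. jd j u h)"
     by eventually_elim (use t in blast)
   qed simp
   show ?thesis using all AE_space
   proof eventually_elim
    case (elim h)
    let ?R = "%u. C1 + real N * (\<Sum>k=1..N. (\<Sum>j=k..N. jd j u h) + C2)"
    have si: "set_integrable lborel {0<..t} (%u. \<Sum>j=k..N. jd j u h)" if "k \<in> {1..N}" for k
     by (rule set_integral_sum(1)) (use elim(1) that in auto)
    have si2: "set_integrable lborel {0<..t} (%u. (\<Sum>j=k..N. jd j u h) + C2)" if "k \<in> {1..N}" for k
     by (rule set_integral_add(1)[OF si[OF that] set_integrable_const_Ioc])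
    have si3: "set_integrable lborel {0<..t} (%u. \<Sum>k=1..N. (\<Sum>j=k..N. jd j u h) + C2)"
     by (rule set_integral_sum(1)[OF si2])
    have const: "(LINT u:{0<..t}|lborel. C) = C * t" for C :: real using t by (simp add: set_lebesgue_integral_def mult.commute)
    have "(LINT u:{0<..t}|lborel. \<bar>jd i u h\<bar>) <= (LINT u:{0<..t}|lborel. ?R u)"
    proof (rule set_integral_mono)
     show "set_integrable lborel {0<..t} (%u. \<bar>jd i u h\<bar>)" using elim(1) i by (intro set_integrable_abs) blast
     show "set_integrable lborel {0<..t} ?R"
      by (intro set_integral_add(1) set_integrable_const_Ioc set_integrable_mult_right) (rule si3)
     fix u
     show "\<bar>jd i u h\<bar> <= ?R u"
      using jacobi_drift_bound[of N "%j. l j (max 0 u) h" \<beta> i a b] l_range[OF _ _ elim(2), of _ "max 0 u"] l_mono[OF _ _ _ _ elim(2), of _ _ "max 0 u"] \<beta> i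
      unfolding jd_def \<beta>_def[symmetric] C1_def C2_def by (simp add: add.assoc)
    qed
    also have "\<dots> = C1 * t + real N * (\<Sum>k=1..N. (\<Sum>j=k..N. LINT u:{0<..t}|lborel. jd j u h) + C2 * t)"
    proof -
     have "(LINT u:{0<..t}|lborel. ?R u) = C1 * t + real N * (LINT u:{0<..t}|lborel. (\<Sum>k=1..N. (\<Sum>j=k..N. jd j u h) + C2))"
      using set_integral_add(2)[OF set_integrable_const_Ioc[of 0 t C1] set_integrable_mult_right[OF si3, of "real N"]] const[of C1] by simp
     also have "(LINT u:{0<..t}|lborel. (\<Sum>k=1..N. (\<Sum>j=k..N. jd j u h) + C2)) = (\<Sum>k=1..N. LINT u:{0<..t}|lborel. (\<Sum>j=k..N. jd j u h) + C2)"
      by (rule set_integral_sum(2)[OF si2])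
     also have "\<dots> = (\<Sum>k=1..N. (\<Sum>j=k..N. LINT u:{0<..t}|lborel. jd j u h) + C2 * t)"
     proof (rule sum.cong[OF refl])
      fix k assume k: "k \<in> {1..N}"
      have "(LINT u:{0<..t}|lborel. (\<Sum>j=k..N. jd j u h) + C2) = (LINT u:{0<..t}|lborel. (\<Sum>j=k..N. jd j u h)) + C2 * t"
       using set_integral_add(2)[OF si[OF k] set_integrable_const_Ioc[of 0 t C2]] const[of C2] by simp
      also have "(LINT u:{0<..t}|lborel. (\<Sum>j=k..N. jd j u h)) = (\<Sum>j=k..N. LINT u:{0<..t}|lborel. jd j u h)"
       by (rule set_integral_sum(2)) (use elim(1) k in auto)
      finally show "(LINT u:{0<..t}|lborel. (\<Sum>j=k..N. jd j u h) + C2) = (\<Sum>j=k..N. LINT u:{0<..t}|lborel. jd j u h) + C2 * t" .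
     qed
     finally show ?thesis .
    qed
    also have "\<dots> = U h"
    proof -
     have "(\<Sum>j=k..N. LINT u:{0<..t}|lborel. jd j u h) = (\<Sum>j=k..N. l j t h - l0 j - I j t h)" if "k \<in> {1..N}" for k
     proof (rule sum.cong[OF refl])
      fix j assume "j \<in> {k..N}"
      then have "j \<in> {1..N}" using that by auto
      then have "l j t h = l0 j + I j t h + (LINT u:{0<..t}|lborel. jd j u h)" using elim(1) by blast
      then show "(LINT u:{0<..t}|lborel. jd j u h) = l j t h - l0 j - I j t h" by simp
     qed
     then have "(\<Sum>k=1..N. (\<Sum>j=k..N. LINT u:{0<..t}|lborel. jd j u h) + C2 * t) = (\<Sum>k=1..N. (\<Sum>j=k..N. l j t h - l0 j - I j t h) + C2 * t)"
      by (intro sum.cong refl) (simp only:)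
     then show ?thesis unfolding U_def by (simp only:)
    qed
    finally show ?case .
   qed
  qed
  have ym: "(%h. l j t h - l0 j - I j t h) \<in> borel_measurable M" if j: "j \<in> {1..N}" for j
   by (intro borel_measurable_diff borel_measurable_const l_measurable Im j t)
  have ysq: "integrable M (%h. (l j t h - l0 j - I j t h)^2)" if j: "j \<in> {1..N}" for j
  proof (rule integrable_square_diff)
   show lm: "(%h. l j t h - l0 j) \<in> borel_measurable M" by (intro borel_measurable_diff borel_measurable_const l_measurable j t)
   show "integrable M (%h. (l j t h - l0 j)^2)"
   proof (rule BM.integrable_bounded)
    show "(%h. (l j t h - l0 j)^2) \<in> borel_measurable M" using lm by measurable
    fix h assume h: "h \<in> space M"
    have "\<bar>l j t h - l0 j\<bar> <= 1 + \<bar>l0 j\<bar>" using l_range[OF j t h] by auto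
    from power_mono[OF this, of 2] show "\<bar>(l j t h - l0 j)^2\<bar> <= (1 + \<bar>l0 j\<bar>)^2" by simp
   qed
   show "I j t \<in> borel_measurable M" by (rule Im[OF j t])
   \<comment> \<open>So far only the increments of \<open>I j\<close> are known to be square
     integrable. At time 0 all simple integrals vanish, so the approximation forces the square of
     \<open>I j 0\<close> to have integral 0.\<close>
   obtain X where X: "\<And>m::nat. simple_predictable M BM.F (X m)"
    and XI: "(%m. \<integral>\<^sup>+h. ennreal ((simple_integral_BM (B j) (X m) 0 h - I j 0 h)^2) \<partial>M) \<longlonglongrightarrow> 0"
    using I[OF j] unfolding ito_integral_def by blast
   have "simple_integral_BM (B j) (X m) 0 h = 0" for m h
    using BM.simple_time(1)[OF X, of _ m] by (auto simp: simple_integral_BM_def min_def intro!: sum.neutral)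
   then have "(%m::nat. \<integral>\<^sup>+h. ennreal ((I j 0 h)^2) \<partial>M) \<longlonglongrightarrow> 0" using XI by simp
   then have "(\<integral>\<^sup>+h. ennreal ((I j 0 h)^2) \<partial>M) = 0" by (simp add: LIMSEQ_const_iff)
   then have I0: "integrable M (%h. (I j 0 h)^2)"
    using Im[OF j order_refl] by (intro integrableI_nonneg) auto
   have "integrable M (%h. ((I j t h - I j 0 h) + I j 0 h)^2)"
    by (rule integrable_square_add[OF borel_measurable_diff[OF Im[OF j t] Im[OF j order_refl]] Im[OF j order_refl] Isq[OF j order_refl t] I0])
   then show "integrable M (%h. (I j t h)^2)" by simp
  qed
  have csq: "integrable M (%h. (C::real)^2)" for C by simp
  have zm: "(%h. (\<Sum>j=k..N. l j t h - l0 j - I j t h) + C2 * t) \<in> borel_measurable M" if "k \<in> {1..N}" for k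
   using that by (intro borel_measurable_add borel_measurable_sum borel_measurable_const ym) auto
  have zsq: "integrable M (%h. ((\<Sum>j=k..N. l j t h - l0 j - I j t h) + C2 * t)^2)" if k: "k \<in> {1..N}" for k
  proof (rule integrable_square_add[OF _ _ _ csq])
   show "(%h. \<Sum>j=k..N. l j t h - l0 j - I j t h) \<in> borel_measurable M" using k by (intro borel_measurable_sum ym) auto
   show "integrable M (%h. (\<Sum>j=k..N. l j t h - l0 j - I j t h)^2)"
    using k by (intro integrable_square_sum ym ysq) auto
  qed simp
  have Um: "U \<in> borel_measurable M" unfolding U_def[abs_def]
   by (rule borel_measurable_add[OF borel_measurable_const borel_measurable_times[OF borel_measurable_const borel_measurable_sum[OF zm]]])
  have Usq: "integrable M (%h. (U h)^2)"
   unfolding U_def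
  proof (rule integrable_square_add[OF _ _ csq])
   show "(%h. real N * (\<Sum>k=1..N. (\<Sum>j=k..N. l j t h - l0 j - I j t h) + C2 * t)) \<in> borel_measurable M"
    by (rule borel_measurable_times[OF borel_measurable_const borel_measurable_sum[OF zm]])
   show "integrable M (%h. (real N * (\<Sum>k=1..N. (\<Sum>j=k..N. l j t h - l0 j - I j t h) + C2 * t))^2)"
    unfolding power_mult_distrib by (intro integrable_mult_right integrable_square_sum zm zsq) auto
  qed simp
  have Vm: "(%h. LINT u:{0<..t}|lborel. \<bar>D i u h\<bar>) \<in> borel_measurable M"
   unfolding set_lebesgue_integral_def
  proof (rule lborel.borel_measurable_lebesgue_integral)
   have "(%p. indicator {0<..t} (snd p) *\<^sub>R \<bar>D i (snd p) (fst p)\<bar>) \<in> borel_measurable (M \<Otimes>\<^sub>M lborel)"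
    using D_joint[OF i] by measurable
   then show "case_prod (%h u. indicator {0<..t} u *\<^sub>R \<bar>D i u h\<bar>) \<in> borel_measurable (M \<Otimes>\<^sub>M lborel)"
    by (simp add: split_beta')
  qed
  show ?thesis
  proof (rule Bochner_Integration.integrable_bound)
   show "integrable M (%h. g^2 * (U h)^2)" using Usq by simp
   show "(%h. (LINT u:{0<..t}|lborel. \<bar>D i u h\<bar>)^2) \<in> borel_measurable M" using Vm by measurable
   show "AE h in M. norm ((LINT u:{0<..t}|lborel. \<bar>D i u h\<bar>)^2) <= norm (g^2 * (U h)^2)"
    using key
   proof eventually_elim
    case (elim h)
    have e: "(LINT u:{0<..t}|lborel. \<bar>D i u h\<bar>) = g * (LINT u:{0<..t}|lborel. \<bar>jd i u h\<bar>)"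
     unfolding D_def abs_mult using g by simp
    have nn: "0 <= (LINT u:{0<..t}|lborel. \<bar>jd i u h\<bar>)" by (simp add: set_lebesgue_integral_def)
    have "(LINT u:{0<..t}|lborel. \<bar>jd i u h\<bar>)^2 <= (U h)^2" by (rule power_mono[OF elim nn])
    then show ?case unfolding e by (simp add: power_mult_distrib mult_left_mono)
   qed
  qed
 qed
 have P: "(\<integral>u\<in>{s<..t}. H i u h * H i u h \<partial>lborel) * g^2 = (LINT u:{s<..t}|lborel. Q i u h)" if i: "i \<in> {1..N}" and h: "h \<in> space M" for i s t h
  unfolding H_square[OF i h] Q_def by simp
 show ?thesis
 proof (intro ito_system.intro ito_system_axioms.intro)
  show "prob_space M" by (rule BM.prob_space_axioms)
  show "finite {1..N}" by simp
  show "subalgebra M (BM.F t)" for t by (rule subalgebra_BM_filtration(1)[OF BM.indep_BMs])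
  show "s <= t ==> subalgebra (BM.F t) (BM.F s)" for s t by (rule subalgebra_BM_filtration(2)[OF BM.indep_BMs])
  show "i \<in> {1..N} ==> 0 <= t ==> X i t \<in> borel_measurable (BM.F t)" for i t by (rule Xm)
  show "i \<in> {1..N} ==> h \<in> space M ==> continuous_on {0..} (%t. X i t h)" for i h
   unfolding X_def by (intro continuous_intros l_continuous)
  show "0 <= g * (1 + \<bar>E\<bar>)" using g by simp
  show "\<bar>X i t h\<bar> <= g * (1 + \<bar>E\<bar>)" if "i \<in> {1..N}" "0 <= t" "h \<in> space M" for i t h
  proof -
   have "\<bar>l i t h - E\<bar> <= 1 + \<bar>E\<bar>" using l_range[OF that] by auto
   then show ?thesis unfolding X_def abs_mult using g by (simp add: mult_left_mono)
  qed
  show "i \<in> {1..N} ==> (%p. D i (snd p) (fst p)) \<in> borel_measurable (M \<Otimes>\<^sub>M lborel)" for i by (rule D_joint)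
  show "i \<in> {1..N} ==> (%p. Q i (snd p) (fst p)) \<in> borel_measurable (M \<Otimes>\<^sub>M lborel)" for i by (rule Q_joint)
  show "0 <= g^2 * 2" by simp
  show "\<bar>Q i u h\<bar> <= g^2 * 2" if "i \<in> {1..N}" "h \<in> space M" for i u h
  proof -
   have "\<bar>2 * l i (max 0 u) h * (1 - l i (max 0 u) h)\<bar> <= 2" using variance_range[OF that, of u] by simp
   then have "\<bar>g^2\<bar> * \<bar>2 * l i (max 0 u) h * (1 - l i (max 0 u) h)\<bar> <= \<bar>g^2\<bar> * 2" by (rule mult_left_mono) simp
   then show ?thesis unfolding Q_def abs_mult[of "g^2"] by simp
  qed
  show "i \<in> {1..N} ==> 0 <= t ==> AE h in M. set_integrable lborel {0<..t} (%u. D i u h)" for i t by (rule Dint)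
  show "i \<in> {1..N} ==> 0 <= t ==> integrable M (%h. (LINT u:{0<..t}|lborel. \<bar>D i u h\<bar>)^2)" for i t by (rule Vsq)
  show "BM.expectation (%h. Z h * (X i t h - X i s h - (LINT u:{s<..t}|lborel. D i u h))) = 0"
   if i: "i \<in> {1..N}" and st: "0 <= s" "s <= t" and Z: "Z \<in> borel_measurable (BM.F s)" "\<And>h. h \<in> space M ==> \<bar>Z h\<bar> <= C" for i s t Z C
  proof -
   have "BM.expectation (%h. Z h * (X i t h - X i s h - (LINT u:{s<..t}|lborel. D i u h))) = BM.expectation (%h. g * (Z h * (I i t h - I i s h)))"
   proof (rule integral_cong_AE)
    show "(%h. Z h * (X i t h - X i s h - (LINT u:{s<..t}|lborel. D i u h))) \<in> borel_measurable M"
     by (intro borel_measurable_times BM.measurable_of_F[OF Z(1)] incm i st)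
    show "(%h. g * (Z h * (I i t h - I i s h))) \<in> borel_measurable M"
     using st by (intro borel_measurable_times borel_measurable_const borel_measurable_diff BM.measurable_of_F[OF Z(1)] Im i) auto
    show "AE h in M. Z h * (X i t h - X i s h - (LINT u:{s<..t}|lborel. D i u h)) = g * (Z h * (I i t h - I i s h))"
     using incr[OF i st] by eventually_elim (simp only: mult.left_commute)
   qed
   also have "\<dots> = g * BM.expectation (%h. Z h * (I i t h - I i s h))" by simp
   also have "\<dots> = 0"
    using BM.ito_increment_product(2)[OF i i I[OF i] I[OF i] H_joint[OF i] H_joint[OF i] st Z] by simp
   finally show ?thesis .
  qed
  show "BM.expectation (%h. Z h * ((X i t h - X i s h - (LINT u:{s<..t}|lborel. D i u h)) * (X j t h - X j s h - (LINT u:{s<..t}|lborel. D j u h))))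
    = (if i = j then BM.expectation (%h. Z h * (LINT u:{s<..t}|lborel. Q i u h)) else 0)"
   if i: "i \<in> {1..N}" and j: "j \<in> {1..N}" and st: "0 <= s" "s <= t" and Z: "Z \<in> borel_measurable (BM.F s)" "\<And>h. h \<in> space M ==> \<bar>Z h\<bar> <= C" for i j s t Z C
  proof -
   have "BM.expectation (%h. Z h * ((X i t h - X i s h - (LINT u:{s<..t}|lborel. D i u h)) * (X j t h - X j s h - (LINT u:{s<..t}|lborel. D j u h))))
    = BM.expectation (%h. g^2 * (Z h * ((I i t h - I i s h) * (I j t h - I j s h))))"
   proof (rule integral_cong_AE)
    show "(%h. Z h * ((X i t h - X i s h - (LINT u:{s<..t}|lborel. D i u h)) * (X j t h - X j s h - (LINT u:{s<..t}|lborel. D j u h)))) \<in> borel_measurable M"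
     by (intro borel_measurable_times BM.measurable_of_F[OF Z(1)] incm i j st)
    show "(%h. g^2 * (Z h * ((I i t h - I i s h) * (I j t h - I j s h)))) \<in> borel_measurable M"
     using st by (intro borel_measurable_times borel_measurable_const borel_measurable_diff BM.measurable_of_F[OF Z(1)] Im i j) auto
    show "AE h in M. Z h * ((X i t h - X i s h - (LINT u:{s<..t}|lborel. D i u h)) * (X j t h - X j s h - (LINT u:{s<..t}|lborel. D j u h)))
      = g^2 * (Z h * ((I i t h - I i s h) * (I j t h - I j s h)))"
     using incr[OF i st] incr[OF j st] by eventually_elim (simp only: power2_eq_square mult_ac)
   qed
   also have "\<dots> = g^2 * BM.expectation (%h. Z h * ((I i t h - I i s h) * (I j t h - I j s h)))" by simp
   also have "\<dots> = (if i = j then BM.expectation (%h. g^2 * (Z h * (\<integral>u\<in>{s<..t}. H i u h * H j u h \<partial>lborel))) else 0)"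
    using BM.ito_increment_product(3)[OF i j I[OF i] I[OF j] H_joint[OF i] H_joint[OF j] st Z] by simp
   also have "\<dots> = (if i = j then BM.expectation (%h. Z h * (LINT u:{s<..t}|lborel. Q i u h)) else 0)"
   proof (cases "i = j")
    case True
    have "BM.expectation (%h. g^2 * (Z h * (\<integral>u\<in>{s<..t}. H i u h * H i u h \<partial>lborel))) = BM.expectation (%h. Z h * (LINT u:{s<..t}|lborel. Q i u h))"
     by (intro Bochner_Integration.integral_cong refl) (simp only: P[OF i, symmetric] mult_ac)
    then show ?thesis using True by simp
   qed simp
   finally show ?thesis .
  qed
 qed
qed

end

section \<open>Power means and their drift\<close>

text \<open>The sum of \<open>x i ^ k / (x i - x j)\<close> over all ordered pairs of distinct
  indices, divided by \<open>N^2\<close> and written in power means; see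
  \<open>offdiagonal_power_sum\<close>. The subtracted term removes the diagonal.\<close>

definition pair_poly :: "nat => (nat => real) => nat => real" where
 "pair_poly N P k = 1/2 * (\<Sum>p<k. P p * P (k - 1 - p)) - real k / (2 * real N) * P (k - 1)"

text \<open>The drift of the \<open>m\<close>-th power mean, as a polynomial in the power means. The linear part
 of the one-particle drift is \<open>e1 - e2 x\<close> and its squared diffusion coefficient is
 \<open>q0 + q1 x - q2 x^2\<close>.\<close>

definition drift_poly :: "nat => real => real => real => real => real => real => nat => (nat => real) => real" where
 "drift_poly N c e1 e2 q0 q1 q2 m P =
   real m * (e1 * P (m - 1) - e2 * P m)
   + c * real m * (q0 * pair_poly N P (m - 1) + q1 * pair_poly N P m - q2 * pair_poly N P (m + 1))
   + real m * (real m - 1) / 2 * (q0 * P (m - 2) + q1 * P (m - 1) - q2 * P m)"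

lemma power_mean_sum: "1 <= N ==> (\<Sum>i=1..N. x i ^ k) = real N * power_mean N x k"
 by (simp add: power_mean_def)

text \<open>Exchanging \<open>i\<close> and \<open>j\<close> pairs the terms to a divided difference
  of the \<open>k\<close>-th power, which is a sum of mixed monomials of degree
  \<open>k - 1\<close>. Completed by the diagonal, such a sum becomes a product of power
  sums.\<close>

lemma offdiagonal_power_sum:
 assumes N: "1 <= N" and dist: "\<And>i j. i \<in> {1..N} ==> j \<in> {1..N} ==> i \<noteq> j ==> x i \<noteq> x j"
 shows "(\<Sum>i=1..N. \<Sum>j\<in>{1..N} - {i}. x i ^ k / (x i - x j)) = (real N)^2 * pair_poly N (power_mean N x) k"
proof -
 let ?P = "power_mean N x"
 have eq: "x i ^ k / (x i - x j) + x j ^ k / (x j - x i) = (\<Sum>p<k. x i ^ p * x j ^ (k - 1 - p))"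
  if "i \<in> {1..N}" "j \<in> {1..N} - {i}" for i j
 proof -
  define d where "d = x i - x j"
  have d: "d \<noteq> 0" "x j - x i = - d" using dist[of i j] that by (auto simp: d_def)
  have "x i ^ k / (x i - x j) + x j ^ k / (x j - x i) = (x i ^ k - x j ^ k) / d"
   unfolding d(2) d_def[symmetric] by (simp add: diff_divide_distrib)
  also have "x i ^ k - x j ^ k = d * (\<Sum>p<k. x j ^ (k - Suc p) * x i ^ p)" unfolding d_def by (rule power_diff_sumr2)
  also have "d * (\<Sum>p<k. x j ^ (k - Suc p) * x i ^ p) / d = (\<Sum>p<k. x i ^ p * x j ^ (k - 1 - p))"
   using d(1) by (simp add: mult.commute)
  finally show ?thesis .
 qed
 have "(\<Sum>i=1..N. \<Sum>j\<in>{1..N} - {i}. x i ^ k / (x i - x j)) = 1/2 * (\<Sum>i=1..N. \<Sum>j\<in>{1..N} - {i}. x i ^ k / (x i - x j) + x j ^ k / (x j - x i))"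
  by (rule sum_offdiagonal_symmetrize) simp
 also have "(\<Sum>i=1..N. \<Sum>j\<in>{1..N} - {i}. x i ^ k / (x i - x j) + x j ^ k / (x j - x i))
   = (\<Sum>i=1..N. \<Sum>j\<in>{1..N} - {i}. \<Sum>p<k. x i ^ p * x j ^ (k - 1 - p))"
  by (intro sum.cong refl eq)
 also have "\<dots> = (\<Sum>i=1..N. (\<Sum>j=1..N. \<Sum>p<k. x i ^ p * x j ^ (k - 1 - p)) - real k * x i ^ (k - 1))"
 proof (rule sum.cong[OF refl])
  fix i assume i: "i \<in> {1..N}"
  have "(\<Sum>p<k. x i ^ p * x i ^ (k - 1 - p)) = (\<Sum>p<k. x i ^ (k - 1))"
   by (rule sum.cong[OF refl]) (simp flip: power_add)
  then show "(\<Sum>j\<in>{1..N} - {i}. \<Sum>p<k. x i ^ p * x j ^ (k - 1 - p)) = (\<Sum>j=1..N. \<Sum>p<k. x i ^ p * x j ^ (k - 1 - p)) - real k * x i ^ (k - 1)"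
   using i by (simp add: sum_diff1)
 qed
 also have "\<dots> = (\<Sum>i=1..N. \<Sum>j=1..N. \<Sum>p<k. x i ^ p * x j ^ (k - 1 - p)) - real k * (real N * ?P (k - 1))"
  unfolding power_mean_sum[OF N, symmetric] by (simp add: sum_subtractf sum_distrib_left)
 also have "(\<Sum>i=1..N. \<Sum>j=1..N. \<Sum>p<k. x i ^ p * x j ^ (k - 1 - p)) = (\<Sum>p<k. (real N * ?P p) * (real N * ?P (k - 1 - p)))"
 proof -
  have "(\<Sum>i=1..N. \<Sum>j=1..N. \<Sum>p<k. x i ^ p * x j ^ (k - 1 - p)) = (\<Sum>i=1..N. \<Sum>p<k. \<Sum>j=1..N. x i ^ p * x j ^ (k - 1 - p))"
   by (intro sum.cong refl sum.swap)
  also have "\<dots> = (\<Sum>p<k. \<Sum>i=1..N. \<Sum>j=1..N. x i ^ p * x j ^ (k - 1 - p))" by (rule sum.swap)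
  also have "\<dots> = (\<Sum>p<k. (real N * ?P p) * (real N * ?P (k - 1 - p)))"
   unfolding power_mean_sum[OF N, symmetric] sum_product ..
  finally show ?thesis .
 qed
 also have "1/2 * ((\<Sum>p<k. (real N * ?P p) * (real N * ?P (k - 1 - p))) - real k * (real N * ?P (k - 1))) = (real N)^2 * pair_poly N ?P k"
 proof -
  have "(\<Sum>p<k. (real N * ?P p) * (real N * ?P (k - 1 - p))) = (real N)^2 * (\<Sum>p<k. ?P p * ?P (k - 1 - p))"
   by (simp add: sum_distrib_left power2_eq_square mult_ac)
  moreover have "real N \<noteq> 0" using N by simp
  then have "(real N)^2 * (real k / (2 * real N) * ?P (k - 1)) = 1/2 * (real k * (real N * ?P (k - 1)))"
   by (simp add: power2_eq_square field_simps)
  ultimately show ?thesis unfolding pair_poly_def by (simp add: right_diff_distrib)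
 qed
 finally show ?thesis .
qed

text \<open>The singular interaction terms combine to a polynomial by antisymmetrization.\<close>

lemma drift_identity:
 fixes x q :: "nat => real"
 assumes N: "1 <= N" and dist: "\<And>i j. i \<in> {1..N} ==> j \<in> {1..N} ==> i \<noteq> j ==> x i \<noteq> x j"
  and q: "\<And>i. i \<in> {1..N} ==> q i = q0 + q1 * x i - q2 * (x i)^2"
  and D: "\<And>i. i \<in> {1..N} ==> D i = e1 - e2 * x i + c / real N * (\<Sum>j\<in>{1..N} - {i}. q i / (x i - x j))"
 shows "(\<Sum>i=1..N. 1 / real N * (real m * x i ^ (m - 1) * D i + real m * (real m - 1) / 2 * x i ^ (m - 2) * q i))
  = drift_poly N c e1 e2 q0 q1 q2 m (power_mean N x)"
proof -
 let ?P = "power_mean N x"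
 have N0: "real N \<noteq> 0" using N by simp
 have off: "(\<Sum>i=1..N. \<Sum>j\<in>{1..N} - {i}. x i ^ k / (x i - x j)) = (real N)^2 * pair_poly N ?P k" for k
  by (rule offdiagonal_power_sum[OF N dist])
 \<comment> \<open>With truncated subtraction \<open>x i ^ (m - 1) * x i\<close> differs from
   \<open>x i ^ m\<close> when \<open>m = 0\<close>; the vanishing prefactor restores the identity.
   The same happens in the next two facts for \<open>m <= 1\<close>.\<close>
 have pw1: "real m * (x i ^ (m - 1) * x i) = real m * x i ^ m" for i by (cases m) auto
 have pw2: "real m * (real m - 1) / 2 * (x i ^ (m - 2) * x i) = real m * (real m - 1) / 2 * x i ^ (m - 1)"
  and pw3: "real m * (real m - 1) / 2 * (x i ^ (m - 2) * (x i)^2) = real m * (real m - 1) / 2 * x i ^ m" for i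
 proof -
  consider "m = 0" | "m = 1" | k where "m = Suc (Suc k)" by (metis One_nat_def nat.exhaust)
  note cases = this
  show "real m * (real m - 1) / 2 * (x i ^ (m - 2) * x i) = real m * (real m - 1) / 2 * x i ^ (m - 1)"
   using cases by cases simp_all
  show "real m * (real m - 1) / 2 * (x i ^ (m - 2) * (x i)^2) = real m * (real m - 1) / 2 * x i ^ m"
   using cases by cases (simp_all add: power2_eq_square)
 qed
 have t1: "real m * x i ^ (m - 1) * (e1 - e2 * x i) = real m * (e1 * x i ^ (m - 1)) - real m * (e2 * x i ^ m)" for i
 proof -
  have "real m * x i ^ (m - 1) * (e1 - e2 * x i) = real m * (e1 * x i ^ (m - 1)) - e2 * (real m * (x i ^ (m - 1) * x i))"
   by (simp add: algebra_simps)
  then show ?thesis unfolding pw1 by simp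
 qed
 have t3: "real m * (real m - 1) / 2 * x i ^ (m - 2) * q i
   = real m * (real m - 1) / 2 * (q0 * x i ^ (m - 2) + q1 * x i ^ (m - 1) - q2 * x i ^ m)" if "i \<in> {1..N}" for i
 proof -
  have "C * p * (q0 + q1 * y - q2 * y^2) = q0 * (C * p) + q1 * (C * (p * y)) - q2 * (C * (p * y^2))"
   and "C * (q0 * p + q1 * p' - q2 * p'') = q0 * (C * p) + q1 * (C * p') - q2 * (C * p'')" for C p p' p'' y
   by (simp_all add: algebra_simps)
  then show ?thesis unfolding q[OF that] by (simp only: pw2 pw3)
 qed
 have t2: "real m * (x i ^ (m - 1) * q i) = real m * (q0 * x i ^ (m - 1) + q1 * x i ^ m - q2 * x i ^ (m + 1))" if "i \<in> {1..N}" for i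
 proof -
  have "real m * (x i ^ (m - 1) * q i) = q0 * (real m * x i ^ (m - 1)) + q1 * (real m * (x i ^ (m - 1) * x i)) - q2 * (real m * (x i ^ (m - 1) * x i)) * x i"
   unfolding q[OF that] by (simp add: algebra_simps power2_eq_square)
  then show ?thesis unfolding pw1 by (simp add: algebra_simps)
 qed
 have "(\<Sum>i=1..N. 1 / real N * (real m * x i ^ (m - 1) * D i + real m * (real m - 1) / 2 * x i ^ (m - 2) * q i))
  = (\<Sum>i=1..N. (real m * (e1 * (1 / real N * x i ^ (m - 1))) - real m * (e2 * (1 / real N * x i ^ m)))
    + c / (real N)^2 * (\<Sum>j\<in>{1..N} - {i}. real m * (x i ^ (m - 1) * q i) / (x i - x j))
    + real m * (real m - 1) / 2 * (q0 * (1 / real N * x i ^ (m - 2)) + q1 * (1 / real N * x i ^ (m - 1)) - q2 * (1 / real N * x i ^ m)))"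
 proof (rule sum.cong[OF refl])
  fix i assume i: "i \<in> {1..N}"
  \<comment> \<open>One factor \<open>1 / real N\<close> from the mean and one from the interaction
    strength combine to the inverse square, which matches the \<open>N^2\<close> produced by the
    off-diagonal sum.\<close>
  have scale: "1 / real N * ((real m * (e1 * y1) - real m * (e2 * y2)) + c / real N * Z + C * (q0 * y3 + q1 * y4 - q2 * y5))
   = (real m * (e1 * (1 / real N * y1)) - real m * (e2 * (1 / real N * y2))) + c / (real N)^2 * Z
    + C * (q0 * (1 / real N * y3) + q1 * (1 / real N * y4) - q2 * (1 / real N * y5))" for C Z y1 y2 y3 y4 y5
   using N0 by (simp add: power2_eq_square field_simps)
  have s: "(\<Sum>j\<in>{1..N} - {i}. real m * (x i ^ (m - 1) * q i) / (x i - x j)) = real m * x i ^ (m - 1) * (\<Sum>j\<in>{1..N} - {i}. q i / (x i - x j))"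
   by (simp add: sum_distrib_left mult.assoc)
  have "real m * x i ^ (m - 1) * D i = real m * x i ^ (m - 1) * (e1 - e2 * x i) + c / real N * (real m * x i ^ (m - 1) * (\<Sum>j\<in>{1..N} - {i}. q i / (x i - x j)))"
   unfolding D[OF i] by (simp add: algebra_simps)
  then have "1 / real N * (real m * x i ^ (m - 1) * D i + real m * (real m - 1) / 2 * x i ^ (m - 2) * q i)
   = 1 / real N * ((real m * (e1 * x i ^ (m - 1)) - real m * (e2 * x i ^ m)) + c / real N * (real m * x i ^ (m - 1) * (\<Sum>j\<in>{1..N} - {i}. q i / (x i - x j)))
     + real m * (real m - 1) / 2 * (q0 * x i ^ (m - 2) + q1 * x i ^ (m - 1) - q2 * x i ^ m))"
   unfolding t1 t3[OF i] by (simp only:)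
  then show "1 / real N * (real m * x i ^ (m - 1) * D i + real m * (real m - 1) / 2 * x i ^ (m - 2) * q i)
   = (real m * (e1 * (1 / real N * x i ^ (m - 1))) - real m * (e2 * (1 / real N * x i ^ m)))
    + c / (real N)^2 * (\<Sum>j\<in>{1..N} - {i}. real m * (x i ^ (m - 1) * q i) / (x i - x j))
    + real m * (real m - 1) / 2 * (q0 * (1 / real N * x i ^ (m - 2)) + q1 * (1 / real N * x i ^ (m - 1)) - q2 * (1 / real N * x i ^ m))"
   using scale unfolding s by (simp only:)
 qed
 also have "\<dots> = (real m * (e1 * ?P (m - 1)) - real m * (e2 * ?P m))
   + c / (real N)^2 * (\<Sum>i=1..N. \<Sum>j\<in>{1..N} - {i}. real m * (x i ^ (m - 1) * q i) / (x i - x j))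
   + real m * (real m - 1) / 2 * (q0 * ?P (m - 2) + q1 * ?P (m - 1) - q2 * ?P m)"
  by (simp only: sum.distrib sum_subtractf sum_distrib_left[symmetric] power_mean_def)
 also have "(\<Sum>i=1..N. \<Sum>j\<in>{1..N} - {i}. real m * (x i ^ (m - 1) * q i) / (x i - x j))
   = (\<Sum>i=1..N. \<Sum>j\<in>{1..N} - {i}. real m * (q0 * (x i ^ (m - 1) / (x i - x j)) + q1 * (x i ^ m / (x i - x j)) - q2 * (x i ^ (m + 1) / (x i - x j))))"
 proof (intro sum.cong refl)
  have div: "r * (q0 * y1 + q1 * y2 - q2 * y3) / d = r * (q0 * (y1 / d) + q1 * (y2 / d) - q2 * (y3 / d))" for r y1 y2 y3 d
   by (simp add: divide_inverse algebra_simps)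
  show "real m * (x i ^ (m - 1) * q i) / (x i - x j) = real m * (q0 * (x i ^ (m - 1) / (x i - x j)) + q1 * (x i ^ m / (x i - x j)) - q2 * (x i ^ (m + 1) / (x i - x j)))"
   if "i \<in> {1..N}" for i j using that by (simp only: t2 div)
 qed
 also have "\<dots> = real m * (q0 * ((real N)^2 * pair_poly N ?P (m - 1)) + q1 * ((real N)^2 * pair_poly N ?P m) - q2 * ((real N)^2 * pair_poly N ?P (m + 1)))"
  by (simp only: sum.distrib sum_subtractf sum_distrib_left[symmetric] off)
 also have "c / (real N)^2 * (real m * (q0 * ((real N)^2 * pair_poly N ?P (m - 1)) + q1 * ((real N)^2 * pair_poly N ?P m) - q2 * ((real N)^2 * pair_poly N ?P (m + 1))))
   = c * real m * (q0 * pair_poly N ?P (m - 1) + q1 * pair_poly N ?P m - q2 * pair_poly N ?P (m + 1))"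
 proof -
  have "c / (real N)^2 * (real m * (q0 * ((real N)^2 * u) + q1 * ((real N)^2 * v) - q2 * ((real N)^2 * w))) = c * real m * (q0 * u + q1 * v - q2 * w)" for u v w
   using N0 by (simp add: field_simps)
  then show ?thesis .
 qed
 finally show ?thesis unfolding drift_poly_def by (simp add: right_diff_distrib)
qed

section \<open>Domination by even power means\<close>

lemma power_mean_0: "1 <= N ==> power_mean N x 0 = 1"
 by (simp add: power_mean_def)

lemma power_mean_even_nonneg: "even k ==> 0 <= power_mean N x k"
 unfolding power_mean_def by (intro mult_nonneg_nonneg sum_nonneg zero_le_even_power) auto

text \<open>Pointwise, \<open>\<bar>y\<bar> ^ p * \<bar>z\<bar> ^ q\<close> is at most the
  \<open>k\<close>-th power of the maximum of 1, \<open>\<bar>y\<bar>\<close> and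
  \<open>\<bar>z\<bar>\<close>, hence at most the sum of the three \<open>k\<close>-th powers.
  Averaging over all pairs, each of the two particles contributes one power mean.\<close>

lemma power_mean_mult_bound:
 assumes N: "1 <= N" and k: "even k" "p + q <= k"
 shows "\<bar>power_mean N x p * power_mean N x q\<bar> <= 1 + 2 * power_mean N x k"
proof -
 have one: "\<bar>y\<bar> ^ p * \<bar>z\<bar> ^ q <= 1 + y ^ k + z ^ k" for y z :: real
 proof -
  define w where "w = max 1 (max \<bar>y\<bar> \<bar>z\<bar>)"
  have w: "1 <= w" "\<bar>y\<bar> <= w" "\<bar>z\<bar> <= w" by (auto simp: w_def)
  have "\<bar>y\<bar> ^ p * \<bar>z\<bar> ^ q <= w ^ p * w ^ q" using w by (intro mult_mono power_mono) auto
  also have "\<dots> = w ^ (p + q)" by (simp add: power_add)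
  also have "\<dots> <= w ^ k" by (rule power_increasing[OF k(2) w(1)])
  also have "\<dots> <= 1 + \<bar>y\<bar> ^ k + \<bar>z\<bar> ^ k"
  proof -
   have "w = 1 \<or> w = \<bar>y\<bar> \<or> w = \<bar>z\<bar>" by (auto simp: w_def max_def)
   moreover have "0 <= \<bar>y\<bar> ^ k" "0 <= \<bar>z\<bar> ^ k" by simp_all
   ultimately show ?thesis by (elim disjE) simp_all
  qed
  also have "\<dots> = 1 + y ^ k + z ^ k" using k(1) by (simp add: power_even_abs)
  finally show ?thesis .
 qed
 have N0: "real N > 0" using N by simp
 have "\<bar>(\<Sum>i=1..N. x i ^ p) * (\<Sum>j=1..N. x j ^ q)\<bar> = \<bar>\<Sum>i=1..N. \<Sum>j=1..N. x i ^ p * x j ^ q\<bar>" by (simp only: sum_product)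
 also have "\<dots> <= (\<Sum>i=1..N. \<Sum>j=1..N. 1 + x i ^ k + x j ^ k)"
 proof (intro order_trans[OF sum_abs sum_mono])
  fix i j show "\<bar>x i ^ p * x j ^ q\<bar> <= 1 + x i ^ k + x j ^ k" using one[of "x i" "x j"] by (simp add: abs_mult power_abs)
 qed
 also have "\<dots> = real N * real N + 2 * (real N * (\<Sum>i=1..N. x i ^ k))"
  by (simp add: sum.distrib sum_distrib_left[symmetric] algebra_simps)
 finally have "\<bar>(\<Sum>i=1..N. x i ^ p) * (\<Sum>j=1..N. x j ^ q)\<bar> / (real N * real N) <= (real N * real N + 2 * (real N * (\<Sum>i=1..N. x i ^ k))) / (real N * real N)"
  by (rule divide_right_mono) simp
 then show ?thesis using N0 by (simp add: power_mean_def abs_mult field_simps)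
qed

lemma power_mean_bound:
 assumes "1 <= N" "even k" "p <= k"
 shows "\<bar>power_mean N x p\<bar> <= 1 + 2 * power_mean N x k"
 using power_mean_mult_bound[of N k 0 p x] assms by (simp add: power_mean_0)

text \<open>\<open>pair_poly\<close> of index \<open>n\<close> has degree \<open>n - 1\<close>,
  hence the condition \<open>n <= k + 1\<close>. This is why the drift of order \<open>m\<close>,
  which contains the index \<open>m + 1\<close>, is still controlled by any even order
  \<open>k\<close> with \<open>m <= k\<close>.\<close>

lemma pair_poly_bound:
 fixes x :: "nat => real"
 assumes N: "1 <= N" and k: "even k" "n <= k + 1"
 defines "W \<equiv> 1 + 2 * power_mean N x k"
 shows "\<bar>pair_poly N (power_mean N x) n\<bar> <= real n * W"
  and "\<bar>1/2 * (\<Sum>p<n. power_mean N x p * power_mean N x (n - 1 - p))\<bar> <= real n * W"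
proof -
 let ?P = "power_mean N x"
 have W0: "0 <= W" unfolding W_def using power_mean_even_nonneg[OF k(1), of N x] by simp
 have "\<bar>\<Sum>p<n. ?P p * ?P (n - 1 - p)\<bar> <= (\<Sum>p<n. W)"
  unfolding W_def by (intro order_trans[OF sum_abs sum_mono] power_mean_mult_bound[OF N k(1)]) (use k(2) in auto)
 then have 1: "\<bar>1/2 * (\<Sum>p<n. ?P p * ?P (n - 1 - p))\<bar> <= 1/2 * (real n * W)" unfolding abs_mult by simp
 have nW: "0 <= real n * W" using W0 by simp
 show "\<bar>1/2 * (\<Sum>p<n. ?P p * ?P (n - 1 - p))\<bar> <= real n * W" using 1 nW by linarith
 have P: "\<bar>?P (n - 1)\<bar> <= W" unfolding W_def by (rule power_mean_bound[OF N k(1)]) (use k(2) in simp)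
 have "\<bar>real n / (2 * real N)\<bar> <= real n / 2" using N divide_left_mono[of "2 * 1" "2 * real N" "real n"] by simp
 then have 2: "\<bar>real n / (2 * real N) * ?P (n - 1)\<bar> <= (real n / 2) * W"
  unfolding abs_mult by (rule mult_mono[OF _ P]) auto
 have "\<bar>u - v\<bar> <= real n * W" if "\<bar>u\<bar> <= 1/2 * (real n * W)" "\<bar>v\<bar> <= (real n / 2) * W" for u v
  using that by simp
 then show "\<bar>pair_poly N ?P n\<bar> <= real n * W" unfolding pair_poly_def using 1 2 by blast
qed

lemma abs_mult_le: "\<bar>x\<bar> <= (y::real) ==> \<bar>r * x\<bar> <= \<bar>r\<bar> * y"
 unfolding abs_mult by (rule mult_left_mono) auto

definition limit_poly :: "real => real => nat => (nat => real) => real" where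
 "limit_poly c v n P = (if n < 2 then 0 else
   v * (c * real n / 2) * (\<Sum>j=0..n-2. P j * P (n - 2 - j)) + v * (1/2) * real n * (real n - 1) * P (n - 2))"

lemma limit_poly_0: "limit_poly c 0 n P = 0"
 by (simp add: limit_poly_def)

text \<open>Measures how far the coefficients are from the values
  \<open>e1 = e2 = q1 = q2 = 0\<close> and \<open>q0 = v\<close> that give
  \<open>limit_poly\<close>; the term with \<open>real N\<close> accounts for the diagonal
  correction. For \<open>v = 0\<close> the limit polynomial vanishes, so the same quantity bounds
  the drift itself.\<close>

definition drift_gap :: "nat => real => real => real => real => real => real => real => nat => real" where
 "drift_gap N c e1 e2 q0 q1 q2 v n =
   real n * (\<bar>e1\<bar> + \<bar>e2\<bar>) + c * real n * (real n + 1) * (\<bar>q0 - v\<bar> + \<bar>q0\<bar> / real N + \<bar>q1\<bar> + \<bar>q2\<bar>)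
    + real n * real n * (\<bar>q0 - v\<bar> + \<bar>q1\<bar> + \<bar>q2\<bar>)"

lemma drift_poly_limit_bound:
 assumes N: "1 <= N" and c: "0 <= c" and k: "even k" "n <= k"
 shows "\<bar>drift_poly N c e1 e2 q0 q1 q2 n (power_mean N x) - limit_poly c v n (power_mean N x)\<bar>
  <= drift_gap N c e1 e2 q0 q1 q2 v n * (1 + 2 * power_mean N x k)"
proof -
 let ?P = "power_mean N x"
 define W where "W = 1 + 2 * ?P k"
 have W0: "0 <= W" unfolding W_def using power_mean_even_nonneg[OF k(1), of N x] by simp
 have P: "\<bar>?P j\<bar> <= W" if "j <= n" for j unfolding W_def by (rule power_mean_bound[OF N k(1)]) (use that k(2) in simp)
 have T: "\<bar>pair_poly N ?P j\<bar> <= (real n + 1) * W" if "j <= n + 1" for j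
 proof -
  have "\<bar>pair_poly N ?P j\<bar> <= real j * W" unfolding W_def by (rule pair_poly_bound(1)[OF N k(1)]) (use that k(2) in simp)
  also have "\<dots> <= (real n + 1) * W" using that by (intro mult_right_mono W0) auto
  finally show ?thesis .
 qed
 let ?A = "1/2 * (\<Sum>p<n - 1. ?P p * ?P (n - 1 - 1 - p))"
 have A: "\<bar>?A\<bar> <= (real n + 1) * W"
 proof -
  have "\<bar>?A\<bar> <= real (n - 1) * W" unfolding W_def by (rule pair_poly_bound(2)[OF N k(1)]) (use k(2) in simp)
  also have "\<dots> <= (real n + 1) * W" by (intro mult_right_mono W0) auto
  finally show ?thesis .
 qed
 have B: "\<bar>real (n - 1) / 2 * ?P (n - 1 - 1)\<bar> <= (real n + 1) * W"
 proof -
  have "\<bar>real (n - 1) / 2 * ?P (n - 1 - 1)\<bar> <= \<bar>real (n - 1) / 2\<bar> * W" by (intro abs_mult_le P) simp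
  also have "\<dots> <= (real n + 1) * W" by (intro mult_right_mono W0) auto
  finally show ?thesis .
 qed
 \<comment> \<open>The diagonal correction is separated, since it becomes small through
   \<open>1 / real N\<close> and not through the coefficients.\<close>
 have split: "pair_poly N ?P (n - 1) = ?A - 1 / real N * (real (n - 1) / 2 * ?P (n - 1 - 1))"
  unfolding pair_poly_def by simp
 have lim: "limit_poly c v n ?P = c * real n * (v * ?A) + real n * (real n - 1) / 2 * (v * ?P (n - 2))"
 proof (cases "n < 2")
  case True
  then have "n = 0 \<or> n = 1" by auto
  then show ?thesis by (auto simp: limit_poly_def)
 next
  case False
  then have "{0..n - 2} = {..<n - 1}" "n - 1 - 1 = n - 2" by auto
  then show ?thesis using False by (simp add: limit_poly_def algebra_simps)
 qed
 have eq: "drift_poly N c e1 e2 q0 q1 q2 n ?P - limit_poly c v n ?P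
  = real n * (e1 * ?P (n - 1) - e2 * ?P n)
   + c * real n * ((q0 - v) * ?A - (q0 / real N) * (real (n - 1) / 2 * ?P (n - 1 - 1)) + q1 * pair_poly N ?P n - q2 * pair_poly N ?P (n + 1))
   + real n * (real n - 1) / 2 * ((q0 - v) * ?P (n - 2) + q1 * ?P (n - 1) - q2 * ?P n)"
 proof -
  have "(real n * E1 + c * real n * (q0 * (A - 1 / real N * Bv) + U) + C2 * (q0 * P2 + V)) - (c * real n * (v * A) + C2 * (v * P2))
   = real n * E1 + c * real n * ((q0 - v) * A - (q0 / real N) * Bv + U) + C2 * ((q0 - v) * P2 + V)" for E1 A Bv U C2 P2 V :: real
   by (simp add: algebra_simps)
  from this[of "e1 * ?P (n - 1) - e2 * ?P n" ?A "real (n - 1) / 2 * ?P (n - 1 - 1)" "q1 * pair_poly N ?P n - q2 * pair_poly N ?P (n + 1)"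
    "real n * (real n - 1) / 2" "?P (n - 2)" "q1 * ?P (n - 1) - q2 * ?P n"]
  show ?thesis unfolding drift_poly_def lim split by (simp only: add_diff_eq add.assoc)
 qed
 have tri4: "\<bar>u - u' + v - w\<bar> <= A + A' + B + C" if "\<bar>u\<bar> <= A" "\<bar>u'\<bar> <= A'" "\<bar>v\<bar> <= B" "\<bar>w\<bar> <= C" for u u' v w A A' B C :: real using that by linarith
 have tri3: "\<bar>u + v - w\<bar> <= A + B + C" if "\<bar>u\<bar> <= A" "\<bar>v\<bar> <= B" "\<bar>w\<bar> <= C" for u v w A B C :: real using that by linarith
 have tri2: "\<bar>u - v\<bar> <= A + B" if "\<bar>u\<bar> <= A" "\<bar>v\<bar> <= B" for u v A B :: real using that by linarith
 have tri3': "\<bar>u + v + w\<bar> <= A + B + C" if "\<bar>u\<bar> <= A" "\<bar>v\<bar> <= B" "\<bar>w\<bar> <= C" for u v w A B C :: real using that by linarith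
 have a: "\<bar>e1 * ?P (n - 1) - e2 * ?P n\<bar> <= \<bar>e1\<bar> * W + \<bar>e2\<bar> * W"
  by (intro tri2 abs_mult_le P) auto
 have b: "\<bar>(q0 - v) * ?A - (q0 / real N) * (real (n - 1) / 2 * ?P (n - 1 - 1)) + q1 * pair_poly N ?P n - q2 * pair_poly N ?P (n + 1)\<bar>
   <= \<bar>q0 - v\<bar> * ((real n + 1) * W) + \<bar>q0 / real N\<bar> * ((real n + 1) * W) + \<bar>q1\<bar> * ((real n + 1) * W) + \<bar>q2\<bar> * ((real n + 1) * W)"
  by (rule tri4[OF abs_mult_le[OF A] abs_mult_le[OF B] abs_mult_le[OF T] abs_mult_le[OF T]]) auto
 have d: "\<bar>(q0 - v) * ?P (n - 2) + q1 * ?P (n - 1) - q2 * ?P n\<bar> <= \<bar>q0 - v\<bar> * W + \<bar>q1\<bar> * W + \<bar>q2\<bar> * W"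
  by (intro tri3 abs_mult_le P) auto
 have c2: "\<bar>real n * (real n - 1) / 2\<bar> <= real n * real n"
 proof (cases n)
  case (Suc k)
  then have "0 <= real n * (real n - 1) / 2" by simp
  moreover have "real n * (real n - 1) / 2 <= real n * real n" by (simp add: algebra_simps)
  ultimately show ?thesis by simp
 qed simp
 have Q0: "0 <= \<bar>q0 - v\<bar> * W + \<bar>q1\<bar> * W + \<bar>q2\<bar> * W" using W0 by simp
 have "\<bar>drift_poly N c e1 e2 q0 q1 q2 n ?P - limit_poly c v n ?P\<bar> <= \<bar>real n\<bar> * (\<bar>e1\<bar> * W + \<bar>e2\<bar> * W)
   + \<bar>c * real n\<bar> * (\<bar>q0 - v\<bar> * ((real n + 1) * W) + \<bar>q0 / real N\<bar> * ((real n + 1) * W) + \<bar>q1\<bar> * ((real n + 1) * W) + \<bar>q2\<bar> * ((real n + 1) * W))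
   + \<bar>real n * (real n - 1) / 2\<bar> * (\<bar>q0 - v\<bar> * W + \<bar>q1\<bar> * W + \<bar>q2\<bar> * W)"
  unfolding eq by (intro tri3' abs_mult_le a b d)
 also have "\<dots> <= real n * (\<bar>e1\<bar> * W + \<bar>e2\<bar> * W)
   + c * real n * (\<bar>q0 - v\<bar> * ((real n + 1) * W) + \<bar>q0\<bar> / real N * ((real n + 1) * W) + \<bar>q1\<bar> * ((real n + 1) * W) + \<bar>q2\<bar> * ((real n + 1) * W))
   + real n * real n * (\<bar>q0 - v\<bar> * W + \<bar>q1\<bar> * W + \<bar>q2\<bar> * W)"
  using mult_right_mono[OF c2 Q0] c by (simp add: abs_mult)
 also have "\<dots> = drift_gap N c e1 e2 q0 q1 q2 v n * W"
  unfolding drift_gap_def by (simp add: algebra_simps)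
 finally show ?thesis unfolding W_def .
qed

text \<open>Formulated for bounded integrable \<open>f\<close>, without continuity. In the supremum
  norm weighted by \<open>exp (- (2 * L * u))\<close> the integral term is at most half the norm
  \<open>s\<close>, so \<open>s <= A + s / 2\<close>; this is the origin of the factor 2 and of the
  rate \<open>2 * L\<close>.\<close>

lemma exponential_Gronwall:
 fixes f :: "real => real"
 assumes L: "0 < L" and A: "0 <= A" and f0: "\<And>t. 0 <= t ==> t <= T ==> 0 <= f t \<and> f t <= C"
  and int: "\<And>t. 0 <= t ==> t <= T ==> set_integrable lborel {0<..t} f"
  and le: "\<And>t. 0 <= t ==> t <= T ==> f t <= A + L * (LINT u:{0<..t}|lborel. f u)"
  and t: "0 <= t" "t <= T"
 shows "f t <= 2 * A * exp (2 * L * T)"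
proof -
 define s where "s = (SUP u\<in>{0..T}. exp (- (2 * L * u)) * f u)"
 have T: "0 <= T" using t by simp
 have bdd: "bdd_above ((%u. exp (- (2 * L * u)) * f u) ` {0..T})"
 proof (intro bdd_aboveI2[where M = C])
  fix u assume u: "u \<in> {0..T}"
  then have "exp (- (2 * L * u)) * f u <= 1 * C" using f0[of u] L by (intro mult_mono) auto
  then show "exp (- (2 * L * u)) * f u <= C" by simp
 qed
 have s: "f u <= s * exp (2 * L * u)" if "0 <= u" "u <= T" for u
 proof -
  have "exp (- (2 * L * u)) * f u <= s" unfolding s_def using that by (intro cSUP_upper bdd) auto
  then have "exp (2 * L * u) * (exp (- (2 * L * u)) * f u) <= exp (2 * L * u) * s" by (rule mult_left_mono) simp
  then show ?thesis by (simp add: exp_minus field_simps)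
 qed
 have s0: "0 <= s"
 proof -
  have "0 <= exp (- (2 * L * 0)) * f 0" using f0[of 0] T by simp
  also have "\<dots> <= s" unfolding s_def using T by (intro cSUP_upper bdd) auto
  finally show ?thesis .
 qed
 have "s <= A + s / 2"
 proof (unfold s_def, rule cSUP_least)
  show "{0..T} \<noteq> {}" using T by simp
  fix u assume u: "u \<in> {0..T}"
  have e: "has_bochner_integral lborel (%x. (2 * L * exp (2 * L * x)) * indicator {0..u} x) (exp (2 * L * u) - exp (2 * L * 0))"
   by (rule has_bochner_integral_FTC_Icc_nonneg) (use u L in \<open>auto intro!: derivative_eq_intros simp: mult_ac\<close>)
  have e': "set_integrable lborel {0<..u} (%x. 2 * L * exp (2 * L * x))"
   and ev: "(LINT x:{0<..u}|lborel. 2 * L * exp (2 * L * x)) = exp (2 * L * u) - 1"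
   using e unfolding set_integral_Icc_eq_Ioc[symmetric] unfolding has_bochner_integral_iff set_integrable_def set_lebesgue_integral_def
   by (simp_all only: real_scaleR_def mult.commute[of "indicator _ _"] mult_zero_right exp_zero simp_thms)
  have ei: "set_integrable lborel {0<..u} (%x. s / (2 * L) * (2 * L * exp (2 * L * x)))"
   by (rule set_integrable_mult_right[OF e'])
  have "(LINT x:{0<..u}|lborel. f x) <= (LINT x:{0<..u}|lborel. s / (2 * L) * (2 * L * exp (2 * L * x)))"
   by (rule set_integral_mono[OF int ei]) (use s u L in auto)
  also have "\<dots> = s / (2 * L) * (exp (2 * L * u) - 1)" unfolding ev[symmetric] by (rule set_integral_mult_right)
  also have "\<dots> <= s / (2 * L) * exp (2 * L * u)" using s0 L by (intro mult_left_mono) auto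
  finally have "L * (LINT x:{0<..u}|lborel. f x) <= L * (s / (2 * L) * exp (2 * L * u))" using L by (intro mult_left_mono) auto
  also have "\<dots> = s / 2 * exp (2 * L * u)" using L by simp
  finally have "f u <= A + s / 2 * exp (2 * L * u)" using le[of u] u by simp
  then have "exp (- (2 * L * u)) * f u <= exp (- (2 * L * u)) * (A + s / 2 * exp (2 * L * u))" by (rule mult_left_mono) simp
  also have "\<dots> = exp (- (2 * L * u)) * A + s / 2" by (simp add: exp_minus field_simps)
  also have "\<dots> <= 1 * A + s / 2" using u L A by (intro add_right_mono mult_right_mono) auto
  finally show "exp (- (2 * L * u)) * f u <= A + (SUP u\<in>{0..T}. exp (- (2 * L * u)) * f u) / 2" by (simp add: s_def)
 qed
 then have s2: "s <= 2 * A" by simp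
 have "f t <= s * exp (2 * L * t)" by (rule s[OF t])
 also have "\<dots> <= (2 * A) * exp (2 * L * T)" using t L s2 s0 A by (intro mult_mono) auto
 finally show ?thesis .
qed

section \<open>Estimates for a fixed number of particles\<close>

context jacobi begin

sublocale sys: ito_system M BM.F "{1..N}" X D Q "g * (1 + \<bar>E\<bar>)" "g^2 * 2"
 by (rule ito_system)

text \<open>Inserting \<open>l = E + x / g\<close> turns the linear drift into
  \<open>e1 - e2 * x\<close> and the squared diffusion coefficient into
  \<open>q0 + q1 * x - 2 * x^2\<close>; the role of \<open>q2\<close> is thus played by the constant
  2.\<close>

definition e1 where "e1 = g * (a + 1 - (a + b + 2) * E)"
definition e2 where "e2 = a + b + 2"
definition q0 where "q0 = 2 * g^2 * E * (1 - E)"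
definition q1 where "q1 = 2 * g * (1 - 2 * E)"
definition S :: "nat => real => 'w => real" where "S k t h = power_mean N (%i. X i t h) k"
definition gap :: "real => nat => real" where "gap v n = drift_gap N c e1 e2 q0 q1 2 v n"
definition dr :: "nat => real => 'w => real" where
 "dr m u h = drift_poly N c e1 e2 q0 q1 2 m (%k. S k u h)"

lemma gap_nonneg: "0 <= gap v n"
 unfolding gap_def drift_gap_def using c by simp

lemma drift_gap_bound: "even k ==> n <= k ==> \<bar>dr n u h - limit_poly c v n (%k. S k u h)\<bar> <= gap v n * (1 + 2 * S k u h)"
 unfolding dr_def S_def gap_def by (rule drift_poly_limit_bound[OF N c])

lemma dr_bound: "even k ==> n <= k ==> \<bar>dr n u h\<bar> <= gap 0 n * (1 + 2 * S k u h)"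
 using drift_gap_bound[of k n u h 0] by (simp add: limit_poly_0)

lemma S_nonneg: "even k ==> 0 <= S k t h"
 unfolding S_def by (rule power_mean_even_nonneg)

lemma S_adapted: "0 <= t ==> S k t \<in> borel_measurable (BM.F t)"
 unfolding S_def[abs_def] power_mean_def
 by (intro borel_measurable_times borel_measurable_const borel_measurable_sum borel_measurable_power sys.X_adapted) auto

lemma S_continuous: "h \<in> space M ==> continuous_on {0..} (%t. S k t h)"
 unfolding S_def power_mean_def
 by (intro continuous_on_mult continuous_on_const continuous_on_sum continuous_on_power sys.X_continuous) auto

lemma S_initial: "h \<in> space M ==> S k 0 h = power_mean N (%i. g * (l0 i - E)) k"
 unfolding S_def power_mean_def X_def by (simp add: l_initial)

lemma S_upper:
 assumes "even k" "0 <= t" "h \<in> space M"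
 shows "S k t h <= (g * (1 + \<bar>E\<bar>)) ^ k"
proof -
 have "(\<Sum>i=1..N. X i t h ^ k) <= (\<Sum>i=1..N. (g * (1 + \<bar>E\<bar>)) ^ k)"
  by (intro sum_mono order_trans[OF abs_ge_self sys.power_X_bounded] assms)
 then have "(\<Sum>i=1..N. X i t h ^ k) <= real N * (g * (1 + \<bar>E\<bar>)) ^ k" by simp
 then show ?thesis unfolding S_def power_mean_def using N by (simp add: field_simps)
qed

lemma dr_continuous: "h \<in> space M ==> continuous_on {0..} (%u. dr m u h)"
 unfolding dr_def drift_poly_def pair_poly_def
 by (intro continuous_on_add continuous_on_diff continuous_on_mult continuous_on_const continuous_on_sum S_continuous)

lemma dr_adapted: "0 <= u ==> dr m u \<in> borel_measurable (BM.F u)"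
 unfolding dr_def[abs_def] drift_poly_def pair_poly_def
 by (intro borel_measurable_add borel_measurable_diff borel_measurable_times borel_measurable_const borel_measurable_sum S_adapted)

lemma Q_quadratic: "0 <= u ==> Q i u h = q0 + q1 * X i u h - 2 * (X i u h)^2"
 unfolding Q_def q0_def q1_def X_def by (simp add: algebra_simps power2_eq_square)

text \<open>\<open>drift_identity\<close> needs distinct particles. Here enters the requirement on
  the process that collisions occupy a Lebesgue null set of times.\<close>

lemma drift_eq:
 "AE h in M. AE u in lborel. 0 < u \<longrightarrow>
   dr m u h = (\<Sum>i=1..N. 1 / real N * (real m * X i u h ^ (m - 1) * D i u h + real m * (real m - 1) / 2 * X i u h ^ (m - 2) * Q i u h))"
proof -
 have "AE h in M. \<forall>i\<in>{1..N}. \<forall>j\<in>{1..N}. i \<noteq> j \<longrightarrow> (AE s in lborel. 0 <= s \<longrightarrow> l i s h \<noteq> l j s h)"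
 proof (intro AE_finite_allI)
  fix i j assume "i \<in> {1..N}" "j \<in> {1..N}"
  then show "AE h in M. i \<noteq> j \<longrightarrow> (AE s in lborel. 0 <= s \<longrightarrow> l i s h \<noteq> l j s h)"
   using l_distinct[of i j] by (cases "i = j") auto
 qed auto
 then show ?thesis
 proof eventually_elim
  case (elim h)
  have "AE s in lborel. \<forall>i\<in>{1..N}. \<forall>j\<in>{1..N}. i \<noteq> j \<longrightarrow> 0 <= s \<longrightarrow> l i s h \<noteq> l j s h"
  proof (intro AE_finite_allI)
   fix i j assume "i \<in> {1..N}" "j \<in> {1..N}"
   then show "AE s in lborel. i \<noteq> j \<longrightarrow> 0 <= s \<longrightarrow> l i s h \<noteq> l j s h"
    using elim by (cases "i = j") auto
  qed auto
  then show ?case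
  proof eventually_elim
   case (elim u)
   show ?case
   proof
    assume u: "0 < u"
    have "l i u h \<noteq> l j u h" if "i \<in> {1..N}" "j \<in> {1..N}" "i \<noteq> j" for i j using elim u that by simp
    then have dist: "X i u h \<noteq> X j u h" if "i \<in> {1..N}" "j \<in> {1..N}" "i \<noteq> j" for i j using that g by (simp add: X_def)
    have Du: "D i u h = e1 - e2 * X i u h + c / real N * (\<Sum>j\<in>{1..N} - {i}. Q i u h / (X i u h - X j u h))" for i
    proof -
     have "c / real N * (\<Sum>j\<in>{1..N} - {i}. Q i u h / (X i u h - X j u h))
      = g * (2 * c / real N / 2 * (\<Sum>j\<in>{1..N} - {i}. 2 * l i u h * (1 - l i u h) / (l i u h - l j u h)))"
     proof -
      have "Q i u h / (X i u h - X j u h) = g * (2 * l i u h * (1 - l i u h) / (l i u h - l j u h))" for j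
      proof -
       have "X i u h - X j u h = g * (l i u h - l j u h)" by (simp add: X_def algebra_simps)
       then show ?thesis using u g by (simp add: Q_def power2_eq_square)
      qed
      then have "(\<Sum>j\<in>{1..N} - {i}. Q i u h / (X i u h - X j u h)) = g * (\<Sum>j\<in>{1..N} - {i}. 2 * l i u h * (1 - l i u h) / (l i u h - l j u h))"
       unfolding sum_distrib_left by (rule sum.cong[OF refl])
      then show ?thesis by simp
     qed
     moreover have "e1 - e2 * X i u h = g * (a + 1 - (a + b + 2) * l i u h)" by (simp add: e1_def e2_def X_def algebra_simps)
     moreover have "jd i u h = (a + 1 - (a + b + 2) * l i u h) + 2 * c / real N / 2 * (\<Sum>j\<in>{1..N} - {i}. 2 * l i u h * (1 - l i u h) / (l i u h - l j u h))"
      using u by (simp only: jd_def jacobi_drift_def max_absorb2 less_imp_le)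
     ultimately show ?thesis unfolding D_def by (simp only: distrib_left)
    qed
    show "dr m u h = (\<Sum>i=1..N. 1 / real N * (real m * X i u h ^ (m - 1) * D i u h + real m * (real m - 1) / 2 * X i u h ^ (m - 2) * Q i u h))"
     unfolding dr_def S_def
     by (rule drift_identity[OF N, symmetric]) (use dist Du Q_quadratic[of u _ h] u in auto)
   qed
  qed
 qed
qed

text \<open>The last constant is \<open>dr_bound\<close> with the even order \<open>2 * m\<close>,
  combined with \<open>S_upper\<close>. It grows with \<open>g\<close>, but the conclusions drawn
  from the locale no longer contain it, except to guarantee integrability.\<close>

sublocale pf: power_functional M BM.F "{1..N}" X D Q "g * (1 + \<bar>E\<bar>)" "g^2 * 2" "1 / real N" m "dr m" "gap 0 m * (1 + 2 * (g * (1 + \<bar>E\<bar>)) ^ (2 * m))" for m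
proof unfold_locales
 show "\<bar>dr m u h\<bar> <= gap 0 m * (1 + 2 * (g * (1 + \<bar>E\<bar>)) ^ (2 * m))" if "0 <= u" "h \<in> space M" for u h
 proof (rule order_trans[OF dr_bound[of "2 * m" m u h]])
  show "gap 0 m * (1 + 2 * S (2 * m) u h) <= gap 0 m * (1 + 2 * (g * (1 + \<bar>E\<bar>)) ^ (2 * m))"
   using S_upper[of "2 * m" u h] that gap_nonneg[of 0 m] by (intro mult_left_mono) auto
 qed auto
 show "0 <= gap 0 m * (1 + 2 * (g * (1 + \<bar>E\<bar>)) ^ (2 * m))"
  using gap_nonneg[of 0 m] g by simp
qed (rule dr_continuous dr_adapted drift_eq; assumption)+

lemma psum_eq: "pf.psum m t h = S m t h"
 unfolding pf.psum_def S_def power_mean_def by (simp add: sum_distrib_left)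

lemma S_measurable: "0 <= t ==> S k t \<in> borel_measurable M"
 by (rule sys.F_measurable[OF _ S_adapted])

lemma S_joint: "(%p. S k (max 0 (snd p)) (fst p)) \<in> borel_measurable (M \<Otimes>\<^sub>M lborel)"
 by (rule continuous_process_jointly_measurable[OF S_measurable S_continuous])

text \<open>The weight \<open>1 + 2 S\<^sub>k\<close> for even \<open>k\<close> dominates all power means of lower order.\<close>

definition W :: "nat => real => 'w => real" where "W k t h = 1 + 2 * S k (max 0 t) h"

lemma W_joint: "(%p. W k (snd p) (fst p)) \<in> borel_measurable (M \<Otimes>\<^sub>M lborel)"
 unfolding W_def using S_joint by measurable

lemma W_bounds:
 assumes "even k" shows "0 <= W k t h" "h \<in> space M ==> \<bar>W k t h\<bar> <= 1 + 2 * (g * (1 + \<bar>E\<bar>)) ^ k"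
 using S_nonneg[OF assms, of "max 0 t" h] S_upper[OF assms, of "max 0 t" h] unfolding W_def by auto

lemma W_measurable: "W k t \<in> borel_measurable M"
 unfolding W_def[abs_def] using S_measurable[of "max 0 t" k] by measurable

lemma W_Fubini:
 assumes k: "even k" and t: "0 <= t"
 shows "BM.expectation (%h. LINT u:{0<..t}|lborel. W k u h) = (LINT u:{0<..t}|lborel. BM.expectation (W k u))"
  and "integrable M (%h. LINT u:{0<..t}|lborel. W k u h)"
  and "set_integrable lborel {0<..t} (%u. BM.expectation (W k u))"
  and "h \<in> space M ==> set_integrable lborel {0<..t} (%u. W k u h)"
proof -
 interpret pair_sigma_finite M "lborel :: real measure" by (rule BM.pair_sigma_finite_lborel)
 let ?C = "1 + 2 * (g * (1 + \<bar>E\<bar>)) ^ k"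
 let ?f = "%h u. indicator {0<..t} u *\<^sub>R W k u h"
 have m: "case_prod ?f \<in> borel_measurable (M \<Otimes>\<^sub>M lborel)"
  using W_joint[of k] by (simp add: split_beta')
 have int: "integrable (M \<Otimes>\<^sub>M lborel) (case_prod ?f)"
 proof (rule Bochner_Integration.integrable_bound[OF _ m])
  have "emeasure (M \<Otimes>\<^sub>M lborel) (space M \<times> {0<..t}) < \<infinity>"
   using t by (simp add: lborel.emeasure_pair_measure_Times BM.emeasure_space_1)
  then have "integrable (M \<Otimes>\<^sub>M lborel) (indicator (space M \<times> {0<..t}) :: _ => real)"
   by (intro integrable_real_indicator) auto
  then show "integrable (M \<Otimes>\<^sub>M lborel) (%p. ?C * indicator (space M \<times> {0<..t}) p)" by simp
  show "AE p in M \<Otimes>\<^sub>M lborel. norm (case_prod ?f p) <= norm (?C * indicator (space M \<times> {0<..t}) p)"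
   using W_bounds(2)[OF k] g by (auto simp: space_pair_measure indicator_def intro!: AE_I2)
 qed
 show "BM.expectation (%h. LINT u:{0<..t}|lborel. W k u h) = (LINT u:{0<..t}|lborel. BM.expectation (W k u))"
  unfolding set_lebesgue_integral_def using Fubini_integral[OF int] by simp
 show "integrable M (%h. LINT u:{0<..t}|lborel. W k u h)"
  unfolding set_lebesgue_integral_def by (rule integrable_fst[OF int])
 show "set_integrable lborel {0<..t} (%u. BM.expectation (W k u))"
  unfolding set_integrable_def using integrable_snd[OF int] by simp
 show "set_integrable lborel {0<..t} (%u. W k u h)" if "h \<in> space M"
 proof -
  have "set_integrable lborel {0<..t} (%u. (1 + 2 * S k u h) * 1)"
   by (rule set_integrable_mult_continuous[OF _ set_integrable_const_Ioc])
     (intro continuous_intros continuous_on_subset[OF S_continuous[OF that]], auto)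
  moreover have "set_integrable lborel {0<..t} (%u. (1 + 2 * S k u h) * 1) \<longleftrightarrow> set_integrable lborel {0<..t} (%u. W k u h)"
   by (rule set_integrable_cong) (auto simp: W_def max_def)
  ultimately show ?thesis by simp
 qed
qed

text \<open>The martingale drops out in expectation, and \<open>dr_bound\<close> with the same even
  order closes the inequality for the weight \<open>W\<close>. The bound depends on \<open>L\<close>
  and \<open>T\<close> only through \<open>L * T\<close>, so it survives a change of the time
  unit.\<close>

lemma moment_bound:
 assumes k: "even k" and L: "0 < L" "gap 0 k <= L / 2" and t: "0 <= t" "t <= T"
 shows "BM.expectation (W k t) <= 2 * (1 + 2 * power_mean N (%i. g * (l0 i - E)) k) * exp (2 * L * T)"
proof (rule exponential_Gronwall[OF L(1) _ _ _ _ t])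
 let ?A = "1 + 2 * power_mean N (%i. g * (l0 i - E)) k"
 show "0 <= ?A" using power_mean_even_nonneg[OF k] by simp
 have int: "integrable M (W k t)" for t by (rule BM.integrable_bounded[OF W_measurable W_bounds(2)[OF k]])
 show "0 <= BM.expectation (W k t) \<and> BM.expectation (W k t) <= 1 + 2 * (g * (1 + \<bar>E\<bar>)) ^ k" for t
 proof
  show "0 <= BM.expectation (W k t)" by (intro integral_nonneg_AE AE_I2 W_bounds(1) k)
  have "BM.expectation (W k t) <= BM.expectation (%_. 1 + 2 * (g * (1 + \<bar>E\<bar>)) ^ k)"
   by (intro integral_mono int) (use W_bounds(2)[OF k] in \<open>auto simp: abs_le_iff\<close>)
  then show "BM.expectation (W k t) <= 1 + 2 * (g * (1 + \<bar>E\<bar>)) ^ k" by (simp add: BM.prob_space)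
 qed
 show "set_integrable lborel {0<..t} (%u. BM.expectation (W k u))" if "0 <= t" for t by (rule W_Fubini(3)[OF k that])
 show "BM.expectation (W k t) <= ?A + L * (LINT u:{0<..t}|lborel. BM.expectation (W k u))" if t: "0 <= t" for t
 proof -
  have mi: "integrable M (pf.mart k t)" by (rule BM.integrable_bounded[OF pf.mart_measurable[OF t] pf.mart_bounded[OF t]])
  have z: "BM.expectation (pf.mart k t) = 0"
   using pf.mart_increment_zero[OF order_refl t, of "%_. 1" 1 k] unfolding pf.mart_0 by simp
  have "BM.expectation (W k t) <= BM.expectation (%h. ?A + 2 * pf.mart k t h + L * (LINT u:{0<..t}|lborel. W k u h))"
  proof (rule integral_mono[OF int])
   show "integrable M (%h. ?A + 2 * pf.mart k t h + L * (LINT u:{0<..t}|lborel. W k u h))"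
    using mi W_Fubini(2)[OF k t] by simp
   fix h assume h: "h \<in> space M"
   have "\<bar>LINT u:{0<..t}|lborel. dr k u h\<bar> <= (LINT u:{0<..t}|lborel. L / 2 * W k u h)"
   proof (rule abs_set_integral_le[OF pf.b_integrable[OF order_refl h]])
    show "set_integrable lborel {0<..t} (%u. L / 2 * W k u h)" using W_Fubini(4)[OF k t h] by simp
    fix u assume u: "u \<in> {0<..t}"
    have "\<bar>dr k u h\<bar> <= gap 0 k * (1 + 2 * S k u h)" by (rule dr_bound[OF k order_refl])
    also have "\<dots> <= L / 2 * (1 + 2 * S k u h)" using S_nonneg[OF k, of u h] by (intro mult_right_mono L) simp
    finally show "\<bar>dr k u h\<bar> <= L / 2 * W k u h" using u by (simp add: W_def max_def)
   qed
   also have "\<dots> = L / 2 * (LINT u:{0<..t}|lborel. W k u h)" by (rule set_integral_mult_right)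
   finally have "\<bar>pf.dB k 0 t h\<bar> <= L / 2 * (LINT u:{0<..t}|lborel. W k u h)" unfolding pf.dB_def .
   moreover have "S k t h = power_mean N (%i. g * (l0 i - E)) k + pf.mart k t h + pf.dB k 0 t h"
    unfolding pf.mart_def psum_eq S_initial[OF h] by simp
   ultimately show "W k t h <= ?A + 2 * pf.mart k t h + L * (LINT u:{0<..t}|lborel. W k u h)"
    using t by (simp add: W_def max_def)
  qed
  also have "\<dots> = ?A + L * (LINT u:{0<..t}|lborel. BM.expectation (W k u))"
  proof -
   have "BM.expectation (%h. r + 2 * Y h + L * I h) = r + L * BM.expectation I"
    if "integrable M Y" "BM.expectation Y = 0" "integrable M I" for r Y I
    using that by (simp add: BM.prob_space)
   from this[OF mi z W_Fubini(2)[OF k t]] show ?thesis unfolding W_Fubini(1)[OF k t] .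
  qed
  finally show ?thesis .
 qed
qed

text \<open>Off the exceptional set the martingale stays within \<open>e / 2\<close> at all times,
  by the maximal inequality, and the accumulated drift error is at most \<open>e / 2\<close>, by
  Markov's inequality. Both rest on the expected time integral of the weight of order
  \<open>2 * n\<close>, the order that occurs in the bracket of an \<open>n\<close>-th power
  mean.\<close>

lemma near_solution:
 assumes n: "1 <= n" and L: "0 < L" "gap 0 (2 * n) <= L / 2" and T: "0 <= T" and e: "0 < e"
  and A: "1 + 2 * power_mean N (%i. g * (l0 i - E)) (2 * n) <= A"
 obtains Z where "Z \<in> sets M"
  "measure M Z <= T * (2 * A * exp (2 * L * T)) * (16 * real n * real n * (\<bar>q0\<bar> + \<bar>q1\<bar> + 2) / (e^2 * real N) + 2 * gap v n / e)"
  "\<And>d t. d \<in> space M ==> d \<notin> Z ==> 0 <= t ==> t <= T ==>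
    \<bar>S n t d - S n 0 d - (LINT u:{0<..t}|lborel. limit_poly c v n (%k. S k u d))\<bar> <= e"
proof -
 let ?k = "2 * n"
 let ?I = "%d. LINT u:{0<..T}|lborel. W ?k u d"
 define R where "R = T * (2 * A * exp (2 * L * T))"
 define q where "q = \<bar>q0\<bar> + \<bar>q1\<bar> + 2"
 have ev: "even ?k" by simp
 have I0: "0 <= ?I d" for d unfolding set_lebesgue_integral_def by (intro integral_nonneg_AE AE_I2) (simp add: W_bounds(1)[OF ev])
 have Ii: "integrable M ?I" by (rule W_Fubini(2)[OF ev T])
 have EI: "BM.expectation ?I <= R"
 proof -
  have "BM.expectation ?I = (LINT u:{0<..T}|lborel. BM.expectation (W ?k u))" by (rule W_Fubini(1)[OF ev T])
  also have "\<dots> <= (LINT u:{0<..T}|lborel. 2 * A * exp (2 * L * T))"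
  proof (rule set_integral_mono[OF W_Fubini(3)[OF ev T] set_integrable_const_Ioc])
   fix u assume "u \<in> {0<..T}"
   then have "BM.expectation (W ?k u) <= 2 * (1 + 2 * power_mean N (%i. g * (l0 i - E)) ?k) * exp (2 * L * T)"
    by (intro moment_bound[OF ev L]) auto
   also have "\<dots> <= 2 * A * exp (2 * L * T)" by (intro mult_right_mono mult_left_mono A) auto
   finally show "BM.expectation (W ?k u) <= 2 * A * exp (2 * L * T)" .
  qed
  also have "\<dots> = R" using T by (simp add: set_lebesgue_integral_def R_def)
  finally show ?thesis .
 qed
 \<comment> \<open>The weight \<open>1 / real N\<close> is squared but summed over \<open>N\<close>
   particles, which leaves one factor \<open>1 / real N\<close>.\<close>
 have mart: "BM.expectation (%d. (pf.mart n T d)^2) <= 2 * real n * real n * q / real N * R"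
 proof -
  have "BM.expectation (%d. (pf.mart n T d)^2)
   <= 2 * BM.expectation (%d. \<Sum>i=1..N. LINT u:{0<..T}|lborel. (1 / real N * (real n * X i u d ^ (n - 1)))^2 * Q i u d)"
   by (rule pf.mart_square_bound[OF T])
  also have "BM.expectation (%d. \<Sum>i=1..N. LINT u:{0<..T}|lborel. (1 / real N * (real n * X i u d ^ (n - 1)))^2 * Q i u d)
    <= BM.expectation (%d. real n * real n * q / real N * ?I d)"
  proof (rule integral_mono')
   show "integrable M (%d. real n * real n * q / real N * ?I d)" using Ii by simp
   show "0 <= real n * real n * q / real N * ?I d" for d using I0 unfolding q_def by simp
   fix d assume d: "d \<in> space M"
   let ?h = "%i u. (1 / real N * (real n * X i u d ^ (n - 1)))^2 * (q0 + q1 * X i u d - 2 * (X i u d)^2)"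
   have hi: "set_integrable lborel {0<..T} (?h i)" if "i \<in> {1..N}" for i
   proof -
    have "set_integrable lborel {0<..T} (%u. ?h i u * 1)"
     by (rule set_integrable_mult_continuous[OF _ set_integrable_const_Ioc])
       (intro continuous_intros sys.X_continuous_Icc that order_refl d)
    then show ?thesis by simp
   qed
   have "(\<Sum>i=1..N. LINT u:{0<..T}|lborel. (1 / real N * (real n * X i u d ^ (n - 1)))^2 * Q i u d) = (\<Sum>i=1..N. LINT u:{0<..T}|lborel. ?h i u)"
    by (intro sum.cong refl set_lebesgue_integral_cong) (simp_all add: Q_quadratic)
   also have "\<dots> = (LINT u:{0<..T}|lborel. (\<Sum>i=1..N. ?h i u))"
    by (rule set_integral_sum(2)[symmetric, OF hi])
   also have "\<dots> <= (LINT u:{0<..T}|lborel. real n * real n * q / real N * W ?k u d)"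
   proof (rule set_integral_mono)
    show "set_integrable lborel {0<..T} (%u. \<Sum>i=1..N. ?h i u)" by (rule set_integral_sum(1)[OF hi])
    show "set_integrable lborel {0<..T} (%u. real n * real n * q / real N * W ?k u d)"
     using W_Fubini(4)[OF ev T d] by (rule set_integrable_mult_right)
    fix u assume u: "u \<in> {0<..T}"
    have Wu: "W ?k u d = 1 + 2 * S ?k u d" using u by (simp add: W_def max_def)
    have "?h i u = real n * real n / real N * (1 / real N * (q0 * X i u d ^ (?k - 2) + q1 * X i u d ^ (?k - 1) - 2 * X i u d ^ ?k))" for i
    proof -
     have ex: "y ^ (?k - 2) = y ^ (n - 1) * y ^ (n - 1)" "y ^ (?k - 1) = y ^ (n - 1) * y ^ (n - 1) * y"
      "y ^ ?k = y ^ (n - 1) * y ^ (n - 1) * y^2" for y :: real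
      using n by (cases n; simp add: power2_eq_square mult_2 power_add)+
     have "p^2 * (q0 + q1 * y - 2 * y^2) = q0 * (p * p) + q1 * (p * p * y) - 2 * (p * p * y^2)" for p y :: real
      by (simp add: power2_eq_square algebra_simps)
     then have "(X i u d ^ (n - 1))^2 * (q0 + q1 * X i u d - 2 * (X i u d)^2) = q0 * X i u d ^ (?k - 2) + q1 * X i u d ^ (?k - 1) - 2 * X i u d ^ ?k"
      unfolding ex .
     moreover have "(1 / r * (r' * p))^2 * z = r' * r' / r * (1 / r * (p^2 * z))" for r r' p z :: real
      by (simp add: power2_eq_square)
     ultimately show ?thesis by (simp only:)
    qed
    then have "(\<Sum>i=1..N. ?h i u) = real n * real n / real N * (q0 * S (?k - 2) u d + q1 * S (?k - 1) u d - 2 * S ?k u d)"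
     unfolding S_def power_mean_def by (simp only: sum_distrib_left[symmetric] sum.distrib sum_subtractf) (simp add: algebra_simps sum_distrib_left)
    also have "\<dots> <= real n * real n / real N * (q * (1 + 2 * S ?k u d))"
    proof (rule mult_left_mono)
     have b: "\<bar>S j u d\<bar> <= 1 + 2 * S ?k u d" if "j <= ?k" for j unfolding S_def by (rule power_mean_bound[OF N ev that])
     have "q0 * S (?k - 2) u d <= \<bar>q0\<bar> * (1 + 2 * S ?k u d)" "q1 * S (?k - 1) u d <= \<bar>q1\<bar> * (1 + 2 * S ?k u d)"
      by (rule order_trans[OF abs_ge_self abs_mult_le[OF b]]; simp)+
     moreover have "0 <= S ?k u d" by (rule S_nonneg[OF ev])
     ultimately show "q0 * S (?k - 2) u d + q1 * S (?k - 1) u d - 2 * S ?k u d <= q * (1 + 2 * S ?k u d)"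
      unfolding q_def by (simp add: distrib_right)
    qed simp
    finally show "(\<Sum>i=1..N. ?h i u) <= real n * real n * q / real N * W ?k u d" unfolding Wu by simp
   qed
   also have "\<dots> = real n * real n * q / real N * ?I d" by (rule set_integral_mult_right)
   finally show "(\<Sum>i=1..N. LINT u:{0<..T}|lborel. (1 / real N * (real n * X i u d ^ (n - 1)))^2 * Q i u d) <= real n * real n * q / real N * ?I d" .
  qed
  also have "BM.expectation (%d. real n * real n * q / real N * ?I d) = real n * real n * q / real N * BM.expectation ?I" by simp
  also have "\<dots> <= real n * real n * q / real N * R" using EI by (rule mult_left_mono) (simp add: q_def)
  finally show ?thesis by (simp add: mult.assoc)
 qed
 define Z1 where "Z1 = {d \<in> space M. \<exists>t\<in>{0..T}. e / 2 < \<bar>pf.mart n t d\<bar>}"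
 define Z2 where "Z2 = {d \<in> space M. e / 2 <= gap v n * ?I d}"
 have Z1: "Z1 \<in> sets M" and P1: "(e / 2)^2 * measure M Z1 <= BM.expectation (%d. (pf.mart n T d)^2)"
  using pf.maximal_inequality[OF T, of "e / 2" n] e unfolding Z1_def by auto
 have Z2: "Z2 \<in> sets M" unfolding Z2_def using borel_measurable_integrable[OF Ii] by measurable
 have P2: "measure M Z2 <= gap v n * R / (e / 2)"
 proof -
  have "measure M Z2 <= BM.expectation (%d. gap v n * ?I d) / (e / 2)"
   unfolding Z2_def by (rule integral_Markov_inequality_measure[where A = "{}"]) (use Ii I0 gap_nonneg e in auto)
  also have "\<dots> <= gap v n * R / (e / 2)" using EI e by (intro divide_right_mono) (simp_all add: mult_left_mono gap_nonneg)
  finally show ?thesis .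
 qed
 show ?thesis
 proof (rule that)
  show "Z1 \<union> Z2 \<in> sets M" using Z1 Z2 by simp
  have "P <= 4 * r / e^2" if "(e / 2)^2 * P <= r" for P r using that e by (simp add: power_divide field_simps)
  from this[OF order_trans[OF P1 mart]] have "measure M Z1 <= 8 * real n * real n * q / real N * R / e^2" by simp
  moreover have "measure M (Z1 \<union> Z2) <= measure M Z1 + measure M Z2" by (rule measure_Un_le[OF Z1 Z2])
  ultimately have "measure M (Z1 \<union> Z2) <= 8 * real n * real n * q / real N * R / e^2 + gap v n * R / (e / 2)" using P2 by simp
  also have "\<dots> <= 16 * real n * real n * q / real N * R / e^2 + gap v n * R / (e / 2)"
  proof -
   have "0 <= R" by (rule order_trans[OF integral_nonneg_AE EI]) (simp add: I0)
   then show ?thesis by (intro add_right_mono divide_right_mono mult_right_mono) (auto simp: q_def)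
  qed
  also have "\<dots> = R * (16 * real n * real n * q / (e^2 * real N) + 2 * gap v n / e)" by (simp add: field_simps)
  finally show "measure M (Z1 \<union> Z2) <= T * (2 * A * exp (2 * L * T)) * (16 * real n * real n * (\<bar>q0\<bar> + \<bar>q1\<bar> + 2) / (e^2 * real N) + 2 * gap v n / e)"
   unfolding R_def q_def .
  fix d t assume d: "d \<in> space M" and nZ: "d \<notin> Z1 \<union> Z2" and t: "0 <= t" "t <= T"
  let ?p = "%u. limit_poly c v n (%k. S k u d)"
  have m: "\<bar>pf.mart n t d\<bar> <= e / 2" using nZ d t unfolding Z1_def by (auto simp: not_less)
  have g: "gap v n * ?I d <= e / 2" using nZ d unfolding Z2_def by auto
  have pi: "set_integrable lborel {0<..t} ?p"
  proof -
   have "set_integrable lborel {0<..t} (%u. ?p u * 1)"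
    by (rule set_integrable_mult_continuous[OF _ set_integrable_const_Ioc], cases "n < 2")
      (auto simp: limit_poly_def intro!: continuous_intros continuous_on_subset[OF S_continuous[OF d]])
   then show ?thesis by simp
  qed
  have di: "set_integrable lborel {0<..t} (%u. dr n u d)" by (rule pf.b_integrable[OF order_refl d])
  have Wi: "set_integrable lborel {0<..T} (%u. gap v n * W ?k u d)" using W_Fubini(4)[OF ev T d] by (rule set_integrable_mult_right)
  have "\<bar>LINT u:{0<..t}|lborel. dr n u d - ?p u\<bar> <= (LINT u:{0<..t}|lborel. gap v n * W ?k u d)"
  proof (rule abs_set_integral_le[OF set_integral_diff(1)[OF di pi]])
   show "set_integrable lborel {0<..t} (%u. gap v n * W ?k u d)" by (rule set_integrable_subset[OF Wi]) (use t in auto)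
   fix u assume "u \<in> {0<..t}"
   then show "\<bar>dr n u d - ?p u\<bar> <= gap v n * W ?k u d" using drift_gap_bound[OF ev, of n u d v] by (simp add: W_def max_def)
  qed
  also have "\<dots> <= (LINT u:{0<..T}|lborel. gap v n * W ?k u d)"
  proof -
   have "0 <= (LINT u:{t<..T}|lborel. gap v n * W ?k u d)"
    unfolding set_lebesgue_integral_def by (intro integral_nonneg_AE AE_I2) (simp add: gap_nonneg W_bounds(1)[OF ev])
   then show ?thesis using set_integral_Ioc_add[OF t Wi] by simp
  qed
  also have "\<dots> = gap v n * ?I d" by (rule set_integral_mult_right)
  finally have "\<bar>(LINT u:{0<..t}|lborel. dr n u d) - (LINT u:{0<..t}|lborel. ?p u)\<bar> <= e / 2"
   using g unfolding set_integral_diff(2)[OF di pi] by simp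
  moreover have "pf.mart n t d = S n t d - S n 0 d - (LINT u:{0<..t}|lborel. dr n u d)"
   unfolding pf.mart_def pf.dB_def psum_eq ..
  ultimately show "\<bar>S n t d - S n 0 d - (LINT u:{0<..t}|lborel. ?p u)\<bar> <= e" using m by linarith
 qed
qed

end

section \<open>Convergence of the power means\<close>

text \<open>\<open>P N\<close> may quantify over all times and need not be a measurable event, so
  its failures are covered by a measurable set of small measure.\<close>

definition whp :: "(nat => 'w measure) => (nat => 'w => bool) => bool" where
 "whp M P \<longleftrightarrow> (\<forall>\<delta>>0. \<forall>\<^sub>F N in sequentially. \<exists>Z\<in>sets (M N). measure (M N) Z <= \<delta> \<and> (\<forall>h\<in>space (M N) - Z. P N h))"

lemma whp_mono:
 assumes "whp M P" "\<forall>\<^sub>F N in sequentially. \<forall>h\<in>space (M N). P N h \<longrightarrow> Q N h"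
 shows "whp M Q"
 unfolding whp_def
proof (intro allI impI)
 fix \<delta> :: real assume "0 < \<delta>"
 then have "\<forall>\<^sub>F N in sequentially. \<exists>Z\<in>sets (M N). measure (M N) Z <= \<delta> \<and> (\<forall>h\<in>space (M N) - Z. P N h)"
  using assms(1) unfolding whp_def by blast
 then show "\<forall>\<^sub>F N in sequentially. \<exists>Z\<in>sets (M N). measure (M N) Z <= \<delta> \<and> (\<forall>h\<in>space (M N) - Z. Q N h)"
  using assms(2) by eventually_elim blast
qed

lemma whp_conj:
 assumes "whp M P" "whp M Q" shows "whp M (%N h. P N h \<and> Q N h)"
 unfolding whp_def
proof (intro allI impI)
 fix \<delta> :: real assume "0 < \<delta>"
 then have "0 < \<delta> / 2" by simp
 note ev = this
 show "\<forall>\<^sub>F N in sequentially. \<exists>Z\<in>sets (M N). measure (M N) Z <= \<delta> \<and> (\<forall>h\<in>space (M N) - Z. P N h \<and> Q N h)"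
  using assms(1)[unfolded whp_def, THEN spec, THEN mp, OF ev] assms(2)[unfolded whp_def, THEN spec, THEN mp, OF ev]
 proof eventually_elim
  case (elim N)
  from elim(1) obtain Y where Y: "Y \<in> sets (M N)" "measure (M N) Y <= \<delta> / 2" "\<forall>h\<in>space (M N) - Y. P N h" by blast
  from elim(2) obtain Z where Z: "Z \<in> sets (M N)" "measure (M N) Z <= \<delta> / 2" "\<forall>h\<in>space (M N) - Z. Q N h" by blast
  have "measure (M N) (Y \<union> Z) <= \<delta>" using measure_Un_le[OF Y(1) Z(1)] Y(2) Z(2) by simp
  then show ?case using Y(1,3) Z(1,3) by (intro bexI[of _ "Y \<union> Z"]) auto
 qed
qed

lemma whp_true: "\<forall>\<^sub>F N in sequentially. \<forall>h\<in>space (M N). P N h ==> whp M P"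
 unfolding whp_def by (intro allI impI) (auto elim!: eventually_mono intro!: bexI[of _ "{}"])

lemma whp_all_less:
 fixes n :: nat
 assumes "\<And>k. k < n ==> whp M (P k)" shows "whp M (%N h. \<forall>k<n. P k N h)"
 using assms
proof (induction n)
 case (Suc n)
 have "whp M (%N h. (\<forall>k<n. P k N h) \<and> P n N h)" by (intro whp_conj Suc) auto
 then show ?case by (rule whp_mono) (auto simp: less_Suc_eq)
qed (simp add: whp_true)

text \<open>\<open>\<delta> <= 1\<close> keeps the values of \<open>P\<close> within
  \<open>C + 1\<close>, so the quadratic part has a Lipschitz constant free of
  \<open>\<delta>\<close>.\<close>

lemma limit_poly_Lipschitz:
 assumes p: "\<And>k. k <= n - 2 ==> \<bar>p k\<bar> <= C" and P: "\<And>k. k <= n - 2 ==> \<bar>P k - p k\<bar> <= \<delta>" and \<delta>: "\<delta> <= 1"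
 shows "\<bar>limit_poly c v n P - limit_poly c v n p\<bar> <= (\<bar>v * (c * real n / 2)\<bar> * (real n * (2 * C + 1)) + \<bar>v * (1/2) * real n * (real n - 1)\<bar>) * \<delta>"
proof -
 have C0: "0 <= C" and d0: "0 <= \<delta>" using p[of 0] P[of 0] by linarith+
 show ?thesis
 proof (cases "n < 2")
  case False
  have pr: "\<bar>P j * P k - p j * p k\<bar> <= (2 * C + 1) * \<delta>" if "j <= n - 2" "k <= n - 2" for j k
  proof -
   have "P j * P k - p j * p k = P j * (P k - p k) + (P j - p j) * p k" by (simp add: algebra_simps)
   also have "\<bar>\<dots>\<bar> <= \<bar>P j\<bar> * \<bar>P k - p k\<bar> + \<bar>P j - p j\<bar> * \<bar>p k\<bar>" by (metis abs_mult abs_triangle_ineq)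
   also have "\<dots> <= (C + 1) * \<delta> + \<delta> * C"
    using p[OF that(1)] p[OF that(2)] P[OF that(1)] P[OF that(2)] \<delta> C0 d0 by (intro add_mono mult_mono) auto
   finally show ?thesis by (simp add: algebra_simps)
  qed
  have "\<bar>(\<Sum>j=0..n-2. P j * P (n - 2 - j)) - (\<Sum>j=0..n-2. p j * p (n - 2 - j))\<bar> <= (\<Sum>j=0..n-2. (2 * C + 1) * \<delta>)"
   unfolding sum_subtractf[symmetric] by (rule order_trans[OF sum_abs sum_mono]) (rule pr; simp)
  also have "\<dots> = real (n - 1) * ((2 * C + 1) * \<delta>)" using False by (simp add: Suc_diff_Suc numeral_2_eq_2)
  also have "\<dots> <= real n * ((2 * C + 1) * \<delta>)" using C0 d0 by (intro mult_right_mono) auto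
  finally have s: "\<bar>(\<Sum>j=0..n-2. P j * P (n - 2 - j)) - (\<Sum>j=0..n-2. p j * p (n - 2 - j))\<bar> <= real n * ((2 * C + 1) * \<delta>)" .
  have l: "\<bar>(r * x + r' * y) - (r * x' + r' * y')\<bar> <= \<bar>r\<bar> * X + \<bar>r'\<bar> * Y" if "\<bar>x - x'\<bar> <= X" "\<bar>y - y'\<bar> <= Y" for r r' x x' y y' X Y :: real
  proof -
   have "(r * x + r' * y) - (r * x' + r' * y') = r * (x - x') + r' * (y - y')" by (simp add: algebra_simps)
   then show ?thesis using abs_triangle_ineq[of "r * (x - x')" "r' * (y - y')"] abs_mult_le[OF that(1), of r] abs_mult_le[OF that(2), of r'] by simp
  qed
  have "\<bar>limit_poly c v n P - limit_poly c v n p\<bar> <= \<bar>v * (c * real n / 2)\<bar> * (real n * ((2 * C + 1) * \<delta>)) + \<bar>v * (1/2) * real n * (real n - 1)\<bar> * \<delta>"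
   unfolding limit_poly_def if_not_P[OF False] by (rule l[OF s P]) simp
  then show ?thesis by (simp only: distrib_right mult.assoc)
 qed (use C0 d0 in \<open>simp add: limit_poly_def\<close>)
qed

lemma limit_poly_continuous:
 assumes "\<And>k. k <= n - 2 ==> continuous_on A (%u. P u k)"
 shows "continuous_on A (%u. limit_poly c v n (P u))"
 unfolding limit_poly_def by (cases "n < 2") (auto intro!: continuous_intros assms)

lemma continuous_set_integrable_Ioc:
 fixes f :: "real => real" shows "continuous_on {a..b} f ==> set_integrable lborel {a<..b} f"
 using set_integrable_mult_continuous[OF _ set_integrable_const_Ioc, of a b f 1] by simp

lemma integral_Icc_eq_LINT_Ioc:
 fixes f :: "real => real" assumes "continuous_on {a..b} f"
 shows "integral {a..b} f = (LINT u:{a<..b}|lborel. f u)"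
 using continuous_set_integrable_Ioc[OF assms] unfolding set_integral_Icc_eq_Ioc[symmetric]
 by (simp add: set_borel_integral_eq_integral(2))

text \<open>Continuity and the integral equation are proved together: the integrand of order
  \<open>n\<close> is continuous by the induction hypothesis, and this makes the gauge integral of
  the recursion coincide with the Lebesgue integral.\<close>

lemma limit_moment_props:
 fixes c v :: real and \<alpha> :: "nat => real" and n :: nat
 defines "m \<equiv> limit_moment c v \<alpha>"
 shows "continuous_on {0..T} (m n) \<and> (\<forall>t\<ge>0. m n t = (if n = 0 then 1 else \<alpha> n) + (LINT u:{0<..t}|lborel. limit_poly c v n (%k. m k u)))"
proof (induction n arbitrary: T rule: less_induct)
 case (less n)
 consider "n = 0" | "n = 1" | "2 <= n" by linarith
 then show ?case
 proof cases
  case 3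
  have c: "continuous_on {0..t} (m k)" if "k <= n - 2" for k t using less[of k] that 3 by auto
  let ?p = "%u. limit_poly c v n (%k. m k u)"
  have pc: "continuous_on {0..t} ?p" for t by (intro limit_poly_continuous c)
  have eq: "m n t = \<alpha> n + integral {0..t} ?p" for t
  proof -
   have ci: "(%u. m j u * m (n - 2 - j) u) integrable_on {0..t}" "m (n - 2) integrable_on {0..t}" if "j <= n - 2" for j
    by (intro integrable_continuous_interval continuous_intros c that; simp)+
   have "integral {0..t} ?p = integral {0..t} (%u. v * (c * real n / 2) * (\<Sum>j=0..n-2. m j u * m (n - 2 - j) u) + v * (1/2) * real n * (real n - 1) * m (n - 2) u)"
    using 3 by (simp add: limit_poly_def)
   also have "\<dots> = v * (c * real n / 2) * (\<Sum>j=0..n-2. integral {0..t} (%u. m j u * m (n - 2 - j) u)) + v * (1/2) * real n * (real n - 1) * integral {0..t} (m (n - 2))"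
   proof -
    have i: "(%u. \<Sum>j=0..n-2. m j u * m (n - 2 - j) u) integrable_on {0..t}"
     by (rule integrable_sum) (simp, rule ci(1), simp)
    have "integral {0..t} (%u. \<Sum>j=0..n-2. m j u * m (n - 2 - j) u) = (\<Sum>j=0..n-2. integral {0..t} (%u. m j u * m (n - 2 - j) u))"
     by (rule Henstock_Kurzweil_Integration.integral_sum) (simp, rule ci(1), simp)
    then show ?thesis
     by (simp only: Henstock_Kurzweil_Integration.integral_add[OF integrable_on_mult_right[OF i] integrable_on_mult_right[OF ci(2)[of 0]]] le0
       Henstock_Kurzweil_Integration.integral_mult_right)
   qed
   finally show ?thesis unfolding m_def using 3 by (subst limit_moment.simps) simp
  qed
  have "continuous_on {0..T} (%t. \<alpha> n + integral {0..t} ?p)"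
   by (intro continuous_intros indefinite_integral_continuous_1 integrable_continuous_interval pc)
  then show ?thesis using 3 eq integral_Icc_eq_LINT_Ioc[OF pc] by simp
 next
  case 1
  then have "m n = (%_. 1)" by (auto simp: m_def limit_moment.simps)
  then show ?thesis using 1 by (simp add: limit_poly_def set_lebesgue_integral_def)
 next
  case 2
  then have "m n = (%_. \<alpha> 1)" by (auto simp: m_def limit_moment.simps)
  then show ?thesis using 2 by (simp add: limit_poly_def set_lebesgue_integral_def)
 qed
qed

section \<open>The scaling limit of the drift\<close>

lemma set_integral_time_change:
 fixes f :: "real => real" assumes r: "0 < r"
 shows "(LINT u:{0<..t / r}|lborel. r * f u) = (LINT u:{0<..t}|lborel. f (u / r))"
proof -
 have "(LINT u:{0<..t / r}|lborel. r * f u) = \<bar>1 / r\<bar> *\<^sub>R (\<integral>u. indicator {0<..t / r} (0 + 1 / r * u) *\<^sub>R (r * f (0 + 1 / r * u)) \<partial>lborel)"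
  unfolding set_lebesgue_integral_def by (rule lborel_integral_real_affine) (use r in simp)
 also have "\<dots> = (\<integral>u. \<bar>1 / r\<bar> *\<^sub>R (indicator {0<..t / r} (0 + 1 / r * u) *\<^sub>R (r * f (0 + 1 / r * u))) \<partial>lborel)" by simp
 also have "\<dots> = (LINT u:{0<..t}|lborel. f (u / r))"
  unfolding set_lebesgue_integral_def
  by (rule Bochner_Integration.integral_cong) (use r in \<open>auto simp: indicator_def field_simps\<close>)
 finally show ?thesis .
qed

text \<open>Positive homogeneity of degree one in the coefficients and \<open>v\<close> jointly:
  slowing time down by the factor \<open>r\<close> divides all of them by \<open>r\<close>.\<close>

lemma drift_gap_scale:
 assumes r: "0 < r" shows "drift_gap N c e1 e2 q0 q1 q2 v n / r = drift_gap N c (e1 / r) (e2 / r) (q0 / r) (q1 / r) (q2 / r) (v / r) n"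
 using r by (simp add: drift_gap_def add_divide_distrib diff_divide_distrib[symmetric] distrib_left)

lemma drift_gap_tendsto:
 assumes "e1 \<longlonglongrightarrow> 0" "e2 \<longlonglongrightarrow> 0" "q0 \<longlonglongrightarrow> s" "q1 \<longlonglongrightarrow> 0" "q2 \<longlonglongrightarrow> 0"
 shows "(%N. drift_gap N c (e1 N) (e2 N) (q0 N) (q1 N) (q2 N) v n) \<longlonglongrightarrow> (c * real n * (real n + 1) + real n * real n) * \<bar>s - v\<bar>"
proof -
 have "(%N. \<bar>q0 N\<bar> * (1 / real N)) \<longlonglongrightarrow> \<bar>s\<bar> * 0" by (intro tendsto_intros assms lim_1_over_n)
 then have q: "(%N. \<bar>q0 N\<bar> / real N) \<longlonglongrightarrow> 0" by simp
 have "(%N. drift_gap N c (e1 N) (e2 N) (q0 N) (q1 N) (q2 N) v n)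
  \<longlonglongrightarrow> real n * (\<bar>0\<bar> + \<bar>0\<bar>) + c * real n * (real n + 1) * (\<bar>s - v\<bar> + 0 + \<bar>0\<bar> + \<bar>0\<bar>) + real n * real n * (\<bar>s - v\<bar> + \<bar>0\<bar> + \<bar>0\<bar>)"
  unfolding drift_gap_def by (intro tendsto_intros assms q)
 then show ?thesis by (simp add: algebra_simps)
qed

locale jacobi_scaling =
 fixes M :: "nat => 'w measure" and B lam :: "nat => nat => real => 'w => real" and lam0 :: "nat => nat => real"
  and \<gamma> \<tau> E :: "nat => real" and a b c \<sigma> :: real and \<alpha> :: "nat => real"
 assumes c: "0 < c" and \<sigma>: "0 < \<sigma>^2"
  and process: "\<And>N. 1 <= N ==> beta_jacobi_process (M N) N a b (2 * c / real N) (B N) (lam0 N) (lam N)"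
  and pos: "\<And>N. 1 <= N ==> \<gamma> N > 0 \<and> \<tau> N > 0 \<and> E N > 0"
  and \<tau>: "filterlim \<tau> at_top sequentially"
  and \<gamma>\<tau>: "(%N. \<gamma> N / \<tau> N) \<longlonglongrightarrow> 0"
  and var: "(%N. 2 * (\<gamma> N)^2 / \<tau> N * E N * (1 - E N)) \<longlonglongrightarrow> \<sigma>^2"
  and init: "\<And>n. (%N. power_mean N (%i. \<gamma> N * (lam0 N i - E N)) n) \<longlonglongrightarrow> \<alpha> n"
begin

definition x where "x N i t h = \<gamma> N * (lam N i (t / \<tau> N) h - E N)"
definition S where "S n N t h = power_mean N (%i. x N i t h) n"
definition m where "m = limit_moment c (\<sigma>^2) \<alpha>"

lemma jacobi: "1 <= N ==> jacobi (M N) N a b c (B N) (lam0 N) (lam N) (\<gamma> N)"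
 using c pos process by (intro jacobi.intro) auto

lemma prob: "1 <= N ==> prob_space (M N)"
 using process by (simp add: beta_jacobi_process_def)

lemma S_eq: "S n N t h = jacobi.S N (lam N) (\<gamma> N) (E N) n (t / \<tau> N) h" if "1 <= N"
proof -
 interpret J: jacobi "M N" N a b c "B N" "lam0 N" "lam N" "\<gamma> N" "E N" by (rule jacobi[OF that])
 show ?thesis unfolding S_def J.S_def x_def J.X_def ..
qed

lemma S_0: "1 <= N ==> S 0 N t h = 1"
 by (simp add: S_def power_mean_0)

lemma S_continuous:
 assumes N: "1 <= N" and h: "h \<in> space (M N)" shows "continuous_on {0..} (%t. S n N t h)"
proof -
 interpret J: jacobi "M N" N a b c "B N" "lam0 N" "lam N" "\<gamma> N" "E N" by (rule jacobi[OF N])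
 have t: "0 < \<tau> N" using pos[OF N] by simp
 show ?thesis unfolding S_eq[OF N]
  by (rule continuous_on_compose2[OF J.S_continuous[OF h]]) (use t in \<open>auto intro!: continuous_intros\<close>)
qed

lemma S_initial: "1 <= N ==> h \<in> space (M N) ==> S n N 0 h = power_mean N (%i. \<gamma> N * (lam0 N i - E N)) n"
 unfolding S_def x_def power_mean_def using jacobi.l_initial[OF jacobi] by simp

lemma S_measurable: "1 <= N ==> 0 <= t ==> S n N t \<in> borel_measurable (M N)"
proof -
 assume N: "1 <= N" and t: "0 <= t"
 interpret J: jacobi "M N" N a b c "B N" "lam0 N" "lam N" "\<gamma> N" "E N" by (rule jacobi[OF N])
 show ?thesis using J.S_measurable[of "t / \<tau> N" n] t pos[OF N] unfolding S_eq[OF N, abs_def] by simp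
qed

lemma coefficients_tendsto:
 shows "(%N. \<gamma> N * (a + 1 - (a + b + 2) * E N) / \<tau> N) \<longlonglongrightarrow> 0" "(%N. (a + b + 2) / \<tau> N) \<longlonglongrightarrow> 0"
  "(%N. 2 * (\<gamma> N)^2 * E N * (1 - E N) / \<tau> N) \<longlonglongrightarrow> \<sigma>^2" "(%N. 2 * \<gamma> N * (1 - 2 * E N) / \<tau> N) \<longlonglongrightarrow> 0" "(%N. 2 / \<tau> N) \<longlonglongrightarrow> 0"
proof -
 \<comment> \<open>The positive limit of the variance coefficient forces
   \<open>E N * (1 - E N)\<close> to be positive eventually, hence \<open>E N < 1\<close>.\<close>
 have E: "\<forall>\<^sub>F N in sequentially. \<bar>E N\<bar> <= 1"
  using order_tendstoD(1)[OF var \<sigma>] eventually_ge_at_top[of 1]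
 proof eventually_elim
  case (elim N)
  have "0 < 2 * (\<gamma> N)^2 / \<tau> N * E N" using pos[OF elim(2)] by simp
  then have "0 < 1 - E N" by (rule zero_less_mult_pos[OF elim(1)])
  then show ?case using pos[OF elim(2)] by simp
 qed
 have null: "(%N. \<gamma> N / \<tau> N * f N) \<longlonglongrightarrow> 0" if "\<forall>\<^sub>F N in sequentially. \<bar>f N\<bar> <= C" for f C
 proof (rule Lim_null_comparison)
  show "\<forall>\<^sub>F N in sequentially. norm (\<gamma> N / \<tau> N * f N) <= \<bar>\<gamma> N / \<tau> N\<bar> * C"
   using that
  proof eventually_elim
   case (elim N)
   show ?case using mult_left_mono[OF elim, of "\<bar>\<gamma> N / \<tau> N\<bar>"] by (simp only: real_norm_def abs_mult abs_ge_zero)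
  qed
  show "(%N. \<bar>\<gamma> N / \<tau> N\<bar> * C) \<longlonglongrightarrow> 0" using tendsto_mult_left_zero[OF tendsto_rabs_zero[OF \<gamma>\<tau>]] by simp
 qed
 have "(%N. \<gamma> N / \<tau> N * (a + 1 - (a + b + 2) * E N)) \<longlonglongrightarrow> 0"
 proof (rule null)
  show "\<forall>\<^sub>F N in sequentially. \<bar>a + 1 - (a + b + 2) * E N\<bar> <= \<bar>a + 1\<bar> + \<bar>a + b + 2\<bar>"
   using E
  proof eventually_elim
   case (elim N)
   have "\<bar>(a + b + 2) * E N\<bar> <= \<bar>a + b + 2\<bar> * 1" by (rule abs_mult_le[OF elim])
   then show ?case using abs_triangle_ineq4[of "a + 1" "(a + b + 2) * E N"] by simp
  qed
 qed
 then show "(%N. \<gamma> N * (a + 1 - (a + b + 2) * E N) / \<tau> N) \<longlonglongrightarrow> 0" by simp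
 have "(%N. \<gamma> N / \<tau> N * (2 * (1 - 2 * E N))) \<longlonglongrightarrow> 0"
  by (rule null[where C = 6]) (use E in \<open>eventually_elim, auto simp: abs_le_iff\<close>)
 then show "(%N. 2 * \<gamma> N * (1 - 2 * E N) / \<tau> N) \<longlonglongrightarrow> 0" by (simp add: mult_ac)
 show "(%N. (a + b + 2) / \<tau> N) \<longlonglongrightarrow> 0" "(%N. 2 / \<tau> N) \<longlonglongrightarrow> 0"
  by (rule real_tendsto_divide_at_top[OF tendsto_const \<tau>])+
 show "(%N. 2 * (\<gamma> N)^2 * E N * (1 - E N) / \<tau> N) \<longlonglongrightarrow> \<sigma>^2" using var by (simp add: mult_ac)
qed

text \<open>\<open>near_solution\<close> is applied with rate \<open>L * \<tau> N\<close>, horizon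
  \<open>T / \<tau> N\<close> and limit coefficient \<open>\<tau> N * \<sigma>^2\<close>. By
  homogeneity the factors \<open>\<tau> N\<close> cancel, and the bound on the exceptional set tends
  to 0.\<close>

lemma near_limit:
 assumes n: "1 <= n" and T: "0 < T" and e: "0 < e"
 shows "whp M (%N d. \<forall>t\<in>{0..T}. \<bar>S n N t d - S n N 0 d - (LINT u:{0<..t}|lborel. limit_poly c (\<sigma>^2) n (%k. S k N u d))\<bar> <= e)"
proof -
 let ?e1 = "%N. \<gamma> N * (a + 1 - (a + b + 2) * E N)" and ?e2 = "a + b + 2"
  and ?q0 = "%N. 2 * (\<gamma> N)^2 * E N * (1 - E N)" and ?q1 = "%N. 2 * \<gamma> N * (1 - 2 * E N)"
 let ?G = "%v n N. drift_gap N c (?e1 N / \<tau> N) (?e2 / \<tau> N) (?q0 N / \<tau> N) (?q1 N / \<tau> N) (2 / \<tau> N) v n"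
 note lim = drift_gap_tendsto[OF coefficients_tendsto, where c = c]
 \<comment> \<open>The limit of the rescaled gap of order \<open>2 * n\<close> for
   \<open>v = 0\<close>, so that \<open>L / 2 = K + 1\<close> eventually exceeds this gap.\<close>
 define K where "K = (c * real (2 * n) * (real (2 * n) + 1) + real (2 * n) * real (2 * n)) * \<bar>\<sigma>^2 - 0\<bar>"
 define L where "L = 2 * (K + 1)"
 have L: "0 < L" unfolding L_def K_def using c by (simp add: add_nonneg_pos)
 have G0: "\<forall>\<^sub>F N in sequentially. ?G 0 (2 * n) N < K + 1"
  by (rule order_tendstoD(2)[OF lim]) (simp add: K_def)
 have G: "?G (\<sigma>^2) n \<longlonglongrightarrow> 0" using lim[where v = "\<sigma>^2" and n = n] by simp
 \<comment> \<open>The initial power mean of order \<open>2 * n\<close> is eventually below its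
   limit plus 1, which bounds the initial weight by \<open>A\<close>.\<close>
 define A where "A = 1 + 2 * (\<alpha> (2 * n) + 1)"
 have A: "\<forall>\<^sub>F N in sequentially. power_mean N (%i. \<gamma> N * (lam0 N i - E N)) (2 * n) < \<alpha> (2 * n) + 1"
  by (rule order_tendstoD(2)[OF init]) simp
 let ?q = "%N. (\<bar>?q0 N / \<tau> N\<bar> + \<bar>?q1 N / \<tau> N\<bar> + 2 / \<tau> N) * (1 / real N)"
 let ?b = "%N. T * (2 * A * exp (2 * L * T)) * (16 * real n * real n / e^2 * ?q N + 2 / e * ?G (\<sigma>^2) n N)"
 have "?b \<longlonglongrightarrow> T * (2 * A * exp (2 * L * T)) * (16 * real n * real n / e^2 * ((\<bar>\<sigma>^2\<bar> + \<bar>0\<bar> + 0) * 0) + 2 / e * 0)"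
  by (intro tendsto_intros coefficients_tendsto lim_1_over_n G)
 then have b: "?b \<longlonglongrightarrow> 0" by simp
 show ?thesis unfolding whp_def
 proof (intro allI impI)
  fix \<delta> :: real assume "0 < \<delta>"
  with b have "\<forall>\<^sub>F N in sequentially. ?b N < \<delta>" by (rule order_tendstoD(2))
  then show "\<forall>\<^sub>F N in sequentially. \<exists>Z\<in>sets (M N). measure (M N) Z <= \<delta> \<and> (\<forall>d\<in>space (M N) - Z.
   \<forall>t\<in>{0..T}. \<bar>S n N t d - S n N 0 d - (LINT u:{0<..t}|lborel. limit_poly c (\<sigma>^2) n (%k. S k N u d))\<bar> <= e)"
   using G0 A eventually_ge_at_top[of 1]
  proof eventually_elim
   case (elim N)
   note N = elim(4)
   have t: "0 < \<tau> N" using pos[OF N] by simp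
   interpret J: jacobi "M N" N a b c "B N" "lam0 N" "lam N" "\<gamma> N" "E N" by (rule jacobi[OF N])
   have gap: "J.gap v k = \<tau> N * ?G (v / \<tau> N) k N" for v k
    using t unfolding drift_gap_scale[OF t, symmetric] J.gap_def J.e1_def J.e2_def J.q0_def J.q1_def by simp
   have gL: "J.gap 0 (2 * n) <= L * \<tau> N / 2"
   proof -
    have "\<tau> N * ?G (0 / \<tau> N) (2 * n) N <= \<tau> N * (K + 1)" using elim(2) t by (intro mult_left_mono) auto
    then show ?thesis unfolding gap L_def by (simp add: algebra_simps)
   qed
   have L': "0 < L * \<tau> N" using L t by simp
   have T': "0 <= T / \<tau> N" using T t by simp
   have A': "1 + 2 * power_mean N (%i. \<gamma> N * (lam0 N i - E N)) (2 * n) <= A" using elim(3) unfolding A_def by simp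
   show ?case
   proof (rule J.near_solution[where v = "\<tau> N * \<sigma>^2", OF n L' gL T' e A'])
    fix Z assume Z: "Z \<in> sets (M N)"
    and mZ: "measure (M N) Z <= T / \<tau> N * (2 * A * exp (2 * (L * \<tau> N) * (T / \<tau> N))) * (16 * real n * real n * (\<bar>J.q0\<bar> + \<bar>J.q1\<bar> + 2) / (e^2 * real N) + 2 * J.gap (\<tau> N * \<sigma>^2) n / e)"
    and good: "\<And>d t. d \<in> space (M N) ==> d \<notin> Z ==> 0 <= t ==> t <= T / \<tau> N ==>
     \<bar>J.S n t d - J.S n 0 d - (LINT u:{0<..t}|lborel. limit_poly c (\<tau> N * \<sigma>^2) n (%k. J.S k u d))\<bar> <= e"
    show ?thesis
   proof (intro bexI[OF _ Z] conjI ballI)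
    have "T / \<tau> N * (2 * A * exp (2 * (L * \<tau> N) * (T / \<tau> N))) * (16 * real n * real n * (\<bar>J.q0\<bar> + \<bar>J.q1\<bar> + 2) / (e^2 * real N) + 2 * J.gap (\<tau> N * \<sigma>^2) n / e) = ?b N"
    proof -
     have "2 * (L * \<tau> N) * (T / \<tau> N) = 2 * L * T" using t by simp
     moreover have "T / r * y * (z * (\<bar>p\<bar> + \<bar>p'\<bar> + 2) / (w * s) + 2 * (r * h) / e) = T * y * (z / w * ((\<bar>p / r\<bar> + \<bar>p' / r\<bar> + 2 / r) * (1 / s)) + 2 / e * h)"
      if "0 < r" for r y z p p' w s h
     proof -
      have "\<bar>p / r\<bar> + \<bar>p' / r\<bar> + 2 / r = (\<bar>p\<bar> + \<bar>p'\<bar> + 2) / r" using that by (simp add: add_divide_distrib)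
      moreover have "T / r * y * (z * Q / (w * s) + 2 * (r * h) / e) = T * y * (z / w * (Q / r * (1 / s)) + 2 / e * h)" for Q
       using that by (simp add: distrib_left mult_ac)
      ultimately show ?thesis by simp
     qed
     ultimately show ?thesis unfolding gap J.q0_def J.q1_def using t by simp
    qed
    then show "measure (M N) Z <= \<delta>" using mZ elim(1) by simp
    fix d t assume w: "d \<in> space (M N) - Z" and s: "t \<in> {0..T}"
    have "\<bar>J.S n (t / \<tau> N) d - J.S n 0 d - (LINT u:{0<..t / \<tau> N}|lborel. limit_poly c (\<tau> N * \<sigma>^2) n (%k. J.S k u d))\<bar> <= e"
     using w s t by (intro good) (auto simp: divide_right_mono)
    moreover have "limit_poly c (\<tau> N * \<sigma>^2) n P = \<tau> N * limit_poly c (\<sigma>^2) n P" for P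
     by (simp add: limit_poly_def algebra_simps)
    ultimately show "\<bar>S n N t d - S n N 0 d - (LINT u:{0<..t}|lborel. limit_poly c (\<sigma>^2) n (%k. S k N u d))\<bar> <= e"
     by (simp only: S_eq[OF N] set_integral_time_change[OF t] div_0)
   qed
   qed
  qed
 qed
qed

theorem moments_converge:
 assumes T: "0 < T" and e: "0 < e"
 shows "whp M (%N v. \<forall>t\<in>{0..T}. \<bar>S n N t v - m n t\<bar> <= e)"
 using e
proof (induction n arbitrary: e rule: less_induct)
 case (less n)
 note mp = limit_moment_props[of _ c "\<sigma>^2" \<alpha>, folded m_def]
 show ?case
 proof (cases "n = 0")
  \<comment> \<open>Order 0 is treated apart because \<open>near_limit\<close> starts at order
    1.\<close>
  case True
  have "m 0 t = 1" for t by (simp add: m_def limit_moment.simps)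
  then show ?thesis using True less(2)
   by (intro whp_true eventually_mono[OF eventually_ge_at_top[of 1]]) (simp add: S_0)
 next
  case False
  have "\<exists>C. \<forall>k\<le>n. \<forall>u\<in>{0..T}. \<bar>m k u\<bar> <= C"
  proof -
   have "\<exists>C. \<forall>u\<in>{0..T}. \<bar>m k u\<bar> <= C" for k
    using compact_imp_bounded[OF compact_continuous_image[OF conjunct1[OF mp, of T k] compact_Icc]] by (auto simp: bounded_iff)
   then obtain C where "\<And>k u. u \<in> {0..T} ==> \<bar>m k u\<bar> <= C k" by metis
   then have "\<bar>m k u\<bar> <= Max (C ` {..n})" if "k <= n" "u \<in> {0..T}" for k u
    using that by (intro order_trans[OF _ Max_ge[of "C ` {..n}" "C k"]]) auto
   then show ?thesis by blast
  qed
  then obtain C where C: "\<And>k u. k <= n ==> u \<in> {0..T} ==> \<bar>m k u\<bar> <= C" by blast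
  define K where "K = \<bar>\<sigma>^2 * (c * real n / 2)\<bar> * (real n * (2 * C + 1)) + \<bar>\<sigma>^2 * (1/2) * real n * (real n - 1)\<bar>"
  have "0 <= C" using C[of 0 0] T by simp
  then have K0: "0 <= K" unfolding K_def by simp
  \<comment> \<open>The thirds of \<open>e\<close> go to the approximate integral equation, to the
    initial value, and to the deviation of the lower orders. The last is amplified by the Lipschitz
    constant \<open>K\<close> and by the time \<open>T\<close>, which fixes
    \<open>\<delta>\<close>.\<close>
  define \<delta> where "\<delta> = min 1 (e / 3 / (T * (K + 1)))"
  have TK: "0 < T * (K + 1)" using T K0 by simp
  have \<delta>: "0 < \<delta>" "\<delta> <= 1" using less(2) TK by (auto simp: \<delta>_def)
  have "T * (K * \<delta>) <= T * (K + 1) * \<delta>" using \<delta> T by (simp add: algebra_simps)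
  also have "\<dots> <= T * (K + 1) * (e / 3 / (T * (K + 1)))" using TK by (intro mult_left_mono) (auto simp: \<delta>_def)
  also have "y * (e / 3 / y) = e / 3" if "0 < y" for y using that by simp
  from this[OF TK] have "T * (K + 1) * (e / 3 / (T * (K + 1))) = e / 3" .
  finally have TK\<delta>: "T * (K * \<delta>) <= e / 3" .
  have "whp M (%N v. (\<forall>k<n. \<forall>t\<in>{0..T}. \<bar>S k N t v - m k t\<bar> <= \<delta>) \<and>
    (\<forall>t\<in>{0..T}. \<bar>S n N t v - S n N 0 v - (LINT u:{0<..t}|lborel. limit_poly c (\<sigma>^2) n (%k. S k N u v))\<bar> <= e / 3))"
   using less(1) \<delta>(1) by (intro whp_conj whp_all_less near_limit T) (use False less(2) in auto)
  moreover have "\<forall>\<^sub>F N in sequentially. \<bar>power_mean N (%i. \<gamma> N * (lam0 N i - E N)) n - \<alpha> n\<bar> < e / 3"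
   using tendstoD[OF init, of "e / 3" n] less(2) by (simp add: dist_real_def)
  then have "\<forall>\<^sub>F N in sequentially. \<forall>v\<in>space (M N). (\<forall>k<n. \<forall>t\<in>{0..T}. \<bar>S k N t v - m k t\<bar> <= \<delta>) \<and>
    (\<forall>t\<in>{0..T}. \<bar>S n N t v - S n N 0 v - (LINT u:{0<..t}|lborel. limit_poly c (\<sigma>^2) n (%k. S k N u v))\<bar> <= e / 3)
    \<longrightarrow> (\<forall>t\<in>{0..T}. \<bar>S n N t v - m n t\<bar> <= e)"
   using eventually_ge_at_top[of 1]
  proof (eventually_elim, intro ballI impI)
   fix N v t assume i: "\<bar>power_mean N (%i. \<gamma> N * (lam0 N i - E N)) n - \<alpha> n\<bar> < e / 3" and N: "1 <= N" and v: "v \<in> space (M N)"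
    and h: "(\<forall>k<n. \<forall>t\<in>{0..T}. \<bar>S k N t v - m k t\<bar> <= \<delta>) \<and>
    (\<forall>t\<in>{0..T}. \<bar>S n N t v - S n N 0 v - (LINT u:{0<..t}|lborel. limit_poly c (\<sigma>^2) n (%k. S k N u v))\<bar> <= e / 3)"
    and t: "t \<in> {0..T}"
   let ?p = "%u. limit_poly c (\<sigma>^2) n (%k. S k N u v)" and ?q = "%u. limit_poly c (\<sigma>^2) n (%k. m k u)"
   have pi: "set_integrable lborel {0<..t} ?p" "set_integrable lborel {0<..t} ?q"
    by (intro continuous_set_integrable_Ioc limit_poly_continuous continuous_on_subset[OF S_continuous[OF N v]], auto)
      (intro continuous_set_integrable_Ioc limit_poly_continuous conjunct1[OF mp])
   have "\<bar>LINT u:{0<..t}|lborel. ?p u - ?q u\<bar> <= (LINT u:{0<..t}|lborel. K * \<delta>)"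
   proof (rule abs_set_integral_le[OF set_integral_diff(1)[OF pi] set_integrable_const_Ioc])
    fix u assume "u \<in> {0<..t}"
    then have u: "u \<in> {0..T}" using t by auto
    show "\<bar>?p u - ?q u\<bar> <= K * \<delta>" unfolding K_def
     by (rule limit_poly_Lipschitz[OF C _ \<delta>(2)]) (use h u False in auto)
   qed
   also have "\<dots> = t * (K * \<delta>)" using t by (simp add: set_lebesgue_integral_def)
   also have "\<dots> <= T * (K * \<delta>)" using t K0 \<delta> by (intro mult_right_mono) auto
   also note TK\<delta>
   finally have "\<bar>(LINT u:{0<..t}|lborel. ?p u) - (LINT u:{0<..t}|lborel. ?q u)\<bar> <= e / 3"
    unfolding set_integral_diff(2)[OF pi] .
   moreover have "m n t = \<alpha> n + (LINT u:{0<..t}|lborel. ?q u)" using mp[of T n] False t by auto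
   moreover have "\<bar>S n N t v - S n N 0 v - (LINT u:{0<..t}|lborel. ?p u)\<bar> <= e / 3" using h t by blast
   ultimately show "\<bar>S n N t v - m n t\<bar> <= e" using i unfolding S_initial[OF N v] by linarith
  qed
  ultimately show ?thesis by (rule whp_mono)
 qed
qed

end

section \<open>The moment problem\<close>

text \<open>The exponential generating function of the moments then converges on a disc of radius at
  least \<open>1 / C\<close>, which is a sufficient condition for determinacy.\<close>

definition factorial_bounded :: "real => (nat => real) => bool" where
 "factorial_bounded C m \<longleftrightarrow> 1 <= C \<and> (\<forall>n. \<bar>m n\<bar> <= C ^ n * fact n)"

lemma real_distributionI_moments: "has_moments \<mu> m ==> real_distribution \<mu>"
 by (simp add: has_moments_def)

text \<open>An absolute moment of odd order is dominated by the next even moment, which explains the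
  shift to \<open>p + 1\<close>; the summand 1 covers the region where
  \<open>\<bar>x\<bar> <= 1\<close>.\<close>

lemma abs_moment_bound:
 assumes \<mu>: "has_moments \<mu> m" and m: "factorial_bounded C m"
 shows "integrable \<mu> (%x. \<bar>x\<bar> ^ p)" "(\<integral>x. \<bar>x\<bar> ^ p \<partial>\<mu>) <= 1 + C ^ (p + 1) * fact (p + 1)"
proof -
 interpret real_distribution \<mu> by (rule real_distributionI_moments[OF \<mu>])
 have mom: "integrable \<mu> (%x. x ^ n)" "(\<integral>x. x ^ n \<partial>\<mu>) = m n" for n using \<mu> by (auto simp: has_moments_def)
 show int: "integrable \<mu> (%x. \<bar>x\<bar> ^ p)" using integrable_abs[OF mom(1)] by (simp add: power_abs)
 define q where "q = (if even p then p else p + 1)"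
 have q: "even q" "p <= q" "q <= p + 1" by (auto simp: q_def)
 have "(\<integral>x. \<bar>x\<bar> ^ p \<partial>\<mu>) <= (\<integral>x. 1 + x ^ q \<partial>\<mu>)"
 proof (rule integral_mono[OF int])
  fix x :: real
  have "\<bar>x\<bar> ^ p <= 1 + \<bar>x\<bar> ^ q"
  proof (cases "\<bar>x\<bar> <= 1")
   case True then show ?thesis using power_le_one[of "\<bar>x\<bar>" p] by (simp add: add_increasing2)
  next
   case False
   then have "\<bar>x\<bar> ^ p <= \<bar>x\<bar> ^ q" by (intro power_increasing q(2)) simp
   then show ?thesis by simp
  qed
  then show "\<bar>x\<bar> ^ p <= 1 + x ^ q" using q(1) by (simp add: power_even_abs)
 qed (simp add: mom)
 also have "\<dots> = 1 + m q" using mom prob_space by simp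
 also have "m q <= C ^ q * fact q" using m by (auto simp: factorial_bounded_def abs_le_iff)
 also have "\<dots> <= C ^ (p + 1) * fact (p + 1)"
  using m q by (intro mult_mono power_increasing fact_mono) (auto simp: factorial_bounded_def)
 finally show "(\<integral>x. \<bar>x\<bar> ^ p \<partial>\<mu>) <= 1 + C ^ (p + 1) * fact (p + 1)" by simp
qed

text \<open>Expansion of the derivatives of a characteristic function around an arbitrary point, with a radius
 that does not depend on the point. Equality of these derivatives therefore spreads from \<open>0\<close> to the line.\<close>

lemma char_derivative_expansion:
 assumes \<mu>: "has_moments \<mu> m" and m: "factorial_bounded C m" and h: "\<bar>h\<bar> <= 1 / (4 * C)"
 shows "(\<integral>x. of_real x ^ k * iexp ((t + h) * x) \<partial>\<mu>) = (\<Sum>j. (\<i> * of_real h) ^ j / fact j * (\<integral>x. of_real x ^ (k + j) * iexp (t * x) \<partial>\<mu>))"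
proof -
 interpret real_distribution \<mu> by (rule real_distributionI_moments[OF \<mu>])
 have C: "1 <= C" using m by (simp add: factorial_bounded_def)
 let ?f = "%j x. (\<i> * of_real h) ^ j / fact j * (of_real x ^ (k + j) * iexp (t * x)) :: complex"
 have nf: "norm (?f j x) = \<bar>h\<bar> ^ j / fact j * \<bar>x\<bar> ^ (k + j)" for j x
  by (simp add: norm_mult norm_divide norm_power)
 have fi: "integrable \<mu> (%x. of_real x ^ (k + j) * iexp (t * x) :: complex)" for j
  by (rule Bochner_Integration.integrable_bound[OF abs_moment_bound(1)[OF \<mu> m, of "k + j"]]) (auto simp: norm_mult norm_power)
 have sums: "(%j. ?f j x) sums (of_real x ^ k * iexp ((t + h) * x))" for x
 proof -
  have "(%j. (\<i> * of_real (h * x)) ^ j /\<^sub>R fact j) sums iexp (h * x)" by (rule exp_converges)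
  then have "(%j. of_real x ^ k * iexp (t * x) * ((\<i> * of_real (h * x)) ^ j /\<^sub>R fact j)) sums (of_real x ^ k * iexp (t * x) * iexp (h * x))"
   by (rule sums_mult)
  moreover have "of_real x ^ k * iexp (t * x) * iexp (h * x) = of_real x ^ k * iexp ((t + h) * x)"
   by (simp add: exp_add[symmetric] distrib_left distrib_right)
  moreover have "of_real x ^ k * iexp (t * x) * ((\<i> * of_real (h * x)) ^ j /\<^sub>R fact j) = ?f j x" for j
   by (simp add: scaleR_conv_of_real power_add power_mult_distrib field_simps)
  ultimately show ?thesis by (simp only:)
 qed
 have "(\<integral>x. (\<Sum>j. ?f j x) \<partial>\<mu>) = (\<Sum>j. \<integral>x. ?f j x \<partial>\<mu>)"
 proof (rule integral_suminf)
  show "integrable \<mu> (?f j)" for j using fi by simp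
  show "AE x in \<mu>. summable (%j. norm (?f j x))"
  proof (rule AE_I2)
   fix x
   have "summable (%j. \<bar>x\<bar> ^ k * ((\<bar>h * x\<bar>) ^ j /\<^sub>R fact j))"
    using exp_converges[of "\<bar>h * x\<bar>"] by (intro summable_mult) (auto simp: sums_iff)
   then show "summable (%j. norm (?f j x))" unfolding nf by (simp add: power_add abs_mult power_mult_distrib field_simps)
  qed
  show "summable (%j. \<integral>x. norm (?f j x) \<partial>\<mu>)"
  proof (rule summable_comparison_test')
   let ?K = "(2 * C) ^ (k + 1) * fact (k + 1)"
   show "summable (%j. (1 + ?K) * (1/2) ^ j :: real)" by (intro summable_mult summable_geometric) simp
   fix j :: nat
   have "\<bar>h\<bar> * (2 * C) <= 1 / (4 * C) * (2 * C)" using h C by (intro mult_right_mono) auto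
   then have hC: "\<bar>h\<bar> * (2 * C) <= 1/2" using C by simp
   have h2: "\<bar>h\<bar> <= 1/2"
   proof -
    have "\<bar>h\<bar> * 1 <= \<bar>h\<bar> * (2 * C)" using C by (intro mult_left_mono) auto
    then show ?thesis using hC by simp
   qed
   \<comment> \<open>Splitting the factorial costs a binomial coefficient, at most a power of 2. The
     terms thus grow like the powers of \<open>2 * C\<close>, and the radius
     \<open>1 / (4 * C)\<close> leaves the ratio 1/2.\<close>
   have f: "(fact (k + j + 1) :: real) <= fact (k + 1) * fact j * 2 ^ (k + 1 + j)"
   proof -
    have "(fact (k + j + 1) :: nat) = fact (k + 1) * fact j * (k + 1 + j choose (k + 1))"
     using binomial_fact_lemma[of "k + 1" "k + 1 + j"] by (simp add: add.commute add.left_commute)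
    also have "\<dots> <= fact (k + 1) * fact j * 2 ^ (k + 1 + j)" by (intro mult_left_mono binomial_le_pow2) simp
    finally have "real (fact (k + j + 1)) <= real (fact (k + 1) * fact j * 2 ^ (k + 1 + j))" by (rule of_nat_mono)
    then show ?thesis by (simp only: of_nat_mult of_nat_power of_nat_fact of_nat_numeral)
   qed
   have "(\<integral>x. norm (?f j x) \<partial>\<mu>) = \<bar>h\<bar> ^ j / fact j * (\<integral>x. \<bar>x\<bar> ^ (k + j) \<partial>\<mu>)" unfolding nf by simp
   also have "\<dots> <= \<bar>h\<bar> ^ j / fact j * (1 + C ^ (k + j + 1) * fact (k + j + 1))"
    by (intro mult_left_mono abs_moment_bound(2)[OF \<mu> m]) simp
   also have "\<dots> <= \<bar>h\<bar> ^ j / fact j * (1 + C ^ (k + j + 1) * (fact (k + 1) * fact j * 2 ^ (k + 1 + j)))"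
    using C by (intro mult_left_mono add_left_mono f) auto
   also have "\<dots> = \<bar>h\<bar> ^ j / fact j + ?K * (\<bar>h\<bar> * (2 * C)) ^ j"
    by (simp add: power_add power_mult_distrib field_simps)
   also have "\<dots> <= (1/2) ^ j + ?K * (1/2) ^ j"
   proof (intro add_mono mult_left_mono power_mono hC)
    have "\<bar>h\<bar> ^ j / fact j <= \<bar>h\<bar> ^ j / 1" by (intro divide_left_mono) auto
    also have "\<dots> <= (1/2) ^ j" using power_mono[OF h2, of j] by simp
    finally show "\<bar>h\<bar> ^ j / fact j <= (1/2) ^ j" .
   qed (use C in auto)
   finally show "norm (\<integral>x. norm (?f j x) \<partial>\<mu>) <= (1 + ?K) * (1/2) ^ j"
    by (simp add: distrib_right)
  qed
 qed
 moreover have "(\<Sum>j. ?f j x) = of_real x ^ k * iexp ((t + h) * x)" for x using sums[of x] by (simp add: sums_iff)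
 ultimately show ?thesis using fi by simp
qed

theorem moments_determine:
 assumes \<mu>: "has_moments \<mu> m" and \<nu>: "has_moments \<nu> m" and m: "factorial_bounded C m"
 shows "\<mu> = \<nu>"
proof (rule Levy_uniqueness)
 show "real_distribution \<mu>" "real_distribution \<nu>" using \<mu> \<nu> by (auto simp: has_moments_def)
 have C: "1 <= C" using m by (simp add: factorial_bounded_def)
 let ?D = "%\<mu> k t. \<integral>x. of_real x ^ k * iexp (t * x) \<partial>\<mu>"
 \<comment> \<open>All derivatives are carried along, since the expansion at the next point uses
   every order at the previous one. At 0 they are the moments up to constant factors.\<close>
 have eq: "?D \<mu> k (real n * h) = ?D \<nu> k (real n * h)" if h: "\<bar>h\<bar> <= 1 / (4 * C)" for n h k
 proof (induction n arbitrary: k)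
  case 0
  have "(\<integral>x. (of_real (x ^ k) :: complex) \<partial>\<rho>) = of_real (m k)" if "has_moments \<rho> m" for \<rho>
   using that by (simp only: integral_complex_of_real has_moments_def)
  from this[OF \<mu>] this[OF \<nu>] show ?case by (simp add: of_real_power)
 next
  case (Suc n)
  have "real (Suc n) * h = real n * h + h" by (simp add: algebra_simps)
  then show ?case
   unfolding char_derivative_expansion[OF \<mu> m h, of k "real n * h", symmetric, THEN sym] by (simp only: char_derivative_expansion[OF \<mu> m h] char_derivative_expansion[OF \<nu> m h] Suc)
 qed
 show "char \<mu> = char \<nu>"
 proof
  fix t :: real
  \<comment> \<open>The number of steps is chosen such that a single step \<open>t / real n\<close>
    stays within the common radius.\<close>
  obtain n :: nat where n: "\<bar>t\<bar> * (4 * C) < real n" using reals_Archimedean2 by blast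
  moreover have "0 <= \<bar>t\<bar> * (4 * C)" using C by simp
  ultimately have n0: "0 < real n" by linarith
  have "\<bar>t / real n\<bar> <= 1 / (4 * C)" using n n0 C by (simp add: field_simps)
  from eq[OF this, of 0 n] show "char \<mu> t = char \<nu> t" using n0 by (simp add: char_def)
 qed
qed

section \<open>Truncated moments and weak limits\<close>

definition clip :: "real => real => real" where "clip R x = max (- R) (min R x)"

text \<open>Where the truncation acts, \<open>\<bar>x\<bar>\<close> exceeds \<open>R\<close>, so one
  extra power of \<open>x\<close> gains a factor \<open>1 / R\<close>; the exponent
  \<open>2 * n + 2\<close> is an even one above \<open>n\<close>. The integrated error is then
  uniformly small over measures with a bounded moment of this order.\<close>

lemma clip_error:
 assumes "1 <= R" shows "\<bar>x ^ n - clip R x ^ n\<bar> <= 2 * x ^ (2 * n + 2) / R"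
proof (cases "\<bar>x\<bar> <= R")
 case True
 then have "clip R x = x" by (auto simp: clip_def)
 moreover have "0 <= 2 * x ^ (2 * n + 2) / R"
  using assms by (intro divide_nonneg_nonneg mult_nonneg_nonneg zero_le_even_power) auto
 ultimately show ?thesis by (simp only: diff_self abs_zero)
next
 case False
 have "\<bar>clip R x\<bar> <= \<bar>x\<bar>" using False assms by (auto simp: clip_def)
 then have "\<bar>clip R x ^ n\<bar> <= \<bar>x\<bar> ^ n" unfolding power_abs by (rule power_mono) simp
 then have "\<bar>x ^ n - clip R x ^ n\<bar> <= 2 * \<bar>x\<bar> ^ n" using abs_triangle_ineq4[of "x ^ n" "clip R x ^ n"] by (simp add: power_abs)
 also have "\<dots> <= 2 * (\<bar>x\<bar> ^ (2 * n + 2) / R)"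
 proof -
  have "\<bar>x\<bar> ^ n * R <= \<bar>x\<bar> ^ n * \<bar>x\<bar>" using False by (intro mult_left_mono) auto
  also have "\<dots> = \<bar>x\<bar> ^ (n + 1)" by simp
  also have "\<dots> <= \<bar>x\<bar> ^ (2 * n + 2)" using False assms by (intro power_increasing) auto
  finally show ?thesis using assms by (simp add: field_simps)
 qed
 finally show ?thesis by (simp add: power_even_abs)
qed

lemma clip_bound: "0 <= R ==> \<bar>clip R x ^ n\<bar> <= R ^ n"
 unfolding power_abs by (rule power_mono) (auto simp: clip_def)

lemma clip_continuous: "isCont (%x. clip R x ^ n) x"
 unfolding clip_def by (intro continuous_intros)

text \<open>Weak convergence applies to the bounded continuous powers of \<open>clip\<close>, and
  the truncation error is controlled along the sequence by a higher even moment. That the limit has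
  moments at all follows from Fatou's lemma, applied to truncated even powers.\<close>

lemma weak_limit_moments:
 assumes \<nu>: "\<And>k. real_distribution (\<nu> k)" "\<And>k n. integrable (\<nu> k) (%x. x ^ n)" and lim: "\<And>n. (%k. \<integral>x. x ^ n \<partial>\<nu> k) \<longlonglongrightarrow> m n"
  and \<mu>: "real_distribution \<mu>" "weak_conv_m \<nu> \<mu>"
 shows "has_moments \<mu> m"
proof -
 interpret \<mu>: real_distribution \<mu> by fact
 have conv: "(%k. \<integral>x. clip R x ^ n \<partial>\<nu> k) \<longlonglongrightarrow> (\<integral>x. clip R x ^ n \<partial>\<mu>)" if "0 <= R" for R n
  by (rule weak_conv_imp_integral_bdd_continuous_conv[where B = "R ^ n", OF \<nu>(1) \<mu> clip_continuous]) (simp only: real_norm_def clip_bound[OF that])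
 have cm: "(%x. clip R x ^ n) \<in> borel_measurable borel" for R n unfolding clip_def by measurable
 have ci: "integrable \<rho> (%x. clip R x ^ n)" if "0 <= R" "real_distribution \<rho>" for R n \<rho>
 proof -
  interpret real_distribution \<rho> by fact
  show ?thesis using clip_bound[OF that(1)] cm by (intro integrable_const_bound[of _ "R ^ n"]) auto
 qed
 have cl: "(%j. clip (real j) x ^ n) \<longlonglongrightarrow> x ^ n" for x n
 proof (rule tendsto_eventually, rule eventually_sequentiallyI)
  fix j assume "nat \<lceil>\<bar>x\<bar>\<rceil> <= j"
  then have "\<bar>x\<bar> <= real j" by linarith
  then show "clip (real j) x ^ n = x ^ n" by (auto simp: clip_def)
 qed
 have err: "\<bar>(\<integral>x. clip R x ^ n \<partial>\<mu>) - m n\<bar> <= 2 * m (2 * n + 2) / R" if R: "1 <= R" for R n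
 proof (rule LIMSEQ_le[OF _ _ exI[of _ 0]])
  show "(%k. \<bar>(\<integral>x. clip R x ^ n \<partial>\<nu> k) - (\<integral>x. x ^ n \<partial>\<nu> k)\<bar>) \<longlonglongrightarrow> \<bar>(\<integral>x. clip R x ^ n \<partial>\<mu>) - m n\<bar>"
   using R by (intro tendsto_intros conv lim) simp
  show "(%k. 2 * (\<integral>x. x ^ (2 * n + 2) \<partial>\<nu> k) / R) \<longlonglongrightarrow> 2 * m (2 * n + 2) / R"
   using R by (intro tendsto_intros lim) simp
  show "\<forall>k\<ge>0. \<bar>(\<integral>x. clip R x ^ n \<partial>\<nu> k) - (\<integral>x. x ^ n \<partial>\<nu> k)\<bar> <= 2 * (\<integral>x. x ^ (2 * n + 2) \<partial>\<nu> k) / R"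
  proof (intro allI impI)
   fix k
   have i: "integrable (\<nu> k) (%x. clip R x ^ n)" using R by (intro ci \<nu>(1)) simp
   have "\<bar>(\<integral>x. clip R x ^ n \<partial>\<nu> k) - (\<integral>x. x ^ n \<partial>\<nu> k)\<bar> = \<bar>\<integral>x. x ^ n - clip R x ^ n \<partial>\<nu> k\<bar>"
    using i \<nu>(2) by (simp add: abs_minus_commute)
   also have "\<dots> <= (\<integral>x. \<bar>x ^ n - clip R x ^ n\<bar> \<partial>\<nu> k)" by (rule integral_abs_bound)
   also have "\<dots> <= (\<integral>x. 2 * x ^ (2 * n + 2) / R \<partial>\<nu> k)"
    by (rule integral_mono[OF integrable_abs[OF Bochner_Integration.integrable_diff[OF \<nu>(2) i]] integrable_divide[OF integrable_mult_right[OF \<nu>(2)]] clip_error[OF R]])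
   also have "\<dots> = 2 * (\<integral>x. x ^ (2 * n + 2) \<partial>\<nu> k) / R" by (simp only: integral_divide_zero integral_mult_right_zero)
   finally show "\<bar>(\<integral>x. clip R x ^ n \<partial>\<nu> k) - (\<integral>x. x ^ n \<partial>\<nu> k)\<bar> <= 2 * (\<integral>x. x ^ (2 * n + 2) \<partial>\<nu> k) / R" .
  qed
 qed
 have even: "integrable \<mu> (%x. x ^ (2 * n))" for n
 proof (rule integrableI_nonneg)
  let ?K = "\<bar>m (2 * n)\<bar> + 2 * \<bar>m (2 * (2 * n) + 2)\<bar>"
  have bd: "(\<integral>\<^sup>+x. ennreal (clip (real (Suc j)) x ^ (2 * n)) \<partial>\<mu>) <= ennreal ?K" for j
  proof -
   have "(\<integral>x. clip (real (Suc j)) x ^ (2 * n) \<partial>\<mu>) <= ?K"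
   proof -
    have "2 * m (2 * (2 * n) + 2) / real (Suc j) <= 2 * \<bar>m (2 * (2 * n) + 2)\<bar> / 1" by (intro frac_le) auto
    moreover have "I <= \<bar>r\<bar> + 2 * \<bar>r'\<bar>" if "\<bar>I - r\<bar> <= q" "q <= 2 * \<bar>r'\<bar> / 1" for I r r' q :: real using that by linarith
    moreover have "1 <= real (Suc j)" by simp
    ultimately show ?thesis using err[of "real (Suc j)" "2 * n"] by blast
   qed
   then have "ennreal (\<integral>x. clip (real (Suc j)) x ^ (2 * n) \<partial>\<mu>) <= ennreal ?K" by (rule ennreal_leI)
   moreover have "(\<integral>\<^sup>+x. ennreal (clip (real (Suc j)) x ^ (2 * n)) \<partial>\<mu>) = ennreal (\<integral>x. clip (real (Suc j)) x ^ (2 * n) \<partial>\<mu>)"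
    by (rule nn_integral_eq_integral[OF ci[OF _ \<mu>(1)]]) (auto simp: zero_le_even_power)
   ultimately show ?thesis by (simp only:)
  qed
  have "(\<integral>\<^sup>+x. ennreal (x ^ (2 * n)) \<partial>\<mu>) = (\<integral>\<^sup>+x. liminf (%j. ennreal (clip (real (Suc j)) x ^ (2 * n))) \<partial>\<mu>)"
  proof (rule nn_integral_cong)
   fix x
   have "(%j. ennreal (clip (real (Suc j)) x ^ (2 * n))) \<longlonglongrightarrow> ennreal (x ^ (2 * n))"
    by (intro tendsto_ennrealI LIMSEQ_Suc[OF cl])
   then show "ennreal (x ^ (2 * n)) = liminf (%j. ennreal (clip (real (Suc j)) x ^ (2 * n)))"
    by (rule lim_imp_Liminf[symmetric, rotated]) simp
  qed
  also have "\<dots> <= liminf (%j. \<integral>\<^sup>+x. ennreal (clip (real (Suc j)) x ^ (2 * n)) \<partial>\<mu>)"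
   by (rule nn_integral_liminf) (use cm in measurable)
  also have "\<dots> <= ennreal ?K" by (intro Liminf_le always_eventually allI bd; simp)
  finally show "(\<integral>\<^sup>+x. ennreal (x ^ (2 * n)) \<partial>\<mu>) < \<infinity>" by (rule le_less_trans) simp
 qed (auto simp: zero_le_even_power)
 have int: "integrable \<mu> (%x. x ^ n)" for n
 proof (rule Bochner_Integration.integrable_bound)
  show "integrable \<mu> (%x. 1 + x ^ (2 * n))" using even by simp
  show "AE x in \<mu>. norm (x ^ n) <= norm (1 + x ^ (2 * n))"
  proof (rule AE_I2)
   fix x :: real
   have "0 <= (\<bar>x ^ n\<bar> - 1)^2 + \<bar>x ^ n\<bar>^2" by simp
   then have "\<bar>x ^ n\<bar> <= 1 + (x ^ n)^2" by (simp add: power2_eq_square algebra_simps abs_mult_self_eq)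
   then show "norm (x ^ n) <= norm (1 + x ^ (2 * n))" by (simp add: power_mult[symmetric] mult.commute)
  qed
 qed simp
 have "(\<integral>x. x ^ n \<partial>\<mu>) = m n" for n
 proof (rule LIMSEQ_unique)
  show "(%j. \<integral>x. clip (real j) x ^ n \<partial>\<mu>) \<longlonglongrightarrow> (\<integral>x. x ^ n \<partial>\<mu>)"
  proof (rule integral_dominated_convergence[where w = "%x. \<bar>x ^ n\<bar>"])
   show "AE x in \<mu>. norm (clip (real j) x ^ n) <= \<bar>x ^ n\<bar>" for j
    by (rule AE_I2) (auto simp: power_abs clip_def intro!: power_mono)
  qed (use int cl cm in auto)
  have "(%j. (\<integral>x. clip (real j) x ^ n \<partial>\<mu>) - m n) \<longlonglongrightarrow> 0"
  proof (rule Lim_null_comparison)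
   show "\<forall>\<^sub>F j in sequentially. norm ((\<integral>x. clip (real j) x ^ n \<partial>\<mu>) - m n) <= 2 * m (2 * n + 2) / real j"
    using eventually_ge_at_top[of 1] unfolding real_norm_def by eventually_elim (rule err, simp)
   show "(%j. 2 * m (2 * n + 2) / real j) \<longlonglongrightarrow> 0" by (rule lim_const_over_n)
  qed
  then show "(%j. \<integral>x. clip (real j) x ^ n \<partial>\<mu>) \<longlonglongrightarrow> m n" by (rule LIM_zero_cancel)
 qed
 then show ?thesis using int \<mu>(1) by (simp add: has_moments_def)
qed

lemma tight_second_moment:
 assumes \<nu>: "\<And>k. real_distribution (\<nu> k)" "\<And>k. integrable (\<nu> k) (%x. x^2)" and K: "\<And>k. (\<integral>x. x^2 \<partial>\<nu> k) <= K"
 shows "tight \<nu>"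
 unfolding tight_def
proof (intro conjI allI impI \<nu>(1))
 fix e :: real assume e: "0 < e"
 \<comment> \<open>Chebyshev's bound \<open>\<bar>K\<bar> / R^2\<close> is at most
   \<open>\<bar>K\<bar> / R\<close>, and this is below \<open>e\<close>.\<close>
 define R where "R = \<bar>K\<bar> / e + 1"
 have R: "1 <= R" "\<bar>K\<bar> < e * R" using e by (auto simp: R_def field_simps)
 have "1 - e < measure (\<nu> k) {- R<..R}" for k
 proof -
  interpret real_distribution "\<nu> k" by (rule \<nu>(1))
  have "prob {x \<in> space (\<nu> k). R^2 <= x^2} <= (\<integral>x. x^2 \<partial>\<nu> k) / R^2"
   by (rule integral_Markov_inequality_measure[OF \<nu>(2), where A = "{}"]) (use R in auto)
  also have "\<dots> <= \<bar>K\<bar> / R^2" using K[of k] by (intro divide_right_mono) auto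
  also have "\<dots> <= \<bar>K\<bar> / R" using R self_le_power[of R 2] by (intro divide_left_mono) auto
  also have "\<dots> < e" using R by (simp add: field_simps)
  finally have m: "prob {x. R^2 <= x^2} < e" by simp
  have "1 = prob ({- R<..R} \<union> (UNIV - {- R<..R}))" using prob_space by simp
  also have "\<dots> <= prob {- R<..R} + prob (UNIV - {- R<..R})" by (rule measure_Un_le) auto
  also have "prob (UNIV - {- R<..R}) <= prob {x. R^2 <= x^2}"
   using R by (intro finite_measure_mono) (auto simp: abs_le_square_iff[symmetric])
  finally show ?thesis using m by simp
 qed
 moreover have "- R < R" using R by simp
 ultimately show "\<exists>a b. a < b \<and> (\<forall>n. 1 - e < measure (\<nu> n) {a<..b})" by blast
qed

text \<open>Convergence of the second moments gives tightness, hence a weakly convergent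
  subsequence. Every subsequential limit has the moments \<open>m\<close>, so all of them coincide
  by \<open>moments_determine\<close>; this yields existence and convergence of the full sequence at
  once.\<close>

theorem method_of_moments:
 assumes \<nu>: "\<And>k. real_distribution (\<nu> k)" "\<And>k n. integrable (\<nu> k) (%x. x ^ n)" and lim: "\<And>n. (%k. \<integral>x. x ^ n \<partial>\<nu> k) \<longlonglongrightarrow> m n"
  and m: "factorial_bounded C m"
 shows "\<exists>\<mu>. has_moments \<mu> m \<and> weak_conv_m \<nu> \<mu>"
proof -
 obtain K where "\<And>k. norm (\<integral>x. x^2 \<partial>\<nu> k) <= K"
  using convergent_imp_Bseq[OF convergentI[OF lim[of 2]]] by (auto simp: Bseq_def)
 then have tight: "tight \<nu>" using \<nu> by (intro tight_second_moment[where K = K]) (auto simp: abs_le_iff)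
 have limit: "has_moments \<rho> m" if "strict_mono s" "real_distribution \<rho>" "weak_conv_m (\<nu> \<circ> s) \<rho>" for s \<rho>
 proof (rule weak_limit_moments[OF _ _ _ that(2,3)])
  show "(%k. \<integral>x. x ^ n \<partial>(\<nu> \<circ> s) k) \<longlonglongrightarrow> m n" for n
   using LIMSEQ_subseq_LIMSEQ[OF lim that(1), of n] by (simp add: comp_def)
 qed (simp_all add: \<nu>)
 obtain r \<mu> where r: "strict_mono (r :: nat => nat)" "real_distribution \<mu>" "weak_conv_m (\<nu> \<circ> id \<circ> r) \<mu>"
  using tight_imp_convergent_subsubsequence[OF tight strict_mono_id] by blast
 then have \<mu>: "has_moments \<mu> m" by (intro limit[of r]) auto
 have "weak_conv_m \<nu> \<mu>"
 proof (rule tight_subseq_weak_converge[OF \<nu>(1) r(2) tight])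
  fix s \<rho> assume "strict_mono s" "real_distribution \<rho>" "weak_conv_m (\<nu> \<circ> s) \<rho>"
  then show "weak_conv_m (\<nu> \<circ> s) \<mu>" using moments_determine[OF \<mu> limit m] by metis
 qed
 then show ?thesis using \<mu> by blast
qed

corollary moments_imp_weak_conv:
 assumes "\<And>k. real_distribution (\<nu> k)" "\<And>k n. integrable (\<nu> k) (%x. x ^ n)" "\<And>n. (%k. \<integral>x. x ^ n \<partial>\<nu> k) \<longlonglongrightarrow> m n"
  "factorial_bounded C m" "has_moments \<mu> m"
 shows "weak_conv_m \<nu> \<mu>"
 using method_of_moments[OF assms(1-4)] moments_determine[OF _ assms(5,4)] by metis

section \<open>Weak convergence expressed by a metric\<close>

lemma weak_conv_eventually_openin:
 assumes \<nu>: "\<And>k. real_distribution (\<nu> k)" and \<mu>: "real_distribution \<mu>" "weak_conv_m \<nu> \<mu>" and U: "openin weak_topology U" "\<mu> \<in> U"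
 shows "\<forall>\<^sub>F k in sequentially. \<nu> k \<in> U"
proof -
 have "generate_topology_on {{\<mu>. real_distribution \<mu> \<and> (\<integral>x. f x \<partial>\<mu>) \<in> U} | (f :: real => real) U.
   continuous_on UNIV f \<and> bounded (range f) \<and> open (U :: real set)} U"
  using U(1) unfolding weak_topology_def by (simp add: openin_topology_generated_by_iff)
 then show ?thesis using U(2)
 \<comment> \<open>\<open>weak_conv_m\<close> speaks of distribution functions, whereas the topology
   is generated by integrals of bounded continuous functions. Induction over the generated topology
   leaves the basic sets, where the two notions meet.\<close>
 proof induction
  case (Int a b)
  then have "\<forall>\<^sub>F k in sequentially. \<nu> k \<in> a" "\<forall>\<^sub>F k in sequentially. \<nu> k \<in> b" by auto
  then show ?case by eventually_elim simp
 next
  case (UN K)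
  then obtain k where k: "k \<in> K" "\<mu> \<in> k" by auto
  then have "\<forall>\<^sub>F j in sequentially. \<nu> j \<in> k" using UN.IH by blast
  then show ?case by eventually_elim (use k in auto)
 next
  case (Basis s)
  then obtain f :: "real => real" and V where s: "s = {\<mu>. real_distribution \<mu> \<and> (\<integral>x. f x \<partial>\<mu>) \<in> V}"
   and f: "continuous_on UNIV f" "bounded (range f)" and V: "open V" by blast
  obtain B where "\<And>x. norm (f x) <= B" using f(2) by (auto simp: bounded_iff)
  then have lim: "(%k. integral\<^sup>L (\<nu> k) f) \<longlonglongrightarrow> integral\<^sup>L \<mu> f"
   using f(1) by (intro weak_conv_imp_integral_bdd_continuous_conv[OF \<nu> \<mu>, where B = B]) (auto simp: continuous_on_eq_continuous_at)
  have "integral\<^sup>L \<mu> f \<in> V" using Basis s by simp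
  from topological_tendstoD[OF lim V this] show ?case by eventually_elim (simp add: s \<nu>)
 qed simp
qed

lemma weak_conv_imp_metric:
 assumes d: "metrizes_weak_topology d" and \<nu>: "\<And>k. real_distribution (\<nu> k)" and \<mu>: "real_distribution \<mu>" "weak_conv_m \<nu> \<mu>"
 shows "(%k. d (\<nu> k) \<mu>) \<longlonglongrightarrow> 0"
proof -
 interpret Metric_space "{\<mu>. real_distribution \<mu>}" d using d by (simp add: metrizes_weak_topology_def)
 show ?thesis
 proof (rule order_tendstoI)
  fix e :: real assume "0 < e"
  have "openin weak_topology (mball \<mu> e)" using d openin_mball[of \<mu> e] by (simp add: metrizes_weak_topology_def)
  then have "\<forall>\<^sub>F k in sequentially. \<nu> k \<in> mball \<mu> e"
   by (rule weak_conv_eventually_openin[OF \<nu> \<mu>]) (use \<mu> \<open>0 < e\<close> in simp)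
  then show "\<forall>\<^sub>F k in sequentially. d (\<nu> k) \<mu> < e" by eventually_elim (simp add: commute)
 next
  fix e :: real assume "e < 0"
  then show "\<forall>\<^sub>F k in sequentially. e < d (\<nu> k) \<mu>" by (intro always_eventually allI) (rule less_le_trans[OF _ nonneg])
 qed
qed

lemma metric_tendsto2:
 assumes d: "metrizes_weak_topology d" and \<nu>: "\<And>k. real_distribution (\<nu> k)" "real_distribution \<nu>'" "weak_conv_m \<nu> \<nu>'"
  and \<mu>: "\<And>k. real_distribution (\<mu> k)" "real_distribution \<mu>'" "weak_conv_m \<mu> \<mu>'"
 shows "(%k. d (\<nu> k) (\<mu> k)) \<longlonglongrightarrow> d \<nu>' \<mu>'"
proof -
 interpret Metric_space "{\<mu>. real_distribution \<mu>}" d using d by (simp add: metrizes_weak_topology_def)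
 have "(%k. d (\<nu> k) (\<mu> k) - d \<nu>' \<mu>') \<longlonglongrightarrow> 0"
 proof (rule Lim_null_comparison)
  show "(%k. d (\<nu> k) \<nu>' + d (\<mu> k) \<mu>') \<longlonglongrightarrow> 0"
   using tendsto_add[OF weak_conv_imp_metric[OF d \<nu>] weak_conv_imp_metric[OF d \<mu>]] by simp
  show "\<forall>\<^sub>F k in sequentially. norm (d (\<nu> k) (\<mu> k) - d \<nu>' \<mu>') <= d (\<nu> k) \<nu>' + d (\<mu> k) \<mu>'"
  proof (intro always_eventually allI)
   fix k
   have "d (\<nu> k) (\<mu> k) <= d (\<nu> k) \<nu>' + d \<nu>' (\<mu> k)" "d \<nu>' (\<mu> k) <= d \<nu>' \<mu>' + d \<mu>' (\<mu> k)"
    "d \<nu>' \<mu>' <= d \<nu>' (\<nu> k) + d (\<nu> k) \<mu>'" "d (\<nu> k) \<mu>' <= d (\<nu> k) (\<mu> k) + d (\<mu> k) \<mu>'"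
    by (rule triangle; use \<nu> \<mu> in simp)+
   then show "norm (d (\<nu> k) (\<mu> k) - d \<nu>' \<mu>') <= d (\<nu> k) \<nu>' + d (\<mu> k) \<mu>'"
    using commute[of \<nu>' "\<nu> k"] commute[of \<mu>' "\<mu> k"] by simp
  qed
 qed
 then show ?thesis by (rule LIM_zero_cancel)
qed

lemma empirical_measure:
 fixes f :: "real => real"
 assumes N: "1 <= N"
 shows "real_distribution (empirical_measure N y)"
  and "f \<in> borel_measurable borel ==> (\<integral>x. f x \<partial>empirical_measure N y) = 1 / real N * (\<Sum>i=1..N. f (y i))"
  and "f \<in> borel_measurable borel ==> integrable (empirical_measure N y) f"
proof -
 have ym: "y \<in> borel_measurable (uniform_count_measure {1..N})"
  by (simp add: measurable_def space_uniform_count_measure sets_uniform_count_measure)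
 interpret prob_space "uniform_count_measure {1..N}" using N by (intro prob_space_uniform_count_measure) auto
 show "real_distribution (empirical_measure N y)" unfolding empirical_measure_def by (rule real_distribution_distr[OF ym])
 show "(\<integral>x. f x \<partial>empirical_measure N y) = 1 / real N * (\<Sum>i=1..N. f (y i))" if "f \<in> borel_measurable borel"
  unfolding empirical_measure_def by (subst integral_distr[OF ym that]) (simp add: integral_uniform_count_measure)
 show "integrable (empirical_measure N y) f" if "f \<in> borel_measurable borel"
  unfolding empirical_measure_def using that
  by (subst integrable_distr_eq[OF ym]) (simp_all add: uniform_count_measure_def integrable_point_measure_finite)
qed

lemma empirical_measure_weak_conv:
 assumes N: "1 <= N" and y: "\<And>i. i \<in> {1..N} ==> (%k. y k i) \<longlonglongrightarrow> y' i"
 shows "weak_conv_m (%k. empirical_measure N (y k)) (empirical_measure N y')"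
proof (rule weak_conv_m_if_rat_steps[OF empirical_measure(1)[OF N] empirical_measure(1)[OF N]])
 fix p q :: rat assume "p < q"
 let ?f = "cts_step (of_rat p) (of_rat q)"
 have c: "continuous_on UNIV ?f"
  using \<open>p < q\<close> by (intro uniformly_continuous_imp_continuous cts_step_uniformly_continuous) (simp add: of_rat_less)
 then have m: "?f \<in> borel_measurable borel" by (rule borel_measurable_continuous_onI)
 show "(%k. integral\<^sup>L (empirical_measure N (y k)) ?f) \<longlonglongrightarrow> integral\<^sup>L (empirical_measure N y') ?f"
  unfolding empirical_measure(2)[OF N m]
  by (intro tendsto_intros continuous_on_tendsto_compose[OF c y]) auto
qed

text \<open>Finitely many moments control the distance uniformly in time, by compactness. Otherwise
  there are times \<open>t k\<close> and measures \<open>\<nu> k\<close> that violate the claim;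
  along a subsequence the times converge to some \<open>l\<close>, and the moments of
  \<open>\<nu> k\<close> and of \<open>\<mu> (t k)\<close> both converge to those of
  \<open>\<mu> l\<close>. Both sequences then converge weakly to \<open>\<mu> l\<close>, so their
  distance tends to 0. One index \<open>k\<close> serves as the number of moments and as the
  precision.\<close>

lemma uniform_metric_bound:
 fixes p :: "nat => real => real"
 assumes d: "metrizes_weak_topology d" and e: "0 < e"
  and \<mu>: "\<And>t. t \<in> {0..T} ==> has_moments (\<mu> t) (%n. p n t)" and C: "\<And>t. t \<in> {0..T} ==> factorial_bounded C (%n. p n t)"
  and p: "\<And>n. continuous_on {0..T} (p n)"
 shows "\<exists>k::nat. \<forall>t\<in>{0..T}. \<forall>\<nu>. real_distribution \<nu> \<longrightarrow> (\<forall>n. integrable \<nu> (%x. x ^ n)) \<longrightarrow>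
  (\<forall>n<k. \<bar>(\<integral>x. x ^ n \<partial>\<nu>) - p n t\<bar> <= 1 / real (Suc k)) \<longrightarrow> d \<nu> (\<mu> t) < e"
proof (rule ccontr)
 assume "\<not> ?thesis"
 then have "\<forall>k::nat. \<exists>t \<nu>. t \<in> {0..T} \<and> real_distribution \<nu> \<and> (\<forall>n. integrable \<nu> (%x. x ^ n)) \<and>
  (\<forall>n<k. \<bar>(\<integral>x. x ^ n \<partial>\<nu>) - p n t\<bar> <= 1 / real (Suc k)) \<and> \<not> d \<nu> (\<mu> t) < e" by blast
 then obtain t \<nu> where t: "\<And>k::nat. t k \<in> {0..T}" and \<nu>: "\<And>k. real_distribution (\<nu> k)" "\<And>k n. integrable (\<nu> k) (%x. x ^ n)"
  and close: "\<And>k n. n < k ==> \<bar>(\<integral>x. x ^ n \<partial>\<nu> k) - p n (t k)\<bar> <= 1 / real (Suc k)" and far: "\<And>k. \<not> d (\<nu> k) (\<mu> (t k)) < e"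
  by metis
 obtain l r where l: "l \<in> {0..T}" and r: "strict_mono r" "(t \<circ> r) \<longlonglongrightarrow> l"
  using seq_compactE[OF compact_imp_seq_compact[OF compact_Icc], of t 0 T] t by blast
 have pl: "(%k. p n (t (r k))) \<longlonglongrightarrow> p n l" for n
  using continuous_on_tendsto_compose[OF p _ l, of "t \<circ> r" sequentially n] r(2) t by (simp add: comp_def)
 have nl: "(%k. \<integral>x. x ^ n \<partial>\<nu> (r k)) \<longlonglongrightarrow> p n l" for n
 proof -
  have "(%k. (\<integral>x. x ^ n \<partial>\<nu> (r k)) - p n (t (r k))) \<longlonglongrightarrow> 0"
  proof (rule Lim_null_comparison)
   show "(%k. inverse (real (Suc k))) \<longlonglongrightarrow> 0" by (rule LIMSEQ_inverse_real_of_nat)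
   show "\<forall>\<^sub>F k in sequentially. norm ((\<integral>x. x ^ n \<partial>\<nu> (r k)) - p n (t (r k))) <= inverse (real (Suc k))"
    using eventually_gt_at_top[of n]
   proof eventually_elim
    case (elim k)
    have k: "k <= r k" by (rule seq_suble[OF r(1)])
    then have "\<bar>(\<integral>x. x ^ n \<partial>\<nu> (r k)) - p n (t (r k))\<bar> <= 1 / real (Suc (r k))" using elim by (intro close) simp
    also have "\<dots> <= inverse (real (Suc k))" using k by (simp add: field_simps)
    finally show ?case by simp
   qed
  qed
  from tendsto_add[OF this pl[of n]] show ?thesis by simp
 qed
 have mom: "real_distribution (\<mu> s)" "integrable (\<mu> s) (%x. x ^ n)" "(\<integral>x. x ^ n \<partial>\<mu> s) = p n s" if "s \<in> {0..T}" for s n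
  using \<mu>[OF that] by (auto simp: has_moments_def)
 have w1: "weak_conv_m (%k. \<nu> (r k)) (\<mu> l)" by (rule moments_imp_weak_conv[OF \<nu> nl C[OF l] \<mu>[OF l]])
 have w2: "weak_conv_m (%k. \<mu> (t (r k))) (\<mu> l)"
 proof (rule moments_imp_weak_conv[OF mom(1,2)[OF t] _ C[OF l] \<mu>[OF l]])
  show "(%k. \<integral>x. x ^ n \<partial>\<mu> (t (r k))) \<longlonglongrightarrow> p n l" for n unfolding mom(3)[OF t] by (rule pl)
 qed
 interpret Metric_space "{\<mu>. real_distribution \<mu>}" d using d by (simp add: metrizes_weak_topology_def)
 have "(%k. d (\<nu> (r k)) (\<mu> (t (r k)))) \<longlonglongrightarrow> d (\<mu> l) (\<mu> l)"
  by (rule metric_tendsto2[OF d \<nu>(1) mom(1)[OF l] w1 mom(1)[OF t] mom(1)[OF l] w2])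
 moreover have "d (\<mu> l) (\<mu> l) < e" using e mom(1)[OF l] by simp
 ultimately have "\<forall>\<^sub>F k in sequentially. d (\<nu> (r k)) (\<mu> (t (r k))) < e" by (rule order_tendstoD(2))
 then show False using far by (auto dest: eventually_happens)
qed

text \<open>By continuity the supremum may be taken over the rational points of the open interval,
  which is a countable dense set.\<close>

lemma SUP_continuous_measurable:
 fixes Y :: "real => 'w => real"
 assumes T: "0 < T" and m: "\<And>t. t \<in> {0..T} ==> Y t \<in> borel_measurable M"
  and c: "\<And>h. h \<in> space M ==> continuous_on {0..T} (%t. Y t h)"
 shows "(%h. SUP t\<in>{0..T}. Y t h) \<in> borel_measurable M"
proof -
 let ?D = "{0<..<T} \<inter> \<rat>"
 have cl: "closure ?D = {0..T}"
 proof
  show "closure ?D \<subseteq> {0..T}" by (rule closure_minimal) auto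
  have "{0<..<T} \<inter> closure \<rat> \<subseteq> closure ?D" by (rule open_Int_closure_subset) simp
  then have "closure {0<..<T} \<subseteq> closure ?D" by (intro closure_minimal) (auto simp: Rats_closure_real)
  then show "{0..T} \<subseteq> closure ?D" using T by simp
 qed
 have D0: "?D \<noteq> {}" using cl T by (metis atLeastAtMost_iff closure_empty empty_iff less_eq_real_def order_refl)
 have bdd: "bdd_above ((%t. Y t h) ` {0..T})" if "h \<in> space M" for h
  by (rule bounded_imp_bdd_above[OF compact_imp_bounded[OF compact_continuous_image[OF c[OF that] compact_Icc]]])
 have sub: "?D \<subseteq> {0..T}" by auto
 have eq: "(SUP t\<in>{0..T}. Y t h) = (SUP t\<in>?D. Y t h)" if h: "h \<in> space M" for h
 proof (rule antisym)
  show "(SUP t\<in>{0..T}. Y t h) <= (SUP t\<in>?D. Y t h)"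
  proof (rule cSUP_least)
   show "{0..T} \<noteq> {}" using T by simp
   fix t assume "t \<in> {0..T}"
   then have t: "t \<in> closure ?D" unfolding cl .
   show "Y t h <= (SUP t\<in>?D. Y t h)"
   proof (rule continuous_le_on_closure[OF _ t])
    show "continuous_on (closure ?D) (%t. Y t h)" unfolding cl by (rule c[OF h])
    show "Y u h <= (SUP t\<in>?D. Y t h)" if "u \<in> ?D" for u
     by (rule cSUP_upper[OF that bdd_above_mono[OF bdd[OF h] image_mono[OF sub]]])
   qed
  qed
  show "(SUP t\<in>?D. Y t h) <= (SUP t\<in>{0..T}. Y t h)"
   by (rule cSUP_subset_mono[OF D0 bdd[OF h] sub order_refl])
 qed
 have "(%h. SUP t\<in>?D. Y t h) \<in> borel_measurable M"
 proof (rule borel_measurable_cSUP)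
  show "countable ?D" by (intro countable_Int2 countable_rat)
  show "Y t \<in> borel_measurable M" if "t \<in> ?D" for t using that sub by (intro m) auto
  show "bdd_above ((%t. Y t h) ` ?D)" if "h \<in> space M" for h by (rule bdd_above_mono[OF bdd[OF that] image_mono[OF sub]])
 qed
 then show ?thesis by (subst measurable_cong[OF eq])
qed

section \<open>Convergence of the empirical measures\<close>

lemma fact_mult_le: "j <= k ==> fact j * fact (k - j) <= (fact k :: real)"
proof -
 assume jk: "j <= k"
 have "fact j * fact (k - j) * 1 <= (fact j * fact (k - j) * (k choose j) :: nat)"
  using jk by (intro mult_left_mono) (simp_all add: Suc_leI zero_less_binomial)
 then have "fact j * fact (k - j) <= (fact k :: nat)" using binomial_fact_lemma[OF jk] by simp
 then have "real (fact j * fact (k - j)) <= real (fact k)" by (rule of_nat_mono)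
 then show ?thesis by simp
qed

text \<open>\<open>n ^ n / n!\<close> is a single term of the exponential series at
  \<open>n\<close>.\<close>

lemma power_le_exp_fact: "real n ^ n <= exp 1 ^ n * fact n"
proof -
 have s: "(%k. real n ^ k /\<^sub>R fact k) sums exp (real n)" by (rule exp_converges)
 have "real n ^ n /\<^sub>R fact n <= exp (real n)"
  using sum_le_suminf[OF sums_summable[OF s], of "{n}"] sums_unique[OF s] by simp
 also have "exp (real n) = exp 1 ^ n" by (simp flip: exp_of_nat_mult)
 finally show ?thesis by (simp add: field_simps)
qed

lemma limit_moment_factorial_bounded:
 assumes c: "0 < c" and v: "0 <= v" and T: "0 <= T" and L: "0 < L" "\<And>n. 1 <= n ==> \<bar>\<alpha> n\<bar> <= (L * real n) ^ n"
 shows "\<exists>C. \<forall>t\<in>{0..T}. factorial_bounded C (%n. limit_moment c v \<alpha> n t)"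
proof -
 let ?m = "limit_moment c v \<alpha>"
 \<comment> \<open>The first summand makes the initial part \<open>\<alpha> n\<close> at most half
   of \<open>C ^ n * fact n\<close>, the last one does the same for the time integral, which has two
   powers of \<open>C\<close> to spare, and 1 ensures \<open>1 <= C\<close>.\<close>
 define C where "C = 2 * (L * exp 1) + 1 + T * (v * (c + 1))"
 have p: "0 <= T * (v * (c + 1))" "0 < L * exp 1" using T v c L by simp_all
 have C: "1 <= C" "L * exp 1 <= C / 2" "T * (v * (c + 1)) <= C"
 proof -
  have "1 <= 2 * s + 1 + r \<and> s <= (2 * s + 1 + r) / 2 \<and> r <= 2 * s + 1 + r" if "0 <= r" "0 < s" for r s :: real
   using that by simp
  from this[OF p] show "1 <= C" "L * exp 1 <= C / 2" "T * (v * (c + 1)) <= C" unfolding C_def by blast+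
 qed
 have "\<forall>t\<in>{0..T}. \<bar>?m n t\<bar> <= C ^ n * fact n" for n
 proof (induction n rule: less_induct)
  case (less n)
  note mp = limit_moment_props[of _ c v \<alpha>]
  show ?case
  proof (cases "n = 0")
   case True then show ?thesis by (simp add: limit_moment.simps)
  next
   case False
   have a: "\<bar>\<alpha> n\<bar> <= C ^ n * fact n / 2"
   proof -
    have "\<bar>\<alpha> n\<bar> <= L ^ n * real n ^ n" using L(2)[of n] False by (simp add: power_mult_distrib)
    also have "\<dots> <= L ^ n * (exp 1 ^ n * fact n)" using L by (intro mult_left_mono power_le_exp_fact) auto
    also have "\<dots> = (L * exp 1) ^ n * fact n" by (simp add: power_mult_distrib)
    also have "\<dots> <= (C / 2) ^ n * fact n" using C p by (intro mult_right_mono power_mono) auto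
    also have "(C / 2) ^ n <= C ^ n / 2"
    proof -
     have "C ^ n / 2 ^ n <= C ^ n / 2 ^ 1" using False C by (intro divide_left_mono power_increasing) auto
     then show ?thesis by (simp add: power_divide)
    qed
    finally show ?thesis by (simp add: mult_right_mono)
   qed
   have lp: "\<bar>limit_poly c v n (%k. ?m k u)\<bar> <= v * (c + 1) / 2 * (C ^ (n - 2) * fact n)" if u: "u \<in> {0..T}" for u
   proof (cases "n < 2")
    case True then show ?thesis using v c C by (simp add: limit_poly_def)
   next
    case n2: False
    then obtain k where k: "n = Suc (Suc k)" by (metis One_nat_def Suc_1 not_less_eq not_less0 old.nat.exhaust)
    have IH: "\<bar>?m j u\<bar> <= C ^ j * fact j" if "j <= k" for j using less that u k by simp
    have pr: "\<bar>?m j u * ?m (k - j) u\<bar> <= C ^ k * fact k" if "j <= k" for j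
    proof -
     have "\<bar>?m j u * ?m (k - j) u\<bar> <= (C ^ j * fact j) * (C ^ (k - j) * fact (k - j))"
      unfolding abs_mult using that C by (intro mult_mono IH) auto
     also have "\<dots> = C ^ k * (fact j * fact (k - j))" using that by (simp add: power_add[symmetric] mult_ac)
     also have "\<dots> <= C ^ k * fact k" using C that by (intro mult_left_mono fact_mult_le) auto
     finally show ?thesis .
    qed
    have "\<bar>\<Sum>j=0..k. ?m j u * ?m (k - j) u\<bar> <= (\<Sum>j=0..k. C ^ k * fact k)"
     by (rule order_trans[OF sum_abs sum_mono]) (simp add: pr)
    then have s: "\<bar>\<Sum>j=0..k. ?m j u * ?m (k - j) u\<bar> <= real (Suc k) * (C ^ k * fact k)" by simp
    have "limit_poly c v n (%k. ?m k u) = (v * (c * real n / 2)) * (\<Sum>j=0..k. ?m j u * ?m (k - j) u) + (v / 2 * real n * real (Suc k)) * ?m k u"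
     unfolding limit_poly_def k by simp
    also have "\<bar>(v * (c * real n / 2)) * (\<Sum>j=0..k. ?m j u * ?m (k - j) u) + (v / 2 * real n * real (Suc k)) * ?m k u\<bar>
     <= \<bar>v * (c * real n / 2)\<bar> * (real (Suc k) * (C ^ k * fact k)) + \<bar>v / 2 * real n * real (Suc k)\<bar> * (C ^ k * fact k)"
     by (rule order_trans[OF abs_triangle_ineq add_mono[OF abs_mult_le[OF s] abs_mult_le[OF IH]]]) simp
    \<comment> \<open>Products of lower factorials stay below \<open>fact k\<close>, and the
      prefactor \<open>n * Suc k\<close> with \<open>k = n - 2\<close> completes this to
      \<open>fact n\<close>. This is why growth of factorial type propagates through the
      recursion.\<close>
    also have "\<dots> = v * (c + 1) / 2 * (C ^ k * (real n * real (Suc k) * fact k))"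
     using v c by (simp add: field_simps)
    also have "real n * real (Suc k) * fact k = fact n" unfolding k fact_Suc by simp
    finally show ?thesis unfolding k by simp
   qed
   show ?thesis
   proof
    fix t assume t: "t \<in> {0..T}"
    let ?B = "v * (c + 1) / 2 * (C ^ (n - 2) * fact n)"
    have B0: "0 <= ?B" using v c C by simp
    have li: "set_integrable lborel {0<..t} (%u. limit_poly c v n (%k. ?m k u))"
     by (intro continuous_set_integrable_Ioc limit_poly_continuous conjunct1[OF mp])
    have "\<bar>LINT u:{0<..t}|lborel. limit_poly c v n (%k. ?m k u)\<bar> <= (LINT u:{0<..t}|lborel. ?B)"
     by (rule abs_set_integral_le[OF li set_integrable_const_Ioc lp]) (use t in auto)
    also have "\<dots> = t * ?B" using t by (simp add: set_lebesgue_integral_def)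
    finally have i: "\<bar>LINT u:{0<..t}|lborel. limit_poly c v n (%k. ?m k u)\<bar> <= t * ?B" .
    have tB: "n < 2 \<or> t * ?B <= C ^ n * fact n / 2"
    proof (cases "n < 2")
     case n2: False
     have "t * ?B <= T * ?B" using t B0 by (intro mult_right_mono) auto
     also have "\<dots> = (T * (v * (c + 1))) * (C ^ (n - 2) * fact n) / 2" by simp
     also have "\<dots> <= C^2 * (C ^ (n - 2) * fact n) / 2"
      using C self_le_power[of C 2] by (intro divide_right_mono mult_right_mono) auto
     also have "C^2 * (C ^ (n - 2) * fact n) = C ^ n * fact n"
     proof -
      have "n = 2 + (n - 2)" using n2 by simp
      then have "C^2 * C ^ (n - 2) = C ^ n" by (metis power_add)
      then show ?thesis by (simp only: mult.assoc[symmetric])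
     qed
     finally show ?thesis by simp
    qed simp
    have i': "\<bar>LINT u:{0<..t}|lborel. limit_poly c v n (%k. ?m k u)\<bar> <= C ^ n * fact n / 2"
    proof (cases "n < 2")
     case True
     then show ?thesis using C by (simp add: limit_poly_def set_lebesgue_integral_def)
    qed (use i tB in linarith)
    have "?m n t = \<alpha> n + (LINT u:{0<..t}|lborel. limit_poly c v n (%k. ?m k u))" using mp[of T n] False t by auto
    then show "\<bar>?m n t\<bar> <= C ^ n * fact n" using a i' by linarith
   qed
  qed
 qed
 then show ?thesis using C(1) unfolding factorial_bounded_def by blast
qed

section \<open>Conclusions for the rescaled particle system\<close>

context jacobi_scaling begin

definition emp where "emp N t h = empirical_measure N (%i. x N i t h)"

lemma to_zero_in_probI:
 assumes Y: "\<And>N. 1 <= N ==> Y N \<in> borel_measurable (M N)" and small: "\<And>e. 0 < e ==> whp M (%N h. Y N h < e)"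
 shows "to_zero_in_prob M Y"
 unfolding to_zero_in_prob_def
proof (intro conjI allI impI Y)
 fix e :: real assume e: "0 < e"
 show "(%N. measure (M N) {h \<in> space (M N). e <= Y N h}) \<longlonglongrightarrow> 0"
 proof (rule order_tendstoI)
  fix \<delta> :: real assume "0 < \<delta>"
  then have d: "0 < \<delta> / 2" by simp
  show "\<forall>\<^sub>F N in sequentially. measure (M N) {h \<in> space (M N). e <= Y N h} < \<delta>"
   using small[OF e, unfolded whp_def, THEN spec, THEN mp, OF d] eventually_ge_at_top[of 1]
  proof eventually_elim
   case (elim N)
   interpret prob_space "M N" by (rule prob[OF elim(2)])
   from elim(1) obtain Z where Z: "Z \<in> sets (M N)" "measure (M N) Z <= \<delta> / 2" "\<forall>h\<in>space (M N) - Z. Y N h < e" by blast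
   have "measure (M N) {h \<in> space (M N). e <= Y N h} <= measure (M N) Z"
    using Z(3) by (intro finite_measure_mono Z(1)) (auto simp: not_less[symmetric])
   then show ?case using Z(2) \<open>0 < \<delta>\<close> by simp
  qed
 qed (auto intro: always_eventually less_le_trans[OF _ measure_nonneg])
qed

lemma m_continuous: "continuous_on {0..T} (m n)"
 unfolding m_def using limit_moment_props by blast

text \<open>A supremum of values below \<open>e\<close> may equal \<open>e\<close>; the margin
  \<open>e / 2\<close> keeps the inequality strict.\<close>

lemma SUP_less:
 fixes f :: "real => real"
 assumes "0 < T" "0 < e" "\<And>t. t \<in> {0..T} ==> f t <= e / 2" shows "(SUP t\<in>{0..T}. f t) < e"
proof -
 have "(SUP t\<in>{0..T}. f t) <= e / 2" using assms by (intro cSUP_least) auto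
 then show ?thesis using assms(2) by simp
qed

theorem moments_tendsto_in_prob:
 assumes T: "0 < T" shows "tendsto_in_prob_C M T (S n) (m n)"
 unfolding tendsto_in_prob_C_def
proof (intro conjI allI impI ballI m_continuous to_zero_in_probI)
 have cont: "continuous_on {0..T} (%t. S n N t h)" if "1 <= N" "h \<in> space (M N)" for N h
  by (rule continuous_on_subset[OF S_continuous[OF that]]) auto
 fix N :: nat assume N: "1 <= N"
 show "continuous_on {0..T} (%t. S n N t h)" if "h \<in> space (M N)" for h by (rule cont[OF N that])
 show "(%h. SUP t\<in>{0..T}. \<bar>S n N t h - m n t\<bar>) \<in> borel_measurable (M N)"
 proof (rule SUP_continuous_measurable[OF T])
  show "(%h. \<bar>S n N t h - m n t\<bar>) \<in> borel_measurable (M N)" if "t \<in> {0..T}" for t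
   using S_measurable[OF N, of t n] that by (intro borel_measurable_abs borel_measurable_diff) auto
  show "continuous_on {0..T} (%t. \<bar>S n N t h - m n t\<bar>)" if "h \<in> space (M N)" for h
   by (intro continuous_intros cont[OF N that] m_continuous)
 qed
next
 fix e :: real assume e: "0 < e"
 then have "0 < e / 2" by simp
 then show "whp M (%N h. (SUP t\<in>{0..T}. \<bar>S n N t h - m n t\<bar>) < e)"
  by (rule whp_mono[OF moments_converge[OF T]]) (auto intro!: always_eventually SUP_less T e)
qed

lemma x_measurable: "1 <= N ==> i \<in> {1..N} ==> 0 <= t ==> x N i t \<in> borel_measurable (M N)"
 using jacobi.l_measurable[OF jacobi, of N i "t / \<tau> N"] pos[of N] unfolding x_def[abs_def] by simp

lemma x_tendsto:
 assumes N: "1 <= N" "i \<in> {1..N}" "h \<in> space (M N)" and u: "\<And>k. 0 <= u k" "0 <= t" "u \<longlonglongrightarrow> t"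
 shows "(%k. x N i (u k) h) \<longlonglongrightarrow> x N i t h"
proof -
 have p: "0 < \<tau> N" using pos[OF N(1)] by simp
 have "(%k. lam N i (u k / \<tau> N) h) \<longlonglongrightarrow> lam N i (t / \<tau> N) h"
  by (rule continuous_on_tendsto_compose[OF jacobi.l_continuous[OF jacobi[OF N(1)] N(2,3)]])
    (use u p in \<open>auto intro!: tendsto_intros\<close>)
 then show ?thesis unfolding x_def by (intro tendsto_intros)
qed

lemma emp_moment:
 assumes N: "1 <= N"
 shows "real_distribution (emp N t h)" "integrable (emp N t h) (%y. y ^ n)" "(\<integral>y. y ^ n \<partial>emp N t h) = S n N t h"
 unfolding emp_def S_def power_mean_def
 by (simp_all add: empirical_measure[OF N] del: One_nat_def)

text \<open>For each \<open>k\<close> some \<open>N\<close> and some single outcome are picked at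
  which the first \<open>k\<close> moments of the empirical measure are within
  \<open>1 / Suc k\<close> of the limits. These deterministic measures have convergent moments, and
  \<open>method_of_moments\<close> supplies a measure with the limiting moments.\<close>

lemma limit_measures:
 assumes L: "\<exists>L>0. \<forall>n\<ge>1. \<bar>\<alpha> n\<bar> <= (L * real n) ^ n"
 shows "\<exists>\<mu>. (\<forall>t\<ge>0. has_moments (\<mu> t) (%n. m n t)) \<and> (\<forall>T\<ge>0. \<exists>C. \<forall>t\<in>{0..T}. factorial_bounded C (%n. m n t))"
proof -
 obtain L where "0 < L" "\<And>n. 1 <= n ==> \<bar>\<alpha> n\<bar> <= (L * real n) ^ n" using L by blast
 then have C: "\<exists>C. \<forall>t\<in>{0..T}. factorial_bounded C (%n. m n t)" if "0 <= T" for T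
  unfolding m_def using c that by (intro limit_moment_factorial_bounded) auto
 have "\<exists>\<mu>. has_moments \<mu> (%n. m n t)" if t: "0 <= t" for t
 proof -
  have "\<exists>\<nu>. real_distribution \<nu> \<and> (\<forall>n. integrable \<nu> (%y. y ^ n)) \<and> (\<forall>n<k. \<bar>(\<integral>y. y ^ n \<partial>\<nu>) - m n t\<bar> <= inverse (real (Suc k)))" for k
  proof -
   \<comment> \<open>The horizon \<open>t + 1\<close> is positive also for
     \<open>t = 0\<close>.\<close>
   have "whp M (%N h. \<forall>n<k. \<forall>s\<in>{0..t + 1}. \<bar>S n N s h - m n s\<bar> <= inverse (real (Suc k)))"
    using t by (intro whp_all_less moments_converge) auto
   note good = this
   have half: "0 < (1/2 :: real)" by simp
   from good[unfolded whp_def, THEN spec, THEN mp, OF half] eventually_ge_at_top[of 1]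
   have "\<forall>\<^sub>F N in sequentially. \<exists>h. 1 <= N \<and> (\<forall>n<k. \<bar>S n N t h - m n t\<bar> <= inverse (real (Suc k)))"
   proof eventually_elim
    case (elim N)
    interpret prob_space "M N" using elim by (intro prob) simp
    from elim obtain Z where Z: "Z \<in> sets (M N)" "prob Z <= 1/2"
     "\<forall>h\<in>space (M N) - Z. \<forall>n<k. \<forall>s\<in>{0..t + 1}. \<bar>S n N s h - m n s\<bar> <= inverse (real (Suc k))" by auto
    \<comment> \<open>An exceptional set of probability at most 1/2 cannot be the whole space, so a
      good outcome exists.\<close>
    have "Z \<noteq> space (M N)" using Z(2) prob_space by auto
    then obtain h where "h \<in> space (M N) - Z" using sets.sets_into_space[OF Z(1)] by blast
    then show ?case using Z(3) t elim by (intro exI[of _ h]) auto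
   qed
   then obtain N h where "1 <= N" "\<forall>n<k. \<bar>S n N t h - m n t\<bar> <= inverse (real (Suc k))" by (auto dest: eventually_happens)
   then show ?thesis using emp_moment[of N t h] by (intro exI[of _ "emp N t h"]) simp
  qed
  then obtain \<nu> where \<nu>: "\<And>k. real_distribution (\<nu> k)" "\<And>k n. integrable (\<nu> k) (%y. y ^ n)"
   and close: "\<And>k n. n < k ==> \<bar>(\<integral>y. y ^ n \<partial>\<nu> k) - m n t\<bar> <= inverse (real (Suc k))" by metis
  have "(%k. \<integral>y. y ^ n \<partial>\<nu> k) \<longlonglongrightarrow> m n t" for n
  proof (rule LIM_zero_cancel, rule Lim_null_comparison[OF _ LIMSEQ_inverse_real_of_nat])
   show "\<forall>\<^sub>F k in sequentially. norm ((\<integral>y. y ^ n \<partial>\<nu> k) - m n t) <= inverse (real (Suc k))"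
    using eventually_gt_at_top[of n] unfolding real_norm_def by eventually_elim (rule close)
  qed
  note lim = this
  from C[OF t] obtain K where "\<forall>s\<in>{0..t}. factorial_bounded K (%n. m n s)" by blast
  then have "factorial_bounded K (%n. m n t)" using t by simp
  from method_of_moments[OF \<nu> lim this] show ?thesis by blast
 qed
 then have "\<exists>\<mu>. \<forall>t\<ge>0. has_moments (\<mu> t) (%n. m n t)" by metis
 then show ?thesis using C by blast
qed

text \<open>All three claims rest on determinacy: it gives uniqueness directly, weak continuity in
  time because the moments are continuous in time, and uniform convergence because, by
  \<open>uniform_metric_bound\<close>, closeness of finitely many moments forces closeness in the
  metric.\<close>

theorem empirical_measures_converge:
 assumes \<mu>: "\<And>t. 0 <= t ==> has_moments (\<mu> t) (%n. m n t)" and C: "\<And>T. 0 <= T ==> \<exists>C. \<forall>t\<in>{0..T}. factorial_bounded C (%n. m n t)"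
 shows "0 <= t ==> has_moments \<nu> (%n. m n t) ==> \<nu> = \<mu> t"
  and "continuous_map (top_of_set {0..}) weak_topology \<mu>"
  and "metrizes_weak_topology d ==> 0 < T ==> to_zero_in_prob M (%N v. SUP t\<in>{0..T}. d (emp N t v) (\<mu> t))"
proof -
 have fb: "\<exists>C. factorial_bounded C (%n. m n t)" if "0 <= t" for t using C[OF that] that by auto
 show "0 <= t ==> has_moments \<nu> (%n. m n t) ==> \<nu> = \<mu> t" using moments_determine[OF _ \<mu>] fb by metis
 have rd: "real_distribution (\<mu> t)" if "0 <= t" for t using \<mu>[OF that] by (simp add: has_moments_def)
 have wc: "weak_conv_m (%k. \<mu> (u k)) (\<mu> t)" if u: "\<And>k. 0 <= u k" "0 <= t" "u \<longlonglongrightarrow> t" for u t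
 proof -
  obtain K where K: "factorial_bounded K (%n. m n t)" using fb[OF u(2)] by blast
  have mom: "integrable (\<mu> (u k)) (%x. x ^ n)" "(\<integral>x. x ^ n \<partial>\<mu> (u k)) = m n (u k)" for k n
   using \<mu>[OF u(1), of k] by (auto simp: has_moments_def)
  obtain R where R: "\<And>k. norm (u k) <= R" using convergent_imp_Bseq[OF convergentI[OF u(3)]] by (auto simp: Bseq_def)
  have uR: "u k \<in> {0..R}" for k using R[of k] u(1)[of k] by simp
  have "t <= R" by (rule LIMSEQ_le_const2[OF u(3)]) (use uR in auto)
  then have tR: "t \<in> {0..R}" using u(2) by simp
  have "(%k. m n (u k)) \<longlonglongrightarrow> m n t" for n
   by (rule continuous_on_tendsto_compose[OF m_continuous u(3) tR]) (simp add: uR del: atLeastAtMost_iff)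
  then show ?thesis by (intro moments_imp_weak_conv[OF rd[OF u(1)] mom(1) _ K \<mu>[OF u(2)]]) (simp only: mom(2))
 qed
 show "continuous_map (top_of_set {0..}) weak_topology \<mu>"
  unfolding weak_topology_def
 proof (rule continuous_on_generated_topo)
  fix U assume "U \<in> {{\<mu>. real_distribution \<mu> \<and> (\<integral>x. f x \<partial>\<mu>) \<in> U} | (f :: real => real) U. continuous_on UNIV f \<and> bounded (range f) \<and> open (U :: real set)}"
  then obtain f :: "real => real" and V where U: "U = {\<mu>. real_distribution \<mu> \<and> (\<integral>x. f x \<partial>\<mu>) \<in> V}"
   and f: "continuous_on UNIV f" "bounded (range f)" and V: "open V" by blast
  obtain R where R: "\<And>x. norm (f x) <= R" using f(2) by (auto simp: bounded_iff)
  have "continuous_on {0..} (%t. \<integral>x. f x \<partial>\<mu> t)"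
  proof (rule continuous_on_sequentiallyI)
   fix u :: "nat => real" and t assume u: "\<forall>k. u k \<in> {0..}" "t \<in> {0..}" "u \<longlonglongrightarrow> t"
   show "(%k. \<integral>x. f x \<partial>\<mu> (u k)) \<longlonglongrightarrow> (\<integral>x. f x \<partial>\<mu> t)"
    using u f(1) R by (intro weak_conv_imp_integral_bdd_continuous_conv[OF _ _ wc, where B = R] rd) (auto simp: continuous_on_eq_continuous_at)
  qed
  then have "openin (top_of_set {0..}) ({0..} \<inter> (%t. \<integral>x. f x \<partial>\<mu> t) -` V)"
   by (rule continuous_openin_preimage_gen[OF _ V])
  moreover have "\<mu> -` U \<inter> topspace (top_of_set {0..}) = {0..} \<inter> (%t. \<integral>x. f x \<partial>\<mu> t) -` V" using rd by (auto simp: U)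
  ultimately show "openin (top_of_set {0..}) (\<mu> -` U \<inter> topspace (top_of_set {0..}))" by simp
 next
  have "\<mu> ` topspace (top_of_set {0..}) \<subseteq> topspace weak_topology" using rd by (auto simp: topspace_weak_topology)
  then show "\<mu> ` topspace (top_of_set {0..}) \<subseteq> \<Union> {{\<mu>. real_distribution \<mu> \<and> (\<integral>x. f x \<partial>\<mu>) \<in> U} | (f :: real => real) U. continuous_on UNIV f \<and> bounded (range f) \<and> open (U :: real set)}"
   unfolding weak_topology_def topology_generated_by_topspace .
 qed
 assume d: "metrizes_weak_topology d" and T: "0 < T"
 show "to_zero_in_prob M (%N v. SUP t\<in>{0..T}. d (emp N t v) (\<mu> t))"
 proof (rule to_zero_in_probI)
  fix N :: nat assume N: "1 <= N"
  show "(%v. SUP t\<in>{0..T}. d (emp N t v) (\<mu> t)) \<in> borel_measurable (M N)"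
  proof (rule SUP_continuous_measurable[OF T])
   fix t assume t: "t \<in> {0..T}"
   \<comment> \<open>Measurability goes through the vector of particles, set to 0 off
     \<open>{1..N}\<close> so that it is a measurable map into a product space; the distance to
     \<open>\<mu> t\<close> is a continuous function of this vector.\<close>
   let ?y = "%v i. if i \<in> {1..N} then x N i t v else 0"
   have "continuous_on UNIV (%y :: nat => real. d (empirical_measure N y) (\<mu> t))"
   proof (rule continuous_on_sequentiallyI)
    fix y :: "nat => nat => real" and z assume y: "y \<longlonglongrightarrow> z"
    have yi: "(%k. y k i) \<longlonglongrightarrow> z i" for i
     by (rule continuous_on_tendsto_compose[OF continuous_on_product_coordinates y]) auto
    show "(%k. d (empirical_measure N (y k)) (\<mu> t)) \<longlonglongrightarrow> d (empirical_measure N z) (\<mu> t)"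
     using t by (intro metric_tendsto2[OF d] empirical_measure(1)[OF N] empirical_measure_weak_conv[OF N yi] rd wc[of "%_. t"]) auto
   qed
   then have "(%y :: nat => real. d (empirical_measure N y) (\<mu> t)) \<in> borel_measurable borel" by (rule borel_measurable_continuous_onI)
   moreover have "?y \<in> borel_measurable (M N)"
   proof (rule measurable_coordinatewise_then_product)
    show "(%v. ?y v i) \<in> borel_measurable (M N)" for i using x_measurable[OF N, of i t] t by (cases "i \<in> {1..N}") auto
   qed
   ultimately have "(%v. d (empirical_measure N (?y v)) (\<mu> t)) \<in> borel_measurable (M N)"
    by (rule measurable_compose[rotated])
   moreover have "empirical_measure N (?y v) = emp N t v" for v
    unfolding emp_def empirical_measure_def by (rule distr_cong) (simp_all add: space_uniform_count_measure)
   ultimately show "(%v. d (emp N t v) (\<mu> t)) \<in> borel_measurable (M N)" by simp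
  next
   fix v assume v: "v \<in> space (M N)"
   show "continuous_on {0..T} (%t. d (emp N t v) (\<mu> t))"
   proof (rule continuous_on_sequentiallyI)
    fix u :: "nat => real" and t assume u: "\<forall>k. u k \<in> {0..T}" "t \<in> {0..T}" "u \<longlonglongrightarrow> t"
    have "weak_conv_m (%k. emp N (u k) v) (emp N t v)" unfolding emp_def
     using u by (intro empirical_measure_weak_conv[OF N] x_tendsto[OF N _ v]) auto
    then show "(%k. d (emp N (u k) v) (\<mu> (u k))) \<longlonglongrightarrow> d (emp N t v) (\<mu> t)"
     using u by (intro metric_tendsto2[OF d] emp_moment(1)[OF N] rd wc) auto
   qed
  qed
 next
  fix e :: real assume e: "0 < e"
  obtain K where K: "\<forall>t\<in>{0..T}. factorial_bounded K (%n. m n t)" using C[of T] T by auto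
  have e2: "0 < e / 2" using e by simp
  have "\<And>t. t \<in> {0..T} ==> has_moments (\<mu> t) (%n. m n t)" using \<mu> by simp
  from uniform_metric_bound[OF d e2 this bspec[OF K] m_continuous]
  obtain k :: nat where k: "\<And>t \<nu>. t \<in> {0..T} ==> real_distribution \<nu> ==> (\<And>n. integrable \<nu> (%x. x ^ n)) ==>
   (\<And>n. n < k ==> \<bar>(\<integral>x. x ^ n \<partial>\<nu>) - m n t\<bar> <= 1 / real (Suc k)) ==> d \<nu> (\<mu> t) < e / 2" by metis
  have "whp M (%N v. \<forall>n<k. \<forall>t\<in>{0..T}. \<bar>S n N t v - m n t\<bar> <= 1 / real (Suc k))"
   by (intro whp_all_less moments_converge T) simp
  then show "whp M (%N v. (SUP t\<in>{0..T}. d (emp N t v) (\<mu> t)) < e)"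
  proof (rule whp_mono, intro eventually_mono[OF eventually_ge_at_top[of 1]] ballI impI)
   fix N :: nat and v assume N: "1 <= N" and h: "\<forall>n<k. \<forall>t\<in>{0..T}. \<bar>S n N t v - m n t\<bar> <= 1 / real (Suc k)"
   show "(SUP t\<in>{0..T}. d (emp N t v) (\<mu> t)) < e"
   proof (rule SUP_less[OF T e])
    fix t assume t: "t \<in> {0..T}"
    show "d (emp N t v) (\<mu> t) <= e / 2"
     by (rule less_imp_le, rule k[OF t emp_moment(1,2)[OF N]]) (use h t in \<open>simp add: emp_moment(3)[OF N]\<close>)
   qed
  qed
 qed
qed

end

theorem mainTheorem6:
  fixes M :: "nat \<Rightarrow> 'w measure"
    and B lam :: "nat \<Rightarrow> nat \<Rightarrow> real \<Rightarrow> 'w \<Rightarrow> real"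
    and lam0 :: "nat \<Rightarrow> nat \<Rightarrow> real"
    and x :: "nat \<Rightarrow> nat \<Rightarrow> real \<Rightarrow> 'w \<Rightarrow> real"
    and S :: "nat \<Rightarrow> nat \<Rightarrow> real \<Rightarrow> 'w \<Rightarrow> real"
    and emp :: "nat \<Rightarrow> real \<Rightarrow> 'w \<Rightarrow> real measure"
    and \<gamma> \<tau> E :: "nat \<Rightarrow> real"
    and a b c \<sigma> :: real
    and \<alpha> :: "nat \<Rightarrow> real"
    and m :: "nat \<Rightarrow> real \<Rightarrow> real"
  defines "x \<equiv> \<lambda>N i t \<omega>. \<gamma> N * (lam N i (t / \<tau> N) \<omega> - E N)"
    and "S \<equiv> \<lambda>n N t \<omega>. power_mean N (\<lambda>i. x N i t \<omega>) n"
    and "emp \<equiv> \<lambda>N t \<omega>. empirical_measure N (\<lambda>i. x N i t \<omega>)"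
    and "m \<equiv> limit_moment c (\<sigma>\<^sup>2) \<alpha>"
  assumes "c > 0" and "a > -1/2" and "b > -1/2" and "\<sigma>\<^sup>2 > 0"
    and jacobi: "\<And>N. N \<ge> 1 \<Longrightarrow> beta_jacobi_process (M N) N a b (2 * c / real N) (B N) (lam0 N) (lam N)"
    and "\<And>N. N \<ge> 1 \<Longrightarrow> \<gamma> N > 0 \<and> \<tau> N > 0 \<and> E N > 0"
    and "filterlim \<tau> at_top sequentially"
    and "(\<lambda>N. \<gamma> N / \<tau> N) \<longlonglongrightarrow> 0"
    and "(\<lambda>N. 2 * (\<gamma> N)\<^sup>2 / \<tau> N * E N * (1 - E N)) \<longlonglongrightarrow> \<sigma>\<^sup>2"
    \<comment> \<open>the initial condition is deterministic\<close>
    and init: "\<And>n. (\<lambda>N. power_mean N (\<lambda>i. \<gamma> N * (lam0 N i - E N)) n) \<longlonglongrightarrow> \<alpha> n"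
  shows "(\<forall>n. \<forall>T>0. tendsto_in_prob_C M T (S n) (m n)) \<and>
    ((\<exists>\<Lambda>>0. \<forall>n\<ge>1. \<bar>\<alpha> n\<bar> \<le> (\<Lambda> * real n) ^ n) \<longrightarrow>
      (\<exists>\<mu> :: real \<Rightarrow> real measure.
         (\<forall>t\<ge>0. has_moments (\<mu> t) (\<lambda>n. m n t) \<and>
            (\<forall>\<nu>. has_moments \<nu> (\<lambda>n. m n t) \<longrightarrow> \<nu> = \<mu> t)) \<and>
         continuous_map (top_of_set {0..}) weak_topology \<mu> \<and>
         (\<forall>d. metrizes_weak_topology d \<longrightarrow>
            (\<forall>T>0. to_zero_in_prob M (\<lambda>N \<omega>. SUP t\<in>{0..T}. d (emp N t \<omega>) (\<mu> t))))))"
proof -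
 interpret J: jacobi_scaling M B lam lam0 \<gamma> \<tau> E a b c \<sigma> \<alpha>
  by (rule jacobi_scaling.intro) (use assms(5,8-) in blast)+
 have eq: "S = J.S" "emp = J.emp" "m = J.m"
  by (simp_all add: fun_eq_iff S_def J.S_def emp_def J.emp_def m_def J.m_def x_def J.x_def)
 show ?thesis unfolding eq
 proof (intro conjI allI impI)
  show "tendsto_in_prob_C M T (J.S n) (J.m n)" if "0 < T" for n T by (rule J.moments_tendsto_in_prob[OF that])
  assume "\<exists>L>0. \<forall>n\<ge>1. \<bar>\<alpha> n\<bar> <= (L * real n) ^ n"
  then obtain \<mu> where \<mu>: "\<And>t. 0 <= t ==> has_moments (\<mu> t) (%n. J.m n t)"
   "\<And>T. 0 <= T ==> \<exists>C. \<forall>t\<in>{0..T}. factorial_bounded C (%n. J.m n t)"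
   using J.limit_measures by blast
  note conv = J.empirical_measures_converge[OF \<mu>]
  show "\<exists>\<mu>. (\<forall>t\<ge>0. has_moments (\<mu> t) (%n. J.m n t) \<and> (\<forall>\<nu>. has_moments \<nu> (%n. J.m n t) \<longrightarrow> \<nu> = \<mu> t)) \<and>
   continuous_map (top_of_set {0..}) weak_topology \<mu> \<and>
   (\<forall>d. metrizes_weak_topology d \<longrightarrow> (\<forall>T>0. to_zero_in_prob M (%N h. SUP t\<in>{0..T}. d (J.emp N t h) (\<mu> t))))"
   by (intro exI[of _ \<mu>] conjI allI impI \<mu>(1) conv)
 qed
qed

end
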